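(* Let $A$ be an operator in $M_n(L^\infty(\mu))$. Then the following statements are equivalent: (1) the relative commutant $\{A\}'\cap M_n(L^\infty(\mu))$ contains a finite frame $\{P_k\}_{k=1}^m$; (2) the relative commutant $\{A\}'\cap M_n(L^\infty(\mu))$ contains a bounded maximal abelian set of idempotents; (3) there is a finite Borel partition $\{\Lambda_t\}_{t=1}^{r}$ of $\Lambda$ such that for each $t$ there exist positive integers $m, n_1,\dots,n_m$ (depending on $t$) with $\sum_{k=1}^m n_k=n$ and an invertible operator $X$ in $M_n(L^\infty(\Lambda_t,\mu))$ such that, for the restriction $A|_{\Lambda_t}\in M_n(L^\infty(\Lambda_t,\mu))$ of $A$ to $(L^2(\Lambda_t,\mu))^{(n)}$, the operator $XA|_{\Lambda_t}X^{-1}$ is block diagonal, $XA|_{\Lambda_t}X^{-1}=A_1\oplus\cdots\oplus A_m$, where each $A_k=(A^k_{ij})_{1\le i,j\le n_k}\in M_{n_k}(L^\infty(\Lambda_t,\mu))$ is upper triangular, $A^k_{jj}=A^k_{11}$ for $j=2,\dots,n_k$, and the support of $A^k_{j,j+1}$ equals $\Lambda_t$ for $j=1,\dots,n_k-1$; (4) there exist an invertible element $X$ in $M_n(L^\infty(\mu))$ and a unitary operator $U$ (from $(L^2(\mu))^{(n)}$ onto a direct integral Hilbert space) such that $UXAX^{-1}U^*$ is a direct integral of strongly irreducible operators with respect to a diagonal algebra $\mathscr D$ and $U^*\mathscr D U\subseteq M_n(L^\infty(\mu))$. If one of the conditions (1), (2), (3), (4) holds for $A$, then for every two bounded maximal abelian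 sets of idempotents $\mathscr P$ and $\mathscr Q$ in $\{A\}'\cap M_n(L^\infty(\mu))$, there exists an invertible element $X$ in $\{A\}'\cap M_n(L^\infty(\mu))$ such that $X\mathscr P X^{-1}=\mathscr Q$.
   Context: Hilbert spaces are complex and separable. $\mu$ is (the completion of) a finite positive regular Borel measure supported on a compact subset $\Lambda$ of $\mathbb C$. Elements of $L^\infty(\mu)$ are regarded as multiplication operators on $L^2(\mu)$, and $M_n(L^\infty(\mu))$ acts on $(L^2(\mu))^{(n)}$ (direct sum of $n$ copies); for $B\in M_n(L^\infty(\mu))$, $B(\lambda)\in M_n(\mathbb C)$ is defined for almost every $\lambda\in\Lambda$. $L^\infty(\Lambda_t,\mu)$ and $L^2(\Lambda_t,\mu)$ refer to the restriction of $\mu$ to $\Lambda_t$. The relative commutant is $\{A\}'\cap M_n(L^\infty(\mu))=\{B\in M_n(L^\infty(\mu)):AB=BA\}$. The support of $f\in L^\infty(\mu)$ is $\{\lambda: f(\lambda)\ne 0\}$ (up to $\mu$-null sets); "the support of $f$ equals $\Lambda_t$" means $f(\lambda)\neq 0$ for $\mu$-almost every $\lambda\in\Lambda_t$. An idempotent is an operator $P$ with $P^2=P$. For an idempotent $P\in M_n(L^\infty(\mu))$, $\mathrm{Tr}(P)(\lambda)=\mathrm{Tr}(P(\lambda))=\mathrm{rank}(P(\lambda))$ for almost every $\lambda$, where $\mathrm{Tr}$ is the standard (non-normalized) trace. A bounded maximal abelian set of idempotents in an algebra $\mathfrak A$ of operators is a norm-bounded set of pairwise commuting idempotents of $\mathfrak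 A$ that is maximal (under inclusion) among sets of pairwise commuting idempotents of $\mathfrak A$. Finite frame: a finite subset $\{P_k\}_{k=1}^m$ of idempotents in $\{A\}'\cap M_n(L^\infty(\mu))$ is a finite frame of $\{A\}'\cap M_n(L^\infty(\mu))$ if (i) $P_iP_j=P_jP_i=0$ for $i\ne j$; (ii) $\sum_{k=1}^m P_k$ is the identity of $M_n(L^\infty(\mu))$; (iii) for each $k$, $P_k$ is minimal (with respect to the order $P\le Q\iff PQ=QP=P$ on idempotents) in the set $\{P\in\mathscr P_k: P(\lambda)\neq 0\text{ a.e. }[\mu]\text{ on }\Lambda_k\}$, where $\mathscr P_k=\{P\in\{A\}'\cap M_n(L^\infty(\mu)):P^2=P,\ PP_k=P_kP\}$ and $\Lambda_k=\{\lambda\in\Lambda:P_k(\lambda)\ne0\}$ is the support of $\mathrm{Tr}(P_k)$; (iv) the first three items also hold for $\{P_kE\}_{k=1}^m$ restricted to $\mathrm{ran}\,E$, for every central projection $E$ of $M_n(L^\infty(\mu))$ (i.e. $E$ is the characteristic function of a Borel subset $\Lambda_E\subseteq\Lambda$ times the identity, and one works over $\Lambda_E$). Strong irreducibility: an operator $T$ on a Hilbert space $\mathscr K$ is strongly irreducible if its commutant $\{T\}'$ in $\mathscr L(\mathscr K)$ (the bounded operators on $\mathscr K$) contains no idempotents other than $0$ and $I$ (equivalently, $XTX^{-1}$ is irreducible for every invertible $X$). Direct integrals: let $\mathscr H_1\subset\mathscr H_2\subset\cdots\subset\mathscr H_\infty$ be Hilbert spaces with $\dim\mathscr H_j=j$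 and $\mathscr H_\infty$ spanned by the other $\mathscr H_j$. Let $\nu$ be (the completion of) a finite positive regular Borel measure supported on a compact set $\Gamma\subset\mathbb R$ with a Borel partition $\{\Gamma_\infty\}\cup\{\Gamma_j\}_{j\ge1}$. The direct integral Hilbert space $\mathscr H=\int^\oplus_\Gamma\mathscr H(\gamma)\,d\nu(\gamma)$ consists of (classes of) measurable $f:\Gamma\to\mathscr H_\infty$ with $f(\gamma)\in\mathscr H(\gamma):=\mathscr H_j$ for $\gamma\in\Gamma_j$ and $\int\|f(\gamma)\|^2d\nu(\gamma)<\infty$, with inner product $\int (f(\gamma),g(\gamma))\,d\nu(\gamma)$. An operator $T$ on $\mathscr H$ is decomposable if there is a strongly $\nu$-measurable operator-valued function $T(\cdot)$ with $T(\gamma)\in\mathscr L(\mathscr H(\gamma))$ and $(Tf)(\gamma)=T(\gamma)f(\gamma)$; it is diagonal if moreover $T(\gamma)$ is a scalar multiple of the identity for almost every $\gamma$. The diagonal algebra $\mathscr D$ is the collection of all diagonal operators. A decomposable $T$ is a direct integral of strongly irreducible operators (with respect to $\mathscr D$) if $T(\gamma)$ is strongly irreducible on $\mathscr H(\gamma)$ for $\nu$-almost every $\gamma$. *)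

theory Defs
  imports
    "HOL-Analysis.Analysis"
    "HOL-Library.Extended_Nat"
    "Jordan_Normal_Form.Matrix"
begin

text \<open>The completion of a finite positive Borel measure supported on the compact set \<open>K\<close>.
  Regularity is automatic for finite Borel measures on the complex plane and on the real line.
  The underlying space is the whole plane or line, and the complement of \<open>K\<close> is null.\<close>

definition compactly_supported_measure :: "'a::euclidean_space set \<Rightarrow> 'a measure \<Rightarrow> bool" where
  "compactly_supported_measure K M \<longleftrightarrow>
     compact K \<and>
     (\<exists>M0. sets M0 = sets borel \<and> finite_measure M0 \<and> emeasure M0 (- K) = 0 \<and> M = completion M0)"

text \<open>Elements of \<open>M\<^sub>n(L\<^sup>\<infinity>(M))\<close> are given by representatives \<open>\<lambda> \<mapsto> B(\<lambda>)\<close>; two representatives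
  denote the same element iff they agree almost everywhere, and all (in)equalities between elements
  are stated in this sense. The restriction of an element to a Borel set \<open>E\<close> is the same
  representative, taken with respect to \<open>restrict_space M E\<close>.\<close>

definition Mn_Linf :: "'a measure \<Rightarrow> nat \<Rightarrow> ('a \<Rightarrow> complex mat) set" where
  "Mn_Linf M n = {B.
     (\<forall>l\<in>space M. B l \<in> carrier_mat n n) \<and>
     (\<forall>i<n. \<forall>j<n. (\<lambda>l. B l $$ (i, j)) \<in> borel_measurable M \<and>
        (\<exists>c. AE l in M. cmod (B l $$ (i, j)) \<le> c))}"

definition rel_commutant ::
    "'a measure \<Rightarrow> nat \<Rightarrow> ('a \<Rightarrow> complex mat) \<Rightarrow> ('a \<Rightarrow> complex mat) set" where
  "rel_commutant M n A = {B \<in> Mn_Linf M n. AE l in M. A l * B l = B l * A l}"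

definition Mn_inverse_pair ::
    "'a measure \<Rightarrow> nat \<Rightarrow> ('a \<Rightarrow> complex mat) \<Rightarrow> ('a \<Rightarrow> complex mat) \<Rightarrow> bool" where
  "Mn_inverse_pair M n X Y \<longleftrightarrow>
     X \<in> Mn_Linf M n \<and> Y \<in> Mn_Linf M n \<and>
     (AE l in M. X l * Y l = 1\<^sub>m n \<and> Y l * X l = 1\<^sub>m n)"

definition commutant_idempotents ::
    "'a measure \<Rightarrow> nat \<Rightarrow> ('a \<Rightarrow> complex mat) \<Rightarrow> ('a \<Rightarrow> complex mat) set" where
  "commutant_idempotents M n A = {P \<in> rel_commutant M n A. AE l in M. P l * P l = P l}"

definition idem_le :: "'a measure \<Rightarrow> ('a \<Rightarrow> complex mat) \<Rightarrow> ('a \<Rightarrow> complex mat) \<Rightarrow> bool" where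
  "idem_le M P Q \<longleftrightarrow> (AE l in M. P l * Q l = P l \<and> Q l * P l = P l)"

text \<open>For \<open>P = P\<^sub>k\<close>: the idempotents of the relative commutant that commute with \<open>P\<^sub>k\<close> and are
  nonzero almost everywhere on \<open>\<Lambda>\<^sub>k = {l. P\<^sub>k(l) \<noteq> 0}\<close>.\<close>

definition frame_competitors ::
    "'a measure \<Rightarrow> nat \<Rightarrow> ('a \<Rightarrow> complex mat) \<Rightarrow> ('a \<Rightarrow> complex mat) \<Rightarrow> ('a \<Rightarrow> complex mat) set"
  where
  "frame_competitors M n A Pk = {P \<in> commutant_idempotents M n A.
     (AE l in M. P l * Pk l = Pk l * P l) \<and>
     (AE l in M. Pk l \<noteq> 0\<^sub>m n n \<longrightarrow> P l \<noteq> 0\<^sub>m n n)}"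

definition frame_conditions ::
    "'a measure \<Rightarrow> nat \<Rightarrow> ('a \<Rightarrow> complex mat) \<Rightarrow> nat \<Rightarrow> (nat \<Rightarrow> 'a \<Rightarrow> complex mat) \<Rightarrow> bool" where
  "frame_conditions M n A m P \<longleftrightarrow>
     (\<forall>k<m. P k \<in> commutant_idempotents M n A) \<and>
     (\<forall>i<m. \<forall>j<m. i \<noteq> j \<longrightarrow>
        (AE l in M. P i l * P j l = 0\<^sub>m n n \<and> P j l * P i l = 0\<^sub>m n n)) \<and>
     (AE l in M. mat n n (\<lambda>ij. \<Sum>k<m. P k l $$ ij) = 1\<^sub>m n) \<and>
     (\<forall>k<m. P k \<in> frame_competitors M n A (P k) \<and>
        (\<forall>Q\<in>frame_competitors M n A (P k). idem_le M Q (P k) \<longrightarrow> (AE l in M. Q l = P k l)))"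

text \<open>The central projections of \<open>M\<^sub>n(L\<^sup>\<infinity>(M))\<close> are \<open>\<chi>\<^sub>E I\<close> with \<open>E \<subseteq> K\<close> Borel; cutting down
  by such a projection means working over \<open>E\<close>.\<close>

definition finite_frame ::
    "'a::topological_space set \<Rightarrow> 'a measure \<Rightarrow> nat \<Rightarrow> ('a \<Rightarrow> complex mat) \<Rightarrow>
     nat \<Rightarrow> (nat \<Rightarrow> 'a \<Rightarrow> complex mat) \<Rightarrow> bool" where
  "finite_frame K M n A m P \<longleftrightarrow>
     frame_conditions M n A m P \<and>
     (\<forall>E\<in>sets borel. E \<subseteq> K \<longrightarrow> frame_conditions (restrict_space M E) n A m P)"

text \<open>A complex Hilbert space presented by representatives: two elements of \<open>vecs H\<close> denote the
  same vector iff their difference has norm \<open>0\<close> (\<open>heq\<close>). Inner products are linear in the first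
  argument.\<close>

record 'a hilbert =
  vecs :: "'a set"
  vadd :: "'a \<Rightarrow> 'a \<Rightarrow> 'a"
  vscale :: "complex \<Rightarrow> 'a \<Rightarrow> 'a"
  vinner :: "'a \<Rightarrow> 'a \<Rightarrow> complex"

definition vnorm :: "'a hilbert \<Rightarrow> 'a \<Rightarrow> real" where
  "vnorm H x = sqrt (Re (vinner H x x))"

definition heq :: "'a hilbert \<Rightarrow> 'a \<Rightarrow> 'a \<Rightarrow> bool" where
  "heq H x y \<longleftrightarrow> vnorm H (vadd H x (vscale H (- 1) y)) = 0"

text \<open>Boundedness and linearity up to \<open>heq\<close> imply that the map respects \<open>heq\<close>, so it induces a
  bounded operator on vectors.\<close>

definition bounded_op :: "'a hilbert \<Rightarrow> 'b hilbert \<Rightarrow> ('a \<Rightarrow> 'b) \<Rightarrow> bool" where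
  "bounded_op H K T \<longleftrightarrow>
     (\<forall>x\<in>vecs H. T x \<in> vecs K) \<and>
     (\<forall>x\<in>vecs H. \<forall>y\<in>vecs H. heq K (T (vadd H x y)) (vadd K (T x) (T y))) \<and>
     (\<forall>c. \<forall>x\<in>vecs H. heq K (T (vscale H c x)) (vscale K c (T x))) \<and>
     (\<exists>C. \<forall>x\<in>vecs H. vnorm K (T x) \<le> C * vnorm H x)"

definition op_eq :: "'a hilbert \<Rightarrow> 'b hilbert \<Rightarrow> ('a \<Rightarrow> 'b) \<Rightarrow> ('a \<Rightarrow> 'b) \<Rightarrow> bool" where
  "op_eq H K S T \<longleftrightarrow> (\<forall>x\<in>vecs H. heq K (S x) (T x))"

definition adjoint_op :: "'a hilbert \<Rightarrow> 'b hilbert \<Rightarrow> ('a \<Rightarrow> 'b) \<Rightarrow> ('b \<Rightarrow> 'a) \<Rightarrow> bool" where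
  "adjoint_op H K T S \<longleftrightarrow>
     bounded_op K H S \<and> (\<forall>x\<in>vecs H. \<forall>y\<in>vecs K. vinner K (T x) y = vinner H x (S y))"

definition unitary_op :: "'a hilbert \<Rightarrow> 'b hilbert \<Rightarrow> ('a \<Rightarrow> 'b) \<Rightarrow> bool" where
  "unitary_op H K U \<longleftrightarrow>
     bounded_op H K U \<and>
     (\<forall>x\<in>vecs H. \<forall>y\<in>vecs H. vinner K (U x) (U y) = vinner H x y) \<and>
     (\<forall>y\<in>vecs K. \<exists>x\<in>vecs H. heq K (U x) y)"

definition strongly_irreducible :: "'a hilbert \<Rightarrow> ('a \<Rightarrow> 'a) \<Rightarrow> bool" where
  "strongly_irreducible H T \<longleftrightarrow>
     bounded_op H H T \<and>
     (\<forall>P. bounded_op H H P \<and> op_eq H H (T \<circ> P) (P \<circ> T) \<and> op_eq H H (P \<circ> P) P \<longrightarrow>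
        op_eq H H P (\<lambda>x. vscale H 0 x) \<or> op_eq H H P id)"

text \<open>The chain \<open>H\<^sub>1 \<subseteq> H\<^sub>2 \<subseteq> \<dots> \<subseteq> H\<^sub>\<infinity>\<close>: \<open>H\<^sub>\<infinity>\<close> is the space of square-summable sequences and
  \<open>H\<^sub>j\<close> consists of those sequences that vanish from index \<open>j\<close> on.\<close>

definition hdim :: "enat \<Rightarrow> (nat \<Rightarrow> complex) hilbert" where
  "hdim j = \<lparr>
     vecs = {x. summable (\<lambda>i. (cmod (x i))\<^sup>2) \<and> (\<forall>i. j \<le> enat i \<longrightarrow> x i = 0)},
     vadd = (\<lambda>x y i. x i + y i),
     vscale = (\<lambda>c x i. c * x i),
     vinner = (\<lambda>x y. \<Sum>i. x i * cnj (y i)) \<rparr>"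

text \<open>A Borel partition \<open>{\<Gamma>\<^sub>\<infinity>} \<union> {\<Gamma>\<^sub>j}\<^sub>j\<^sub>\<ge>\<^sub>1\<close> is encoded by the function \<open>d\<close> with value \<open>j\<close> on
  \<open>\<Gamma>\<^sub>j\<close>, so the fibre at \<open>g\<close> is \<open>hdim (d g)\<close>. Values of \<open>d\<close> outside the compact support are
  irrelevant.\<close>

definition dimension_function :: "('a::topological_space \<Rightarrow> enat) \<Rightarrow> bool" where
  "dimension_function d \<longleftrightarrow> (\<forall>j. {g. d g = j} \<in> sets borel) \<and> (\<forall>g. 1 \<le> d g)"

text \<open>Measurability of a function into the separable space \<open>H\<^sub>\<infinity>\<close> is measurability of all
  coordinates.\<close>

definition direct_integral :: "'a measure \<Rightarrow> ('a \<Rightarrow> enat) \<Rightarrow> ('a \<Rightarrow> nat \<Rightarrow> complex) hilbert" where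
  "direct_integral M d = \<lparr>
     vecs = {f. (\<forall>g. f g \<in> vecs (hdim (d g))) \<and>
                (\<forall>i. (\<lambda>g. f g i) \<in> borel_measurable M) \<and>
                integrable M (\<lambda>g. (vnorm (hdim (d g)) (f g))\<^sup>2)},
     vadd = (\<lambda>f h g. vadd (hdim (d g)) (f g) (h g)),
     vscale = (\<lambda>c f g. vscale (hdim (d g)) c (f g)),
     vinner = (\<lambda>f h. LINT g|M. vinner (hdim (d g)) (f g) (h g)) \<rparr>"

text \<open>The field \<open>F\<close> of bounded operators is strongly measurable: on each \<open>{g. d g = j}\<close> the map
  \<open>g \<mapsto> F(g) x\<close> is measurable for every \<open>x \<in> H\<^sub>j\<close>.\<close>

definition operator_field ::
    "'a measure \<Rightarrow> ('a \<Rightarrow> enat) \<Rightarrow> ('a \<Rightarrow> (nat \<Rightarrow> complex) \<Rightarrow> (nat \<Rightarrow> complex)) \<Rightarrow> bool" where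
  "operator_field M d F \<longleftrightarrow>
     (\<forall>g. bounded_op (hdim (d g)) (hdim (d g)) (F g)) \<and>
     (\<forall>j. \<forall>x\<in>vecs (hdim j). \<forall>i. (\<lambda>g. if d g = j then F g x i else 0) \<in> borel_measurable M)"

definition decomposes ::
    "'a measure \<Rightarrow> ('a \<Rightarrow> enat) \<Rightarrow> (('a \<Rightarrow> nat \<Rightarrow> complex) \<Rightarrow> ('a \<Rightarrow> nat \<Rightarrow> complex)) \<Rightarrow>
     ('a \<Rightarrow> (nat \<Rightarrow> complex) \<Rightarrow> (nat \<Rightarrow> complex)) \<Rightarrow> bool" where
  "decomposes M d T F \<longleftrightarrow>
     bounded_op (direct_integral M d) (direct_integral M d) T \<and>
     operator_field M d F \<and>
     (\<forall>f\<in>vecs (direct_integral M d). AE g in M. T f g = F g (f g))"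

definition diagonal_algebra ::
    "'a measure \<Rightarrow> ('a \<Rightarrow> enat) \<Rightarrow> (('a \<Rightarrow> nat \<Rightarrow> complex) \<Rightarrow> ('a \<Rightarrow> nat \<Rightarrow> complex)) set" where
  "diagonal_algebra M d = {T. \<exists>F. decomposes M d T F \<and>
     (AE g in M. \<exists>c. op_eq (hdim (d g)) (hdim (d g)) (F g) (vscale (hdim (d g)) c))}"

definition direct_integral_of_strongly_irreducibles ::
    "'a measure \<Rightarrow> ('a \<Rightarrow> enat) \<Rightarrow> (('a \<Rightarrow> nat \<Rightarrow> complex) \<Rightarrow> ('a \<Rightarrow> nat \<Rightarrow> complex)) \<Rightarrow> bool" where
  "direct_integral_of_strongly_irreducibles M d T \<longleftrightarrow>
     (\<exists>F. decomposes M d T F \<and> (AE g in M. strongly_irreducible (hdim (d g)) (F g)))"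

text \<open>The direct sum of \<open>n\<close> copies of \<open>L\<^sup>2(M)\<close>: an \<open>n\<close>-tuple \<open>(f\<^sub>0, \<dots>, f\<^sub>n\<^sub>-\<^sub>1)\<close> of functions is
  the function \<open>l \<mapsto> (f\<^sub>0(l), \<dots>, f\<^sub>n\<^sub>-\<^sub>1(l), 0, 0, \<dots>)\<close>, so it is the direct integral with constant
  fibre dimension \<open>n\<close>.\<close>

definition L2n :: "'a measure \<Rightarrow> nat \<Rightarrow> ('a \<Rightarrow> nat \<Rightarrow> complex) hilbert" where
  "L2n M n = direct_integral M (\<lambda>_. enat n)"

definition mat_op ::
    "nat \<Rightarrow> ('a \<Rightarrow> complex mat) \<Rightarrow> ('a \<Rightarrow> nat \<Rightarrow> complex) \<Rightarrow> ('a \<Rightarrow> nat \<Rightarrow> complex)" where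
  "mat_op n B f = (\<lambda>l i. if i < n then \<Sum>j<n. B l $$ (i, j) * f l j else 0)"

definition norm_bounded :: "'a measure \<Rightarrow> nat \<Rightarrow> ('a \<Rightarrow> complex mat) set \<Rightarrow> bool" where
  "norm_bounded M n S \<longleftrightarrow>
     (\<exists>C. \<forall>B\<in>S. \<forall>f\<in>vecs (L2n M n). vnorm (L2n M n) (mat_op n B f) \<le> C * vnorm (L2n M n) f)"

definition commuting_idempotents ::
    "'a measure \<Rightarrow> nat \<Rightarrow> ('a \<Rightarrow> complex mat) \<Rightarrow> ('a \<Rightarrow> complex mat) set \<Rightarrow> bool" where
  "commuting_idempotents M n A S \<longleftrightarrow>
     S \<subseteq> commutant_idempotents M n A \<and>
     (\<forall>P\<in>S. \<forall>Q\<in>S. AE l in M. P l * Q l = Q l * P l)"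

text \<open>A maximal set of representatives is automatically closed under almost-everywhere equality,
  so such sets are exactly the maximal sets of elements.\<close>

definition bounded_maximal_abelian_idempotents ::
    "'a measure \<Rightarrow> nat \<Rightarrow> ('a \<Rightarrow> complex mat) \<Rightarrow> ('a \<Rightarrow> complex mat) set \<Rightarrow> bool" where
  "bounded_maximal_abelian_idempotents M n A S \<longleftrightarrow>
     norm_bounded M n S \<and>
     commuting_idempotents M n A S \<and>
     (\<forall>S'. commuting_idempotents M n A S' \<and> S \<subseteq> S' \<longrightarrow> S' = S)"

definition conjugate_set ::
    "'a measure \<Rightarrow> nat \<Rightarrow> ('a \<Rightarrow> complex mat) \<Rightarrow> ('a \<Rightarrow> complex mat) \<Rightarrow>
     ('a \<Rightarrow> complex mat) set \<Rightarrow> ('a \<Rightarrow> complex mat) set" where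
  "conjugate_set M n X Y S = {Q \<in> Mn_Linf M n. \<exists>P\<in>S. AE l in M. Q l = X l * P l * Y l}"

definition jordan_block_form ::
    "'a measure \<Rightarrow> nat \<Rightarrow> ('a \<Rightarrow> complex mat) \<Rightarrow> bool" where
  "jordan_block_form M n A \<longleftrightarrow>
     (\<exists>(m::nat) (nn::nat \<Rightarrow> nat) X Y (B :: nat \<Rightarrow> 'a \<Rightarrow> complex mat).
        0 < m \<and> (\<forall>k<m. 0 < nn k) \<and> (\<Sum>k<m. nn k) = n \<and>
        Mn_inverse_pair M n X Y \<and>
        (\<forall>k<m. B k \<in> Mn_Linf M (nn k)) \<and>
        (AE l in M. X l * A l * Y l = diag_block_mat (map (\<lambda>k. B k l) [0..<m])) \<and>
        (\<forall>k<m.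
           (AE l in M. upper_triangular (B k l)) \<and>
           (\<forall>j<nn k. AE l in M. B k l $$ (j, j) = B k l $$ (0, 0)) \<and>
           (\<forall>j. Suc j < nn k \<longrightarrow> (AE l in M. B k l $$ (j, Suc j) \<noteq> 0))))"

definition piecewise_jordan_block_form ::
    "'a::topological_space set \<Rightarrow> 'a measure \<Rightarrow> nat \<Rightarrow> ('a \<Rightarrow> complex mat) \<Rightarrow> bool" where
  "piecewise_jordan_block_form K M n A \<longleftrightarrow>
     (\<exists>(r::nat) (L :: nat \<Rightarrow> 'a set).
        (\<forall>t<r. L t \<in> sets borel) \<and> disjoint_family_on L {..<r} \<and> (\<Union>t<r. L t) = K \<and>
        (\<forall>t<r. jordan_block_form (restrict_space M (L t)) n A))"

definition similar_to_direct_integral ::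
    "'a measure \<Rightarrow> nat \<Rightarrow> ('a \<Rightarrow> complex mat) \<Rightarrow> bool" where
  "similar_to_direct_integral M n A \<longleftrightarrow>
     (\<exists>X Y (G :: real set) N d U Us.
        Mn_inverse_pair M n X Y \<and>
        compactly_supported_measure G N \<and> dimension_function d \<and>
        unitary_op (L2n M n) (direct_integral N d) U \<and>
        adjoint_op (L2n M n) (direct_integral N d) U Us \<and>
        direct_integral_of_strongly_irreducibles N d
          (U \<circ> mat_op n X \<circ> mat_op n A \<circ> mat_op n Y \<circ> Us) \<and>
        (\<forall>T\<in>diagonal_algebra N d. \<exists>B\<in>Mn_Linf M n.
           op_eq (L2n M n) (L2n M n) (Us \<circ> T \<circ> U) (mat_op n B)))"

end

theory Submission
  imports Defs "Jordan_Normal_Form.Jordan_Normal_Form_Existence"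
begin

text \<open>
  All four conditions are compared with a fifth one: a bounded measurable family of idempotents
  commuting with \<open>A\<close> that is, at almost every point, an orthogonal decomposition of the identity into
  idempotents which are minimal in the commutant of the matrix \<open>A(l)\<close>. At a single point such a
  decomposition splits the matrix into indecomposable pieces, and any two of them are similar
  within the commutant (Krull--Schmidt), with bounds depending only on the bounds of the
  idempotents. Because the witnesses stay in a fixed compact set and the relations are closed, they
  can be selected measurably, which turns pointwise similarities into invertible elements of
  \<open>M\<^sub>n(L\<^sup>\<infinity>)\<close>. A bounded maximal abelian set of idempotents yields such a family by splitting off
  idempotents of minimal rank. From the Jordan form one passes to a direct integral by placing the
  blocks over disjoint copies of the plane, coded into the line by a Borel injection. Conversely, an
  idempotent that commutes with the diagonal algebra acts fibrewise, so if almost all fibres are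
  strongly irreducible it is the characteristic function of a set.
\<close>

section \<open>A Borel coding of the plane in the line\<close>

text \<open>Two quantitative obstacles shape the argument. An element of \<open>Mn_Linf\<close>
  needs one essential bound, so every pointwise similarity must be bounded in terms of the bounds of
  the idempotents alone; and a measurable choice is made from a compact set by a closed relation,
  whereas "nonzero" and "strictly smaller" are open conditions. For the bounds, a basis of the range
  of a minimal idempotent is orthonormalised by an upper triangular change of basis, which keeps the
  triangular shape of the compressed matrix and gives \<open>E\<close> with entries at most 1 and
  \<open>G = star E * P\<close>. Superdiagonal entries are therefore left merely nonzero: scaling
  them to 1 could destroy the bounds. In the exchange of idempotents a diagonal entry of modulus at
  least \<open>1 / (q + 1)\<close> is available, since at most \<open>q\<close> such entries add up
  to 1. The open conditions that remain are exhausted by closed ones with thresholds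
  \<open>1 / J\<close>. Zero counts as a minimal idempotent, so that a frame with a fixed number of
  members serves points at which the number of indecomposable pieces varies.\<close>

lemma ternary_digits:
 fixes a :: "nat => nat"
 assumes a: "\<And>i. a i \<le> 1"
 defines "t \<equiv> \<Sum>k. real (a k) / 3 ^ Suc k"
 shows "\<lfloor>3 ^ Suc i * t\<rfloor> mod 3 = int (a i)" "0 \<le> t" "t < 1"
proof -
 \<comment> \<open>\<open>T i\<close> is the tail left after \<open>i\<close> ternary digits. With
   digits 0 and 1 only, every tail is at most 1/2, so no carry disturbs the floor; in base 2 the
   sequences 0.0111... and 0.1000... would have the same value.\<close>
 define T where "T i = (\<Sum>k. real (a (i + k)) / 3 ^ Suc k)" for i
 have g: "(%k. 1 / 3 ^ Suc k :: real) sums (1 / 2)"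
  using sums_mult[OF geometric_sums[of "1/3 :: real"], of "1/3"] by (simp add: power_divide field_simps)
 have le: "real (a (i + k)) / 3 ^ Suc k \<le> 1 / 3 ^ Suc k" for i k
  using a[of "i + k"] by (intro divide_right_mono) auto
 have sm: "summable (%k. real (a (i + k)) / 3 ^ Suc k)" for i
  by (rule summable_comparison_test'[OF sums_summable[OF g], of 0]) (use le[of i] in auto)
 have T: "0 \<le> T i" "T i < 1" for i
 proof -
  show "0 \<le> T i" unfolding T_def by (rule suminf_nonneg[OF sm]) simp
  have "T i \<le> 1 / 2" unfolding T_def sums_unique[OF g] by (rule suminf_le[OF le sm sums_summable[OF g]])
  then show "T i < 1" by simp
 qed
 have rec: "3 * T i = a i + T (Suc i)" for i
 proof -
  have "T i = real (a i) / 3 + (\<Sum>k. real (a (i + Suc k)) / 3 ^ Suc (Suc k))"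
   unfolding T_def using suminf_split_head[OF sm[of i]] by simp
  also have "(\<Sum>k. real (a (i + Suc k)) / 3 ^ Suc (Suc k)) = (\<Sum>k. (1/3) * (real (a (Suc i + k)) / 3 ^ Suc k))"
   by (rule suminf_cong) simp
  also have "\<dots> = 1 / 3 * T (Suc i)" unfolding T_def by (rule suminf_mult[OF sm])
  finally show ?thesis by simp
 qed
 have T0: "T 0 = t" unfolding T_def t_def by simp
 show "0 \<le> t" "t < 1" using T[of 0] T0 by auto
 have "\<exists>N::int. 3 ^ i * t = N + T i" for i
 proof (induction i)
  case 0 then show ?case using T0 by (intro exI[of _ 0]) simp
 next
  case (Suc i)
  then obtain N :: int where "3 ^ i * t = N + T i" by blast
  then have "3 ^ Suc i * t = (3 * N + int (a i)) + T (Suc i)" using rec[of i] by simp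
  then show ?case by blast
 qed
 then obtain N :: int where "3 ^ i * t = N + T i" by blast
 then have "3 ^ Suc i * t = (3 * N + int (a i)) + T (Suc i)" using rec[of i] by simp
 then have "\<lfloor>3 ^ Suc i * t\<rfloor> = 3 * N + int (a i)" using T[of "Suc i"] by (intro floor_unique) auto
 then show "\<lfloor>3 ^ Suc i * t\<rfloor> mod 3 = int (a i)" using a[of i] by simp
qed

text \<open>A real number is the infimum of the rationals above it. Rationals that are not above
  \<open>x\<close> contribute \<open>\<infinity>\<close>, neutral for the infimum, so that the index
  set does not depend on \<open>x\<close>.\<close>

lemma INF_rat_above:
 fixes x :: real
 shows "(INF i. if x < real_of_rat (from_nat_into UNIV i) then ereal (real_of_rat (from_nat_into UNIV i)) else \<infinity>) = ereal x"
proof -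
 define f where "f i = (if x < real_of_rat (from_nat_into UNIV i) then ereal (real_of_rat (from_nat_into UNIV i)) else \<infinity>)" for i
 have "ereal x \<le> (INF i. f i)" by (rule INF_greatest) (simp add: f_def)
 moreover have "(INF i. f i) \<le> ereal x"
 proof (rule ereal_le_epsilon2)
  fix \<epsilon> :: real assume e: "0 < \<epsilon>"
  obtain q where q: "x < real_of_rat q" "real_of_rat q < x + \<epsilon>" using of_rat_dense[of x "x + \<epsilon>"] e by auto
  obtain i where i: "q = from_nat_into UNIV i"
   using from_nat_into_surj[of UNIV q] by auto
  have "(INF i. f i) \<le> f i" by (rule INF_lower) simp
  also have "f i = ereal (real_of_rat q)" unfolding f_def i[symmetric] using q by simp
  also have "\<dots> \<le> ereal x + ereal \<epsilon>" using q by simp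
  finally show "(INF i. f i) \<le> ereal x + ereal \<epsilon>" .
 qed
 ultimately have "(INF i. f i) = ereal x" by (rule antisym[rotated])
 then show ?thesis unfolding f_def .
qed

text \<open>Even ternary digits record which rationals exceed \<open>Re z\<close>, odd digits which
  exceed \<open>Im z\<close>; decoding takes infima over the recorded rationals. Both directions use
  countable operations only. The range in [0, 1) lets integer translates of the code be disjoint,
  which makes room for several copies of the plane in the line.\<close>

lemma borel_code:
 "\<exists>(\<phi>::complex => real) (\<psi>::real => complex). \<phi> \<in> borel_measurable borel \<and> \<psi> \<in> borel_measurable borel \<and>
  (\<forall>z. \<psi> (\<phi> z) = z) \<and> (\<forall>z. 0 \<le> \<phi> z \<and> \<phi> z < 1)"
proof -
 define q :: "nat => real" where "q i = real_of_rat (from_nat_into UNIV i)" for i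
 define a :: "complex => nat => nat" where
  "a z i = (if even i then (if Re z < q (i div 2) then 1 else 0) else (if Im z < q (i div 2) then 1 else 0))" for z i
 define \<phi> where "\<phi> z = (\<Sum>k. real (a z k) / 3 ^ Suc k)" for z
 define b where "b i t \<longleftrightarrow> \<lfloor>3 ^ Suc i * t\<rfloor> mod 3 = 1" for i and t :: real
 define \<psi> where "\<psi> t = Complex (real_of_ereal (INF i. if b (2 * i) t then ereal (q i) else \<infinity>))
  (real_of_ereal (INF i. if b (2 * i + 1) t then ereal (q i) else \<infinity>))" for t
 have a1: "a z i \<le> 1" for z i unfolding a_def by auto
 note td = ternary_digits[of "a z" for z, OF a1, folded \<phi>_def]
 have b_eq: "b i (\<phi> z) \<longleftrightarrow> a z i = 1" for i z
  unfolding b_def using td(1)[of i z] by simp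
 have "\<psi> (\<phi> z) = z" for z
  unfolding \<psi>_def b_eq a_def using INF_rat_above[of "Re z", folded q_def] INF_rat_above[of "Im z", folded q_def]
  by (simp cong: if_cong)
 moreover have "\<phi> \<in> borel_measurable borel" unfolding \<phi>_def a_def
  by measurable
 moreover have bm: "Measurable.pred borel (b i)" for i unfolding b_def by measurable
 have "\<psi> \<in> borel_measurable borel"
 proof -
  have "(%t. real_of_ereal (INF i. if b (f i) t then ereal (q i) else \<infinity>)) \<in> borel_measurable borel" for f
   using bm by (intro borel_measurable_real_of_ereal borel_measurable_INF measurable_If) auto
  then show ?thesis unfolding \<psi>_def Complex_eq by (intro borel_measurable_add borel_measurable_times borel_measurable_of_real) auto
 qed
 ultimately show ?thesis using td(2,3) by blast
qed

section \<open>Finitely supported matrices\<close>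

text \<open>Matrices of all sizes live in one type, as infinite matrices of finite support. They
  form a ring without unit, so products of rectangular matrices are rearranged by ring laws without
  side conditions on dimensions. Sizes return as the predicate \<open>rect\<close>, with
  \<open>e n\<close> as the identity on the first \<open>n\<close> coordinates.\<close>

typedef fmat = "{f :: nat => nat => complex. \<exists>N. \<forall>i j. N \<le> i \<or> N \<le> j --> f i j = 0}"
 morphisms ent Abs_fmat
 by (rule exI[of _ "%_ _. 0"]) simp

lemma fmat_eqI: "(\<And>i j. ent X i j = ent Y i j) ==> X = Y"
 by (simp add: ent_inject[symmetric] ext)

lemma ent_support: "\<exists>N. \<forall>i j. N \<le> i \<or> N \<le> j --> ent X i j = 0"
 using ent[of X] by simp

lemma ent_Abs: "(\<And>i j. N \<le> i \<or> N \<le> j ==> f i j = 0) ==> ent (Abs_fmat f) = f"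
 by (intro Abs_fmat_inverse) auto

instantiation fmat :: ring
begin

definition "0 = Abs_fmat (%i j. 0)"
definition "X + Y = Abs_fmat (%i j. ent X i j + ent Y i j)"
definition "X - Y = Abs_fmat (%i j. ent X i j - ent Y i j)"
definition "- X = Abs_fmat (%i j. - ent X i j)"
text \<open>Row \<open>i\<close> of \<open>X\<close> has finite support, so the sum is finite
  without reference to any size.\<close>

definition "X * Y = Abs_fmat (%i j. \<Sum>k | ent X i k \<noteq> 0. ent X i k * ent Y k j)"

lemma ent_zero [simp]: "ent 0 i j = 0"
 unfolding zero_fmat_def by (subst ent_Abs[of 0]) auto

lemma ent_add [simp]: "ent (X + Y) i j = ent X i j + ent Y i j"
proof -
 obtain N M where "\<forall>i j. N \<le> i \<or> N \<le> j --> ent X i j = 0" "\<forall>i j. M \<le> i \<or> M \<le> j --> ent Y i j = 0"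
  using ent_support by blast
 then show ?thesis unfolding plus_fmat_def by (subst ent_Abs[of "max N M"]) auto
qed

lemma ent_diff [simp]: "ent (X - Y) i j = ent X i j - ent Y i j"
proof -
 obtain N M where "\<forall>i j. N \<le> i \<or> N \<le> j --> ent X i j = 0" "\<forall>i j. M \<le> i \<or> M \<le> j --> ent Y i j = 0"
  using ent_support by blast
 then show ?thesis unfolding minus_fmat_def by (subst ent_Abs[of "max N M"]) auto
qed

lemma ent_uminus [simp]: "ent (- X) i j = - ent X i j"
proof -
 obtain N where "\<forall>i j. N \<le> i \<or> N \<le> j --> ent X i j = 0" using ent_support by blast
 then show ?thesis unfolding uminus_fmat_def by (subst ent_Abs[of N]) auto
qed

lemma ent_mult':
 assumes "\<And>k. N \<le> k ==> ent X i k = 0"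
 shows "ent (X * Y) i j = (\<Sum>k<N. ent X i k * ent Y k j)"
proof -
 obtain M L where M: "\<forall>i j. M \<le> i \<or> M \<le> j --> ent X i j = 0" "\<forall>i j. L \<le> i \<or> L \<le> j --> ent Y i j = 0"
  using ent_support by blast
 have "ent (X * Y) i j = (\<Sum>k | ent X i k \<noteq> 0. ent X i k * ent Y k j)"
  unfolding times_fmat_def using M by (subst ent_Abs[of "max M L"]) (auto intro!: sum.neutral)
 also have "\<dots> = (\<Sum>k<N. ent X i k * ent Y k j)"
  using assms by (intro sum.mono_neutral_left) (auto simp: not_le[symmetric])
 finally show ?thesis .
qed

instance
proof
 fix a b c :: fmat
 obtain M L where M: "\<And>i j. M \<le> i \<or> M \<le> j ==> ent a i j = 0" "\<And>i j. L \<le> i \<or> L \<le> j ==> ent b i j = 0"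
  using ent_support by metis
 show "a * b * c = a * (b * c)"
 proof (rule fmat_eqI)
  fix i j
  have ab: "ent (a * b) i k = 0" if "L \<le> k" for k
   using M that by (subst ent_mult'[of M]) auto
  have "ent (a * b * c) i j = (\<Sum>k<L. (\<Sum>l<M. ent a i l * ent b l k) * ent c k j)"
   using M ab by (subst ent_mult'[of L]) (auto simp: ent_mult'[of M])
  also have "\<dots> = (\<Sum>l<M. ent a i l * (\<Sum>k<L. ent b l k * ent c k j))"
   unfolding sum_distrib_left sum_distrib_right
   by (subst sum.swap) (simp add: mult_ac)
  also have "\<dots> = ent (a * (b * c)) i j"
   using M by (simp add: ent_mult'[of M] ent_mult'[of L])
  finally show "ent (a * b * c) i j = ent (a * (b * c)) i j" .
 qed
 define K where "K = max M L"
 have K: "\<And>i j. K \<le> i \<or> K \<le> j ==> ent a i j = 0" "\<And>i j. K \<le> i \<or> K \<le> j ==> ent b i j = 0"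
  using M unfolding K_def by auto
 show "(a + b) * c = a * c + b * c"
  using K by (intro fmat_eqI) (simp add: ent_mult'[of K] sum.distrib algebra_simps)
 show "a * (b + c) = a * b + a * c"
  using K by (intro fmat_eqI) (simp add: ent_mult'[of K] sum.distrib algebra_simps)
 show "a + b + c = a + (b + c)" by (rule fmat_eqI) (simp add: add.assoc)
 show "a + b = b + a" by (rule fmat_eqI) (simp add: add.commute)
 show "0 + a = a" by (rule fmat_eqI) simp
 show "- a + a = 0" by (rule fmat_eqI) simp
 show "a - b = a + - b" by (rule fmat_eqI) simp
qed

end

lemma ent_sum [simp]: "ent (\<Sum>k\<in>S. f k) i j = (\<Sum>k\<in>S. ent (f k) i j)"
 by (induction S rule: infinite_finite_induct) auto

definition rect :: "nat => nat => fmat => bool" where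
 "rect n r X \<longleftrightarrow> (\<forall>i j. ent X i j \<noteq> 0 --> i < n \<and> j < r)"

lemma rectD: "rect n r X ==> n \<le> i \<or> r \<le> j ==> ent X i j = 0"
 unfolding rect_def by (meson not_le)

lemma rectI: "(\<And>i j. n \<le> i \<or> r \<le> j ==> ent X i j = 0) ==> rect n r X"
 unfolding rect_def by (meson not_le)

lemma ent_mult: "rect n r X ==> ent (X * Y) i j = (\<Sum>k<r. ent X i k * ent Y k j)"
 by (rule ent_mult') (auto dest: rectD)

lemma ent_mult_right:
 assumes "rect r n Y" shows "ent (X * Y) i j = (\<Sum>k<r. ent X i k * ent Y k j)"
proof -
 obtain N where N: "\<And>i j. N \<le> i \<or> N \<le> j ==> ent X i j = 0" using ent_support by metis
 then have "ent (X * Y) i j = (\<Sum>k<max r N. ent X i k * ent Y k j)"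
  by (intro ent_mult') auto
 also have "\<dots> = (\<Sum>k<r. ent X i k * ent Y k j)"
  using rectD[OF assms] by (intro sum.mono_neutral_right) auto
 finally show ?thesis .
qed

definition mk_fmat :: "nat => nat => (nat => nat => complex) => fmat" where
 "mk_fmat n r f = Abs_fmat (%i j. if i < n \<and> j < r then f i j else 0)"

lemma ent_mk [simp]: "ent (mk_fmat n r f) i j = (if i < n \<and> j < r then f i j else 0)"
 unfolding mk_fmat_def by (subst ent_Abs[of "max n r"]) auto

lemma rect_mk [simp]: "rect n r (mk_fmat n r f)"
 by (simp add: rect_def)

definition smul :: "complex => fmat => fmat" where
 "smul c X = Abs_fmat (%i j. c * ent X i j)"

lemma ent_smul [simp]: "ent (smul c X) i j = c * ent X i j"
proof -
 obtain N where "\<forall>i j. N \<le> i \<or> N \<le> j --> ent X i j = 0" using ent_support by blast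
 then show ?thesis unfolding smul_def by (subst ent_Abs[of N]) auto
qed

definition star :: "fmat => fmat" where
 "star X = Abs_fmat (%i j. cnj (ent X j i))"

lemma ent_star [simp]: "ent (star X) i j = cnj (ent X j i)"
proof -
 obtain N where "\<forall>i j. N \<le> i \<or> N \<le> j --> ent X i j = 0" using ent_support by blast
 then show ?thesis unfolding star_def by (subst ent_Abs[of N]) auto
qed

definition e :: "nat => fmat" where
 "e n = mk_fmat n n (%i j. if i = j then 1 else 0)"

text \<open>The matrix unit. As a right factor \<open>mu b 0\<close> extracts column
  \<open>b\<close> as a column vector, as a left factor \<open>mu 0 a\<close> extracts row
  \<open>a\<close> as a row vector.\<close>

definition mu :: "nat => nat => fmat" where
 "mu a b = mk_fmat (Suc a) (Suc b) (%i j. if i = a \<and> j = b then 1 else 0)"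

lemma ent_e [simp]: "ent (e n) i j = (if i = j \<and> i < n then 1 else 0)"
 by (auto simp: e_def)

lemma ent_mu [simp]: "ent (mu a b) i j = (if i = a \<and> j = b then 1 else 0)"
 by (auto simp: mu_def)

lemma rect_e [simp]: "rect n n (e n)" by (simp add: e_def)
lemma rect_zero [simp]: "rect n r 0" by (simp add: rect_def)
lemma rect_add [intro]: "rect n r X ==> rect n r Y ==> rect n r (X + Y)"
 by (rule rectI) (simp add: rectD)
lemma rect_diff [intro]: "rect n r X ==> rect n r Y ==> rect n r (X - Y)"
 by (rule rectI) (simp add: rectD)
lemma rect_uminus [intro]: "rect n r X ==> rect n r (- X)"
 by (rule rectI) (simp add: rectD)
lemma rect_smul [intro]: "rect n r X ==> rect n r (smul c X)"
 by (rule rectI) (simp add: rectD)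
lemma rect_star [intro]: "rect n r X ==> rect r n (star X)"
 by (rule rectI) (auto simp: rectD)
lemma rect_sum [intro]: "(\<And>k. k \<in> S ==> rect n r (f k)) ==> rect n r (\<Sum>k\<in>S. f k)"
 by (induction S rule: infinite_finite_induct) auto
lemma rect_mult [intro]:
 assumes "rect n r X" "rect r' m Y" shows "rect n m (X * Y)"
 by (rule rectI) (auto simp: ent_mult[OF assms(1)] rectD[OF assms(1)] rectD[OF assms(2)])
lemma rect_mono: "rect n r X ==> n \<le> n' ==> r \<le> r' ==> rect n' r' X"
 unfolding rect_def by (meson less_le_trans)
lemma rect_mu: "a < n ==> b < r ==> rect n r (mu a b)"
 by (auto simp: rect_def)

lemma ent_e_mult [simp]: "ent (e n * X) i j = (if i < n then ent X i j else 0)"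
 by (simp add: ent_mult[OF rect_e] if_distrib[of "%x. x * _"] cong: if_cong)

lemma ent_mult_e [simp]: "ent (X * e n) i j = (if j < n then ent X i j else 0)"
proof -
 have "ent (X * e n) i j = (\<Sum>k<n. if k = j then ent X i k else 0)"
  unfolding ent_mult_right[OF rect_e] by (intro sum.cong) auto
 then show ?thesis by simp
qed

lemma rect_iff: "rect n r X \<longleftrightarrow> e n * X = X \<and> X * e r = X"
proof
 assume r: "rect n r X"
 show "e n * X = X \<and> X * e r = X"
  by (intro conjI fmat_eqI) (simp_all add: rectD[OF r])
next
 assume *: "e n * X = X \<and> X * e r = X"
 show "rect n r X" unfolding rect_def
 proof (intro allI impI)
  fix i j assume "ent X i j \<noteq> 0"
  then have "ent (e n * X) i j \<noteq> 0" "ent (X * e r) i j \<noteq> 0" using * by metis+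
  then show "i < n \<and> j < r" by (auto split: if_splits)
 qed
qed

lemma e_mult: "rect n r X ==> e n * X = X" by (simp add: rect_iff)
lemma mult_e: "rect n r X ==> X * e r = X" by (simp add: rect_iff)

lemma ent_mu_mult [simp]: "ent (mu a b * X) i j = (if i = a then ent X b j else 0)"
proof -
 have "rect (Suc a) (Suc b) (mu a b)" by (rule rect_mu) auto
 from ent_mult[OF this] show ?thesis
  by (simp add: if_distrib[of "%x. x * _"] cong: if_cong)
qed

lemma ent_mult_mu [simp]: "ent (X * mu a b) i j = (if j = b then ent X i a else 0)"
proof -
 have "rect (Suc a) (Suc b) (mu a b)" by (rule rect_mu) auto
 from ent_mult_right[OF this] have "ent (X * mu a b) i j = (\<Sum>k<Suc a. if k = a then if j = b then ent X i k else 0 else 0)"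
  by (simp add: if_distrib[of "%x. _ * x"] cong: if_cong)
 then show ?thesis by (simp del: sum.lessThan_Suc)
qed

lemma smul_mult_left: "smul c X * Y = smul c (X * Y)"
proof (rule fmat_eqI)
 fix i j
 obtain N where N: "\<And>i j. N \<le> i \<or> N \<le> j ==> ent X i j = 0" using ent_support by metis
 show "ent (smul c X * Y) i j = ent (smul c (X * Y)) i j"
  using N by (simp add: ent_mult'[of N] sum_distrib_left mult_ac)
qed

lemma smul_mult_right: "X * smul c Y = smul c (X * Y)"
proof (rule fmat_eqI)
 fix i j
 obtain N where N: "\<And>i j. N \<le> i \<or> N \<le> j ==> ent X i j = 0" using ent_support by metis
 show "ent (X * smul c Y) i j = ent (smul c (X * Y)) i j"
  using N by (simp add: ent_mult'[of N] sum_distrib_left mult_ac)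
qed

lemma smul_simps:
 "smul c (X + Y) = smul c X + smul c Y" "smul c (X - Y) = smul c X - smul c Y"
 "smul (a + b) X = smul a X + smul b X" "smul (a - b) X = smul a X - smul b X"
 by (auto intro!: fmat_eqI simp: algebra_simps)

lemma smul_smul [simp]: "smul c (smul d X) = smul (c * d) X"
 and smul_one [simp]: "smul 1 X = X" and smul_zero [simp]: "smul 0 X = 0" and smul_0 [simp]: "smul c 0 = 0"
 by (auto intro!: fmat_eqI simp: algebra_simps)

lemma star_star [simp]: "star (star X) = X" by (rule fmat_eqI) simp
lemma star_add: "star (X + Y) = star X + star Y" by (rule fmat_eqI) simp
lemma star_smul: "star (smul c X) = smul (cnj c) (star X)" by (rule fmat_eqI) simp
lemma star_zero [simp]: "star 0 = 0" by (rule fmat_eqI) simp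
lemma star_mult: "star (X * Y) = star Y * star X"
proof (rule fmat_eqI)
 fix i j
 obtain N M where N: "\<And>i j. N \<le> i \<or> N \<le> j ==> ent X i j = 0" "\<And>i j. M \<le> i \<or> M \<le> j ==> ent Y i j = 0"
  using ent_support by metis
 have "ent (X * Y) j i = (\<Sum>k<max N M. ent X j k * ent Y k i)"
  by (rule ent_mult') (simp add: N)
 moreover have "ent (star Y * star X) i j = (\<Sum>k<max N M. ent (star Y) i k * ent (star X) k j)"
  by (rule ent_mult') (simp add: N)
 ultimately show "ent (star (X * Y)) i j = ent (star Y * star X) i j"
  by (simp add: mult.commute)
qed
lemma star_e [simp]: "star (e n) = e n" by (rule fmat_eqI) simp

definition tr :: "nat => fmat => complex" where "tr n X = (\<Sum>i<n. ent X i i)"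

lemma tr_add: "tr n (X + Y) = tr n X + tr n Y" and tr_diff: "tr n (X - Y) = tr n X - tr n Y"
 by (simp_all add: tr_def sum.distrib sum_subtractf)

lemma tr_comm:
 assumes "rect n r X" "rect r n Y" shows "tr n (X * Y) = tr r (Y * X)"
 unfolding tr_def ent_mult[OF assms(1)] ent_mult[OF assms(2)]
 by (subst sum.swap) (simp add: mult_ac)

lemma tr_e [simp]: "tr n (e n) = of_nat n" by (simp add: tr_def)

section \<open>Translation between \<open>complex mat\<close> and \<open>fmat\<close>, and rank
  factorisation\<close>

definition fm :: "nat => complex mat => fmat" where "fm n B = mk_fmat n n (%i j. B $$ (i, j))"
definition tm :: "nat => fmat => complex mat" where "tm n X = mat n n (%(i, j). ent X i j)"

lemma rect_fm [simp]: "rect n n (fm n B)" by (simp add: fm_def)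
lemma ent_fm [simp]: "ent (fm n B) i j = (if i < n \<and> j < n then B $$ (i, j) else 0)" by (simp add: fm_def)
lemma tm_carrier [simp]: "tm n X \<in> carrier_mat n n" by (simp add: tm_def)
lemma tm_index [simp]: "i < n ==> j < n ==> tm n X $$ (i, j) = ent X i j" by (simp add: tm_def)
lemma fm_tm [simp]: "rect n n X ==> fm n (tm n X) = X"
 by (rule fmat_eqI) (metis ent_fm rectD not_le tm_index)
lemma tm_fm [simp]: "B \<in> carrier_mat n n ==> tm n (fm n B) = B"
 by (intro eq_matI) (auto simp: tm_def)
lemma fm_inj: "A \<in> carrier_mat n n ==> B \<in> carrier_mat n n ==> fm n A = fm n B \<longleftrightarrow> A = B"
 by (metis tm_fm)
lemma fm_mult: "A \<in> carrier_mat n n ==> B \<in> carrier_mat n n ==> fm n (A * B) = fm n A * fm n B"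
 by (rule fmat_eqI) (auto simp: ent_mult[OF rect_fm] scalar_prod_def atLeast0LessThan)
lemma fm_one [simp]: "fm n (1\<^sub>m n) = e n"
 by (rule fmat_eqI) auto
lemma fm_zero [simp]: "fm n (0\<^sub>m n n) = 0"
 by (rule fmat_eqI) auto

lemma tm_mult: "rect n n X ==> rect n n Y ==> tm n (X * Y) = tm n X * tm n Y"
 by (metis fm_mult fm_tm tm_carrier tm_fm mult_carrier_mat)
lemma tm_e [simp]: "tm n (e n) = 1\<^sub>m n" by (metis fm_one tm_fm one_carrier_mat)

lemma left_right_inverse:
 assumes "rect n n X" "rect n n Y" "X * Y = e n" shows "Y * X = e n"
proof -
 have "tm n X * tm n Y = 1\<^sub>m n" using assms by (metis tm_mult tm_e)
 then have "tm n Y * tm n X = 1\<^sub>m n" by (rule mat_mult_left_right_inverse[OF tm_carrier tm_carrier])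
 then have "tm n (Y * X) = 1\<^sub>m n" using assms by (simp add: tm_mult)
 then show ?thesis using assms by (metis fm_one fm_tm rect_mult)
qed

text \<open>Rank one idempotents are peeled off. If entry \<open>(a, b)\<close> of \<open>P\<close>
  is nonzero, let \<open>v\<close> be column \<open>b\<close> and \<open>w\<close> row
  \<open>a\<close> divided by that entry. Then \<open>v * w\<close> is an idempotent below
  \<open>P\<close>, and subtracting it clears row \<open>a\<close> without filling a zero row, so
  the number of nonzero rows drops.\<close>

lemma idem_factor:
 assumes "rect n n P" "P * P = P"
 shows "\<exists>r F G. r \<le> n \<and> rect n r F \<and> rect r n G \<and> F * G = P \<and> G * F = e r"
proof -
 have "\<exists>r F G. r \<le> q \<and> rect n r F \<and> rect r n G \<and> F * G = P \<and> G * F = e r"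
  if "rect n n P" "P * P = P" "card {i. i < n \<and> (\<exists>j. ent P i j \<noteq> 0)} \<le> q" for q P
  using that
 proof (induction q arbitrary: P)
  case 0
  then have "{i. i < n \<and> (\<exists>j. ent P i j \<noteq> 0)} = {}" by simp
  then have "P = 0" using rectD[OF 0(1)] by (intro fmat_eqI) (metis (mono_tags, lifting) ent_zero empty_iff mem_Collect_eq not_le)
  moreover have "e 0 = 0" by (rule fmat_eqI) simp
  ultimately show ?case by (intro exI[of _ 0] exI[of _ "0::fmat"]) auto
 next
  case (Suc q)
  show ?case
  proof (cases "P = 0")
   case True
   moreover have "e 0 = 0" by (rule fmat_eqI) simp
   ultimately show ?thesis by (intro exI[of _ 0] exI[of _ "0::fmat"]) auto
  next
   case False
   then obtain a b where ab: "ent P a b \<noteq> 0" by (metis fmat_eqI ent_zero)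
   then have abn: "a < n" "b < n" using Suc.prems(1) by (auto simp: rect_def)
   define v where "v = P * mu b 0"
   define w where "w = smul (1 / ent P a b) (mu 0 a * P)"
   have rv: "rect n 1 v" "rect 1 n w" unfolding v_def w_def
    using Suc.prems(1) rect_mu[of b n 0 1] rect_mu[of 0 1 a n] abn by auto
   have Pv: "P * v = v" "w * P = w"
    unfolding v_def w_def using Suc.prems(2)
    by (simp_all add: mult.assoc[symmetric] smul_mult_left) (simp add: mult.assoc)
   have "w * v = smul (1 / ent P a b) (mu 0 a * (P * mu b 0))"
    unfolding w_def v_def smul_mult_left using Suc.prems(2) by (metis mult.assoc)
   moreover have "mu 0 a * (P * mu b 0) = smul (ent P a b) (mu 0 0)"
    by (rule fmat_eqI) simp
   ultimately have wv: "w * v = mu 0 0" using ab by simp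
   define P' where "P' = P - v * w"
   have vw: "v * mu 0 0 = v" "mu 0 0 * w = w"
    by (rule fmat_eqI, use rectD[OF rv(1)] rectD[OF rv(2)] in \<open>auto simp: Suc_leI\<close>)+
   have vwvw: "v * (w * (v * w)) = v * w" "P * (v * w) = v * w" "w * (v * w) = w"
    using vw wv Pv by (metis mult.assoc)+
   have rP': "rect n n P'" unfolding P'_def using Suc.prems(1) rv by blast
   have P'P': "P' * P' = P'" unfolding P'_def
    using Suc.prems(2) vwvw Pv by (simp add: left_diff_distrib right_diff_distrib mult.assoc)
   have row: "ent (v * w) i j = ent P i b * ent P a j / ent P a b" for i j
   proof -
    have "ent (v * w) i j = ent v i 0 * ent w 0 j" using ent_mult[OF rv(1)] by simp
    then show ?thesis unfolding v_def w_def by (simp add: mult_ac)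
   qed
   have "{i. i < n \<and> (\<exists>j. ent P' i j \<noteq> 0)} \<subseteq> {i. i < n \<and> (\<exists>j. ent P i j \<noteq> 0)} - {a}"
    using ab unfolding P'_def by (auto simp: row) (metis mult_zero_left div_0)
   then have "card {i. i < n \<and> (\<exists>j. ent P' i j \<noteq> 0)} \<le> card ({i. i < n \<and> (\<exists>j. ent P i j \<noteq> 0)} - {a})"
    by (intro card_mono) auto
   also have "\<dots> \<le> q" using Suc.prems(3) ab abn by (subst card_Diff_singleton) auto
   finally obtain r F G where IH: "r \<le> q" "rect n r F" "rect r n G" "F * G = P'" "G * F = e r"
    using Suc.IH[OF rP' P'P'] by blast
   have P'v: "P' * v = 0" "w * P' = 0" unfolding P'_def
    using Pv wv vw vwvw by (simp_all add: left_diff_distrib right_diff_distrib mult.assoc)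
   have Gv: "G * v = 0"
   proof -
    have "G * v = (e r * G) * v" using IH by (simp add: e_mult)
    also have "\<dots> = G * (P' * v)" using IH by (metis mult.assoc)
    finally show ?thesis using P'v by simp
   qed
   have wF: "w * F = 0"
   proof -
    have "w * F = w * (F * e r)" using IH by (simp add: mult_e)
    also have "\<dots> = (w * P') * F" using IH by (metis mult.assoc)
    finally show ?thesis using P'v by simp
   qed
   have F0: "F * mu r 0 = 0" "mu 0 r * G = 0"
    by (rule fmat_eqI, use rectD[OF IH(2)] rectD[OF IH(3)] in simp)+
   have mm: "mu 0 r * mu r 0 = mu 0 0" "mu r 0 * mu 0 r = mu r r" "mu 0 0 * mu 0 r = mu 0 r"
    by (rule fmat_eqI, simp)+
   \<comment> \<open>The vectors \<open>v\<close> and \<open>w\<close> become column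
     \<open>r\<close> and row \<open>r\<close> of the enlarged factors. Cross terms vanish in one
     product because column \<open>r\<close> of \<open>F\<close> and row \<open>r\<close> of
     \<open>G\<close> are zero, in the other because \<open>G * v = 0\<close> and
     \<open>w * F = 0\<close>.\<close>
   have "(F + v * mu 0 r) * (G + mu r 0 * w) = F * G + (F * mu r 0) * w + v * (mu 0 r * G) + v * (mu 0 r * mu r 0) * w"
    by (simp add: algebra_simps)
   also have "\<dots> = P" using IH(4) F0 mm vw unfolding P'_def by simp
   finally have FG: "(F + v * mu 0 r) * (G + mu r 0 * w) = P" .
   have "(G + mu r 0 * w) * (F + v * mu 0 r) = G * F + (G * v) * mu 0 r + mu r 0 * (w * F) + mu r 0 * ((w * v) * mu 0 r)"
    by (simp add: algebra_simps)
   also have "\<dots> = e r + mu r r" using IH(5) Gv wF mm wv by simp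
   also have "\<dots> = e (Suc r)" by (rule fmat_eqI) auto
   finally have GF: "(G + mu r 0 * w) * (F + v * mu 0 r) = e (Suc r)" .
   have "rect n (Suc r) (F + v * mu 0 r)" "rect (Suc r) n (G + mu r 0 * w)"
    using rect_mono[OF IH(2)] rect_mono[OF IH(3)] rv rect_mu[of 0 1 r "Suc r"] rect_mu[of r "Suc r" 0 1]
    by (auto intro!: rect_add)
   then show ?thesis using FG GF IH(1) by (intro exI conjI) auto
  qed
 qed
 moreover have "card {i. i < n \<and> (\<exists>j. ent P i j \<noteq> 0)} \<le> n"
  using card_mono[of "{..<n}" "{i. i < n \<and> (\<exists>j. ent P i j \<noteq> 0)}"] by auto
 ultimately show ?thesis using assms by simp
qed

section \<open>Jordan blocks and minimal idempotents\<close>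

text \<open>\<open>band 0\<close> means upper triangular and \<open>band 1\<close> strictly upper
  triangular. Widths add under multiplication, so strictly upper triangular matrices of a fixed size
  are nilpotent.\<close>

definition band :: "nat => fmat => bool" where
 "band d X \<longleftrightarrow> (\<forall>i j. j < i + d --> ent X i j = 0)"

text \<open>The block shape of \<open>jordan_block_form\<close> at a single point: one Jordan block
  with an unnormalised superdiagonal and arbitrary entries above it.\<close>

definition jlike :: "nat => fmat => bool" where
 "jlike r C \<longleftrightarrow> rect r r C \<and> band 0 C \<and> (\<forall>i<r. ent C i i = ent C 0 0) \<and>
  (\<forall>i. Suc i < r --> ent C i (Suc i) \<noteq> 0)"

text \<open>Entries are bounded instead of the operator norm because this is a closed condition on
  each entry separately, and it cuts a compact box out of the product space used for
  selection.\<close>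

definition mbd :: "real => fmat => bool" where
 "mbd c X \<longleftrightarrow> (\<forall>i j. cmod (ent X i j) \<le> c)"

lemma sum_single:
 fixes f :: "nat => 'a::comm_monoid_add"
 assumes "a < r" "\<And>k. k < r ==> k \<noteq> a ==> f k = 0"
 shows "(\<Sum>k<r. f k) = f a"
 using assms by (subst sum.remove[of _ a]) (auto intro: sum.neutral)

lemma e_mult2: "rect n r X ==> e n * (X * Z) = X * Z"
 by (metis e_mult mult.assoc)
lemma mult_e2: "rect n r X ==> X * (e r * Z) = X * Z"
 by (metis mult_e mult.assoc)

lemma bandD: "band d X ==> j < i + d ==> ent X i j = 0"
 by (simp add: band_def)

text \<open>On the outermost diagonal of the product only one term of each sum survives. That
  formula is what allows diagonals and superdiagonals to be compared below.\<close>

lemma band_mult: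
 assumes "band d X" "band d' Y"
 shows "band (d + d') (X * Y)" and "ent (X * Y) i (i + d + d') = ent X i (i + d) * ent Y (i + d) (i + d + d')"
proof -
 obtain N where N: "\<And>i j. N \<le> i \<or> N \<le> j ==> ent X i j = 0" using ent_support by metis
 show "band (d + d') (X * Y)" unfolding band_def
 proof (intro allI impI)
  fix i j assume j: "j < i + (d + d')"
  have "ent X i k * ent Y k j = 0" for k
   using bandD[OF assms(1), of k i] bandD[OF assms(2), of j k] j by (cases "k < i + d") auto
  then show "ent (X * Y) i j = 0" by (simp add: ent_mult'[of N] N)
 qed
 have "ent (X * Y) i (i + d + d') = (\<Sum>k<max N (Suc (i + d)). ent X i k * ent Y k (i + d + d'))"
  by (rule ent_mult') (simp add: N)
 also have "\<dots> = ent X i (i + d) * ent Y (i + d) (i + d + d')"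
 proof (rule sum_single)
  fix k assume "k \<noteq> i + d"
  then show "ent X i k * ent Y k (i + d + d') = 0"
   using bandD[OF assms(1), of k i] bandD[OF assms(2), of "i + d + d'" k] by (cases "k < i + d") auto
 qed simp
 finally show "ent (X * Y) i (i + d + d') = ent X i (i + d) * ent Y (i + d) (i + d + d')" .
qed

lemma band_add: "band d X ==> band d Y ==> band d (X + Y)"
 and band_diff: "band d X ==> band d Y ==> band d (X - Y)"
 and band_smul: "band d X ==> band d (smul c X)"
 by (simp_all add: band_def)

lemma band_e: "band 0 (e n)" by (simp add: band_def)
lemma band_mono: "band d X ==> d' \<le> d ==> band d' X" by (simp add: band_def)

lemma band_rect_zero: "rect r r X ==> band r X ==> X = 0"
proof (rule fmat_eqI)
 fix i j assume *: "rect r r X" "band r X"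
 show "ent X i j = ent 0 i j"
  using bandD[OF *(2), of j i] rectD[OF *(1), of i j] by (cases "j < r") auto
qed

lemma jlike_nilpotent_part:
 assumes "jlike r C"
 defines "N \<equiv> C - smul (ent C 0 0) (e r)"
 shows "rect r r N" "band 1 N" "\<And>i. Suc i < r ==> ent N i (Suc i) \<noteq> 0"
proof -
 have C: "rect r r C" "band 0 C" "\<And>i. i < r ==> ent C i i = ent C 0 0"
  "\<And>i. Suc i < r ==> ent C i (Suc i) \<noteq> 0"
  using assms(1) unfolding jlike_def by blast+
 show "rect r r N" unfolding N_def by (intro rect_diff rect_smul C(1) rect_e)
 show "band 1 N" unfolding band_def
 proof (intro allI impI)
  fix i j :: nat assume "j < i + 1"
  then consider "j < i" | "j = i" "i < r" | "j = i" "r \<le> i" by linarith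
  moreover have "ent N i j = ent C i j - ent C 0 0 * (if i = j \<and> i < r then 1 else 0)"
   unfolding N_def by simp
  ultimately show "ent N i j = 0"
  proof cases
   case 1 then show ?thesis using bandD[OF C(2), of j i] \<open>ent N i j = _\<close> by simp
  next
   case 2 then show ?thesis using C(3)[of i] \<open>ent N i j = _\<close> by simp
  next
   case 3 then show ?thesis using rectD[OF C(1), of i j] \<open>ent N i j = _\<close> by simp
  qed
 qed
 show "\<And>i. Suc i < r ==> ent N i (Suc i) \<noteq> 0"
  using C(4) by (simp add: N_def)
qed

text \<open>Only the nilpotent part \<open>N\<close> of \<open>C\<close> matters. Triangularity is
  proved column by column from \<open>B * N = N * B\<close>; then the superdiagonal of this equation
  equates consecutive diagonal entries of \<open>B\<close>, as the superdiagonal of \<open>N\<close>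
  has no zeros.\<close>

lemma jlike_commutant:
 assumes C: "jlike r C" and B: "rect r r B" "B * C = C * B"
 shows "band 0 B" "i < r ==> ent B i i = ent B 0 0"
proof -
 define N where "N = C - smul (ent C 0 0) (e r)"
 note N = jlike_nilpotent_part[OF C, folded N_def]
 have BN: "B * N = N * B"
  unfolding N_def by (simp add: left_diff_distrib right_diff_distrib smul_mult_left smul_mult_right e_mult[OF B(1)] mult_e[OF B(1)] B(2))
 have low: "\<forall>i>j. ent B i j = 0" for j
 proof (induction j rule: less_induct)
  case (less j)
  show ?case
  proof (rule ccontr)
   assume neg: "\<not> (\<forall>i>j. ent B i j = 0)"
   define S where "S = {i. j < i \<and> ent B i j \<noteq> 0}"
   have "S \<subseteq> {..<r}" using B(1) unfolding S_def rect_def by blast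
   then have fin: "finite S" by (rule finite_subset) simp
   have "S \<noteq> {}" using neg unfolding S_def by auto
   \<comment> \<open>The lowest nonzero entry of column \<open>j\<close> below the diagonal. In the
     row just above it, \<open>N * B\<close> has a single term, namely this entry times a
     superdiagonal entry of \<open>N\<close>, while \<open>B * N\<close> only involves columns of
     \<open>B\<close> before \<open>j\<close>, already known to vanish there.\<close>
   define i where "i = Max S"
   have iS: "i \<in> S" unfolding i_def using fin \<open>S \<noteq> {}\<close> by (rule Max_in)
   have above: "ent B k j = 0" if "i < k" for k
   proof (rule ccontr)
    assume "ent B k j \<noteq> 0"
    then have "k \<in> S" using that iS unfolding S_def by auto
    then show False using Max_ge[OF fin, of k] that unfolding i_def by simp
   qed
   obtain i' where i': "i = Suc i'" using iS unfolding S_def by (cases i) auto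
   have ir: "i < r" using iS \<open>S \<subseteq> {..<r}\<close> by auto
   have ij: "j \<le> i'" using iS i' unfolding S_def by auto
   have "ent (N * B) i' j = (\<Sum>k<r. ent N i' k * ent B k j)" using ent_mult[OF N(1)] .
   also have "\<dots> = ent N i' i * ent B i j"
   proof (rule sum_single[OF ir])
    fix k assume "k \<noteq> i"
    then show "ent N i' k * ent B k j = 0"
     using bandD[OF N(2), of k i'] above[of k] i' by (cases "k < i") auto
   qed
   finally have 1: "ent (N * B) i' j = ent N i' i * ent B i j" .
   have "ent (B * N) i' j = (\<Sum>k<r. ent B i' k * ent N k j)" using ent_mult[OF B(1)] .
   also have "\<dots> = 0"
   proof (intro sum.neutral ballI)
    fix k assume "k \<in> {..<r}"
    show "ent B i' k * ent N k j = 0"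
     using bandD[OF N(2), of j k] less.IH[of k] ij by (cases "k < j") auto
   qed
   finally have "ent N i' i * ent B i j = 0" using 1 BN by simp
   then show False using N(3)[of i'] iS ir i' unfolding S_def by auto
  qed
 qed
 then show b0: "band 0 B" by (simp add: band_def)
 show "i < r ==> ent B i i = ent B 0 0"
 proof (induction i)
  case (Suc i)
  have "ent (B * N) i (i + 0 + 1) = ent (N * B) i (i + 1 + 0)" using BN by simp
  then have "ent B i i * ent N i (Suc i) = ent N i (Suc i) * ent B (Suc i) (Suc i)"
   using band_mult(2)[OF b0 N(2), of i] band_mult(2)[OF N(2) b0, of i] by simp
  then show ?case using N(3)[of i] Suc by auto
 qed simp
qed

text \<open>Squaring doubles the band width, and \<open>Q\<close> is its own square.\<close>

lemma strict_idem_zero: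
 assumes "rect r r Q" "band 1 Q" "Q * Q = Q" shows "Q = 0"
proof -
 have "band k Q" if "1 \<le> k" for k
  using that
 proof (induction k rule: nat_induct_at_least)
  case base then show ?case by (rule assms(2))
 next
  case (Suc k)
  then show ?case using band_mult(1)[OF Suc.IH Suc.IH] assms(3) by (simp add: band_mono)
 qed
 then show ?thesis using band_rect_zero[OF assms(1)] band_mono[of "Suc r" Q r] by simp
qed

text \<open>The diagonal of \<open>Q\<close> is constant and idempotent, hence 0 or 1 throughout, so
  \<open>Q\<close> or \<open>e r - Q\<close> is a strictly upper triangular idempotent. This is the
  strong irreducibility of a block in matrix form.\<close>

lemma jlike_idem:
 assumes "jlike r C" "rect r r Q" "Q * Q = Q" "Q * C = C * Q"
 shows "Q = 0 \<or> Q = e r"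
proof -
 note b = jlike_commutant[OF assms(1,2,4)]
 have "ent Q 0 0 = ent Q 0 0 * ent Q 0 0"
  using band_mult(2)[OF b(1) b(1), of 0] assms(3) by simp
 then consider "ent Q 0 0 = 0" | "ent Q 0 0 = 1" by auto
 then show ?thesis
 proof cases
  case 1
  have "band 1 Q" unfolding band_def
  proof (intro allI impI)
   fix i j :: nat assume "j < i + 1"
   then show "ent Q i j = 0"
    using bandD[OF b(1), of j i] b(2)[of i] 1 rectD[OF assms(2), of i j] by (cases "j = i"; cases "i < r") auto
  qed
  then show ?thesis using strict_idem_zero[OF assms(2) _ assms(3)] by simp
 next
  case 2
  have "band 1 (e r - Q)" unfolding band_def
  proof (intro allI impI)
   fix i j :: nat assume "j < i + 1"
   then show "ent (e r - Q) i j = 0"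
    using bandD[OF b(1), of j i] b(2)[of i] 2 rectD[OF assms(2), of i j] by (cases "j = i"; cases "i < r") auto
  qed
  moreover have "rect r r (e r - Q)" using assms(2) by auto
  moreover have "(e r - Q) * (e r - Q) = e r - Q"
   by (simp add: left_diff_distrib right_diff_distrib e_mult[OF rect_e] e_mult[OF assms(2)] mult_e[OF assms(2)] assms(3))
  ultimately have "e r - Q = 0" by (intro strict_idem_zero)
  then show ?thesis by simp
 qed
qed

definition pmin :: "fmat => fmat => bool" where
 "pmin A P \<longleftrightarrow> P * P = P \<and> A * P = P * A \<and>
  (\<forall>Q. Q * Q = Q \<and> A * Q = Q * A \<and> P * Q = Q \<and> Q * P = Q --> Q = 0 \<or> Q = P)"

text \<open>If the Jordan normal form had two or more blocks, the projection onto the first one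
  would be a nontrivial idempotent of the commutant.\<close>

lemma indecomposable_jordan:
 assumes C: "rect r r C" and r: "0 < r"
  and triv: "\<And>Q. rect r r Q ==> Q * Q = Q ==> Q * C = C * Q ==> Q = 0 \<or> Q = e r"
 shows "\<exists>T S. rect r r T \<and> rect r r S \<and> T * S = e r \<and> S * T = e r \<and> jlike r (S * C * T)"
proof -
 let ?A = "tm r C"
 obtain as where "char_poly ?A = (\<Prod>a\<leftarrow>as. [:- a, 1:])"
  using char_poly_factorized[OF tm_carrier] by blast
 then obtain na where "jordan_nf ?A na" using jordan_nf_exists[OF tm_carrier] by blast
 then have na: "0 \<notin> fst ` set na" "similar_mat ?A (jordan_matrix na)" unfolding jordan_nf_def by auto
 obtain U V where "similar_mat_wit ?A (jordan_matrix na) U V" using na(2) unfolding similar_mat_def by auto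
 then have w: "jordan_matrix na \<in> carrier_mat r r" "U \<in> carrier_mat r r" "V \<in> carrier_mat r r"
  "U * V = 1\<^sub>m r" "V * U = 1\<^sub>m r" "?A = U * jordan_matrix na * V"
  unfolding similar_mat_wit_def Let_def by (auto simp: tm_def)
 define T where "T = fm r U" define S where "S = fm r V" define J where "J = fm r (jordan_matrix na)"
 have TS: "rect r r T" "rect r r S" "rect r r J" "T * S = e r" "S * T = e r"
  unfolding T_def S_def J_def using w by (simp_all add: fm_mult[symmetric])
 have "C = fm r (U * jordan_matrix na * V)" using w(6) C by (metis fm_tm)
 then have CJ: "C = T * J * S"
  unfolding T_def S_def J_def fm_mult[OF mult_carrier_mat[OF w(2) w(1)] w(3)] fm_mult[OF w(2) w(1)] .
 have SCT: "S * C * T = J"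
 proof -
  have "S * C * T = (S * T) * J * (S * T)" unfolding CJ by (simp add: mult.assoc)
  then show ?thesis using TS(5) by (simp add: e_mult[OF TS(3)] mult_e[OF TS(3)])
 qed
 have sz: "sum_list (map fst na) = r" using w(1) by auto
 show ?thesis
 proof (cases na)
  case Nil then show ?thesis using sz r by simp
 next
  case (Cons x xs)
  obtain k a where x: "x = (k, a)" by force
  have k0: "0 < k" using na(1) Cons x by (cases k) auto
  show ?thesis
  proof (cases xs)
   case Nil
   then have "k = r" using sz Cons x by simp
   moreover have "jordan_matrix na = jordan_block k a"
    unfolding jordan_matrix_def Cons Nil x by (simp only: list.map split_conv diag_block_mat_singleton)
   ultimately have "jlike r J" unfolding J_def jlike_def band_def using r by auto
   then show ?thesis using TS(1,2,4,5) SCT by (intro exI[of _ T] exI[of _ S]) simp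
  next
   case (Cons y ys)
   note na_eq = \<open>na = x # xs\<close>
   let ?m = "sum_list (map fst xs)"
   have km: "k + ?m = r" using sz na_eq x by simp
   have m0: "0 < ?m" using na(1) na_eq Cons by (cases "fst y") auto
   have Jm: "jordan_matrix na = four_block_mat (jordan_block k a) (0\<^sub>m k ?m) (0\<^sub>m ?m k) (jordan_matrix xs)"
    using na_eq x jordan_matrix_Cons by simp
   have "ent J i j = 0" if "(i < k) \<noteq> (j < k)" for i j
    unfolding J_def using that km w(1) by (auto simp: Jm)
   then have comm: "e k * J = J * e k" by (intro fmat_eqI) auto
   define Q where "Q = T * e k * S"
   have kr: "k < r" using km m0 by simp
   have ek: "rect r r (e k)" by (rule rect_mono[OF rect_e]) (use kr in auto)
   have "rect r r Q" unfolding Q_def using TS ek by blast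
   moreover have "Q * Q = Q"
   proof -
    have "Q * Q = T * e k * (S * T) * e k * S" unfolding Q_def by (simp add: mult.assoc)
    also have "\<dots> = T * (e k * (e r * e k)) * S" by (simp only: TS(5) mult.assoc)
    also have "\<dots> = Q" unfolding Q_def by (simp only: e_mult[OF ek] e_mult[OF rect_e[of k]])
    finally show ?thesis .
   qed
   moreover have "Q * C = C * Q"
   proof -
    have "Q * C = T * e k * (S * T) * J * S" unfolding Q_def CJ by (simp add: mult.assoc)
    also have "\<dots> = T * (e k * J) * S" by (simp only: TS(5) mult.assoc e_mult2[OF TS(3)])
    also have "\<dots> = T * J * (S * T) * e k * S" unfolding comm by (simp only: TS(5) mult.assoc e_mult2[OF ek])
    also have "\<dots> = C * Q" unfolding Q_def CJ by (simp add: mult.assoc)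
    finally show ?thesis .
   qed
   ultimately have "Q = 0 \<or> Q = e r" by (rule triv)
   moreover have ekQ: "e k = S * Q * T"
   proof -
    have "S * Q * T = (S * T) * e k * (S * T)" unfolding Q_def by (simp add: mult.assoc)
    then show ?thesis using TS(5) by (simp add: e_mult[OF ek] mult_e[OF ek])
   qed
   ultimately have "e k = 0 \<or> e k = e r" using TS(5) mult_e[OF TS(2)] by auto
   moreover have False if "e k = 0"
    using arg_cong[OF that, of "%X. ent X 0 0"] k0 by simp
   moreover have False if "e k = e r"
    using arg_cong[OF that, of "%X. ent X k k"] kr by simp
   ultimately show ?thesis by blast
  qed
 qed
qed

text \<open>Gram--Schmidt applied to the columns of \<open>F\<close>, which are independent because
  \<open>G\<close> is a left inverse. The change of basis is kept upper triangular since such a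
  similarity preserves \<open>jlike\<close>.\<close>

lemma gram_schmidt_upper:
 assumes "rect n r F" "rect r n G" "G * F = e r"
 shows "\<exists>R. rect r r R \<and> band 0 R \<and> (\<forall>i<r. ent R i i \<noteq> 0) \<and> star (F * R) * (F * R) = e r"
 using assms
proof (induction r arbitrary: F G)
 case 0
 have "e 0 = 0" by (rule fmat_eqI) simp
 then show ?case by (intro exI[of _ 0]) (simp add: band_def)
next
 case (Suc r)
 define F0 where "F0 = F * e r" define G0 where "G0 = e r * G"
 have er: "rect (Suc r) (Suc r) (e r)" by (rule rect_mono[OF rect_e]) auto
 have F0: "rect n r F0" "rect r n G0" unfolding F0_def G0_def
  using rect_mult[OF Suc.prems(1) rect_e] rect_mult[OF rect_e Suc.prems(2)] by auto
 have "G0 * F0 = e r * (G * F) * e r" unfolding F0_def G0_def by (simp add: mult.assoc)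
 then have "G0 * F0 = e r" using Suc.prems(3) mult_e[OF er] e_mult[OF rect_e[of r]] by simp
 then obtain R0 where R0: "rect r r R0" "band 0 R0" "\<forall>i<r. ent R0 i i \<noteq> 0" "star (F0 * R0) * (F0 * R0) = e r"
  using Suc.IH[OF F0] by blast
 define E0 where "E0 = F0 * R0"
 have E0: "rect n r E0" unfolding E0_def using F0 R0 by blast
 have FR0: "F * R0 = E0" unfolding E0_def F0_def by (simp add: e_mult[OF R0(1)] mult.assoc)
 \<comment> \<open>\<open>F * mu r r\<close> is the last column of \<open>F\<close>.
   \<open>S\<close> holds its coefficients against the orthonormal columns found so far, and
   \<open>f\<close> is what remains of the column once its projection is subtracted.\<close>
 define S where "S = star E0 * (F * mu r r)"
 define V where "V = mu r r - R0 * S"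
 define f where "f = F * V"
 have mrr: "rect (Suc r) (Suc r) (mu r r)" by (rule rect_mu) auto
 have rS: "rect r (Suc r) S" unfolding S_def using rect_mult[OF rect_star[OF E0] rect_mult[OF Suc.prems(1) mrr]] .
 have rV: "rect (Suc r) (Suc r) V" unfolding V_def
  using rect_mono[OF rect_mult[OF R0(1) rS], of "Suc r" "Suc r"] mrr by auto
 have rf: "rect n (Suc r) f" unfolding f_def using Suc.prems(1) rV by blast
 have mm: "mu r r * mu r r = mu r r" by (rule fmat_eqI) auto
 have Sm: "S * mu r r = S" unfolding S_def using mm by (simp add: mult.assoc)
 have Vm: "V * mu r r = V" unfolding V_def using Sm mm by (simp add: left_diff_distrib mult.assoc)
 have fm': "f * mu r r = f" unfolding f_def using Vm by (simp add: mult.assoc)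
 have fcol: "ent f i j = 0" if "j \<noteq> r" for i j
  using that ent_mult_mu[of f r r i j] fm' by simp
 have Ef: "star E0 * f = 0"
 proof -
  have "star E0 * f = S - (star E0 * E0) * S"
   unfolding f_def V_def right_diff_distrib S_def using FR0 by (simp add: mult.assoc[symmetric])
  then show ?thesis using R0(4) e_mult[OF rS] unfolding E0_def by simp
 qed
 have fE: "star f * E0 = 0" using star_mult[of "star E0" f] Ef by simp
 \<comment> \<open>Row \<open>r\<close> of \<open>G\<close> pairs to 1 with the last column of
   \<open>F\<close> and to 0 with the others, so it detects the last column in
   \<open>f\<close>.\<close>
 have "f \<noteq> 0"
 proof
  assume "f = 0"
  have "mu r r * (G * f) = mu r r * e (Suc r) * V"
   unfolding f_def Suc.prems(3)[symmetric] by (simp add: mult.assoc)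
  also have "\<dots> = mu r r * V" using mult_e[OF mrr] by simp
  also have "\<dots> = mu r r - (mu r r * R0) * S" unfolding V_def using mm by (simp add: right_diff_distrib mult.assoc)
  also have "mu r r * R0 = 0" by (rule fmat_eqI) (simp add: rectD[OF R0(1)])
  finally have "mu r r = 0" using \<open>f = 0\<close> by simp
  then show False using ent_mu[of r r r r] by simp
 qed
 then obtain i0 where i0: "ent f i0 r \<noteq> 0" using fcol by (metis fmat_eqI ent_zero)
 then have i0n: "i0 < n" using rf unfolding rect_def by blast
 define v where "v = (\<Sum>i<n. (cmod (ent f i r))\<^sup>2)"
 have v0: "0 < v" unfolding v_def
  by (rule sum_pos2[of _ i0]) (use i0 i0n in auto)
 have ff: "star f * f = smul (of_real v) (mu r r)"
 proof (rule fmat_eqI)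
  fix i j
  have "ent (star f * f) i j = (\<Sum>k<n. cnj (ent f k i) * ent f k j)"
   using ent_mult[OF rect_star[OF rf]] by simp
  also have "\<dots> = (if i = r \<and> j = r then of_real v else 0)"
   using fcol unfolding v_def
   by (auto simp: complex_norm_square mult.commute simp del: of_real_power intro!: sum.neutral)
  finally show "ent (star f * f) i j = ent (smul (of_real v) (mu r r)) i j" by simp
 qed
 define s :: complex where "s = of_real (1 / sqrt v)"
 have s: "s \<noteq> 0" "cnj s = s" "s * s * of_real v = 1"
  using v0 unfolding s_def by (auto simp: complex_eq_iff field_simps)
 define R where "R = R0 + smul s V"
 have FR: "F * R = E0 + smul s f" unfolding R_def f_def by (simp add: distrib_left FR0 smul_mult_right)
 have "star (F * R) * (F * R) = star E0 * E0 + smul s (star E0 * f) + smul s (star f * E0) + smul (s * s) (star f * f)"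
  unfolding FR star_add star_smul s(2) by (simp add: algebra_simps smul_mult_left smul_mult_right smul_simps)
 also have "\<dots> = e r + mu r r" using R0(4)[folded E0_def] Ef fE ff s(3) by simp
 also have "\<dots> = e (Suc r)" by (rule fmat_eqI) auto
 finally have 1: "star (F * R) * (F * R) = e (Suc r)" .
 have RS0: "ent (R0 * S) i j = 0" if "j \<noteq> r \<or> r \<le> i" for i j
 proof -
  have "R0 * S * mu r r = R0 * S" using Sm by (simp add: mult.assoc)
  then have "j \<noteq> r ==> ent (R0 * S) i j = 0" using ent_mult_mu[of "R0 * S" r r i j] by simp
  then show ?thesis using that rectD[OF rect_mult[OF R0(1) rS]] by blast
 qed
 have 2: "rect (Suc r) (Suc r) R" unfolding R_def using rect_mono[OF R0(1), of "Suc r" "Suc r"] rV by auto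
 have 3: "band 0 R" unfolding band_def
 proof (intro allI impI)
  fix i j :: nat assume "j < i + 0"
  then show "ent R i j = 0" unfolding R_def V_def using bandD[OF R0(2), of j i] RS0[of j i]
   by (cases "j = r") auto
 qed
 have 4: "\<forall>i<Suc r. ent R i i \<noteq> 0"
 proof (intro allI impI)
  fix i assume "i < Suc r"
  then show "ent R i i \<noteq> 0" unfolding R_def V_def using R0(3) RS0[of i i] s(1) rectD[OF R0(1), of i i]
   by (cases "i = r") auto
 qed
 show ?case using 1 2 3 4 by blast
qed

text \<open>Below the diagonal, column \<open>j\<close> of \<open>S * R\<close> is column
  \<open>j\<close> of \<open>S\<close> times a nonzero diagonal entry of \<open>R\<close>, plus
  multiples of earlier columns of \<open>S\<close>, which already vanish there.\<close>

lemma upper_inverse: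
 assumes R: "rect r r R" "band 0 R" "\<And>i. i < r ==> ent R i i \<noteq> 0" and S: "rect r r S" "S * R = e r"
 shows "band 0 S"
proof -
 have "\<forall>i>j. ent S i j = 0" for j
 proof (induction j rule: less_induct)
  case (less j)
  show ?case
  proof (intro allI impI)
   fix i assume ij: "j < i"
   show "ent S i j = 0"
   proof (cases "j < r")
    case False then show ?thesis using rectD[OF S(1), of i j] by simp
   next
    case True
    have "ent (S * R) i j = (\<Sum>k<r. ent S i k * ent R k j)" by (rule ent_mult[OF S(1)])
    also have "\<dots> = ent S i j * ent R j j"
    proof (rule sum_single[OF True])
     fix k assume "k \<noteq> j"
     then show "ent S i k * ent R k j = 0"
      using less.IH[of k] bandD[OF R(2), of j k] ij by (cases "k < j") auto
    qed
    finally show ?thesis using S(2) ij R(3)[OF True] by simp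
   qed
  qed
 qed
 then show ?thesis by (simp add: band_def)
qed

text \<open>The superdiagonal of the conjugated nilpotent part is the old one times diagonal entries
  of \<open>U\<close> and \<open>V\<close>, and these are nonzero because
  \<open>U * V = e r\<close>.\<close>

lemma jlike_conj:
 assumes J: "jlike r J" and U: "rect r r U" "band 0 U" and V: "rect r r V" "band 0 V" and UV: "U * V = e r"
 shows "jlike r (U * J * V)"
proof -
 define a where "a = ent J 0 0"
 define N where "N = J - smul (ent J 0 0) (e r)"
 note N = jlike_nilpotent_part[OF J, folded N_def]
 have J_eq: "J = N + smul a (e r)" unfolding N_def a_def by simp
 define M where "M = U * N * V"
 have UJV: "U * J * V = M + smul a (e r)"
  unfolding M_def J_eq
  by (simp add: distrib_left distrib_right smul_mult_left smul_mult_right mult_e[OF U(1)] UV)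
 have bM: "band 1 M" unfolding M_def
  using band_mult(1)[OF band_mult(1)[OF U(2) N(2)] V(2)] by simp
 have sM: "ent M i (Suc i) = ent U i i * ent N i (Suc i) * ent V (Suc i) (Suc i)" for i
  unfolding M_def using band_mult(2)[OF band_mult(1)[OF U(2) N(2)] V(2), of i] band_mult(2)[OF U(2) N(2), of i]
  by simp
 have nz: "ent U i i \<noteq> 0" "ent V i i \<noteq> 0" if "i < r" for i
  using band_mult(2)[OF U(2) V(2), of i] UV that by auto
 have ent1: "ent (U * J * V) i j = ent M i j + (if i = j \<and> i < r then a else 0)" for i j
  unfolding UJV by simp
 have "rect r r J" using J by (simp add: jlike_def)
 then have "rect r r (U * J * V)" using U(1) V(1) by blast
 moreover have "band 0 (U * J * V)" unfolding UJV
  by (intro band_add band_mono[OF bM] band_smul band_e) simp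
 moreover have "\<forall>i<r. ent (U * J * V) i i = ent (U * J * V) 0 0"
  using bandD[OF bM] unfolding ent1 by auto
 moreover have "\<forall>i. Suc i < r --> ent (U * J * V) i (Suc i) \<noteq> 0"
  unfolding ent1 sM using nz N(3) by auto
 ultimately show ?thesis unfolding jlike_def by blast
qed

text \<open>A coordinate system for the range of \<open>P\<close>: the columns of \<open>E\<close>
  are a basis, \<open>G\<close> reads off coordinates, and \<open>G * A * E\<close> is the matrix of
  the compression of \<open>A\<close>.\<close>

definition jcorner :: "nat => fmat => fmat => nat => fmat => fmat => bool" where
 "jcorner n A P r E G \<longleftrightarrow> 0 < r \<and> r \<le> n \<and> rect n r E \<and> rect r n G \<and> E * G = P \<and> G * E = e r \<and>
  jlike r (G * A * E)"

lemma jcornerD: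
 assumes "jcorner n A P r E G"
 shows "0 < r" "r \<le> n" "rect n r E" "rect r n G" "E * G = P" "G * E = e r" "jlike r (G * A * E)"
  "P * E = E" "G * P = G"
proof -
 show *: "0 < r" "r \<le> n" "rect n r E" "rect r n G" "E * G = P" "G * E = e r" "jlike r (G * A * E)"
  using assms unfolding jcorner_def by blast+
 show "P * E = E" unfolding *(5)[symmetric] by (simp add: mult.assoc *(6) mult_e[OF *(3)])
 show "G * P = G" unfolding *(5)[symmetric] by (simp add: mult.assoc[symmetric] *(6) e_mult[OF *(4)])
qed

lemma pminD:
 assumes "pmin A P"
 shows "P * P = P" "A * P = P * A"
  "\<And>Q. Q * Q = Q ==> A * Q = Q * A ==> P * Q = Q ==> Q * P = Q ==> Q = 0 \<or> Q = P"
 using assms unfolding pmin_def by blast+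

text \<open>Minimality of \<open>P\<close> means that the compression of \<open>A\<close> to the
  range of \<open>P\<close> has only trivial idempotents in its commutant, so it is a single Jordan
  block in some basis, which is then orthonormalised. The conclusions \<open>mbd 1 E\<close> and
  \<open>G = star E * P\<close> bound both factors in terms of \<open>P\<close>, however badly
  conditioned the Jordan basis was.\<close>

lemma pmin_jordan:
 assumes A: "rect n n A" and P: "rect n n P" and min: "pmin A P" and nz: "P \<noteq> 0"
 shows "\<exists>r E G. jcorner n A P r E G \<and> mbd 1 E \<and> G = star E * P"
proof -
 note m = pminD[OF min]
 obtain r F G where FG: "r \<le> n" "rect n r F" "rect r n G" "F * G = P" "G * F = e r"
  using idem_factor[OF P m(1)] by blast
 have r0: "0 < r"
 proof (rule ccontr)
  assume "\<not> 0 < r"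
  then have "F = 0" using rectD[OF FG(2)] by (intro fmat_eqI) simp
  then show False using FG(4) nz by simp
 qed
 have PF: "P * F = F" unfolding FG(4)[symmetric] by (simp add: mult.assoc FG(5) mult_e[OF FG(2)])
 have GP: "G * P = G" unfolding FG(4)[symmetric] by (simp add: mult.assoc[symmetric] FG(5) e_mult[OF FG(3)])
 define C where "C = G * A * F"
 have rC: "rect r r C" unfolding C_def using FG A by blast
 have AF: "A * F = F * C"
 proof -
  have "A * F = (A * P) * F" by (simp add: mult.assoc PF)
  also have "\<dots> = (P * A) * F" using m(2) by simp
  also have "\<dots> = F * C" unfolding C_def FG(4)[symmetric] by (simp add: mult.assoc)
  finally show ?thesis .
 qed
 have GA: "G * A = C * G"
 proof -
  have "G * A = G * (P * A)" using GP by (simp add: mult.assoc[symmetric])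
  also have "\<dots> = G * (A * P)" using m(2) by simp
  also have "\<dots> = C * G" unfolding C_def FG(4)[symmetric] by (simp add: mult.assoc)
  finally show ?thesis .
 qed
 \<comment> \<open>An idempotent \<open>Q\<close> of the compression is lifted to the idempotent
   \<open>F * Q * G\<close> below \<open>P\<close>, which minimality decides, and is recovered from
   it by compressing.\<close>
 have triv: "Q = 0 \<or> Q = e r" if Q: "rect r r Q" "Q * Q = Q" "Q * C = C * Q" for Q
 proof -
  define Q' where "Q' = F * Q * G"
  have "Q' * Q' = F * (Q * (G * F) * Q) * G" unfolding Q'_def by (simp add: mult.assoc)
  also have "\<dots> = Q'" unfolding Q'_def FG(5) mult_e[OF Q(1)] Q(2) ..
  finally have 1: "Q' * Q' = Q'" .
  have "A * Q' = A * F * Q * G" unfolding Q'_def by (simp add: mult.assoc)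
  also have "\<dots> = F * (C * Q) * G" unfolding AF by (simp add: mult.assoc)
  also have "\<dots> = F * Q * (C * G)" unfolding Q(3)[symmetric] by (simp add: mult.assoc)
  also have "\<dots> = Q' * A" unfolding GA[symmetric] Q'_def by (simp add: mult.assoc)
  finally have 2: "A * Q' = Q' * A" .
  have 3: "P * Q' = Q'" "Q' * P = Q'" unfolding Q'_def using PF GP
   by (simp_all add: mult.assoc[symmetric]) (simp add: mult.assoc GP)
  have "G * Q' * F = (G * F) * Q * (G * F)" unfolding Q'_def by (simp add: mult.assoc)
  then have QQ: "Q = G * Q' * F" unfolding FG(5) by (simp add: e_mult[OF Q(1)] mult_e[OF Q(1)])
  from m(3)[OF 1 2 3] show ?thesis
  proof
   assume "Q' = 0" then show ?thesis using QQ by simp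
  next
   assume "Q' = P" then have "Q = e r" using QQ GP FG(5) by simp
   then show ?thesis ..
  qed
 qed
 obtain T S where T: "rect r r T" "rect r r S" "T * S = e r" "S * T = e r" "jlike r (S * C * T)"
  using indecomposable_jordan[OF rC r0 triv] by blast
 define F1 where "F1 = F * T" define G1 where "G1 = S * G"
 have F1: "rect n r F1" "rect r n G1" unfolding F1_def G1_def using FG T by blast+
 have "G1 * F1 = S * (G * F) * T" unfolding F1_def G1_def by (simp add: mult.assoc)
 then have G1F1: "G1 * F1 = e r" unfolding FG(5) mult_e[OF T(2)] T(4) .
 have "F1 * G1 = F * (T * S) * G" unfolding F1_def G1_def by (simp add: mult.assoc)
 then have F1G1: "F1 * G1 = P" unfolding T(3) mult_e[OF FG(2)] FG(4) .
 have G1A: "G1 * A * F1 = S * C * T" unfolding F1_def G1_def C_def by (simp add: mult.assoc)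
 obtain R where R: "rect r r R" "band 0 R" "\<forall>i<r. ent R i i \<noteq> 0" "star (F1 * R) * (F1 * R) = e r"
  using gram_schmidt_upper[OF F1 G1F1] by blast
 define E where "E = F1 * R"
 define R1 where "R1 = star E * F1"
 have rE: "rect n r E" unfolding E_def using F1 R by blast
 have rR1: "rect r r R1" unfolding R1_def using rE F1 by blast
 have SE: "star E * E = e r" using R(4) unfolding E_def .
 have R1R: "R1 * R = e r" using SE unfolding R1_def E_def by (simp add: mult.assoc)
 have RR1: "R * R1 = e r" by (rule left_right_inverse[OF rR1 R(1) R1R])
 have bR1: "band 0 R1" by (rule upper_inverse[OF R(1,2) _ rR1 R1R]) (use R(3) in blast)
 define G2 where "G2 = R1 * G1"
 have rG2: "rect r n G2" unfolding G2_def using rR1 F1 by blast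
 have "E * G2 = F1 * (R * R1) * G1" unfolding E_def G2_def by (simp add: mult.assoc)
 then have EG2: "E * G2 = P" unfolding RR1 mult_e[OF F1(1)] F1G1 .
 have "G2 * E = R1 * (G1 * F1) * R" unfolding E_def G2_def by (simp add: mult.assoc)
 then have G2E: "G2 * E = e r" unfolding G1F1 mult_e[OF rR1] R1R .
 have "G2 * A * E = R1 * (G1 * A * F1) * R" unfolding E_def G2_def by (simp add: mult.assoc)
 then have j: "jlike r (G2 * A * E)" using jlike_conj[OF T(5) rR1 bR1 R(1,2) R1R] G1A by simp
 have "star E * P = (star E * E) * G2" unfolding EG2[symmetric] by (simp add: mult.assoc)
 then have G2eq: "G2 = star E * P" unfolding SE e_mult[OF rG2] ..
 have "mbd 1 E" unfolding mbd_def
 proof (intro allI)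
  fix i j
  show "cmod (ent E i j) \<le> 1"
  proof (cases "i < n \<and> j < r")
   case False
   then show ?thesis using rectD[OF rE, of i j] by (simp add: not_less)
  next
   case True
   have "of_real (\<Sum>k<n. (cmod (ent E k j))\<^sup>2) = ent (star E * E) j j"
    unfolding ent_mult[OF rect_star[OF rE]] by (simp add: complex_norm_square mult.commute del: of_real_power)
   also have "\<dots> = of_real 1" unfolding SE using True by simp
   finally have "(\<Sum>k<n. (cmod (ent E k j))\<^sup>2) = 1" unfolding of_real_eq_iff .
   moreover have "(cmod (ent E i j))\<^sup>2 \<le> (\<Sum>k<n. (cmod (ent E k j))\<^sup>2)"
    by (rule member_le_sum) (use True in auto)
   ultimately show ?thesis by (simp add: abs_square_le_1)
  qed
 qed
 moreover have "jcorner n A P r E G2"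
  unfolding jcorner_def using r0 FG(1) rE rG2 EG2 G2E j by blast
 ultimately show ?thesis using G2eq by blast
qed

text \<open>As \<open>P\<close> commutes with \<open>A\<close>, compressing preserves commutation
  with \<open>A\<close>. So every element of the commutant of \<open>A\<close> compresses to a
  scalar plus a nilpotent matrix: the corner of a minimal idempotent is local, and the entry at
  \<open>0 0\<close> decides about invertibility.\<close>

lemma jcorner_commutant:
 assumes jc: "jcorner n A P r E G" and AP: "A * P = P * A" and AB: "A * B = B * A" and rB: "rect n n B"
 shows "band 0 (G * B * E)" "i < r ==> ent (G * B * E) i i = ent (G * B * E) 0 0"
proof -
 note j = jcornerD[OF jc]
 have rGBE: "rect r r (G * B * E)" using j rB by blast
 have "(G * B * E) * (G * A * E) = G * B * (E * G) * A * E" by (simp add: mult.assoc)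
 also have "\<dots> = G * B * (P * A) * E" unfolding j(5) by (simp add: mult.assoc)
 also have "\<dots> = G * (B * A) * (P * E)" unfolding AP[symmetric] by (simp add: mult.assoc)
 also have "\<dots> = (G * P) * (A * B) * E" unfolding AB j(8,9) ..
 also have "\<dots> = G * (A * P) * B * E" unfolding AP by (simp add: mult.assoc)
 also have "\<dots> = (G * A * E) * (G * B * E)" unfolding j(5)[symmetric] by (simp add: mult.assoc)
 finally have "(G * B * E) * (G * A * E) = (G * A * E) * (G * B * E)" .
 from jlike_commutant[OF j(7) rGBE this]
 show "band 0 (G * B * E)" "i < r ==> ent (G * B * E) i i = ent (G * B * E) 0 0" by blast+
qed

section \<open>Entrywise bounds and inverses of unipotent matrices\<close>

lemma mbd_nonneg: "mbd c X ==> 0 \<le> c"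
 unfolding mbd_def by (meson norm_ge_zero order_trans)
lemma mbd_mono: "mbd c X ==> c \<le> d ==> mbd d X"
 unfolding mbd_def by (meson order_trans)
lemma mbd_add: "mbd c X ==> mbd d Y ==> mbd (c + d) (X + Y)"
 unfolding mbd_def ent_add by (meson norm_triangle_mono)
lemma mbd_diff: "mbd c X ==> mbd d Y ==> mbd (c + d) (X - Y)"
 unfolding mbd_def ent_diff by (meson add_mono norm_triangle_ineq4 order_trans)
lemma mbd_smul: "mbd c X ==> mbd (cmod a * c) (smul a X)"
 unfolding mbd_def ent_smul norm_mult by (meson mult_left_mono norm_ge_zero)
lemma mbd_e: "mbd 1 (e n)" by (simp add: mbd_def)
lemma mbd_star: "mbd c X ==> mbd c (star X)" by (simp add: mbd_def)
lemma mbd_mult: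
 fixes n r :: nat and c d :: real
 assumes "rect a r X" "r \<le> n" "mbd c X" "mbd d Y"
 shows "mbd (n * c * d) (X * Y)"
 unfolding mbd_def
proof (intro allI)
 fix i j
 have c: "0 \<le> c" "0 \<le> d" using assms mbd_nonneg by blast+
 have "cmod (ent (X * Y) i j) \<le> (\<Sum>k<r. c * d)"
  unfolding ent_mult[OF assms(1)]
  by (rule order_trans[OF norm_sum sum_mono])
   (use assms(3,4) c in \<open>auto simp: norm_mult mbd_def intro!: mult_mono\<close>)
 also have "\<dots> \<le> n * c * d" using c assms(2) by (simp add: mult.assoc mult_right_mono)
 finally show "cmod (ent (X * Y) i j) \<le> n * c * d" .
qed

text \<open>Partial sums of the Neumann series. For a strictly upper triangular \<open>M\<close> of
  size \<open>r\<close> the series stops after \<open>r\<close> steps, so no smallness of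
  \<open>M\<close> is involved.\<close>

primrec neumann :: "fmat => nat => nat => fmat" where
 "neumann M r 0 = e r"
| "neumann M r (Suc k) = e r + M * neumann M r k"

primrec nbound :: "real => nat => real" where
 "nbound c 0 = 1"
| "nbound c (Suc k) = 1 + c * nbound c k"

lemma rect_neumann: "rect r r M ==> rect r r (neumann M r k)"
 by (induction k) auto

lemma neumann_inverse:
 assumes M: "rect r r M" "band 1 M"
 shows "(e r - M) * neumann M r r = e r"
proof -
 have "band (Suc k) (e r - (e r - M) * neumann M r k)" for k
 proof (induction k)
  case 0
  have "e r - (e r - M) * neumann M r 0 = M" by (simp add: left_diff_distrib e_mult[OF rect_e] mult_e[OF M(1)])
  then show ?case using M(2) by simp
 next
  case (Suc k)
  have "e r - (e r - M) * neumann M r (Suc k) = M * (e r - (e r - M) * neumann M r k)"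
   by (simp add: algebra_simps e_mult[OF rect_e] mult_e[OF M(1)] e_mult2[OF M(1)] e_mult2[OF rect_neumann[OF M(1)]]
    e_mult[OF rect_neumann[OF M(1)]])
  then show ?case using band_mult(1)[OF M(2) Suc.IH] by simp
 qed
 then have "band r (e r - (e r - M) * neumann M r r)" by (rule band_mono) simp
 moreover have "rect r r (e r - (e r - M) * neumann M r r)"
  using rect_neumann[OF M(1)] M(1) by (intro rect_diff rect_mult[where r=r] rect_e)
 ultimately have "e r - (e r - M) * neumann M r r = 0" by (rule band_rect_zero[rotated])
 then show ?thesis by simp
qed

lemma mbd_neumann:
 fixes n r :: nat and c :: real
 assumes "rect r r M" "r \<le> n" "mbd c M"
 shows "mbd (nbound (n * c) k) (neumann M r k)"
proof (induction k)
 case 0 show ?case by (simp add: mbd_e)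
next
 case (Suc k)
 show ?case using mbd_add[OF mbd_e mbd_mult[OF assms(1,2,3) Suc.IH]] by simp
qed

lemma nbound_nonneg: "0 \<le> c ==> 0 \<le> nbound c k" by (induction k) auto

text \<open>The rank \<open>r\<close> of a corner varies with the point; summing the bounds for all
  \<open>k \<le> n\<close> removes the dependence on it.\<close>

lemma mbd_neumann_uniform:
 fixes n r :: nat and c :: real
 assumes "rect r r M" "r \<le> n" "mbd c M"
 shows "mbd (\<Sum>k\<le>n. nbound (n * c) k) (neumann M r r)"
proof (rule mbd_mono[OF mbd_neumann[OF assms]])
 have "0 \<le> n * c" using mbd_nonneg[OF assms(3)] by simp
 then show "nbound (n * c) r \<le> (\<Sum>k\<le>n. nbound (n * c) k)"
  by (intro member_le_sum nbound_nonneg) (use assms(2) in auto)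
qed

section \<open>The exchange of one minimal idempotent for another\<close>

lemma rect_sq: "rect n n X ==> rect n n Y ==> rect n n (X * Y)"
 by (rule rect_mult)

lemma comm_mult: "A * U = U * A ==> A * V = V * A ==> A * (U * V) = (U * V) * (A::fmat)"
 by (metis mult.assoc)
lemma comm_add: "A * U = U * A ==> A * V = V * A ==> A * (U + V) = (U + V) * (A::fmat)"
 by (simp add: algebra_simps)
lemma comm_diff: "A * U = U * A ==> A * V = V * A ==> A * (U - V) = (U - V) * (A::fmat)"
 by (simp add: algebra_simps)
lemma comm_e: "rect n n A ==> A * e n = e n * A"
 by (simp add: e_mult mult_e)

text \<open>The compression of \<open>Q\<close> to the corner of \<open>P\<close> is upper
  triangular with constant diagonal \<open>c\<close>, hence invertible; \<open>Bi\<close> is the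
  inverse of \<open>P * Q * P\<close> in that corner. \<open>X\<close> intertwines because
  \<open>X * P = Q * P = Q * X\<close>, and \<open>Y\<close> is its explicit inverse. The last two
  conclusions say that \<open>X\<close> acts trivially on whatever both idempotents
  annihilate.\<close>

lemma exchange_core:
 assumes A: "rect n n A" and P: "rect n n P" "pmin A P" "P \<noteq> 0" and Q: "rect n n Q" "pmin A Q"
  and jc: "jcorner n A P r E G" and c: "c = ent (G * Q * E) 0 0" "c \<noteq> 0"
 defines "Bi \<equiv> E * smul (1 / c) (neumann (e r - smul (1 / c) (G * Q * E)) r r) * G"
 defines "X \<equiv> Q * P + (e n - Q) * (e n - P)" and "Y \<equiv> e n + Bi * Q - Q * Bi"
 shows "rect n n X" "rect n n Y" "X * Y = e n" "Y * X = e n" "A * X = X * A" "A * Y = Y * A" "X * P * Y = Q"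
  "\<And>Z. rect n n Z ==> P * Z = 0 ==> Q * Z = 0 ==> X * Z = Z"
  "\<And>Z. rect n n Z ==> Z * P = 0 ==> Z * Q = 0 ==> Z * X = Z"
proof -
 note j = jcornerD[OF jc] and mP = pminD[OF P(2)] and mQ = pminD[OF Q(2)]
 define B' where "B' = G * Q * E"
 define M where "M = e r - smul (1 / c) B'"
 define D where "D = smul (1 / c) (neumann M r r)"
 have Bi: "Bi = E * D * G" unfolding Bi_def D_def M_def B'_def ..
 have rB': "rect r r B'" unfolding B'_def using j Q by blast
 have rM: "rect r r M" unfolding M_def using rB' by (intro rect_diff rect_smul rect_e)
 have rD: "rect r r D" unfolding D_def using rect_neumann[OF rM] by blast
 have rBi: "rect n n Bi" unfolding Bi using j rD by blast
 note bB = jcorner_commutant[OF jc mP(2) mQ(2) Q(1), folded B'_def]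
 have "band 1 M" unfolding band_def
 proof (intro allI impI)
  fix i k :: nat assume ki: "k < i + 1"
  have "ent M i k = (if i = k \<and> i < r then 1 else 0) - 1 / c * ent B' i k" unfolding M_def by simp
  moreover have "ent B' i k = (if i = k \<and> i < r then c else 0)"
   using ki bandD[OF bB(1), of k i] bB(2)[of i] c(1)[folded B'_def] rectD[OF rB', of i k]
   by (cases "k = i"; cases "i < r") auto
  ultimately show "ent M i k = 0" using c(2) by simp
 qed
 from neumann_inverse[OF rM this] have "smul (1 / c) B' * neumann M r r = e r" unfolding M_def by simp
 then have B'D: "B' * D = e r" unfolding D_def by (simp add: smul_mult_left smul_mult_right)
 have DB': "D * B' = e r" by (rule left_right_inverse[OF rB' rD B'D])
 have BiP: "Bi * P = Bi" unfolding Bi by (simp add: mult.assoc j(9))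
 have PBi: "P * Bi = Bi" unfolding Bi by (simp add: mult.assoc[symmetric] j(8))
 have "Bi * Q * P = E * (D * B') * G" unfolding Bi B'_def j(5)[symmetric] by (simp add: mult.assoc)
 then have BiQP: "Bi * (Q * P) = P" unfolding DB' mult_e[OF j(3)] j(5) by (simp add: mult.assoc)
 have "P * Q * Bi = E * (B' * D) * G" unfolding Bi B'_def j(5)[symmetric] by (simp add: mult.assoc)
 then have PQBi: "P * (Q * Bi) = P" unfolding B'D mult_e[OF j(3)] j(5) by (simp add: mult.assoc)
 \<comment> \<open>\<open>Bi\<close> inverts, relative to \<open>P\<close>, an element that commutes
   with \<open>A\<close>. The chain inserts \<open>Bi * (Q * P) = P\<close> on one side and removes
   \<open>P * (Q * Bi) = P\<close> on the other.\<close>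
 have ABi: "A * Bi = Bi * A"
 proof -
  have "A * Bi = A * (P * Bi)" using PBi by simp
  also have "\<dots> = P * A * Bi" using mP(2) by (simp add: mult.assoc[symmetric])
  also have "\<dots> = Bi * Q * (P * A) * Bi" using arg_cong[OF BiQP, of "%Z. Z * A * Bi"] by (simp add: mult.assoc)
  also have "\<dots> = Bi * Q * A * (P * Bi)" unfolding mP(2)[symmetric] by (simp add: mult.assoc)
  also have "\<dots> = Bi * (Q * A) * Bi" unfolding PBi by (simp add: mult.assoc)
  also have "\<dots> = Bi * (A * Q) * Bi" unfolding mQ(2) ..
  also have "\<dots> = Bi * P * A * Q * Bi" unfolding BiP by (simp add: mult.assoc)
  also have "\<dots> = Bi * (P * A) * Q * Bi" by (simp add: mult.assoc)
  also have "\<dots> = Bi * A * (P * (Q * Bi))" unfolding mP(2)[symmetric] by (simp add: mult.assoc)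
  also have "\<dots> = Bi * (P * A)" unfolding PQBi mP(2)[symmetric] by (simp add: mult.assoc)
  also have "\<dots> = Bi * A" using BiP by (simp add: mult.assoc[symmetric])
  finally show ?thesis .
 qed
 have BiQBi: "Bi * (Q * Bi) = Bi"
 proof -
  have "Bi * (Q * Bi) = Bi * (Q * P) * Bi" using PBi by (simp add: mult.assoc)
  then show ?thesis unfolding BiQP PBi .
 qed
 \<comment> \<open>Minimality of \<open>Q\<close> enters here: \<open>Q * Bi * Q\<close> is a
   nonzero idempotent of the commutant below \<open>Q\<close>, so it is all of \<open>Q\<close>.
   Without this \<open>P\<close> would only be matched with a part of \<open>Q\<close>.\<close>
 have QBiQ: "Q * (Bi * Q) = Q"
 proof -
  define W where "W = Q * (Bi * Q)"
  have "W * W = Q * (Bi * ((Q * Q) * (Bi * Q)))" unfolding W_def by (simp add: mult.assoc)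
  also have "\<dots> = Q * (Bi * (Q * Bi) * Q)" unfolding mQ(1) by (simp add: mult.assoc)
  also have "\<dots> = W" unfolding BiQBi W_def ..
  finally have 1: "W * W = W" .
  have 2: "A * W = W * A" unfolding W_def by (intro comm_mult mQ(2) ABi)
  have 3: "Q * W = W" unfolding W_def using mQ(1) by (simp add: mult.assoc[symmetric])
  have 4: "W * Q = W" unfolding W_def using mQ(1) by (simp add: mult.assoc)
  have "W \<noteq> 0"
  proof
   assume "W = 0"
   have "Bi * W * P = Bi * (Q * Bi) * (Q * P)" unfolding W_def by (simp add: mult.assoc)
   then have "Bi * W * P = P" unfolding BiQBi BiQP .
   then show False using \<open>W = 0\<close> P(3) by simp
  qed
  then show ?thesis using mQ(3)[OF 1 2 3 4] unfolding W_def by blast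
 qed
 note en = e_mult[OF P(1)] mult_e[OF P(1)] e_mult[OF Q(1)] mult_e[OF Q(1)] e_mult[OF rBi] mult_e[OF rBi] e_mult[OF rect_e[of n]]
  e_mult2[OF P(1)] mult_e2[OF P(1)] e_mult2[OF Q(1)] mult_e2[OF Q(1)] e_mult2[OF rBi] mult_e2[OF rBi] e_mult2[OF rect_e[of n]]
 have r2: "P * (P * Z) = P * Z" "Q * (Q * Z) = Q * Z" "Bi * (P * Z) = Bi * Z" "Q * (Bi * (Q * Z)) = Q * Z" for Z
  using mP(1) mQ(1) BiP QBiQ by (metis mult.assoc)+
 have X_eq: "X = e n - Q - P + Q * P + Q * P" unfolding X_def
  by (simp add: left_diff_distrib right_diff_distrib en)
 show rX: "rect n n X" unfolding X_def
  by (intro rect_add rect_diff rect_sq rect_e P(1) Q(1))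
 show rY: "rect n n Y" unfolding Y_def
  by (intro rect_add rect_diff rect_sq rect_e rBi Q(1))
 show YX: "Y * X = e n" unfolding X_eq Y_def
  by (simp add: distrib_left distrib_right left_diff_distrib right_diff_distrib mult.assoc en r2 mP(1) mQ(1) BiP QBiQ BiQP)
 show XY: "X * Y = e n" by (rule left_right_inverse[OF rY rX YX])
 show "A * X = X * A" unfolding X_def
  by (intro comm_add comm_mult comm_diff comm_e A mP(2) mQ(2))
 show "A * Y = Y * A" unfolding Y_def
  by (intro comm_add comm_mult comm_diff comm_e A mQ(2) ABi)
 have "X * P = Q * X" unfolding X_eq
  by (simp add: distrib_left distrib_right left_diff_distrib right_diff_distrib mult.assoc en r2 mP(1) mQ(1))
 then have "X * P * Y = Q * (X * Y)" by (simp add: mult.assoc)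
 then show "X * P * Y = Q" unfolding XY mult_e[OF Q(1)] .
 show "X * Z = Z" if "rect n n Z" "P * Z = 0" "Q * Z = 0" for Z
  unfolding X_eq using that by (simp add: distrib_right left_diff_distrib mult.assoc e_mult[OF that(1)])
 show "Z * X = Z" if "rect n n Z" "Z * P = 0" "Z * Q = 0" for Z
  unfolding X_eq using that by (simp add: distrib_left right_diff_distrib mult.assoc[symmetric] mult_e[OF that(1)])
qed

text \<open>The constants collect the bounds of the factors in \<open>exchange_core\<close> as these
  are multiplied together: \<open>g\<close> for \<open>G\<close>, \<open>b\<close> for
  \<open>G * Q * E\<close>, \<open>m\<close> and \<open>h\<close> for the Neumann series,
  \<open>\<beta>\<close> for \<open>Bi\<close>. They involve only \<open>n\<close>, \<open>C\<close>
  and \<open>\<delta>\<close>, so \<open>K\<close> can be fixed before the matrices.\<close>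

lemma exchange:
 fixes n :: nat and C \<delta> :: real
 assumes "0 < \<delta>"
 shows "\<exists>K. \<forall>A P Q r E G. rect n n A \<and> rect n n P \<and> pmin A P \<and> P \<noteq> 0 \<and> rect n n Q \<and> pmin A Q \<and>
   mbd C P \<and> mbd C Q \<and> jcorner n A P r E G \<and> mbd 1 E \<and> G = star E * P \<and> \<delta> \<le> cmod (ent (G * Q * E) 0 0) -->
   (\<exists>X Y. rect n n X \<and> rect n n Y \<and> X * Y = e n \<and> Y * X = e n \<and> A * X = X * A \<and> A * Y = Y * A \<and>
    X * P * Y = Q \<and> mbd K X \<and> mbd K Y \<and>
    (\<forall>Z. rect n n Z --> P * Z = 0 --> Q * Z = 0 --> X * Z = Z) \<and>
    (\<forall>Z. rect n n Z --> Z * P = 0 --> Z * Q = 0 --> Z * X = Z))"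
proof -
 define g where "g = real n * 1 * C"
 define b where "b = real n * (real n * g * C) * 1"
 define m where "m = 1 + 1 / \<delta> * b"
 define h where "h = (\<Sum>k\<le>n. nbound (n * m) k)"
 define d where "d = 1 / \<delta> * h"
 define \<beta> where "\<beta> = real n * (real n * 1 * d) * g"
 define KX where "KX = n * C * C + n * (1 + C) * (1 + C)"
 define KY where "KY = 1 + n * \<beta> * C + n * C * \<beta>"
 show ?thesis
 proof (intro exI[of _ "max KX KY"] allI impI, elim conjE)
  fix A P Q r E G
  assume A: "rect n n A" and P: "rect n n P" "pmin A P" "P \<noteq> 0" and Q: "rect n n Q" "pmin A Q"
   and C: "mbd C P" "mbd C Q" and jc: "jcorner n A P r E G" and E: "mbd 1 E" and G: "G = star E * P"
   and \<delta>: "\<delta> \<le> cmod (ent (G * Q * E) 0 0)"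
  define c where "c = ent (G * Q * E) 0 0"
  have c0: "c \<noteq> 0" using \<delta> assms unfolding c_def by auto
  have c1: "cmod (1 / c) \<le> 1 / \<delta>" using \<delta> assms unfolding c_def[symmetric]
   by (simp add: norm_divide frac_le)
  define M where "M = e r - smul (1 / c) (G * Q * E)"
  define D where "D = smul (1 / c) (neumann M r r)"
  define Bi where "Bi = E * D * G"
  note j = jcornerD[OF jc]
  note ex = exchange_core[OF A P Q jc c_def c0, folded M_def, folded D_def, folded Bi_def]
  have mG: "mbd g G" unfolding G g_def by (rule mbd_mult[OF rect_star[OF j(3)] _ mbd_star[OF E] C(1)]) simp
  have rGQ: "rect r n (G * Q)" using j Q by blast
  have mB: "mbd b (G * Q * E)" unfolding b_def
   by (rule mbd_mult[OF rGQ _ mbd_mult[OF j(4) _ mG C(2)] E]) simp_all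
  have "cmod (1 / c) * b \<le> 1 / \<delta> * b" using c1 mbd_nonneg[OF mB] by (rule mult_right_mono)
  then have mM: "mbd m M" unfolding m_def M_def
   by (intro mbd_diff mbd_e mbd_mono[OF mbd_smul[OF mB]])
  have rM: "rect r r M" unfolding M_def by (intro rect_diff rect_smul rect_mult[OF rGQ j(3)] rect_e)
  have mh: "mbd h (neumann M r r)" unfolding h_def by (rule mbd_neumann_uniform[OF rM j(2) mM])
  have "cmod (1 / c) * h \<le> 1 / \<delta> * h" using c1 mbd_nonneg[OF mh] by (rule mult_right_mono)
  then have mD: "mbd d D" unfolding d_def D_def by (intro mbd_mono[OF mbd_smul[OF mh]])
  have rD: "rect r r D" unfolding D_def using rect_neumann[OF rM] by blast
  have rED: "rect n r (E * D)" using j rD by blast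
  have mBi: "mbd \<beta> Bi" unfolding Bi_def \<beta>_def
   by (rule mbd_mult[OF rED j(2) mbd_mult[OF j(3) j(2) E mD] mG])
  have rBi: "rect n n Bi" unfolding Bi_def using rED j by blast
  have "rect n n (e n - Q)" using Q(1) by auto
  then have "mbd KX (Q * P + (e n - Q) * (e n - P))" unfolding KX_def
   by (intro mbd_add mbd_mult[OF Q(1) order_refl C(2,1)] mbd_mult[OF _ order_refl] mbd_diff mbd_e C)
  moreover have "mbd KY (e n + Bi * Q - Q * Bi)" unfolding KY_def
   by (intro mbd_diff mbd_add mbd_mult[OF Q(1) order_refl C(2) mBi] mbd_mult[OF rBi order_refl mBi C(2)] mbd_e)
  ultimately show "\<exists>X Y. rect n n X \<and> rect n n Y \<and> X * Y = e n \<and> Y * X = e n \<and> A * X = X * A \<and> A * Y = Y * A \<and>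
    X * P * Y = Q \<and> mbd (max KX KY) X \<and> mbd (max KX KY) Y \<and>
    (\<forall>Z. rect n n Z --> P * Z = 0 --> Q * Z = 0 --> X * Z = Z) \<and>
    (\<forall>Z. rect n n Z --> Z * P = 0 --> Z * Q = 0 --> Z * X = Z)"
   using ex mbd_mono by (intro exI[of _ "Q * P + (e n - Q) * (e n - P)"] exI[of _ "e n + Bi * Q - Q * Bi"]) auto
 qed
qed

section \<open>Similarity of orthogonal decompositions\<close>

lemma pmin_conj:
 assumes P: "rect n n P" "pmin A P" and X: "rect n n X" "rect n n Y" "X * Y = e n" "Y * X = e n"
  and A: "A * X = X * A" "A * Y = Y * A"
 shows "pmin A (X * P * Y)"
proof -
 note m = pminD[OF P(2)]
 have YX: "Y * (X * Z) = e n * Z" "X * (Y * Z) = e n * Z" for Z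
  using X(3,4) by (metis mult.assoc)+
 have 1: "X * P * Y * (X * P * Y) = X * P * Y"
  by (simp add: mult.assoc YX e_mult2[OF P(1)]) (simp add: mult.assoc[symmetric], simp add: mult.assoc m(1))
 have 2: "A * (X * P * Y) = X * P * Y * A"
  by (intro comm_mult A m(2))
 show ?thesis unfolding pmin_def
 proof (intro conjI allI impI 1 2, elim conjE)
  fix Q assume Q: "Q * Q = Q" "A * Q = Q * A" "X * P * Y * Q = Q" "Q * (X * P * Y) = Q"
  define Q' where "Q' = Y * Q * X"
  have Qe: "e n * Q = Q" "Q * e n = Q" using Q(3,4) e_mult[OF X(1)] mult_e[OF X(2)] by (metis mult.assoc)+
  have QXY: "X * Q' * Y = Q" unfolding Q'_def by (simp add: mult.assoc YX X(3) Qe)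
  have PQ': "P * Q' = Q'"
  proof -
   have "Q' = Y * (X * P * Y * Q) * X" unfolding Q(3) Q'_def ..
   also have "\<dots> = e n * P * (Y * Q * X)" using X(4) by (simp add: mult.assoc YX)
   finally show ?thesis unfolding Q'_def e_mult[OF P(1)] by simp
  qed
  have Q'P: "Q' * P = Q'"
  proof -
   have "Q' = Y * (Q * (X * P * Y)) * X" unfolding Q(4) Q'_def ..
   also have "\<dots> = Y * Q * X * (P * e n)" using X(4) by (simp add: mult.assoc)
   finally show ?thesis unfolding Q'_def mult_e[OF P(1)] by simp
  qed
  have "Q' * Q' = Y * (Q * (e n * Q)) * X" unfolding Q'_def by (simp add: mult.assoc YX)
  then have "Q' * Q' = Q'" unfolding Qe Q(1) Q'_def .
  moreover have "A * Q' = Q' * A" unfolding Q'_def by (intro comm_mult A Q(2))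
  ultimately have "Q' = 0 \<or> Q' = P" using m(3) PQ' Q'P by blast
  then show "Q = 0 \<or> Q = X * P * Y" using QXY by auto
 qed
qed

definition ortho :: "nat set => (nat => fmat) => bool" where
 "ortho I P \<longleftrightarrow> (\<forall>i\<in>I. \<forall>j\<in>I. i \<noteq> j --> P i * P j = 0)"

lemma ortho_sum:
 assumes "finite I" "ortho I P" "k \<in> I" "P k * P k = P k"
 shows "P k * (\<Sum>i\<in>I. P i) = P k" "(\<Sum>i\<in>I. P i) * P k = P k"
proof -
 have "(\<Sum>i\<in>I - {k}. P k * P i) = 0" "(\<Sum>i\<in>I - {k}. P i * P k) = 0"
  using assms(2,3) unfolding ortho_def by (auto intro!: sum.neutral)
 moreover have "(\<Sum>i\<in>I. P i) = P k + (\<Sum>i\<in>I - {k}. P i)" using assms by (simp add: sum.remove)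
 ultimately show "P k * (\<Sum>i\<in>I. P i) = P k" "(\<Sum>i\<in>I. P i) * P k = P k"
  using assms(4) by (simp_all add: distrib_left distrib_right sum_distrib_left sum_distrib_right)
qed

text \<open>Members may be zero and need not add up to the identity: frames are padded with zeros,
  and the induction of \<open>krull_schmidt\<close> works with shrinking sums.\<close>

definition ks_family :: "nat => fmat => real => nat set => (nat => fmat) => nat => bool" where
 "ks_family n A C I P m \<longleftrightarrow> finite I \<and> card I \<le> m \<and>
  (\<forall>k\<in>I. rect n n (P k) \<and> pmin A (P k) \<and> mbd C (P k)) \<and> ortho I P"

text \<open>One similarity matches the nonzero members on both sides. The last two clauses, by which
  \<open>X\<close> fixes the complement of the common sum \<open>S\<close>, carry the induction of
  \<open>krull_schmidt\<close>: a pair matched earlier lies in the complement of the sum treated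
  later.\<close>

definition ks_similar :: "nat => fmat => real => nat set => (nat => fmat) => nat set => (nat => fmat) =>
  fmat => fmat => fmat => bool" where
 "ks_similar n A K I P J Q S X Y \<longleftrightarrow>
  rect n n X \<and> rect n n Y \<and> X * Y = e n \<and> Y * X = e n \<and> A * X = X * A \<and> A * Y = Y * A \<and>
    mbd K X \<and> mbd K Y \<and>
    (\<forall>k\<in>I. P k = 0 \<or> (\<exists>l\<in>J. X * P k * Y = Q l)) \<and>
    (\<forall>l\<in>J. Q l = 0 \<or> (\<exists>k\<in>I. X * P k * Y = Q l)) \<and>
    X * (e n - S) = e n - S \<and> (e n - S) * X = e n - S"

lemma ks_familyD:
 assumes "ks_family n A C I P m"
 shows "finite I" "card I \<le> m" "\<And>k. k \<in> I ==> rect n n (P k)" "\<And>k. k \<in> I ==> pmin A (P k)"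
  "\<And>k. k \<in> I ==> mbd C (P k)" "ortho I P"
 using assms unfolding ks_family_def by auto

text \<open>Induction on the size of the first family: a nonzero \<open>P k0\<close> is exchanged
  for some \<open>Q l0\<close>, and what is left of the two families is compared inside
  \<open>S - Q l0\<close>. Conjugation enlarges the bound of the remaining idempotents to
  \<open>C'\<close>, so \<open>C\<close> is generalised. Because \<open>K\<close> precedes the
  matrices, it serves all points of the measure space at once.\<close>

lemma krull_schmidt:
 fixes n q :: nat
 shows "\<exists>K. \<forall>A P Q S I J. rect n n A \<and> ks_family n A C I P m \<and> ks_family n A C J Q q \<and>
   (\<Sum>k\<in>I. P k) = S \<and> (\<Sum>l\<in>J. Q l) = S -->
   (\<exists>X Y. ks_similar n A K I P J Q S X Y)"
proof (induction m arbitrary: C)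
 case 0
 have "ks_similar n A 1 I P J Q S (e n) (e n)"
  if A: "rect n n A" and I: "ks_family n A C I P 0" and J: "ks_family n A C J Q q"
   and S: "(\<Sum>k\<in>I. P k) = S" "(\<Sum>l\<in>J. Q l) = S" for A P Q S I J
 proof -
  have I0: "I = {}" using ks_familyD(1,2)[OF I] by auto
  then have S0: "S = 0" using S by auto
  have "Q l = 0" if "l \<in> J" for l
   using ortho_sum(1)[OF ks_familyD(1,6)[OF J] that pminD(1)[OF ks_familyD(4)[OF J that]]] unfolding S(2) S0 by simp
  then show ?thesis unfolding ks_similar_def I0 S0
   by (simp add: mbd_e e_mult[OF rect_e] comm_e[OF A])
 qed
 then show ?case by (intro exI[of _ 1]) blast
next
 case (Suc m)
 \<comment> \<open>The at most \<open>q\<close> numbers \<open>f l\<close> defined below add up to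
   1, the corner entry of \<open>G * S * E = e r\<close>, so they cannot all be smaller than
   \<open>1 / (q + 1)\<close> in modulus.\<close>
 define \<delta> :: real where "\<delta> = 1 / (q + 1)"
 have \<delta>0: "0 < \<delta>" unfolding \<delta>_def by simp
 obtain K1 where K1: "\<forall>A P Q r E G. rect n n A \<and> rect n n P \<and> pmin A P \<and> P \<noteq> 0 \<and> rect n n Q \<and> pmin A Q \<and>
   mbd C P \<and> mbd C Q \<and> jcorner n A P r E G \<and> mbd 1 E \<and> G = star E * P \<and> \<delta> \<le> cmod (ent (G * Q * E) 0 0) -->
   (\<exists>X Y. rect n n X \<and> rect n n Y \<and> X * Y = e n \<and> Y * X = e n \<and> A * X = X * A \<and> A * Y = Y * A \<and>
    X * P * Y = Q \<and> mbd K1 X \<and> mbd K1 Y \<and>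
    (\<forall>Z. rect n n Z --> P * Z = 0 --> Q * Z = 0 --> X * Z = Z) \<and>
    (\<forall>Z. rect n n Z --> Z * P = 0 --> Z * Q = 0 --> Z * X = Z))"
  using exchange[OF \<delta>0, of n C] by (rule exE)
 define C' where "C' = max C (n * (n * K1 * C) * K1)"
 obtain K2 where K2: "\<forall>A P Q S I J. rect n n A \<and> ks_family n A C' I P m \<and> ks_family n A C' J Q q \<and>
   (\<Sum>k\<in>I. P k) = S \<and> (\<Sum>l\<in>J. Q l) = S --> (\<exists>X Y. ks_similar n A K2 I P J Q S X Y)"
  using Suc.IH[of C'] by (rule exE)
 define K where "K = max 1 (max (n * K2 * K1) (n * K1 * K2))"
 have "\<exists>X Y. ks_similar n A K I P J Q S X Y"
  if A: "rect n n A" and I: "ks_family n A C I P (Suc m)" and J: "ks_family n A C J Q q"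
   and sP: "(\<Sum>k\<in>I. P k) = S" and sQ: "(\<Sum>l\<in>J. Q l) = S" for A P Q S I J
 proof -
  note fin = ks_familyD(1)[OF I] ks_familyD(1)[OF J] and cI = ks_familyD(2)[OF I] and cJ = ks_familyD(2)[OF J]
   and P = ks_familyD(3,4,5)[OF I] and Q = ks_familyD(3,4,5)[OF J] and o = ks_familyD(6)[OF I] ks_familyD(6)[OF J]
  have rS: "rect n n S" unfolding sP[symmetric] by (rule rect_sum) (rule P(1))
  have PS: "P k * S = P k" "S * P k = P k" if "k \<in> I" for k
   using ortho_sum[OF fin(1) o(1) that pminD(1)[OF P(2)[OF that]]] sP by simp_all
  have QS: "Q k * S = Q k" "S * Q k = Q k" if "k \<in> J" for k
   using ortho_sum[OF fin(2) o(2) that pminD(1)[OF Q(2)[OF that]]] sQ by simp_all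
  show ?thesis
  proof (cases "\<forall>k\<in>I. P k = 0")
   case True
   then have S: "S = 0" using sP by (metis sum.neutral)
   have "Q l = 0" if "l \<in> J" for l using QS(1)[OF that] unfolding S by simp
   moreover have "mbd K (e n)" by (rule mbd_mono[OF mbd_e]) (simp add: K_def)
   ultimately show ?thesis using True unfolding S ks_similar_def
    by (intro exI[of _ "e n"]) (simp add: e_mult[OF rect_e] comm_e[OF A])
  next
   case False
   then obtain k0 where k0: "k0 \<in> I" "P k0 \<noteq> 0" by blast
   obtain r E G where jc: "jcorner n A (P k0) r E G" and E: "mbd 1 E" and G: "G = star E * P k0"
    using pmin_jordan[OF A P(1)[OF k0(1)] P(2)[OF k0(1)] k0(2)] by blast
   note j = jcornerD[OF jc]
   define f where "f l = ent (G * Q l * E) 0 0" for l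
   have "(\<Sum>l\<in>J. f l) = ent (G * S * E) 0 0"
    unfolding f_def sQ[symmetric] by (simp add: sum_distrib_left sum_distrib_right)
   also have "G * S * E = G * (P k0 * S) * E" using j(9) by (metis mult.assoc)
   also have "\<dots> = e r" unfolding PS(1)[OF k0(1)] j(9) j(6) ..
   finally have sf: "(\<Sum>l\<in>J. f l) = 1" using j(1) by simp
   have "\<exists>l\<in>J. \<delta> \<le> cmod (f l)"
   proof (rule ccontr)
    assume "\<not> (\<exists>l\<in>J. \<delta> \<le> cmod (f l))"
    then have less: "cmod (f l) \<le> \<delta>" if "l \<in> J" for l using that by force
    have "1 \<le> (\<Sum>l\<in>J. cmod (f l))" using norm_sum[of f J] unfolding sf by simp
    also have "\<dots> \<le> real (card J) * \<delta>" using sum_bounded_above[of J "%l. cmod (f l)" \<delta>] less by simp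
    also have "\<dots> \<le> real q * \<delta>" using cJ \<delta>0 by (simp add: mult_right_mono)
    also have "\<dots> < 1" unfolding \<delta>_def by simp
    finally show False by simp
   qed
   then obtain l0 where l0: "l0 \<in> J" "\<delta> \<le> cmod (f l0)" by blast
   have pre: "rect n n A \<and> rect n n (P k0) \<and> pmin A (P k0) \<and> P k0 \<noteq> 0 \<and> rect n n (Q l0) \<and> pmin A (Q l0) \<and>
    mbd C (P k0) \<and> mbd C (Q l0) \<and> jcorner n A (P k0) r E G \<and> mbd 1 E \<and> G = star E * P k0 \<and>
    \<delta> \<le> cmod (ent (G * Q l0 * E) 0 0)"
    by (intro conjI A k0(2) jc E G l0(2)[unfolded f_def] P Q k0(1) l0(1))
   obtain X1 Y1 where X1: "rect n n X1 \<and> rect n n Y1 \<and> X1 * Y1 = e n \<and> Y1 * X1 = e n \<and> A * X1 = X1 * A \<and>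
    A * Y1 = Y1 * A \<and> X1 * P k0 * Y1 = Q l0 \<and> mbd K1 X1 \<and> mbd K1 Y1 \<and>
    (\<forall>Z. rect n n Z --> P k0 * Z = 0 --> Q l0 * Z = 0 --> X1 * Z = Z) \<and>
    (\<forall>Z. rect n n Z --> Z * P k0 = 0 --> Z * Q l0 = 0 --> Z * X1 = Z)"
    using K1[rule_format, OF pre] by (elim exE)
   have X1Z: "X1 * Z = Z" if "rect n n Z" "P k0 * Z = 0" "Q l0 * Z = 0" for Z using X1 that by blast
   have ZX1: "Z * X1 = Z" if "rect n n Z" "Z * P k0 = 0" "Z * Q l0 = 0" for Z using X1 that by blast
   have X1: "rect n n X1" "rect n n Y1" "X1 * Y1 = e n" "Y1 * X1 = e n"
    "A * X1 = X1 * A" "A * Y1 = Y1 * A" "X1 * P k0 * Y1 = Q l0" "mbd K1 X1" "mbd K1 Y1"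
    using X1 by blast+
   define Z where "Z = e n - S"
   have rZ: "rect n n Z" unfolding Z_def using rS by (intro rect_diff rect_e)
   have PZ: "P k * Z = 0" "Z * P k = 0" if "k \<in> I" for k
    unfolding Z_def using PS[OF that] P(1)[OF that]
    by (simp_all add: left_diff_distrib right_diff_distrib mult_e[OF P(1)[OF that]] e_mult[OF P(1)[OF that]])
   have QZ: "Q k * Z = 0" "Z * Q k = 0" if "k \<in> J" for k
    unfolding Z_def using QS[OF that] Q(1)[OF that]
    by (simp_all add: left_diff_distrib right_diff_distrib mult_e[OF Q(1)[OF that]] e_mult[OF Q(1)[OF that]])
   have XZ: "X1 * Z = Z" "Z * X1 = Z"
    using X1Z[OF rZ PZ(1)[OF k0(1)] QZ(1)[OF l0(1)]] ZX1[OF rZ PZ(2)[OF k0(1)] QZ(2)[OF l0(1)]] by auto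
   have XS: "X1 * S = S * X1"
   proof -
    have "X1 - X1 * S = X1 - S * X1"
     using XZ unfolding Z_def by (simp add: left_diff_distrib right_diff_distrib mult_e[OF X1(1)] e_mult[OF X1(1)])
    then show ?thesis by simp
   qed
   have "X1 * S * Y1 = S * (X1 * Y1)" unfolding XS by (simp add: mult.assoc)
   then have XSY: "X1 * S * Y1 = S" unfolding X1(3) mult_e[OF rS] .
   define P' where "P' k = X1 * P k * Y1" for k
   define S' where "S' = S - Q l0"
   define I' where "I' = I - {k0}" define J' where "J' = J - {l0}"
   have XYm: "X1 * U * Y1 * (X1 * V * Y1) = X1 * (U * V) * Y1" if "rect n n V" for U V
   proof -
    have "X1 * U * Y1 * (X1 * V * Y1) = X1 * U * ((Y1 * X1) * V) * Y1" by (simp add: mult.assoc)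
    then show ?thesis unfolding X1(4) e_mult[OF that] by (simp add: mult.assoc)
   qed
   have sP': "(\<Sum>k\<in>I'. P' k) = S'"
   proof -
    have "(\<Sum>k\<in>I. P' k) = S" unfolding P'_def using XSY unfolding sP[symmetric]
     by (simp add: sum_distrib_left sum_distrib_right)
    then show ?thesis unfolding I'_def S'_def using X1(7) k0(1) fin(1) unfolding P'_def
     by (simp add: sum_diff1)
   qed
   have sQ': "(\<Sum>l\<in>J'. Q l) = S'" unfolding J'_def S'_def using sQ l0(1) fin(2) by (simp add: sum_diff1)
   have oP': "ortho I' P'" unfolding ortho_def
   proof (intro ballI impI)
    fix i k assume "i \<in> I'" "k \<in> I'" "i \<noteq> k"
    then have "P i * P k = 0" "rect n n (P k)" using o(1) P(1) unfolding ortho_def I'_def by auto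
    then show "P' i * P' k = 0" unfolding P'_def by (simp add: XYm)
   qed
   have oQ': "ortho J' Q" using o(2) unfolding ortho_def J'_def by blast
   have P'props: "rect n n (P' k) \<and> pmin A (P' k) \<and> mbd C' (P' k)" if "k \<in> I'" for k
   proof (intro conjI)
    have k: "k \<in> I" using that unfolding I'_def by blast
    show "rect n n (P' k)" unfolding P'_def by (rule rect_sq[OF rect_sq[OF X1(1) P(1)[OF k]] X1(2)])
    show "pmin A (P' k)" unfolding P'_def by (rule pmin_conj[OF P(1)[OF k] P(2)[OF k] X1(1-6)])
    have "mbd (n * (n * K1 * C) * K1) (P' k)" unfolding P'_def
     by (rule mbd_mult[OF rect_sq[OF X1(1) P(1)[OF k]] order_refl
        mbd_mult[OF X1(1) order_refl X1(8) P(3)[OF k]] X1(9)])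
    then show "mbd C' (P' k)" by (rule mbd_mono) (simp add: C'_def)
   qed
   have Q'props: "rect n n (Q l) \<and> pmin A (Q l) \<and> mbd C' (Q l)" if "l \<in> J'" for l
    using Q[of l] that mbd_mono[of C "Q l" C'] unfolding J'_def C'_def by auto
   have "card I' \<le> m" "card J' \<le> q" unfolding I'_def J'_def using cI cJ k0(1) l0(1) fin by auto
   then have "ks_family n A C' I' P' m" "ks_family n A C' J' Q q" unfolding ks_family_def
    using P'props Q'props oP' oQ' fin unfolding I'_def J'_def by simp_all
   then obtain X2 Y2 where XY2: "ks_similar n A K2 I' P' J' Q S' X2 Y2"
    using K2[rule_format, of A I' P' J' Q S'] A sP' sQ' by blast
   have X2: "rect n n X2" "rect n n Y2" "X2 * Y2 = e n" "Y2 * X2 = e n"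
    "A * X2 = X2 * A" "A * Y2 = Y2 * A" "mbd K2 X2" "mbd K2 Y2"
    and P'Q: "\<And>k. k \<in> I' ==> P' k = 0 \<or> (\<exists>l\<in>J'. X2 * P' k * Y2 = Q l)"
    and QP': "\<And>l. l \<in> J' ==> Q l = 0 \<or> (\<exists>k\<in>I'. X2 * P' k * Y2 = Q l)"
    and Z2: "X2 * (e n - S') = e n - S'" "(e n - S') * X2 = e n - S'"
    using XY2 unfolding ks_similar_def by blast+
   define X where "X = X2 * X1" define Y where "Y = Y1 * Y2"
   note Ql = Q(1)[OF l0(1)] QS[OF l0(1)] pminD(1)[OF Q(2)[OF l0(1)]]
   have Z'Q: "(e n - S') * Q l0 = Q l0" "Q l0 * (e n - S') = Q l0"
    unfolding S'_def using Ql by (simp_all add: left_diff_distrib right_diff_distrib mult_e[OF Ql(1)] e_mult[OF Ql(1)])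
   \<comment> \<open>\<open>Q l0\<close> lies in the complement of \<open>S'\<close>, where
     \<open>X2\<close> acts as the identity, so the second similarity does not disturb the first
     match.\<close>
   have X2Q: "X2 * Q l0 = Q l0"
    using arg_cong[OF Z2(1), of "%U. U * Q l0"] unfolding mult.assoc Z'Q(1) .
   have rZ': "rect n n (e n - S')" unfolding S'_def using rS Ql(1) by (intro rect_diff rect_e)
   have "(e n - S') * Y2 = (e n - S') * X2 * Y2" unfolding Z2(2) ..
   also have "\<dots> = e n - S'" using mult_e[OF rZ'] X2(3) by (simp add: mult.assoc)
   finally have ZY2: "(e n - S') * Y2 = e n - S'" .
   have QY2: "Q l0 * Y2 = Q l0"
    using arg_cong[OF ZY2, of "%U. Q l0 * U"] unfolding mult.assoc[symmetric] Z'Q(2) .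
   have XPY: "X * P k * Y = X2 * P' k * Y2" for k unfolding X_def Y_def P'_def by (simp add: mult.assoc)
   have k0l0: "X * P k0 * Y = Q l0" unfolding XPY using X1(7) X2Q QY2 unfolding P'_def by simp
   have P0: "P k = 0" if "P' k = 0" "k \<in> I" for k
   proof -
    have "Y1 * P' k * X1 = (Y1 * X1) * P k * (Y1 * X1)" unfolding P'_def by (simp add: mult.assoc)
    then show ?thesis using that X1(4) e_mult[OF P(1)[OF that(2)]] mult_e[OF P(1)[OF that(2)]] by simp
   qed
   have "rect n n X" "rect n n Y" unfolding X_def Y_def by (intro rect_sq X1 X2)+
   moreover have "Y * X = e n"
   proof -
    have "Y * X = Y1 * ((Y2 * X2) * X1)" unfolding X_def Y_def by (simp add: mult.assoc)
    then show ?thesis using X2(4) X1(4) e_mult[OF X1(1)] by simp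
   qed
   moreover have "X * Y = e n"
    using left_right_inverse[of n Y X] calculation by blast
   moreover have "A * X = X * A" "A * Y = Y * A" unfolding X_def Y_def by (intro comm_mult X1 X2)+
   moreover have "mbd K X" "mbd K Y" unfolding X_def Y_def K_def
    by (rule mbd_mono[OF mbd_mult[OF X2(1) order_refl X2(7) X1(8)]], simp)
     (rule mbd_mono[OF mbd_mult[OF X1(2) order_refl X1(9) X2(8)]], simp add: mult.commute mult.left_commute)
   moreover have "\<forall>k\<in>I. P k = 0 \<or> (\<exists>l\<in>J. X * P k * Y = Q l)"
   proof
    fix k assume k: "k \<in> I"
    show "P k = 0 \<or> (\<exists>l\<in>J. X * P k * Y = Q l)"
    proof (cases "k = k0")
     case True then show ?thesis using k0l0 l0(1) by blast
    next
     case False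
     then have "k \<in> I'" using k unfolding I'_def by blast
     then show ?thesis using P'Q[of k] P0[OF _ k] unfolding XPY J'_def by blast
    qed
   qed
   moreover have "\<forall>l\<in>J. Q l = 0 \<or> (\<exists>k\<in>I. X * P k * Y = Q l)"
   proof
    fix l assume l: "l \<in> J"
    show "Q l = 0 \<or> (\<exists>k\<in>I. X * P k * Y = Q l)"
    proof (cases "l = l0")
     case True then show ?thesis using k0l0 k0(1) by blast
    next
     case False
     then have "l \<in> J'" using l unfolding J'_def by blast
     then show ?thesis using QP'[of l] unfolding XPY I'_def by blast
    qed
   qed
   moreover have Z'Z: "(e n - S') * Z = Z" "Z * (e n - S') = Z"
   proof -
    have "S * Z = 0" "Z * S = 0" unfolding sP[symmetric] using PZ
     by (simp_all add: sum_distrib_left sum_distrib_right)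
    then show "(e n - S') * Z = Z" "Z * (e n - S') = Z" unfolding S'_def using QZ[OF l0(1)]
     by (simp_all add: left_diff_distrib right_diff_distrib mult_e[OF rZ] e_mult[OF rZ])
   qed
   moreover have "X * Z = Z"
   proof -
    have "X * Z = X2 * (e n - S') * Z" unfolding X_def using XZ(1) Z'Z(1) by (simp add: mult.assoc)
    then show ?thesis unfolding Z2(1) Z'Z(1) .
   qed
   moreover have "Z * X = Z"
   proof -
    have "Z * X = Z * X2 * X1" unfolding X_def by (simp add: mult.assoc)
    also have "Z * X2 = Z * ((e n - S') * X2)" unfolding mult.assoc[symmetric] Z'Z(2) ..
    finally show ?thesis unfolding Z2(2) Z'Z(2) XZ(2) .
   qed
   ultimately show ?thesis unfolding ks_similar_def Z_def by blast
  qed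
 qed
 then show ?case by blast
qed

section \<open>Block coordinates and the assembly of a Jordan basis\<close>

definition off :: "(nat => nat) => nat => nat" where
 "off nn k = (\<Sum>k'<k. nn k')"

lemma off_0 [simp]: "off nn 0 = 0" and off_Suc [simp]: "off nn (Suc k) = off nn k + nn k"
 by (simp_all add: off_def)

lemma off_mono: "k \<le> k' ==> off nn k \<le> off nn k'"
 unfolding off_def by (rule sum_mono2) auto

lemma off_less: "k < m ==> i < nn k ==> off nn k + i < off nn m"
 using off_mono[of "Suc k" m nn] by simp

lemma off_split: "p < off nn m ==> \<exists>k<m. \<exists>i<nn k. p = off nn k + i"
proof (induction m)
 case (Suc m)
 show ?case
 proof (cases "p < off nn m")
  case True
  then show ?thesis using Suc.IH less_SucI by blast
 next
  case False
  then show ?thesis using Suc.prems by (intro exI[of _ m] conjI exI[of _ "p - off nn m"]) auto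
 qed
qed simp

lemma off_inj:
 assumes "i < nn k" "j < nn k'" "off nn k + i = off nn k' + j"
 shows "k = k'" "i = j"
proof -
 show "k = k'"
 proof (rule ccontr)
  assume "k \<noteq> k'"
  then consider "k < k'" | "k' < k" by linarith
  then show False
   using off_less[of k k' i nn] off_less[of k' k j nn] assms by cases simp_all
 qed
 then show "i = j" using assms(3) by simp
qed

text \<open>Multiplication by \<open>shift nn n k\<close> on the left selects the rows of block
  \<open>k\<close>; multiplication by its adjoint on the right selects the columns.\<close>

definition shift :: "(nat => nat) => nat => nat => fmat" where
 "shift nn n k = mk_fmat (nn k) n (%i p. if p = off nn k + i then 1 else 0)"

lemma rect_shift: "rect (nn k) n (shift nn n k)" unfolding shift_def by simp

lemma ent_shift_mult:
 assumes "i < nn k" "off nn k + i < n"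
 shows "ent (shift nn n k * X) i p = ent X (off nn k + i) p"
proof -
 have "ent (shift nn n k * X) i p = (\<Sum>q<n. ent (shift nn n k) i q * ent X q p)"
  by (rule ent_mult[OF rect_shift])
 also have "\<dots> = ent (shift nn n k) i (off nn k + i) * ent X (off nn k + i) p"
  by (rule sum_single[OF assms(2)]) (simp add: shift_def)
 finally show ?thesis using assms by (simp add: shift_def)
qed

lemma ent_mult_star_shift:
 assumes "j < nn k" "off nn k + j < n"
 shows "ent (X * star (shift nn n k)) i j = ent X i (off nn k + j)"
proof -
 have "ent (star (shift nn n k * star X)) i j = cnj (cnj (ent X i (off nn k + j)))"
  unfolding ent_star ent_shift_mult[OF assms] ..
 then show ?thesis unfolding star_mult star_star by simp
qed

definition block_form :: "nat => (nat => nat) => fmat => bool" where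
 "block_form m nn B \<longleftrightarrow> (\<forall>k<m. \<forall>k'<m. \<forall>i<nn k. \<forall>j<nn k'.
  (k \<noteq> k' --> ent B (off nn k + i) (off nn k' + j) = 0) \<and>
  (k = k' \<and> j < i --> ent B (off nn k + i) (off nn k' + j) = 0) \<and>
  (k = k' \<and> i = j --> ent B (off nn k + i) (off nn k' + j) = ent B (off nn k) (off nn k)))"

text \<open>A lower bound \<open>\<epsilon>\<close> replaces nonvanishing because measurable
  selection requires a closed condition.\<close>

definition superdiag :: "nat => (nat => nat) => real => fmat => bool" where
 "superdiag m nn \<epsilon> B \<longleftrightarrow>
  (\<forall>k<m. \<forall>i. Suc i < nn k --> \<epsilon> \<le> cmod (ent B (off nn k + i) (off nn k + Suc i)))"

text \<open>The coordinate systems of the corners are put side by side: the columns of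
  \<open>Y\<close> are those of the \<open>E k\<close>, the rows of \<open>X\<close> those of the
  \<open>G k\<close>, so one corner's bounds are the bounds of the whole. Blocks off the diagonal
  vanish because \<open>P k * P k' = 0\<close>. Unlike the bounds on \<open>X\<close> and
  \<open>Y\<close>, the number \<open>\<epsilon>\<close> depends on the matrices.\<close>

lemma frame_block_form:
 fixes n m :: nat and C :: real
 assumes A: "rect n n A" and P: "\<And>k. k < m ==> rect n n (P k)" "\<And>k. k < m ==> pmin A (P k)" "\<And>k. k < m ==> P k \<noteq> 0"
   "\<And>k. k < m ==> mbd C (P k)"
  and o: "ortho {..<m} P" and s: "(\<Sum>k<m. P k) = e n" and nn: "\<And>k. k < m ==> tr n (P k) = of_nat (nn k)"
 shows "(\<forall>k<m. 0 < nn k) \<and> off nn m = n \<and>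
  (\<exists>X Y \<epsilon>. rect n n X \<and> rect n n Y \<and> X * Y = e n \<and> Y * X = e n \<and> mbd (max 1 (n * C)) X \<and> mbd (max 1 (n * C)) Y \<and>
   block_form m nn (X * A * Y) \<and> 0 < \<epsilon> \<and> superdiag m nn \<epsilon> (X * A * Y))"
proof -
 have "\<exists>p. jcorner n A (P k) (fst p) (snd p) (star (snd p) * P k) \<and> mbd 1 (snd p)" if "k \<in> {..<m}" for k
  using pmin_jordan[OF A P(1) P(2) P(3), of k] that by fastforce
 then have "\<exists>p. \<forall>k\<in>{..<m}. jcorner n A (P k) (fst (p k)) (snd (p k)) (star (snd (p k)) * P k) \<and> mbd 1 (snd (p k))"
  by (intro bchoice) blast
 then obtain p where p: "\<forall>k\<in>{..<m}. jcorner n A (P k) (fst (p k)) (snd (p k)) (star (snd (p k)) * P k) \<and> mbd 1 (snd (p k))"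
  by (rule exE)
 define r where "r k = fst (p k)" for k
 define E where "E k = snd (p k)" for k
 define G where "G k = star (E k) * P k" for k
 have jc: "\<And>k. k < m ==> jcorner n A (P k) (r k) (E k) (G k)" and E: "\<And>k. k < m ==> mbd 1 (E k)"
  using p unfolding r_def E_def G_def by simp_all
 note j = jcornerD[OF jc]
 \<comment> \<open>The trace identifies the rank of each corner with the prescribed
   \<open>nn k\<close>, so the block sizes are independent of the choices made by
   \<open>pmin_jordan\<close>.\<close>
 have r_nn: "r k = nn k" if "k < m" for k
 proof -
  have "of_nat (nn k) = tr (r k) (G k * E k)"
   using tr_comm[OF j(3)[OF that] j(4)[OF that]] nn[OF that] j(5)[OF that] by simp
  then have "of_nat (nn k) = (of_nat (r k) :: complex)" using j(6)[OF that] by simp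
  then show ?thesis by (simp only: of_nat_eq_iff)
 qed
 have nn0: "\<forall>k<m. 0 < nn k" using j(1) r_nn by auto
 have "of_nat (off nn m) = (\<Sum>k<m. tr n (P k))" unfolding off_def of_nat_sum using nn by simp
 also have "\<dots> = tr n (\<Sum>k<m. P k)" unfolding tr_def ent_sum by (rule sum.swap)
 also have "\<dots> = (of_nat n :: complex)" unfolding s by simp
 finally have "(of_nat (off nn m) :: complex) = of_nat n" .
 then have offn: "off nn m = n" by (simp only: of_nat_eq_iff)
 define T where "T k = shift nn n k" for k
 have rT: "rect (nn k) n (T k)" for k unfolding T_def by (rule rect_shift)
 have rTs: "rect n (nn k) (star (T k))" for k by (rule rect_star[OF rT])
 have TT: "T k * star (T k') = (if k = k' then e (nn k) else 0)" if k: "k < m" "k' < m" for k k'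
 proof (rule fmat_eqI)
  fix i j'
  show "ent (T k * star (T k')) i j' = ent (if k = k' then e (nn k) else 0) i j'"
  proof (cases "i < nn k \<and> j' < nn k'")
   case False
   have "rect (nn k) (nn k') (T k * star (T k'))" by (rule rect_mult[OF rT rTs])
   then show ?thesis using rectD[of "nn k" "nn k'" _ i j'] False by (auto simp: not_less)
  next
   case True
   have "ent (T k * star (T k')) i j' = ent (star (T k')) (off nn k + i) j'"
    unfolding T_def by (rule ent_shift_mult) (use True off_less[OF k(1), of i nn] offn in auto)
   also have "\<dots> = (if off nn k + i = off nn k' + j' then 1 else 0)"
    unfolding T_def shift_def using True off_less[OF k(1), of i nn] offn by auto
   finally show ?thesis using True off_inj[of i nn k j' k'] by auto
  qed
 qed
 have jr: "rect n (nn k) (E k)" "rect (nn k) n (G k)" "E k * G k = P k" "G k * E k = e (nn k)"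
  "jlike (nn k) (G k * A * E k)" "P k * E k = E k" "G k * P k = G k" if "k < m" for k
  using j(3-9)[OF that] unfolding r_nn[OF that] by simp_all
 define Y where "Y = (\<Sum>k<m. E k * T k)"
 define X where "X = (\<Sum>k<m. star (T k) * G k)"
 have rY: "rect n n Y" unfolding Y_def by (intro rect_sum rect_mult[OF jr(1) rT]) simp
 have rX: "rect n n X" unfolding X_def by (intro rect_sum rect_mult[OF rTs jr(2)]) simp
 have TX: "T k * X = G k" if k: "k < m" for k
 proof -
  have "T k * X = (\<Sum>k'<m. (T k * star (T k')) * G k')" unfolding X_def by (simp add: sum_distrib_left mult.assoc)
  also have "\<dots> = (T k * star (T k)) * G k"
   by (rule sum_single[OF k]) (use k TT in auto)
  finally show ?thesis using TT[OF k k] e_mult[OF jr(2)[OF k]] by simp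
 qed
 have YT: "Y * star (T k) = E k" if k: "k < m" for k
 proof -
  have "Y * star (T k) = (\<Sum>k'<m. E k' * (T k' * star (T k)))" unfolding Y_def by (simp add: sum_distrib_right mult.assoc)
  also have "\<dots> = E k * (T k * star (T k))"
   by (rule sum_single[OF k]) (use k TT in auto)
  finally show ?thesis using TT[OF k k] mult_e[OF jr(1)[OF k]] by simp
 qed
 have "Y * X = (\<Sum>k<m. E k * (T k * X))" unfolding Y_def by (simp add: sum_distrib_right mult.assoc)
 also have "\<dots> = (\<Sum>k<m. P k)" by (rule sum.cong) (use TX jr(3) in auto)
 finally have YX: "Y * X = e n" unfolding s .
 have XY: "X * Y = e n" by (rule left_right_inverse[OF rY rX YX])
 have P0: "P k * P k' = 0" if "k < m" "k' < m" "k \<noteq> k'" for k k' using o that unfolding ortho_def by blast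
 have ent_C: "ent (X * A * Y) (off nn k + i) (off nn k' + j') = (if k = k' then ent (G k * A * E k) i j' else 0)"
  if k: "k < m" "k' < m" "i < nn k" "j' < nn k'" for k k' i j'
 proof -
  have "ent (X * A * Y) (off nn k + i) (off nn k' + j') = ent (T k * (X * A * Y) * star (T k')) i j'"
  proof -
   have "off nn k + i < n" "off nn k' + j' < n"
    using off_less[of k m i nn] off_less[of k' m j' nn] k offn by auto
   then show ?thesis unfolding T_def
    using ent_mult_star_shift[where nn = nn and k = k', OF k(4)] ent_shift_mult[where nn = nn and k = k, OF k(3)] by simp
  qed
  also have "T k * (X * A * Y) * star (T k') = (T k * X) * A * (Y * star (T k'))" by (simp add: mult.assoc)
  also have "\<dots> = G k * A * E k'" unfolding TX[OF k(1)] YT[OF k(2)] ..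
  finally have fin1: "ent (X * A * Y) (off nn k + i) (off nn k' + j') = ent (G k * A * E k') i j'" .
  have GAE: "k \<noteq> k' ==> G k * A * E k' = 0"
  proof -
   assume "k \<noteq> k'"
   have "G k * A * E k' = G k * (P k * A) * (P k' * E k')"
    unfolding jr(6)[OF k(2)] mult.assoc[symmetric] jr(7)[OF k(1)] ..
   also have "\<dots> = G k * A * (P k * P k') * E k'"
    unfolding pminD(2)[OF P(2)[OF k(1)], symmetric] by (simp add: mult.assoc)
   finally show ?thesis using P0[OF k(1,2) \<open>k \<noteq> k'\<close>] by simp
  qed
  show ?thesis using fin1 GAE by (cases "k = k'") auto
 qed
 have jl: "band 0 (G k * A * E k)" "\<And>i. i < nn k ==> ent (G k * A * E k) i i = ent (G k * A * E k) 0 0"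
  "\<And>i. Suc i < nn k ==> ent (G k * A * E k) i (Suc i) \<noteq> 0" if "k < m" for k
  using jr(5)[OF that] unfolding jlike_def by blast+
 have bf: "block_form m nn (X * A * Y)" unfolding block_form_def
 proof (intro allI impI conjI)
  fix k k' i j' assume k: "k < m" "k' < m" "i < nn k" "j' < nn k'"
  show "ent (X * A * Y) (off nn k + i) (off nn k' + j') = 0" if "k \<noteq> k'"
   using ent_C[OF k] that by simp
  show "ent (X * A * Y) (off nn k + i) (off nn k' + j') = 0" if "k = k' \<and> j' < i"
   using ent_C[OF k] that bandD[OF jl(1)[OF k(1)], of j' i] by simp
  show "ent (X * A * Y) (off nn k + i) (off nn k' + j') = ent (X * A * Y) (off nn k) (off nn k)" if "k = k' \<and> i = j'"
   using ent_C[OF k] ent_C[OF k(1,1), of 0 0] nn0 k that jl(2)[OF k(1,3)] by simp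
 qed
 define W where "W = (\<Union>k<m. (%i. cmod (ent (X * A * Y) (off nn k + i) (off nn k + Suc i))) ` {i. Suc i < nn k})"
 have "finite {i. Suc i < c}" for c :: nat by (rule finite_subset[of _ "{..<c}"]) auto
 then have finW: "finite W" unfolding W_def by (intro finite_UN_I finite_imageI) auto
 have Wpos: "0 < w" if wW: "w \<in> W" for w
 proof -
  obtain k i where k: "k < m" "Suc i < nn k" and w: "w = cmod (ent (X * A * Y) (off nn k + i) (off nn k + Suc i))"
   using wW unfolding W_def by blast
  then show ?thesis unfolding w using ent_C[of k k i "Suc i"] jl(3)[of k i] by simp
 qed
 define \<epsilon> where "\<epsilon> = Min (insert 1 W)"
 have "0 < \<epsilon>" unfolding \<epsilon>_def using finW Wpos by (subst Min_gr_iff) auto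
 moreover have "superdiag m nn \<epsilon> (X * A * Y)" unfolding superdiag_def
 proof (intro allI impI)
  fix k i assume "k < m" "Suc i < nn k"
  then have "cmod (ent (X * A * Y) (off nn k + i) (off nn k + Suc i)) \<in> W" unfolding W_def by blast
  then show "\<epsilon> \<le> cmod (ent (X * A * Y) (off nn k + i) (off nn k + Suc i))"
   unfolding \<epsilon>_def using finW by (intro Min_le) auto
 qed
 moreover have "mbd (max 1 (n * C)) Y" unfolding mbd_def
 proof (intro allI)
  fix i p
  show "cmod (ent Y i p) \<le> max 1 (n * C)"
  proof (cases "p < n")
   case False then show ?thesis using rectD[OF rY, of n p] rectD[OF rY, of i p] by simp
  next
   case True
   then obtain k j' where k: "k < m" "j' < nn k" "p = off nn k + j'" using off_split[of p nn m] offn by blast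
   have "ent Y i p = ent (Y * star (T k)) i j'" unfolding T_def k(3)
    by (rule ent_mult_star_shift[symmetric]) (use k True in auto)
   then have "cmod (ent Y i p) \<le> 1" unfolding YT[OF k(1)] using E[OF k(1)] unfolding mbd_def by simp
   then show ?thesis by simp
  qed
 qed
 moreover have "mbd (max 1 (n * C)) X" unfolding mbd_def
 proof (intro allI)
  fix p i
  show "cmod (ent X p i) \<le> max 1 (n * C)"
  proof (cases "p < n")
   case False then show ?thesis using rectD[OF rX, of p i] by simp
  next
   case True
   then obtain k j' where k: "k < m" "j' < nn k" "p = off nn k + j'" using off_split[of p nn m] offn by blast
   have "mbd (real n * 1 * C) (G k)" unfolding G_def
    by (rule mbd_mult[OF rect_star[OF jr(1)[OF k(1)]] order_refl mbd_star[OF E[OF k(1)]] P(4)[OF k(1)]])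
   moreover have "ent X p i = ent (T k * X) j' i" unfolding T_def k(3)
    by (rule ent_shift_mult[symmetric]) (use k True in auto)
   ultimately have "cmod (ent X p i) \<le> n * C" unfolding TX[OF k(1)] unfolding mbd_def by simp
   then show ?thesis by simp
  qed
 qed
 ultimately show ?thesis using nn0 offn rX rY XY YX bf by blast
qed

section \<open>Measurable selection\<close>

text \<open>Tube lemma: an open set containing a compact fibre contains a whole strip around
  it.\<close>

lemma closed_projection:
 fixes R :: "('x::topological_space \<times> 'y::topological_space) set"
 assumes "closed R" "compact K"
 shows "closed {x. \<exists>y\<in>K. (x, y) \<in> R}"
proof -
 have "open (- {x. \<exists>y\<in>K. (x, y) \<in> R})"
 proof (subst open_subopen, intro ballI)
  fix x assume "x \<in> - {x. \<exists>y\<in>K. (x, y) \<in> R}"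
  then have "{x} \<times> K \<subseteq> - R" by auto
  then obtain X where "x \<in> X" "open X" "X \<times> K \<subseteq> - R"
   using Elementary_Topology.tube_lemma[OF assms(2), of "- R" x] assms(1) by (auto simp: open_Compl)
  then show "\<exists>T. open T \<and> x \<in> T \<and> T \<subseteq> - {x. \<exists>y\<in>K. (x, y) \<in> R}" by blast
 qed
 then show ?thesis by (simp add: closed_def)
qed

lemma compact_decreasing_Inter:
 fixes G :: "nat => 'y::t2_space set"
 assumes "\<And>i. compact (G i)" "\<And>i. G i \<noteq> {}" "\<And>i. G (Suc i) \<subseteq> G i"
 shows "(\<Inter>i. G i) \<noteq> {}"
proof -
 have dec: "G j \<subseteq> G i" if "i \<le> j" for i j using assms(3) that by (rule lift_Suc_antimono_le)
 have "G 0 \<inter> \<Inter>(range G) \<noteq> {}"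
 proof (rule compact_imp_fip[OF assms(1)])
  show "closed T" if "T \<in> range G" for T using that assms(1) compact_imp_closed by auto
  fix F' assume F': "finite F'" "F' \<subseteq> range G"
  then obtain I where I: "finite I" "F' = G ` I" by (meson finite_subset_image)
  define N where "N = Max (insert 0 I)"
  have "G N \<subseteq> G i" if "i \<in> insert 0 I" for i
   by (rule dec) (use that I(1) in \<open>simp add: N_def\<close>)
  then have "G N \<subseteq> G 0 \<inter> \<Inter>F'" unfolding I(2) by blast
  then show "G 0 \<inter> \<Inter>F' \<noteq> {}" using assms(2)[of N] by blast
 qed
 then show ?thesis by blast
qed

text \<open>Each stage intersects with the next closed set unless that would leave nothing. With the
  complements of a countable basis as closed sets, the limit is a single point.\<close>

primrec sel_seq :: "(nat => 'y set) => 'y set => nat => 'y set" where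
 "sel_seq C F 0 = F"
| "sel_seq C F (Suc i) = (if sel_seq C F i \<inter> C i = {} then sel_seq C F i else sel_seq C F i \<inter> C i)"

text \<open>All measurability is expressed by the events that a compact set meets a closed one. For
  the fibres of \<open>R\<close> these are measurable by \<open>closed_projection\<close>, and the
  events at one stage of \<open>sel_seq\<close> are Boolean combinations of events at the previous
  stage. By compactness the selected point lies in a closed set iff every stage meets that
  set.\<close>

lemma closed_selection:
 fixes K :: "'y::{second_countable_topology,t2_space} set" and R :: "('x::topological_space \<times> 'y) set"
 assumes K: "compact K" and R: "closed R" and D: "D \<in> borel_measurable M"
 defines "E \<equiv> {l \<in> space M. \<exists>y\<in>K. (D l, y) \<in> R}"
 shows "E \<in> sets M"
  "\<exists>s. (\<forall>l\<in>E. s l \<in> K \<and> (D l, s l) \<in> R) \<and> (\<forall>C. closed C --> {l \<in> E. s l \<in> C} \<in> sets M)"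
proof -
 obtain B :: "'y set set" where B: "countable B" "topological_basis B"
  using ex_countable_basis by blast
 have Bne: "B \<noteq> {}" using B(2) unfolding topological_basis_def by (metis UNIV_I Union_empty empty_iff open_UNIV subset_empty)
 define C where "C i = - from_nat_into B i" for i
 have Bopen: "open (from_nat_into B i)" for i
  using topological_basis_open[OF B(2) from_nat_into[OF Bne]] .
 have C: "closed (C i)" for i unfolding C_def using Bopen by auto
 define F where "F l = {y \<in> K. (D l, y) \<in> R}" for l
 have "closed {y. (D l, y) \<in> R}" for l
 proof -
  have "closed ((%y. (D l, y)) -` R)" by (intro closed_vimage R continuous_intros)
  then show ?thesis by (simp add: vimage_def)
 qed
 then have cF: "compact (F l)" for l
  unfolding F_def using compact_Int_closed[OF K] by (simp add: Collect_conj_eq)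
 have cS: "compact (sel_seq C (F l) i)" for l i
  by (induction i) (auto simp: cF compact_Int_closed C)
 have dec: "sel_seq C (F l) (Suc i) \<subseteq> sel_seq C (F l) i" for l i by auto
 have ne: "sel_seq C (F l) i \<noteq> {}" if "l \<in> E" for l i
  using that by (induction i) (auto simp: E_def F_def)
 have meas: "{l \<in> space M. sel_seq C (F l) i \<inter> V \<noteq> {}} \<in> sets M" if "closed V" for i V
  using that
 proof (induction i arbitrary: V)
  case 0
  have "{x. \<exists>y\<in>K \<inter> V. (x, y) \<in> R} \<in> sets borel"
   using closed_projection[OF R compact_Int_closed[OF K 0]] by (rule borel_closed)
  then have "D -` {x. \<exists>y\<in>K \<inter> V. (x, y) \<in> R} \<inter> space M \<in> sets M" using D by (rule measurable_sets[rotated])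
  also have "D -` {x. \<exists>y\<in>K \<inter> V. (x, y) \<in> R} \<inter> space M = {l \<in> space M. sel_seq C (F l) 0 \<inter> V \<noteq> {}}"
   unfolding F_def by auto
  finally show ?case .
 next
  case (Suc i)
  have "{l \<in> space M. sel_seq C (F l) (Suc i) \<inter> V \<noteq> {}} =
   {l \<in> space M. sel_seq C (F l) i \<inter> (C i \<inter> V) \<noteq> {}} \<union>
   ({l \<in> space M. sel_seq C (F l) i \<inter> V \<noteq> {}} - {l \<in> space M. sel_seq C (F l) i \<inter> C i \<noteq> {}})"
   by auto
  then show ?case using Suc.IH[OF closed_Int[OF C Suc.prems]] Suc.IH[OF Suc.prems] Suc.IH[OF C] by simp
 qed
 have E_eq: "E = {l \<in> space M. sel_seq C (F l) 0 \<inter> UNIV \<noteq> {}}" unfolding E_def F_def by auto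
 show Em: "E \<in> sets M" unfolding E_eq by (rule meas) simp
 define s where "s l = (SOME y. y \<in> (\<Inter>i. sel_seq C (F l) i))" for l
 have sI: "s l \<in> sel_seq C (F l) i" if "l \<in> E" for l i
 proof -
  have "(\<Inter>i. sel_seq C (F l) i) \<noteq> {}" by (rule compact_decreasing_Inter) (rule cS, rule ne[OF that], rule dec)
  then have "\<exists>y. y \<in> (\<Inter>i. sel_seq C (F l) i)" by blast
  then have "s l \<in> (\<Inter>i. sel_seq C (F l) i)" unfolding s_def by (rule someI_ex)
  then show ?thesis by blast
 qed
 \<comment> \<open>A basic open set separates \<open>z\<close> from \<open>y\<close>. At its stage
   the point \<open>y\<close> shows that the complement is met, so the cut is carried out and
   removes \<open>z\<close>.\<close>
 have uniq: "y = z" if y: "\<And>i. y \<in> sel_seq C (F l) i" and z: "\<And>i. z \<in> sel_seq C (F l) i" for y z l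
 proof (rule ccontr)
  assume "y \<noteq> z"
  then obtain U where U: "open U" "z \<in> U" "y \<notin> U" using t1_space[of z y] by auto
  then obtain V where V: "V \<in> B" "z \<in> V" "V \<subseteq> U" using topological_basisE[OF B(2) U(1,2)] by blast
  obtain i where i: "V = from_nat_into B i" using V(1) B(1) by (metis from_nat_into_surj)
  have "y \<in> C i" unfolding C_def using i V U by blast
  then have "sel_seq C (F l) (Suc i) \<subseteq> C i" using y[of i] by auto
  then show False using z[of "Suc i"] V(2) i unfolding C_def by blast
 qed
 have "{l \<in> E. s l \<in> V} \<in> sets M" if V: "closed V" for V
 proof -
  have "{l \<in> E. s l \<in> V} = (\<Inter>i. {l \<in> space M. sel_seq C (F l) i \<inter> V \<noteq> {}})"
  proof (intro equalityI subsetI INT_I)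
   fix l i assume "l \<in> {l \<in> E. s l \<in> V}"
   then show "l \<in> {l \<in> space M. sel_seq C (F l) i \<inter> V \<noteq> {}}" using sI[of l i] unfolding E_def by blast
  next
   fix l assume l: "l \<in> (\<Inter>i. {l \<in> space M. sel_seq C (F l) i \<inter> V \<noteq> {}})"
   then have "l \<in> space M" "sel_seq C (F l) 0 \<inter> V \<noteq> {}" by blast+
   then have lE: "l \<in> E" unfolding E_eq by blast
   have "(\<Inter>i. sel_seq C (F l) i \<inter> V) \<noteq> {}"
   proof (rule compact_decreasing_Inter)
    show "compact (sel_seq C (F l) i \<inter> V)" for i by (rule compact_Int_closed[OF cS V])
    show "sel_seq C (F l) i \<inter> V \<noteq> {}" for i using l by blast
    show "sel_seq C (F l) (Suc i) \<inter> V \<subseteq> sel_seq C (F l) i \<inter> V" for i using dec[of l i] by blast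
   qed
   then obtain y where y: "\<And>i. y \<in> sel_seq C (F l) i" "y \<in> V" by auto
   have "y = s l" by (rule uniq[OF y(1) sI[OF lE]])
   then show "l \<in> {l \<in> E. s l \<in> V}" using y lE by simp
  qed
  then show ?thesis using meas[OF V] by auto
 qed
 moreover have "\<forall>l\<in>E. s l \<in> K \<and> (D l, s l) \<in> R" using sI[of _ 0] unfolding F_def by auto
 ultimately show "\<exists>s. (\<forall>l\<in>E. s l \<in> K \<and> (D l, s l) \<in> R) \<and> (\<forall>C. closed C --> {l \<in> E. s l \<in> C} \<in> sets M)" by blast
qed

section \<open>Measurable and continuous fields of matrices, and their selection\<close>

text \<open>The size condition holds at every point, not just almost everywhere, so the algebra of
  \<open>fmat\<close> applies pointwise without exceptional sets.\<close>

definition mfm :: "'a measure => nat => ('a => fmat) => bool" where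
 "mfm M n f \<longleftrightarrow> (\<forall>l. rect n n (f l)) \<and> (\<forall>i j. (%l. ent (f l) i j) \<in> borel_measurable M)"

definition cfm :: "nat => ('a::topological_space => fmat) => bool" where
 "cfm n f \<longleftrightarrow> (\<forall>l. rect n n (f l)) \<and> (\<forall>i j. continuous_on UNIV (%l. ent (f l) i j))"

lemma mfmD: "mfm M n f ==> rect n n (f l)" "mfm M n f ==> (%l. ent (f l) i j) \<in> borel_measurable M"
 by (simp_all add: mfm_def)
lemma cfmD: "cfm n f ==> rect n n (f l)" "cfm n f ==> continuous_on UNIV (%l. ent (f l) i j)"
 by (simp_all add: cfm_def)

lemma mfmI: "(\<And>l. rect n n (f l)) ==> (\<And>i j. (%l. ent (f l) i j) \<in> borel_measurable M) ==> mfm M n f"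
 by (simp add: mfm_def)
lemma cfmI: "(\<And>l. rect n n (f l)) ==> (\<And>i j. continuous_on UNIV (%l. ent (f l) i j)) ==> cfm n f"
 by (simp add: cfm_def)

lemma mfm_mult:
 assumes f: "mfm M n f" and g: "mfm M n g" shows "mfm M n (%l. f l * g l)"
proof (rule mfmI)
 show "rect n n (f l * g l)" for l by (rule rect_sq[OF mfmD(1)[OF f] mfmD(1)[OF g]])
 show "(%l. ent (f l * g l) i j) \<in> borel_measurable M" for i j
  unfolding ent_mult[OF mfmD(1)[OF f]]
  by (intro borel_measurable_sum borel_measurable_times mfmD(2)[OF f] mfmD(2)[OF g])
qed

lemma mfm_diff:
 assumes f: "mfm M n f" and g: "mfm M n g" shows "mfm M n (%l. f l - g l)"
 unfolding mfm_def ent_diff using mfmD(1)[OF f] mfmD(1)[OF g]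
 by (intro conjI allI borel_measurable_diff mfmD(2)[OF f] mfmD(2)[OF g] rect_diff) blast+

lemma mfm_const: "rect n n X ==> mfm M n (%l. X)"
 by (rule mfmI) simp_all

lemma mfm_if:
 assumes E: "E \<in> sets M" and f: "mfm M n f" and g: "mfm M n g"
 shows "mfm M n (%l. if l \<in> E then f l else g l)"
proof (rule mfmI)
 show "rect n n (if l \<in> E then f l else g l)" for l using mfmD(1)[OF f] mfmD(1)[OF g] by simp
 show "(%l. ent (if l \<in> E then f l else g l) i j) \<in> borel_measurable M" for i j
  unfolding if_distrib[of "%X. ent X i j"]
  by (rule measurable_If_set[OF mfmD(2)[OF f] mfmD(2)[OF g]]) (use E in auto)
qed

lemma cfm_mult:
 assumes f: "cfm n f" and g: "cfm n g" shows "cfm n (%l. f l * g l)"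
proof (rule cfmI)
 show "rect n n (f l * g l)" for l by (rule rect_sq[OF cfmD(1)[OF f] cfmD(1)[OF g]])
 show "continuous_on UNIV (%l. ent (f l * g l) i j)" for i j
  unfolding ent_mult[OF cfmD(1)[OF f]]
  by (intro continuous_on_sum continuous_on_mult cfmD(2)[OF f] cfmD(2)[OF g])
qed

lemma cfm_diff:
 assumes f: "cfm n f" and g: "cfm n g" shows "cfm n (%l. f l - g l)"
 unfolding cfm_def ent_diff using cfmD(1)[OF f] cfmD(1)[OF g]
 by (intro conjI allI continuous_on_diff cfmD(2)[OF f] cfmD(2)[OF g] rect_diff) blast+

lemma cfm_const: "rect n n X ==> cfm n (%l. X)"
 by (rule cfmI) simp_all

lemma continuous_on_eval3:
 fixes f :: "'z::topological_space => nat => nat => nat => complex"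
 assumes "continuous_on UNIV f" shows "continuous_on UNIV (%z. f z k i j)"
proof -
 note c = continuous_on_product_then_coordinatewise
 show ?thesis by (rule c[OF c[OF c[OF assms]]])
qed

lemma cfm_coord:
 fixes k :: nat
 shows cfm_fst: "cfm n (%z :: _ \<times> 'a::topological_space. mk_fmat n n (fst z k))"
 and cfm_snd: "cfm n (%z :: 'a \<times> _. mk_fmat n n (snd z k))"
proof -
 have 1: "continuous_on UNIV (%z :: (nat => nat => nat => complex) \<times> 'a::topological_space. fst z k i j)" for i j
  by (intro continuous_on_eval3 continuous_on_fst continuous_on_id)
 have 2: "continuous_on UNIV (%z :: 'a::topological_space \<times> (nat => nat => nat => complex). snd z k i j)" for i j
  by (intro continuous_on_eval3 continuous_on_snd continuous_on_id)
 show "cfm n (%z :: _ \<times> 'a. mk_fmat n n (fst z k))"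
 proof (rule cfmI)
  show "continuous_on UNIV (%z :: _ \<times> 'a. ent (mk_fmat n n (fst z k)) i j)" for i j
   using 1[of i j] by (cases "i < n"; cases "j < n") simp_all
 qed simp
 show "cfm n (%z :: 'a \<times> _. mk_fmat n n (snd z k))"
 proof (rule cfmI)
  show "continuous_on UNIV (%z :: 'a \<times> _. ent (mk_fmat n n (snd z k)) i j)" for i j
   using 2[of i j] by (cases "i < n"; cases "j < n") simp_all
 qed simp
qed

lemma closed_fm_eq:
 assumes "cfm n f" "cfm n g" shows "closed {z. f z = g z}"
proof -
 have "{z. f z = g z} = (\<Inter>i. \<Inter>j. {z. ent (f z) i j = ent (g z) i j})"
  using fmat_eqI by auto
 also have "closed \<dots>"
  by (intro closed_INT ballI closed_Collect_eq cfmD(2)[OF assms(1)] cfmD(2)[OF assms(2)])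
 finally show ?thesis .
qed

lemma closed_fm_ge:
 assumes "cfm n f" shows "closed {z. c \<le> cmod (ent (f z) i j)}"
 by (intro closed_Collect_le continuous_intros cfmD(2)[OF assms])

lemma closed_fm_ent_eq:
 assumes "cfm n f" shows "closed {z. ent (f z) i j = ent (f z) i' j'}" "closed {z. ent (f z) i j = 0}"
 by (intro closed_Collect_eq continuous_intros cfmD(2)[OF assms])+

text \<open>Tychonoff's theorem, applied once for each of the three indices.\<close>

lemma compact_box: "compact {y :: nat => nat => nat => complex. \<forall>k i j. cmod (y k i j) \<le> c}"
proof -
 have *: "compact {f :: nat => 'b::topological_space. \<forall>i. f i \<in> S}" if "compact S" for S
 proof -
  have "compactin (product_topology (%i::nat. euclidean) UNIV) (PiE UNIV (%i. S))"
   unfolding compactin_PiE using that by simp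
  moreover have "PiE UNIV (%i::nat. S) = {f. \<forall>i. f i \<in> S}" by (auto simp: PiE_def Pi_def extensional_def)
  ultimately show ?thesis by (simp add: euclidean_product_topology)
 qed
 have "compact {z :: complex. cmod z \<le> c}" using compact_cball[of "0::complex" c] by (simp add: cball_def)
 from *[OF *[OF *[OF this]]] show ?thesis by simp
qed

lemma borel_measurableI_closed:
 fixes f :: "'a => 'b::topological_space"
 assumes "\<And>S. closed S ==> f -` S \<inter> space M \<in> sets M"
 shows "f \<in> borel_measurable M"
proof (rule borel_measurableI)
 fix S :: "'b set" assume "open S"
 then have "space M - f -` (- S) \<inter> space M \<in> sets M" using assms[of "- S"] by auto
 also have "space M - f -` (- S) \<inter> space M = f -` S \<inter> space M" by auto
 finally show "f -` S \<inter> space M \<in> sets M" .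
qed

text \<open>Countably many data \<open>D k\<close> and unknowns \<open>Y k\<close> are coded by
  their entries in product spaces, where the bound \<open>c\<close> describes a compact box.
  \<open>mk_fmat\<close> cuts an arbitrary code down to size \<open>n\<close>, so that
  \<open>R\<close> becomes a closed relation between unrestricted codes.\<close>

lemma fmat_selection:
 fixes R :: "(nat => fmat) => (nat => fmat) => bool"
 assumes D: "\<And>k. mfm M n (D k)" and c: "0 \<le> c"
  and R: "closed {z. R (%k. mk_fmat n n (fst z k)) (%k. mk_fmat n n (snd z k))}"
 defines "E \<equiv> {l \<in> space M. \<exists>Y. (\<forall>k. rect n n (Y k) \<and> mbd c (Y k)) \<and> R (%k. D k l) Y}"
 shows "E \<in> sets M"
  "\<exists>S. (\<forall>k. mfm M n (S k)) \<and> (\<forall>k l. mbd c (S k l)) \<and> (\<forall>l\<in>E. R (%k. D k l) (%k. S k l))"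
proof -
 define d where "d l = (%k i j. ent (D k l) i j)" for l
 have dm: "d \<in> borel_measurable M" unfolding d_def
  by (intro measurable_coordinatewise_then_product mfmD(2)[OF D])
 have mk: "mk_fmat n n (ent X) = X" if "rect n n X" for X
  by (rule fmat_eqI) (use rectD[OF that] in \<open>auto simp: not_less\<close>)
 have dD: "(%k. mk_fmat n n (d l k)) = (%k. D k l)" for l
  unfolding d_def using mk[OF mfmD(1)[OF D]] by simp
 let ?K = "{y :: nat => nat => nat => complex. \<forall>k i j. cmod (y k i j) \<le> c}"
 let ?R = "{z. R (%k. mk_fmat n n (fst z k)) (%k. mk_fmat n n (snd z k))}"
 note cs = closed_selection[OF compact_box[of c] R dm]
 have E_eq: "E = {l \<in> space M. \<exists>y\<in>?K. (d l, y) \<in> ?R}"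
 proof (intro equalityI subsetI)
  fix l assume "l \<in> E"
  then obtain Y where Y: "l \<in> space M" "\<And>k. rect n n (Y k)" "\<And>k. mbd c (Y k)" "R (%k. D k l) Y" unfolding E_def by blast
  have "(%k. ent (Y k)) \<in> ?K" "(d l, %k. ent (Y k)) \<in> ?R" using Y mk[OF Y(2)] dD[of l] by (simp_all add: mbd_def)
  then show "l \<in> {l \<in> space M. \<exists>y\<in>?K. (d l, y) \<in> ?R}" using Y(1) by blast
 next
  fix l assume "l \<in> {l \<in> space M. \<exists>y\<in>?K. (d l, y) \<in> ?R}"
  then obtain y where y: "l \<in> space M" "y \<in> ?K" "(d l, y) \<in> ?R" by blast
  then show "l \<in> E" unfolding E_def using dD[of l] c
   by (intro CollectI conjI exI[of _ "%k. mk_fmat n n (y k)"]) (auto simp: mbd_def)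
 qed
 show Em: "E \<in> sets M" unfolding E_eq by (rule cs(1))
 obtain s where "(\<forall>l\<in>E. s l \<in> ?K \<and> (d l, s l) \<in> ?R) \<and> (\<forall>C. closed C --> {l \<in> E. s l \<in> C} \<in> sets M)"
  using cs(2)[folded E_eq] by (rule exE)
 then have s: "\<forall>l\<in>E. s l \<in> ?K \<and> (d l, s l) \<in> ?R" "\<forall>C. closed C --> {l \<in> E. s l \<in> C} \<in> sets M"
  by (rule conjunct1, rule conjunct2)
 \<comment> \<open>The value 0 off \<open>E\<close> keeps the selected fields measurable and bounded
   everywhere.\<close>
 define S where "S k l = (if l \<in> E then mk_fmat n n (s l k) else 0)" for k l
 have sm: "(%l. if l \<in> E then s l k i j else 0) \<in> borel_measurable M" for k i j
 proof (rule borel_measurableI_closed)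
  fix V :: "complex set" assume "closed V"
  have "closed ((%y :: nat => nat => nat => complex. y k i j) -` V)"
   by (intro closed_vimage \<open>closed V\<close> continuous_on_eval3 continuous_intros)
  then have *: "{l \<in> E. s l \<in> (%y. y k i j) -` V} \<in> sets M" using s(2) by blast
  have eq: "(%l. if l \<in> E then s l k i j else 0) -` V \<inter> space M =
   {l \<in> E. s l \<in> (%y. y k i j) -` V} \<union> {l \<in> space M - E. 0 \<in> V}"
  proof (rule Set.set_eqI)
   fix l
   have "l \<in> E ==> l \<in> space M" by (rule subsetD[OF sets.sets_into_space[OF Em]])
   then show "l \<in> (%l. if l \<in> E then s l k i j else 0) -` V \<inter> space M \<longleftrightarrow>
    l \<in> {l \<in> E. s l \<in> (%y. y k i j) -` V} \<union> {l \<in> space M - E. 0 \<in> V}"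
    by (cases "l \<in> E") auto
  qed
  have m0: "{l \<in> space M - E. 0 \<in> V} \<in> sets M" using Em by (cases "0 \<in> V") simp_all
  show "(%l. if l \<in> E then s l k i j else 0) -` V \<inter> space M \<in> sets M"
   unfolding eq by (rule sets.Un[OF * m0])
 qed
 have "mfm M n (S k)" for k unfolding mfm_def
 proof (intro conjI allI)
  show "rect n n (S k l)" for l unfolding S_def by simp
  fix i j
  have "(%l. ent (S k l) i j) = (%l. if i < n \<and> j < n then if l \<in> E then s l k i j else 0 else 0)"
   unfolding S_def by auto
  then show "(%l. ent (S k l) i j) \<in> borel_measurable M" using sm by simp
 qed
 moreover have "mbd c (S k l)" for k l unfolding S_def mbd_def using s(1) c by auto
 moreover have "R (%k. D k l) (%k. S k l)" if "l \<in> E" for l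
  using s(1) that dD[of l] unfolding S_def by auto
 ultimately show "\<exists>S. (\<forall>k. mfm M n (S k)) \<and> (\<forall>k l. mbd c (S k l)) \<and> (\<forall>l\<in>E. R (%k. D k l) (%k. S k l))" by blast
qed

section \<open>Essentially bounded fields and idempotents of the commutant\<close>

definition bfm :: "'a measure => nat => ('a => fmat) => bool" where
 "bfm M n f \<longleftrightarrow> mfm M n f \<and> (\<exists>C. AE l in M. mbd C (f l))"

lemma bfmD: "bfm M n f ==> mfm M n f" "bfm M n f ==> rect n n (f l)"
 by (auto simp: bfm_def mfm_def)

lemma rect_mbd: assumes "rect n n X" shows "\<exists>C. mbd C X"
proof -
 have "cmod (ent X i j) \<le> (\<Sum>i<n. \<Sum>j<n. cmod (ent X i j))" for i j
 proof (cases "i < n \<and> j < n")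
  case True
  have "cmod (ent X i j) \<le> (\<Sum>j<n. cmod (ent X i j))" by (rule member_le_sum) (use True in auto)
  also have "\<dots> \<le> (\<Sum>i<n. \<Sum>j<n. cmod (ent X i j))"
   by (rule member_le_sum[of i "{..<n}" "%i. \<Sum>j<n. cmod (ent X i j)"]) (use True in \<open>auto intro: sum_nonneg\<close>)
  finally show ?thesis .
 next
  case False
  then have "ent X i j = 0" using rectD[OF assms] by (meson not_le)
  then show ?thesis by (simp add: sum_nonneg)
 qed
 then show ?thesis unfolding mbd_def by blast
qed

lemma bfm_fm:
 assumes "B \<in> Mn_Linf M n" shows "bfm M n (%l. fm n (B l))"
proof -
 have m: "(%l. B l $$ (i, j)) \<in> borel_measurable M" "\<exists>c. AE l in M. cmod (B l $$ (i, j)) \<le> c"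
  if "i < n" "j < n" for i j using assms that unfolding Mn_Linf_def by auto
 obtain c where c: "AE l in M. cmod (B l $$ (i, j)) \<le> c i j" if "i < n" "j < n" for i j
  using m(2) by metis
 have "AE l in M. \<forall>i\<in>{..<n}. \<forall>j\<in>{..<n}. cmod (B l $$ (i, j)) \<le> c i j"
  by (intro AE_finite_allI) (auto intro: c)
 then have "AE l in M. mbd (\<Sum>i<n. \<Sum>j<n. \<bar>c i j\<bar>) (fm n (B l))"
 proof (rule AE_mp, intro AE_I2 impI)
  fix l assume l: "\<forall>i\<in>{..<n}. \<forall>j\<in>{..<n}. cmod (B l $$ (i, j)) \<le> c i j"
  show "mbd (\<Sum>i<n. \<Sum>j<n. \<bar>c i j\<bar>) (fm n (B l))" unfolding mbd_def
  proof (intro allI)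
   fix i j
   show "cmod (ent (fm n (B l)) i j) \<le> (\<Sum>i<n. \<Sum>j<n. \<bar>c i j\<bar>)"
   proof (cases "i < n \<and> j < n")
    case True
    then have "cmod (ent (fm n (B l)) i j) \<le> \<bar>c i j\<bar>" using l by force
    also have "\<dots> \<le> (\<Sum>j<n. \<bar>c i j\<bar>)"
     by (rule member_le_sum[of j "{..<n}" "%j. \<bar>c i j\<bar>"]) (use True in auto)
    also have "\<dots> \<le> (\<Sum>i<n. \<Sum>j<n. \<bar>c i j\<bar>)"
     by (rule member_le_sum[of i "{..<n}" "%i. \<Sum>j<n. \<bar>c i j\<bar>"]) (use True in \<open>auto intro: sum_nonneg\<close>)
    finally show ?thesis .
   next
    case False
    then show ?thesis by (auto intro: sum_nonneg)
   qed
  qed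
 qed
 moreover have "mfm M n (%l. fm n (B l))" unfolding mfm_def
 proof (intro conjI allI rect_fm)
  fix i j
  show "(%l. ent (fm n (B l)) i j) \<in> borel_measurable M"
   using m(1)[of i j] by (cases "i < n \<and> j < n") auto
 qed
 ultimately show ?thesis unfolding bfm_def by blast
qed

lemma bfm_tm:
 assumes "bfm M n f" shows "(%l. tm n (f l)) \<in> Mn_Linf M n"
proof -
 obtain C where C: "AE l in M. mbd C (f l)" using assms unfolding bfm_def by blast
 have "AE l in M. cmod (ent (f l) i j) \<le> C" for i j using C by (auto simp: mbd_def)
 then show ?thesis using mfmD(2)[OF bfmD(1)[OF assms]] unfolding Mn_Linf_def by auto
qed

lemma fm_tm_bfm: "bfm M n f ==> fm n (tm n (f l)) = f l"
 by (simp add: bfmD)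

lemma Mn_carrier: "B \<in> Mn_Linf M n ==> l \<in> space M ==> B l \<in> carrier_mat n n"
 unfolding Mn_Linf_def by blast

lemma bfm_mult: "bfm M n f ==> bfm M n g ==> bfm M n (%l. f l * g l)"
 unfolding bfm_def
proof (elim conjE exE, intro conjI)
 fix C D assume f: "mfm M n f" "mfm M n g" and ae: "AE l in M. mbd C (f l)" "AE l in M. mbd D (g l)"
 from ae have "AE l in M. mbd (n * C * D) (f l * g l)"
  by eventually_elim (rule mbd_mult[OF mfmD(1)[OF f(1)] order_refl])
 then show "\<exists>C. AE l in M. mbd C (f l * g l)" by blast
qed (rule mfm_mult)

lemma bfm_diff: "bfm M n f ==> bfm M n g ==> bfm M n (%l. f l - g l)"
 unfolding bfm_def
proof (elim conjE exE, intro conjI)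
 fix C D assume f: "mfm M n f" "mfm M n g" and ae: "AE l in M. mbd C (f l)" "AE l in M. mbd D (g l)"
 from ae have "AE l in M. mbd (C + D) (f l - g l)" by eventually_elim (rule mbd_diff)
 then show "\<exists>C. AE l in M. mbd C (f l - g l)" by blast
qed (rule mfm_diff)

lemma bfm_const: "rect n n X ==> bfm M n (%l. X)"
 unfolding bfm_def using rect_mbd[of n X] by (auto intro: mfm_const)

lemma bfm_if: "E \<in> sets M ==> bfm M n f ==> bfm M n g ==> bfm M n (%l. if l \<in> E then f l else g l)"
 unfolding bfm_def
proof (elim conjE exE, intro conjI)
 fix C D assume f: "mfm M n f" "mfm M n g" and ae: "AE l in M. mbd C (f l)" "AE l in M. mbd D (g l)"
 from ae have "AE l in M. mbd (max C D) (if l \<in> E then f l else g l)"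
  by eventually_elim (auto intro: mbd_mono)
 then show "\<exists>C. AE l in M. mbd C (if l \<in> E then f l else g l)" by blast
qed (rule mfm_if)

lemma mfm_restrict: "mfm M n f ==> mfm (restrict_space M E) n f"
 unfolding mfm_def by (auto intro: measurable_restrict_space1)

lemma AE_restrictI: "E \<inter> space M \<in> sets M ==> (AE l in M. P l) ==> AE l in restrict_space M E. P l"
 by (simp add: AE_restrict_space_iff) (erule AE_mp, simp)

lemma bfm_restrict: "E \<inter> space M \<in> sets M ==> bfm M n f ==> bfm (restrict_space M E) n f"
 unfolding bfm_def using mfm_restrict[of M n f E] AE_restrictI[of E M] by blast

lemma Mn_Linf_restrict:
 assumes "E \<inter> space M \<in> sets M" "B \<in> Mn_Linf M n" shows "B \<in> Mn_Linf (restrict_space M E) n"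
proof -
 have "\<exists>c. AE l in restrict_space M E. cmod (B l $$ (i, j)) \<le> c" if "i < n" "j < n" for i j
  using assms(2) that AE_restrictI[OF assms(1)] unfolding Mn_Linf_def by blast
 then show ?thesis using assms(2) unfolding Mn_Linf_def
  by (auto intro: measurable_restrict_space1 simp: space_restrict_space)
qed

definition CI :: "'a measure => nat => ('a => fmat) => ('a => fmat) => bool" where
 "CI M n a p \<longleftrightarrow> bfm M n p \<and> (AE l in M. a l * p l = p l * a l \<and> p l * p l = p l)"

lemma CI_fm:
 assumes A: "A \<in> Mn_Linf M n" and P: "P \<in> commutant_idempotents M n A"
 shows "CI M n (%l. fm n (A l)) (%l. fm n (P l))"
proof -
 have P': "P \<in> Mn_Linf M n" "AE l in M. A l * P l = P l * A l" "AE l in M. P l * P l = P l"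
  using P unfolding commutant_idempotents_def rel_commutant_def by auto
 from AE_space P'(2,3) have "AE l in M. fm n (A l) * fm n (P l) = fm n (P l) * fm n (A l) \<and> fm n (P l) * fm n (P l) = fm n (P l)"
  by eventually_elim (metis fm_mult Mn_carrier A P'(1))
 then show ?thesis unfolding CI_def using bfm_fm[OF P'(1)] by blast
qed

lemma CI_tm:
 assumes A: "A \<in> Mn_Linf M n" and p: "CI M n (%l. fm n (A l)) p"
 shows "(%l. tm n (p l)) \<in> commutant_idempotents M n A"
proof -
 have b: "bfm M n p" and "AE l in M. fm n (A l) * p l = p l * fm n (A l) \<and> p l * p l = p l" using p unfolding CI_def by auto
 from AE_space this(2) have "AE l in M. A l * tm n (p l) = tm n (p l) * A l \<and> tm n (p l) * tm n (p l) = tm n (p l)"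
 proof eventually_elim
  case (elim l)
  have c: "A l \<in> carrier_mat n n" using Mn_carrier[OF A elim(1)] .
  have r: "rect n n (p l)" by (rule bfmD(2)[OF b])
  have "fm n (A l * tm n (p l)) = fm n (tm n (p l) * A l)" using elim(2) c r by (simp add: fm_mult)
  then have "A l * tm n (p l) = tm n (p l) * A l" using c by (metis fm_inj mult_carrier_mat tm_carrier)
  moreover have "tm n (p l) * tm n (p l) = tm n (p l)" using elim(2) tm_mult[OF r r] by simp
  ultimately show ?case by blast
 qed
 then show ?thesis unfolding commutant_idempotents_def rel_commutant_def using bfm_tm[OF b] by auto
qed

text \<open>Where minimality fails there is a smaller idempotent \<open>Q\<close> with entries at
  most \<open>J\<close> such that both \<open>Q\<close> and \<open>Q - p l\<close> have an entry of
  modulus at least \<open>1 / J\<close>. For fixed \<open>J\<close> this is a closed relation, so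
  the witnesses can be chosen as a bounded measurable field, and \<open>hyp\<close> makes their
  domain a null set. Countably many \<open>J\<close> cover all failures.\<close>

lemma pmin_AE:
 assumes a: "mfm M n a" and p: "mfm M n p" and ip: "AE l in M. a l * p l = p l * a l \<and> p l * p l = p l"
  and hyp: "\<And>E q. E \<in> sets M ==> bfm M n q ==>
   \<forall>l\<in>E. q l * q l = q l \<and> a l * q l = q l * a l \<and> p l * q l = q l \<and> q l * p l = q l \<and> q l \<noteq> 0 \<and> q l \<noteq> p l ==>
   AE l in M. l \<notin> E"
 shows "AE l in M. pmin (a l) (p l)"
proof -
 define D where "D k = (if k = 0 then a else p)" for k :: nat
 define R where "R J x y \<longleftrightarrow> y 0 * y 0 = y 0 \<and> x 0 * y 0 = y 0 * x 0 \<and> x 1 * y 0 = y 0 \<and> y 0 * x 1 = y 0 \<and>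
   (\<exists>i<n. \<exists>j<n. 1 / J \<le> cmod (ent (y 0) i j)) \<and> (\<exists>i<n. \<exists>j<n. 1 / J \<le> cmod (ent (y 0 - x 1) i j))"
  for J :: real and x y :: "nat => fmat"
 define E where "E J = {l \<in> space M. \<exists>Y. (\<forall>k. rect n n (Y k) \<and> mbd J (Y k)) \<and> R J (%k. D k l) Y}" for J
 have D: "mfm M n (D k)" for k unfolding D_def using a p by simp
 have cl: "closed {z. R J (%k. mk_fmat n n (fst z k)) (%k. mk_fmat n n (snd z k))}" for J
 proof -
  let ?x = "%(z :: (nat => nat => nat => complex) \<times> (nat => nat => nat => complex)) k. mk_fmat n n (fst z k)"
  let ?y = "%(z :: (nat => nat => nat => complex) \<times> (nat => nat => nat => complex)) k. mk_fmat n n (snd z k)"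
  have "{z. R J (?x z) (?y z)} = {z. ?y z 0 * ?y z 0 = ?y z 0} \<inter> {z. ?x z 0 * ?y z 0 = ?y z 0 * ?x z 0} \<inter>
   {z. ?x z 1 * ?y z 0 = ?y z 0} \<inter> {z. ?y z 0 * ?x z 1 = ?y z 0} \<inter>
   (\<Union>i<n. \<Union>j<n. {z. 1 / J \<le> cmod (ent (?y z 0) i j)}) \<inter>
   (\<Union>i<n. \<Union>j<n. {z. 1 / J \<le> cmod (ent (?y z 0 - ?x z 1) i j)})"
   unfolding R_def by auto
  also have "closed \<dots>"
   by (intro closed_Int closed_fm_eq[where n = n] closed_UN finite_lessThan ballI closed_fm_ge[where n = n] cfm_mult cfm_diff cfm_fst cfm_snd)
  finally show ?thesis .
 qed
 have notE: "AE l in M. l \<notin> E J" if "0 < J" for J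
 proof -
  have J0: "0 \<le> J" using that by simp
  have fs1: "E J \<in> sets M" unfolding E_def
   by (rule fmat_selection(1)[where R = "R J" and D = D, OF D J0 cl])
  have "\<exists>S. (\<forall>k. mfm M n (S k)) \<and> (\<forall>k l. mbd J (S k l)) \<and> (\<forall>l\<in>E J. R J (%k. D k l) (%k. S k l))"
   unfolding E_def by (rule fmat_selection(2)[where R = "R J" and D = D, OF D J0 cl])
  then obtain S where S: "(\<forall>k. mfm M n (S k)) \<and> (\<forall>k l. mbd J (S k l)) \<and> (\<forall>l\<in>E J. R J (%k. D k l) (%k. S k l))"
   by (rule exE)
  show ?thesis
  proof (rule hyp)
   show "E J \<in> sets M" by (rule fs1)
   show "bfm M n (S 0)" unfolding bfm_def using S by blast
   show "\<forall>l\<in>E J. S 0 l * S 0 l = S 0 l \<and> a l * S 0 l = S 0 l * a l \<and> p l * S 0 l = S 0 l \<and> S 0 l * p l = S 0 l \<and> S 0 l \<noteq> 0 \<and> S 0 l \<noteq> p l"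
   proof
    fix l assume "l \<in> E J"
    then have "R J (%k. D k l) (%k. S k l)" using S by blast
    moreover have "0 < 1 / J" using that by simp
    ultimately show "S 0 l * S 0 l = S 0 l \<and> a l * S 0 l = S 0 l * a l \<and> p l * S 0 l = S 0 l \<and> S 0 l * p l = S 0 l \<and> S 0 l \<noteq> 0 \<and> S 0 l \<noteq> p l"
     unfolding R_def D_def by auto
   qed
  qed
 qed
 have "AE l in M. \<forall>J::nat. l \<notin> E (real (Suc J))" unfolding AE_all_countable using notE by simp
 from AE_space ip this show ?thesis
 proof eventually_elim
  case (elim l)
  show ?case unfolding pmin_def
  proof (intro conjI allI impI, use elim(2) in blast, use elim(2) in blast, elim conjE)
   fix Q assume Q: "Q * Q = Q" "a l * Q = Q * a l" "p l * Q = Q" "Q * p l = Q"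
   have rp: "rect n n (p l)" by (rule mfmD(1)[OF p])
   have rQ: "rect n n Q" unfolding rect_iff using Q(3,4) e_mult[OF rp] mult_e[OF rp] by (metis mult.assoc)
   show "Q = 0 \<or> Q = p l"
   proof (rule ccontr)
    assume neg: "\<not> (Q = 0 \<or> Q = p l)"
    then obtain i j where ij: "ent Q i j \<noteq> 0" by (metis fmat_eqI ent_zero)
    have "Q - p l \<noteq> 0" using neg by simp
    then obtain i' j' where ij': "ent (Q - p l) i' j' \<noteq> 0" by (metis fmat_eqI ent_zero)
    have lt: "i < n" "j < n" "i' < n" "j' < n"
     using ij ij' rQ rect_diff[OF rQ rp] unfolding rect_def by blast+
    obtain C where C: "mbd C Q" using rect_mbd[OF rQ] by blast
    obtain J :: nat where J: "C + 1 / cmod (ent Q i j) + 1 / cmod (ent (Q - p l) i' j') \<le> real J" using real_arch_simple by blast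
    have p0: "0 < 1 / cmod (ent Q i j)" "0 < 1 / cmod (ent (Q - p l) i' j')" "0 \<le> C"
     using ij ij' mbd_nonneg[OF C] by auto
    have J': "C \<le> real (Suc J)" "1 / cmod (ent Q i j) \<le> real (Suc J)" "1 / cmod (ent (Q - p l) i' j') \<le> real (Suc J)"
     using J p0 unfolding of_nat_Suc by linarith+
    have inv: "1 / y \<le> x" if "0 < x" "1 / x \<le> y" "0 < y" for x y :: real
     using that by (simp add: field_simps)
    have "1 / real (Suc J) \<le> cmod (ent Q i j)" "1 / real (Suc J) \<le> cmod (ent (Q - p l) i' j')"
     using inv[OF _ J'(2)] inv[OF _ J'(3)] ij ij' by simp_all
    then have "R (real (Suc J)) (%k. D k l) (%k. Q)" unfolding R_def D_def using Q lt by auto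
    then have "l \<in> E (real (Suc J))" unfolding E_def using elim(1) rQ mbd_mono[OF C J'(1)]
     by (intro CollectI conjI exI[of _ "%k. Q"]) auto
    then show False using elim(3) by blast
   qed
  qed
 qed
qed

section \<open>Pointwise frames and finite frames\<close>

text \<open>The condition to which the others are reduced. Individual members may vanish on sets of
  positive measure.\<close>

definition pframe :: "'a measure => nat => ('a => fmat) => nat => (nat => 'a => fmat) => bool" where
 "pframe M n a m p \<longleftrightarrow> (\<forall>k<m. bfm M n (p k)) \<and>
  (AE l in M. (\<forall>k<m. pmin (a l) (p k l)) \<and> ortho {..<m} (%k. p k l) \<and> (\<Sum>k<m. p k l) = e n)"

lemma tm_zero [simp]: "tm n 0 = 0\<^sub>m n n"
 by (intro eq_matI) (auto simp: tm_def)

lemma pframeD: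
 assumes "pframe M n a m p"
 shows "k < m ==> bfm M n (p k)" "AE l in M. (\<forall>k<m. pmin (a l) (p k l)) \<and> ortho {..<m} (%k. p k l) \<and> (\<Sum>k<m. p k l) = e n"
 using assms unfolding pframe_def by blast+

lemma pframe_restrict:
 assumes "E \<inter> space M \<in> sets M" "pframe M n a m p" shows "pframe (restrict_space M E) n a m p"
 using assms(2) bfm_restrict[OF assms(1)] AE_restrictI[OF assms(1)] unfolding pframe_def by blast

lemma mat_sum_fm: "fm n (mat n n (%ij. \<Sum>k<m. B k $$ ij)) = (\<Sum>k<m. fm n (B k))"
 by (rule fmat_eqI) auto

text \<open>Pointwise minimality leaves a competitor below \<open>p k\<close> only the values 0 and
  \<open>p k l\<close>, and a competitor is not 0 where \<open>p k l\<close> is nonzero.\<close>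

lemma frame_conditions_pframe:
 assumes A: "A \<in> Mn_Linf M n" and p: "pframe M n (%l. fm n (A l)) m p"
 shows "frame_conditions M n A m (%k l. tm n (p k l))"
proof -
 note b = pframeD(1)[OF p] and ae = pframeD(2)[OF p]
 have CIp: "CI M n (%l. fm n (A l)) (p k)" if "k < m" for k
  unfolding CI_def using b[OF that] ae that by (auto simp: pmin_def)
 have ci: "(%l. tm n (p k l)) \<in> commutant_idempotents M n A" if "k < m" for k
  by (rule CI_tm[OF A CIp[OF that]])
 have orth: "AE l in M. tm n (p i l) * tm n (p j l) = 0\<^sub>m n n \<and> tm n (p j l) * tm n (p i l) = 0\<^sub>m n n"
  if "i < m" "j < m" "i \<noteq> j" for i j
 proof (rule AE_mp[OF ae], intro AE_I2 impI, elim conjE)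
  fix l assume "ortho {..<m} (%k. p k l)"
  then have "p i l * p j l = 0" "p j l * p i l = 0" using that unfolding ortho_def by auto
  then show "tm n (p i l) * tm n (p j l) = 0\<^sub>m n n \<and> tm n (p j l) * tm n (p i l) = 0\<^sub>m n n"
   using tm_mult[OF bfmD(2)[OF b[OF that(1)]] bfmD(2)[OF b[OF that(2)]], of l l]
    tm_mult[OF bfmD(2)[OF b[OF that(2)]] bfmD(2)[OF b[OF that(1)]], of l l]
   by simp
 qed
 have sum1: "AE l in M. mat n n (%ij. \<Sum>k<m. tm n (p k l) $$ ij) = 1\<^sub>m n"
 proof (rule AE_mp[OF ae], intro AE_I2 impI, elim conjE)
  fix l assume "(\<Sum>k<m. p k l) = e n"
  moreover have "(\<Sum>k<m. fm n (tm n (p k l))) = (\<Sum>k<m. p k l)"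
   by (rule sum.cong) (use bfmD(2)[OF b] in simp_all)
  ultimately have "fm n (mat n n (%ij. \<Sum>k<m. tm n (p k l) $$ ij)) = fm n (1\<^sub>m n)" unfolding mat_sum_fm by simp
  then show "mat n n (%ij. \<Sum>k<m. tm n (p k l) $$ ij) = 1\<^sub>m n" by (subst (asm) fm_inj) auto
 qed
 have comp: "(%l. tm n (p k l)) \<in> frame_competitors M n A (%l. tm n (p k l))" if "k < m" for k
  unfolding frame_competitors_def using ci[OF that] by simp
 have min: "AE l in M. Q l = tm n (p k l)"
  if k: "k < m" and Q: "Q \<in> frame_competitors M n A (%l. tm n (p k l))" and le: "idem_le M Q (%l. tm n (p k l))" for k Q
 proof -
  have Qc: "Q \<in> commutant_idempotents M n A" and nz: "AE l in M. tm n (p k l) \<noteq> 0\<^sub>m n n --> Q l \<noteq> 0\<^sub>m n n"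
   using Q unfolding frame_competitors_def by auto
  have QM: "Q \<in> Mn_Linf M n" using Qc unfolding commutant_idempotents_def rel_commutant_def by blast
  have "AE l in M. fm n (A l) * fm n (Q l) = fm n (Q l) * fm n (A l) \<and> fm n (Q l) * fm n (Q l) = fm n (Q l)"
   using CI_fm[OF A Qc] unfolding CI_def by blast
  from this le[unfolded idem_le_def] AE_space nz ae show ?thesis
  proof eventually_elim
   case (elim l)
   have c: "Q l \<in> carrier_mat n n" by (rule Mn_carrier[OF QM elim(3)])
   have r: "rect n n (p k l)" by (rule bfmD(2)[OF b[OF k]])
   have "fm n (Q l * tm n (p k l)) = fm n (Q l) * p k l" "fm n (tm n (p k l) * Q l) = p k l * fm n (Q l)"
    using c r by (simp_all add: fm_mult)
   then have 1: "fm n (Q l) * p k l = fm n (Q l)" "p k l * fm n (Q l) = fm n (Q l)" using elim(2) by simp_all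
   have "pmin (fm n (A l)) (p k l)" using elim(5) k by blast
   from pminD(3)[OF this, of "fm n (Q l)"] have "fm n (Q l) = 0 \<or> fm n (Q l) = p k l" using elim(1) 1 by blast
   then show ?case
   proof
    assume "fm n (Q l) = 0"
    then have "Q l = 0\<^sub>m n n" using fm_inj[OF c zero_carrier_mat] by simp
    then have "tm n (p k l) = 0\<^sub>m n n" using elim(4) by blast
    then show ?thesis using \<open>Q l = 0\<^sub>m n n\<close> by simp
   next
    assume "fm n (Q l) = p k l"
    then show ?thesis using tm_fm[OF c] by simp
   qed
  qed
 qed
 show ?thesis unfolding frame_conditions_def using ci orth sum1 comp min by blast
qed

locale comp_meas =
 fixes M :: "'a::topological_space measure" and M0 K
 assumes M0: "sets M0 = sets borel" and fin: "finite_measure M0" and K: "K \<in> sets borel" "emeasure M0 (- K) = 0"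
  and M: "M = completion M0"
begin

lemma borel_sub: "E \<in> sets borel ==> E \<in> sets M"
 unfolding M using M0 by (simp add: sets_completionI_sets)

lemma space_M [simp]: "space M = UNIV"
 unfolding M space_completion using sets_eq_imp_space_eq[OF M0] by simp

lemma AE_K: "AE l in M. l \<in> K"
proof -
 have "- K \<in> null_sets M0" using K M0 by (auto simp: null_sets_def)
 then have "AE l in M0. l \<notin> - K" by (rule AE_not_in)
 then show ?thesis unfolding M by (auto intro: AE_completion)
qed

text \<open>Selection produces sets of the completed sigma-algebra, whereas central projections and
  partitions are Borel subsets of \<open>K\<close>. Passing to the main part inside \<open>K\<close>
  costs a null set.\<close>

lemma borel_part:
 assumes "E \<in> sets M"
 shows "\<exists>E'\<in>sets borel. E' \<subseteq> E \<and> E' \<subseteq> K \<and> (AE l in M. l \<in> E --> l \<in> E')"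
proof (intro bexI conjI)
 have E: "E \<in> sets (completion M0)" using assms M by simp
 show "main_part M0 E \<inter> K \<in> sets borel" using main_part_sets[OF E] K M0 by auto
 show "main_part M0 E \<inter> K \<subseteq> E" using main_part_null_part_Un[OF E] by blast
 have "AE l in M. l \<notin> null_part M0 E" unfolding M by (rule AE_completion[OF AE_notin_null_part[OF E]])
 then show "AE l in M. l \<in> E --> l \<in> main_part M0 E \<inter> K"
  using AE_K by eventually_elim (use main_part_null_part_Un[OF E] in blast)
qed auto

lemma fin_M: "finite_measure M"
 using fin unfolding M by (auto intro!: finite_measureI simp: finite_measure.emeasure_finite)

lemma pframe_finite_frame:
 assumes A: "A \<in> Mn_Linf M n" and p: "pframe M n (%l. fm n (A l)) m p"
 shows "finite_frame K M n A m (%k l. tm n (p k l))"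
 unfolding finite_frame_def
proof (intro conjI ballI impI)
 show "frame_conditions M n A m (%k l. tm n (p k l))" by (rule frame_conditions_pframe[OF A p])
 fix E assume "E \<in> sets borel" "E \<subseteq> K"
 then have E: "E \<inter> space M \<in> sets M" using borel_sub by simp
 show "frame_conditions (restrict_space M E) n A m (%k l. tm n (p k l))"
  by (rule frame_conditions_pframe[OF Mn_Linf_restrict[OF E A] pframe_restrict[OF E p]])
qed

text \<open>A measurable field of smaller, nonzero idempotents over \<open>E\<close> would be a
  proper competitor over a Borel part \<open>E'\<close> of \<open>E\<close>. The frame conditions
  over \<open>E'\<close> exclude it unless \<open>E'\<close> is null, so \<open>pmin_AE\<close>
  applies.\<close>

lemma finite_frame_pframe:
 assumes A: "A \<in> Mn_Linf M n" and F: "finite_frame K M n A m P"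
 shows "pframe M n (%l. fm n (A l)) m (%k l. fm n (P k l))"
proof -
 have fc: "frame_conditions M n A m P" using F unfolding finite_frame_def by blast
 have Pc: "P k \<in> commutant_idempotents M n A" if "k < m" for k using fc that unfolding frame_conditions_def by blast
 have PM: "P k \<in> Mn_Linf M n" if "k < m" for k
  using Pc[OF that] unfolding commutant_idempotents_def rel_commutant_def by blast
 have CIp: "CI M n (%l. fm n (A l)) (%l. fm n (P k l))" if "k < m" for k by (rule CI_fm[OF A Pc[OF that]])
 have bp: "bfm M n (%l. fm n (P k l))" if "k < m" for k using CIp[OF that] unfolding CI_def by blast
 have ba: "bfm M n (%l. fm n (A l))" by (rule bfm_fm[OF A])
 have min: "AE l in M. pmin (fm n (A l)) (fm n (P k l))" if k: "k < m" for k
 proof (rule pmin_AE[OF bfmD(1)[OF ba] bfmD(1)[OF bp[OF k]]])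
  show "AE l in M. fm n (A l) * fm n (P k l) = fm n (P k l) * fm n (A l) \<and> fm n (P k l) * fm n (P k l) = fm n (P k l)"
   using CIp[OF k] unfolding CI_def by blast
  fix E q
  assume E: "E \<in> sets M" and q: "bfm M n q" and qE: "\<forall>l\<in>E. q l * q l = q l \<and> fm n (A l) * q l = q l * fm n (A l) \<and>
   fm n (P k l) * q l = q l \<and> q l * fm n (P k l) = q l \<and> q l \<noteq> 0 \<and> q l \<noteq> fm n (P k l)"
  obtain E' where E': "E' \<in> sets borel" "E' \<subseteq> E" "E' \<subseteq> K" "AE l in M. l \<in> E --> l \<in> E'" using borel_part[OF E] by blast
  let ?M = "restrict_space M E'"
  have Es: "E' \<inter> space M \<in> sets M" using borel_sub[OF E'(1)] by simp
  have fcE: "frame_conditions ?M n A m P" using F E' unfolding finite_frame_def by blast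
  define Q where "Q l = tm n (q l)" for l
  have AE': "A \<in> Mn_Linf ?M n" by (rule Mn_Linf_restrict[OF Es A])
  have inE: "AE l in ?M. l \<in> E'" by (simp add: AE_restrict_space_iff[OF Es])
  have bq: "bfm ?M n q" by (rule bfm_restrict[OF Es q])
  have ci: "CI ?M n (%l. fm n (A l)) q" unfolding CI_def
  proof (intro conjI bq)
   show "AE l in ?M. fm n (A l) * q l = q l * fm n (A l) \<and> q l * q l = q l"
    using inE by eventually_elim (use qE E'(2) in blast)
  qed
  have Qc: "Q \<in> commutant_idempotents ?M n A" unfolding Q_def by (rule CI_tm[OF AE' ci])
  have PE: "P k \<in> Mn_Linf ?M n" by (rule Mn_Linf_restrict[OF Es PM[OF k]])
  have le: "AE l in ?M. Q l * P k l = Q l \<and> P k l * Q l = Q l"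
   using inE AE_space
  proof eventually_elim
   case (elim l)
   have c: "P k l \<in> carrier_mat n n" using Mn_carrier[OF PM[OF k]] by simp
   have r: "rect n n (q l)" by (rule bfmD(2)[OF q])
   have "fm n (P k l) * q l = q l" "q l * fm n (P k l) = q l" using qE elim(1) E'(2) by blast+
   then have "tm n (q l) * tm n (fm n (P k l)) = tm n (q l)" "tm n (fm n (P k l)) * tm n (q l) = tm n (q l)"
    using tm_mult[OF r rect_fm, of "P k l"] tm_mult[OF rect_fm r, of "P k l"] by simp_all
   then show ?case unfolding Q_def using tm_fm[OF c] by simp
  qed
  have nzQ: "AE l in ?M. Q l \<noteq> 0\<^sub>m n n \<and> Q l \<noteq> P k l" using inE
  proof eventually_elim
   case (elim l)
   have r: "rect n n (q l)" by (rule bfmD(2)[OF q])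
   have "q l \<noteq> 0" "q l \<noteq> fm n (P k l)" using qE elim E'(2) by blast+
   then have "fm n (Q l) \<noteq> fm n (0\<^sub>m n n)" "fm n (Q l) \<noteq> fm n (P k l)" unfolding Q_def using fm_tm[OF r] by simp_all
   then show ?case by auto
  qed
  have "Q \<in> frame_competitors ?M n A (P k)" unfolding frame_competitors_def
  proof (intro CollectI conjI Qc)
   show "AE l in ?M. Q l * P k l = P k l * Q l" using le by eventually_elim simp
   show "AE l in ?M. P k l \<noteq> 0\<^sub>m n n --> Q l \<noteq> 0\<^sub>m n n" using nzQ by eventually_elim simp
  qed
  moreover have "idem_le ?M Q (P k)" unfolding idem_le_def by (rule le)
  ultimately have "AE l in ?M. Q l = P k l" using fcE k unfolding frame_conditions_def by blast
  then have "AE l in ?M. False" using nzQ by eventually_elim blast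
  then have "AE l in M. l \<notin> E'" unfolding AE_restrict_space_iff[OF Es] by simp
  then show "AE l in M. l \<notin> E" using E'(4) by eventually_elim blast
 qed
 have "AE l in M. \<forall>k\<in>{..<m}. pmin (fm n (A l)) (fm n (P k l))"
  by (rule AE_finite_allI) (use min in auto)
 moreover have "AE l in M. \<forall>i\<in>{..<m}. \<forall>j\<in>{..<m}. i \<noteq> j --> P i l * P j l = 0\<^sub>m n n"
 proof (intro AE_finite_allI finite_lessThan)
  fix i j assume "i \<in> {..<m}" "j \<in> {..<m}"
  then have "i \<noteq> j --> (AE l in M. P i l * P j l = 0\<^sub>m n n \<and> P j l * P i l = 0\<^sub>m n n)"
   using fc unfolding frame_conditions_def by auto
  then show "AE l in M. i \<noteq> j --> P i l * P j l = 0\<^sub>m n n" by (cases "i = j") auto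
 qed
 moreover have "AE l in M. mat n n (%ij. \<Sum>k<m. P k l $$ ij) = 1\<^sub>m n" using fc unfolding frame_conditions_def by blast
 ultimately have "AE l in M. (\<forall>k<m. pmin (fm n (A l)) (fm n (P k l))) \<and> ortho {..<m} (%k. fm n (P k l)) \<and>
  (\<Sum>k<m. fm n (P k l)) = e n"
 proof eventually_elim
  case (elim l)
  have "fm n (P i l) * fm n (P j l) = 0" if "i < m" "j < m" "i \<noteq> j" for i j
  proof -
   have "P i l \<in> carrier_mat n n" "P j l \<in> carrier_mat n n" using Mn_carrier[OF PM] that by simp_all
   then have "fm n (P i l) * fm n (P j l) = fm n (P i l * P j l)" by (simp add: fm_mult)
   also have "P i l * P j l = 0\<^sub>m n n" using elim(2) that by blast
   finally show ?thesis by simp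
  qed
  moreover have "(\<Sum>k<m. fm n (P k l)) = e n" unfolding mat_sum_fm[symmetric] using elim(3) by simp
  ultimately show ?case using elim(1) unfolding ortho_def by auto
 qed
 then show ?thesis unfolding pframe_def using bp by blast
qed

end

section \<open>The maximal abelian set attached to a frame\<close>

lemma maximal_absorb:
 assumes A: "A \<in> Mn_Linf M n" and S: "commuting_idempotents M n A S"
  and max: "\<And>S'. commuting_idempotents M n A S' ==> S \<subseteq> S' ==> S' = S"
  and Z: "Z \<in> commutant_idempotents M n A" and c: "\<And>P. P \<in> S ==> AE l in M. P l * Z l = Z l * P l"
 shows "Z \<in> S"
proof -
 have "commuting_idempotents M n A (insert Z S)" unfolding commuting_idempotents_def
 proof (intro conjI ballI)
  show "insert Z S \<subseteq> commutant_idempotents M n A" using Z S unfolding commuting_idempotents_def by blast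
  fix P Q assume PQ: "P \<in> insert Z S" "Q \<in> insert Z S"
  have c': "AE l in M. Z l * P l = P l * Z l" if "P \<in> S" for P using c[OF that] by eventually_elim simp
  show "AE l in M. P l * Q l = Q l * P l"
   using PQ c c' S unfolding commuting_idempotents_def by (elim insertE) auto
 qed
 from max[OF this] show ?thesis by blast
qed

lemma fm_comm_iff:
 assumes "X \<in> carrier_mat n n" "Y \<in> carrier_mat n n"
 shows "X * Y = Y * X \<longleftrightarrow> fm n X * fm n Y = fm n Y * fm n X"
 using fm_inj[of "X * Y" n "Y * X"] assms by (simp add: fm_mult)

text \<open>On each \<open>p k\<close> both matrices act as 0 or as the identity, so they commute
  there, and the \<open>p k\<close> add up to the identity.\<close>

lemma dichotomy_comm:
 assumes z: "rect n n z" "\<And>k. k < m ==> z * p k = 0 \<or> z * p k = p k"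
  and w: "rect n n w" "\<And>k. k < m ==> w * p k = 0 \<or> w * p k = p k" and s: "(\<Sum>k<m. p k) = e n"
 shows "z * w = w * (z::fmat)"
proof -
 have "z * (w * p k) = w * (z * p k)" if "k < m" for k
  using z(2)[OF that] w(2)[OF that] by auto
 then have "(\<Sum>k<m. z * (w * p k)) = (\<Sum>k<m. w * (z * p k))" by (intro sum.cong) auto
 then have "z * (w * (\<Sum>k<m. p k)) = w * (z * (\<Sum>k<m. p k))" by (simp add: sum_distrib_left)
 then show ?thesis unfolding s mult_e[OF z(1)] mult_e[OF w(1)] .
qed

text \<open>\<open>z * p\<close> is an idempotent of the commutant below \<open>p\<close>.\<close>

lemma pmin_dichotomy:
 assumes "pmin a p" "a * z = z * a" "z * z = z" "z * p = p * z"
 shows "z * p = 0 \<or> z * p = p"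
proof -
 note m = pminD[OF assms(1)]
 have "z * p * (z * p) = z * (p * z) * p" by (simp add: mult.assoc)
 also have "\<dots> = (z * z) * (p * p)" unfolding assms(4)[symmetric] by (simp add: mult.assoc)
 finally have 1: "z * p * (z * p) = z * p" unfolding assms(3) m(1) .
 have 2: "a * (z * p) = z * p * a" by (rule comm_mult[OF assms(2) m(2)])
 have "p * (z * p) = p * (p * z)" unfolding assms(4) ..
 then have 3: "p * (z * p) = z * p" using m(1) assms(4) by (simp add: mult.assoc[symmetric])
 have 4: "z * p * p = z * p" using m(1) by (simp add: mult.assoc)
 show ?thesis by (rule m(3)[OF 1 2 3 4])
qed

text \<open>At almost every point the members are partial sums of the frame, by
  \<open>pmin_dichotomy\<close>. Defining the set by commutation with the frame instead makes its
  maximality immediate.\<close>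

definition frame_set :: "'a measure => nat => ('a => complex mat) => nat => (nat => 'a => fmat) => ('a => complex mat) set" where
 "frame_set M n A m p = {Z \<in> commutant_idempotents M n A. \<forall>k<m. AE l in M. fm n (Z l) * p k l = p k l * fm n (Z l)}"

lemma frame_set_dichotomy:
 assumes A: "A \<in> Mn_Linf M n" and p: "pframe M n (%l. fm n (A l)) m p" and Z: "Z \<in> frame_set M n A m p"
 shows "AE l in M. \<forall>k<m. fm n (Z l) * p k l = 0 \<or> fm n (Z l) * p k l = p k l"
proof -
 have Zc: "CI M n (%l. fm n (A l)) (%l. fm n (Z l))" using CI_fm[OF A] Z unfolding frame_set_def by blast
 have "AE l in M. \<forall>k\<in>{..<m}. fm n (Z l) * p k l = p k l * fm n (Z l)"
  by (rule AE_finite_allI) (use Z in \<open>auto simp: frame_set_def\<close>)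
 moreover have "AE l in M. fm n (A l) * fm n (Z l) = fm n (Z l) * fm n (A l) \<and> fm n (Z l) * fm n (Z l) = fm n (Z l)"
  using Zc unfolding CI_def by blast
 ultimately show ?thesis using pframeD(2)[OF p]
  by eventually_elim (use pmin_dichotomy in blast)
qed

text \<open>A commuting set that contains \<open>frame_set\<close> contains the frame, hence
  commutes with it and adds nothing. The bound comes from writing \<open>B\<close> as the sum of the
  \<open>B * p k\<close>, each of which is 0 or \<open>p k\<close>.\<close>

lemma frame_set_props:
 assumes A: "A \<in> Mn_Linf M n" and p: "pframe M n (%l. fm n (A l)) m p"
 shows "commuting_idempotents M n A (frame_set M n A m p)"
  "k < m ==> (%l. tm n (p k l)) \<in> frame_set M n A m p"
  "\<And>S'. commuting_idempotents M n A S' ==> frame_set M n A m p \<subseteq> S' ==> S' = frame_set M n A m p"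
  "\<exists>C. \<forall>B\<in>frame_set M n A m p. AE l in M. mbd C (fm n (B l))"
proof -
 note b = pframeD(1)[OF p] and ae = pframeD(2)[OF p] and di = frame_set_dichotomy[OF A p]
 have sub: "frame_set M n A m p \<subseteq> Mn_Linf M n"
  unfolding frame_set_def commutant_idempotents_def rel_commutant_def by blast
 show 1: "commuting_idempotents M n A (frame_set M n A m p)" unfolding commuting_idempotents_def
 proof (intro conjI ballI)
  show "frame_set M n A m p \<subseteq> commutant_idempotents M n A" unfolding frame_set_def by blast
  fix P Q assume P: "P \<in> frame_set M n A m p" and Q: "Q \<in> frame_set M n A m p"
  show "AE l in M. P l * Q l = Q l * P l"
   using di[OF P] di[OF Q] ae AE_space
  proof eventually_elim
   case (elim l)
   have "P l \<in> carrier_mat n n" "Q l \<in> carrier_mat n n"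
    by (rule Mn_carrier[OF subsetD[OF sub P] elim(4)], rule Mn_carrier[OF subsetD[OF sub Q] elim(4)])
   moreover have "fm n (P l) * fm n (Q l) = fm n (Q l) * fm n (P l)"
   proof (rule dichotomy_comm[OF rect_fm _ rect_fm])
    show "(\<Sum>k<m. p k l) = e n" using elim(3) by blast
    show "fm n (P l) * p k l = 0 \<or> fm n (P l) * p k l = p k l" if "k < m" for k using elim(1) that by blast
    show "fm n (Q l) * p k l = 0 \<or> fm n (Q l) * p k l = p k l" if "k < m" for k using elim(2) that by blast
   qed
   ultimately show ?case using fm_comm_iff by blast
  qed
 qed
 show 2: "(%l. tm n (p k l)) \<in> frame_set M n A m p" if k: "k < m" for k
 proof -
  have "CI M n (%l. fm n (A l)) (p k)" unfolding CI_def using b[OF k] ae k by (auto simp: pmin_def)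
  then have "(%l. tm n (p k l)) \<in> commutant_idempotents M n A" by (rule CI_tm[OF A])
  moreover have "AE l in M. p k l * p j l = p j l * p k l" if "j < m" for j
   using ae
  proof eventually_elim
   case (elim l)
   then show ?case using that k unfolding ortho_def by (cases "j = k") auto
  qed
  ultimately show ?thesis unfolding frame_set_def using fm_tm_bfm[OF b[OF k]] by simp
 qed
 show "S' = frame_set M n A m p" if S': "commuting_idempotents M n A S'" "frame_set M n A m p \<subseteq> S'" for S'
 proof (rule equalityI[OF _ S'(2)], rule subsetI)
  fix Z assume Z: "Z \<in> S'"
  have Zc: "Z \<in> commutant_idempotents M n A" using S' Z unfolding commuting_idempotents_def by blast
  then have ZM: "Z \<in> Mn_Linf M n" unfolding commutant_idempotents_def rel_commutant_def by blast
  have "AE l in M. fm n (Z l) * p k l = p k l * fm n (Z l)" if k: "k < m" for k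
  proof -
   have "AE l in M. Z l * tm n (p k l) = tm n (p k l) * Z l"
    by (rule S'(1)[unfolded commuting_idempotents_def, THEN conjunct2, rule_format, OF Z subsetD[OF S'(2) 2[OF k]]])
   then show ?thesis using AE_space
   proof eventually_elim
    case (elim l)
    then show ?case using fm_comm_iff[OF Mn_carrier[OF ZM elim(2)] tm_carrier, of "p k l"] fm_tm_bfm[OF b[OF k], of l] by simp
   qed
  qed
  then show "Z \<in> frame_set M n A m p" unfolding frame_set_def using Zc by blast
 qed
 have "\<forall>k\<in>{..<m}. \<exists>C. AE l in M. mbd C (p k l)" using b unfolding bfm_def by blast
 then obtain C where C: "\<And>k. k < m ==> AE l in M. mbd (C k) (p k l)" by (metis lessThan_iff)
 have Cae: "AE l in M. \<forall>k\<in>{..<m}. mbd (C k) (p k l)" by (rule AE_finite_allI) (use C in auto)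
 have "AE l in M. mbd (\<Sum>k<m. C k) (fm n (B l))" if B: "B \<in> frame_set M n A m p" for B
  using di[OF B] Cae ae
 proof eventually_elim
  case (elim l)
  have "fm n (B l) = fm n (B l) * (\<Sum>k<m. p k l)" using elim(3) mult_e[OF rect_fm] by simp
  also have "\<dots> = (\<Sum>k<m. fm n (B l) * p k l)" by (simp add: sum_distrib_left)
  finally have eq: "fm n (B l) = (\<Sum>k<m. fm n (B l) * p k l)" .
  have "mbd (C k) (fm n (B l) * p k l)" if "k < m" for k
  proof -
   have "mbd (C k) (p k l)" using elim(2) that by blast
   then show ?thesis using elim(1) that mbd_nonneg[of "C k" "p k l"] by (auto simp: mbd_def)
  qed
  then have "cmod (\<Sum>k<m. ent (fm n (B l) * p k l) i j) \<le> (\<Sum>k<m. C k)" for i j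
   by (intro order_trans[OF norm_sum] sum_mono) (auto simp: mbd_def)
  then have "mbd (\<Sum>k<m. C k) (\<Sum>k<m. fm n (B l) * p k l)" unfolding mbd_def by simp
  then show ?case using eq by metis
 qed
 then show "\<exists>C. \<forall>B\<in>frame_set M n A m p. AE l in M. mbd C (fm n (B l))" by blast
qed

section \<open>Maximal abelian sets of idempotents\<close>

lemma idem_tr:
 assumes "rect n n P" "P * P = P"
 shows "\<exists>r\<le>n. tr n P = of_nat r \<and> (r = 0 --> P = 0)"
proof -
 obtain r F G where *: "r \<le> n" "rect n r F" "rect r n G" "F * G = P" "G * F = e r"
  using idem_factor[OF assms] by blast
 have "tr n P = of_nat r" using tr_comm[OF *(2,3)] *(4,5) by simp
 moreover have "P = 0" if "r = 0"
 proof -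
  have "F = 0" by (rule fmat_eqI) (use rectD[OF *(2)] that in simp)
  then show ?thesis using *(4) by simp
 qed
 ultimately show ?thesis using *(1) by blast
qed

text \<open>The rank of an idempotent, obtained by rounding the trace so that it is a total function
  and measurable in the entries.\<close>

definition rk :: "nat => fmat => nat" where "rk n P = nat \<lfloor>Re (tr n P)\<rfloor>"

lemma rk_idem:
 assumes "rect n n P" "P * P = P"
 shows "tr n P = of_nat (rk n P)" "rk n P \<le> n" "rk n P = 0 ==> P = 0"
 using idem_tr[OF assms] unfolding rk_def by auto

lemma rk_diff:
 assumes "rect n n P" "P * P = P" "rect n n Q" "Q * Q = Q" "P * Q = Q" "Q * P = Q"
 shows "(P - Q) * (P - Q) = P - Q" "rk n (P - Q) + rk n Q = rk n P" "rk n P \<le> rk n Q ==> P = Q"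
proof -
 show *: "(P - Q) * (P - Q) = P - Q" by (simp add: left_diff_distrib right_diff_distrib assms)
 have r: "rect n n (P - Q)" using assms by blast
 have "of_nat (rk n (P - Q)) + of_nat (rk n Q) = (of_nat (rk n P) :: complex)"
  unfolding rk_idem(1)[OF r *, symmetric] rk_idem(1)[OF assms(1,2), symmetric] rk_idem(1)[OF assms(3,4), symmetric]
  by (simp add: tr_diff)
 then show **: "rk n (P - Q) + rk n Q = rk n P" by (simp only: of_nat_add[symmetric] of_nat_eq_iff)
 show "P = Q" if "rk n P \<le> rk n Q" using rk_idem(3)[OF r *] ** that by simp
qed

lemma mfm_rk: "mfm M n f ==> (%l. rk n (f l)) \<in> measurable M (count_space UNIV)"
proof -
 assume f: "mfm M n f"
 have [measurable]: "(%l. ent (f l) i j) \<in> borel_measurable M" for i j by (rule mfmD(2)[OF f])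
 have [measurable]: "(%l. Re (tr n (f l))) \<in> borel_measurable M" unfolding tr_def by measurable
 then show ?thesis unfolding rk_def by measurable
qed

lemma mfm_rk_real: "mfm M n f ==> (%l. real (rk n (f l))) \<in> borel_measurable M"
 by (rule measurable_compose[OF mfm_rk]) auto

locale max_abelian = comp_meas M M0 K for M :: "'a::topological_space measure" and M0 K +
 fixes n A S C
 assumes A: "A \<in> Mn_Linf M n" and S: "commuting_idempotents M n A S"
  and max: "\<And>S'. commuting_idempotents M n A S' ==> S \<subseteq> S' ==> S' = S"
  and bd: "\<And>B. B \<in> S ==> AE l in M. mbd C (fm n (B l))"
begin

definition a where "a l = fm n (A l)"

definition sp :: "('a => fmat) => bool" where "sp p \<longleftrightarrow> bfm M n p \<and> (%l. tm n (p l)) \<in> S"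

lemma spD:
 assumes "sp p"
 shows "bfm M n p" "mfm M n p" "rect n n (p l)" "AE l in M. a l * p l = p l * a l" "AE l in M. p l * p l = p l" "AE l in M. mbd C (p l)"
proof -
 show b: "bfm M n p" using assms unfolding sp_def by blast
 then show "mfm M n p" "rect n n (p l)" by (rule bfmD)+
 have "(%l. tm n (p l)) \<in> S" using assms unfolding sp_def by blast
 then have "CI M n (%l. fm n (A l)) (%l. fm n (tm n (p l)))" and m: "AE l in M. mbd C (fm n (tm n (p l)))"
  using CI_fm[OF A] S bd unfolding commuting_idempotents_def by blast+
 then have "AE l in M. a l * p l = p l * a l \<and> p l * p l = p l" unfolding CI_def a_def fm_tm_bfm[OF b] by blast
 then show "AE l in M. a l * p l = p l * a l" "AE l in M. p l * p l = p l" by auto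
 show "AE l in M. mbd C (p l)" using m unfolding fm_tm_bfm[OF b] .
qed

lemma sp_comm:
 assumes "sp p" "sp q" shows "AE l in M. p l * q l = q l * p l"
proof -
 have "AE l in M. tm n (p l) * tm n (q l) = tm n (q l) * tm n (p l)"
  by (rule S[unfolded commuting_idempotents_def, THEN conjunct2, rule_format,
     OF assms(1)[unfolded sp_def, THEN conjunct2] assms(2)[unfolded sp_def, THEN conjunct2]])
 then show ?thesis
  by eventually_elim (use fm_comm_iff[OF tm_carrier tm_carrier] spD(3)[OF assms(1)] spD(3)[OF assms(2)] in auto)
qed

lemma sp_fm: "Z \<in> S ==> sp (%l. fm n (Z l))"
proof -
 assume Z: "Z \<in> S"
 then have Zc: "Z \<in> commutant_idempotents M n A" using S unfolding commuting_idempotents_def by blast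
 then have ZM: "Z \<in> Mn_Linf M n" unfolding commutant_idempotents_def rel_commutant_def by blast
 have "tm n (fm n (Z l)) = Z l" for l using tm_fm Mn_carrier[OF ZM, of l] by simp
 then show ?thesis unfolding sp_def using bfm_fm[OF ZM] Z by simp
qed

text \<open>Maximality in its working form: an idempotent of the commutant that commutes with all of
  \<open>S\<close> is absorbed by \<open>S\<close>. The closure properties below are
  instances.\<close>

lemma spI:
 assumes b: "bfm M n p" and ae: "AE l in M. a l * p l = p l * a l" "AE l in M. p l * p l = p l"
  and c: "\<And>q. sp q ==> AE l in M. p l * q l = q l * p l"
 shows "sp p"
 unfolding sp_def
proof (intro conjI b)
 have "CI M n (%l. fm n (A l)) p" unfolding CI_def using b ae unfolding a_def by auto
 then have ci: "(%l. tm n (p l)) \<in> commutant_idempotents M n A" by (rule CI_tm[OF A])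
 show "(%l. tm n (p l)) \<in> S"
 proof (rule maximal_absorb[OF A S max ci])
  fix P assume P: "P \<in> S"
  then have PM: "P \<in> Mn_Linf M n" using S unfolding commuting_idempotents_def commutant_idempotents_def rel_commutant_def by blast
  from c[OF sp_fm[OF P]] show "AE l in M. P l * tm n (p l) = tm n (p l) * P l"
  proof eventually_elim
   case (elim l)
   have "P l \<in> carrier_mat n n" using Mn_carrier[OF PM] by simp
   then show ?case using fm_comm_iff[of "P l" n "tm n (p l)"] elim fm_tm_bfm[OF b] by simp
  qed
 qed
qed

lemma ba: "bfm M n a" unfolding a_def by (rule bfm_fm[OF A])

lemma sp_one: "sp (%l. e n)"
 by (rule spI) (use comm_e[OF bfmD(2)[OF ba]] comm_e[OF spD(3)] in \<open>auto simp: bfm_const e_mult[OF rect_e]\<close>)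

lemma sp_mult:
 assumes p: "sp p" and q: "sp q" shows "sp (%l. p l * q l)"
proof (rule spI)
 show "bfm M n (%l. p l * q l)" by (rule bfm_mult[OF spD(1)[OF p] spD(1)[OF q]])
 show "AE l in M. a l * (p l * q l) = p l * q l * a l"
  using spD(4)[OF p] spD(4)[OF q] by eventually_elim (rule comm_mult)
 show "AE l in M. p l * q l * (p l * q l) = p l * q l"
  using spD(5)[OF p] spD(5)[OF q] sp_comm[OF p q]
 proof eventually_elim
  case (elim l)
  have "p l * q l * (p l * q l) = p l * (q l * p l) * q l" by (simp add: mult.assoc)
  also have "\<dots> = (p l * p l) * (q l * q l)" unfolding elim(3)[symmetric] by (simp add: mult.assoc)
  finally show ?case unfolding elim(1,2) .
 qed
 show "AE l in M. p l * q l * r l = r l * (p l * q l)" if "sp r" for r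
  using sp_comm[OF that p] sp_comm[OF that q] by eventually_elim (rule comm_mult[symmetric])
qed

lemma sp_diff:
 assumes p: "sp p" and q: "sp q" and le: "AE l in M. p l * q l = q l" shows "sp (%l. p l - q l)"
proof (rule spI)
 show "bfm M n (%l. p l - q l)" by (rule bfm_diff[OF spD(1)[OF p] spD(1)[OF q]])
 show "AE l in M. a l * (p l - q l) = (p l - q l) * a l"
  using spD(4)[OF p] spD(4)[OF q] by eventually_elim (rule comm_diff)
 show "AE l in M. (p l - q l) * (p l - q l) = p l - q l"
  using spD(5)[OF p] spD(5)[OF q] sp_comm[OF p q] le
  by eventually_elim (simp add: left_diff_distrib right_diff_distrib)
 show "AE l in M. (p l - q l) * r l = r l * (p l - q l)" if "sp r" for r
  using sp_comm[OF that p] sp_comm[OF that q] by eventually_elim (rule comm_diff[symmetric])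
qed

lemma sp_if:
 assumes p: "sp p" and q: "sp q" and E: "E \<in> sets M" shows "sp (%l. if l \<in> E then p l else q l)"
proof (rule spI)
 show "bfm M n (%l. if l \<in> E then p l else q l)" by (rule bfm_if[OF E spD(1)[OF p] spD(1)[OF q]])
 show "AE l in M. a l * (if l \<in> E then p l else q l) = (if l \<in> E then p l else q l) * a l"
  using spD(4)[OF p] spD(4)[OF q] by eventually_elim simp
 show "AE l in M. (if l \<in> E then p l else q l) * (if l \<in> E then p l else q l) = (if l \<in> E then p l else q l)"
  using spD(5)[OF p] spD(5)[OF q] by eventually_elim simp
 show "AE l in M. (if l \<in> E then p l else q l) * r l = r l * (if l \<in> E then p l else q l)" if "sp r" for r
  using sp_comm[OF that p] sp_comm[OF that q] by eventually_elim simp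
qed

text \<open>Countably many members can be glued along a measurable index because they share the
  bound \<open>C\<close>. This is where the boundedness of the abelian set is used.\<close>

lemma sp_glue:
 assumes p: "\<And>i::nat. sp (p i)" and i: "i \<in> measurable M (count_space UNIV)"
 shows "sp (%l. p (i l) l)"
proof (rule spI)
 have "AE l in M. \<forall>i. mbd C (p i l)" unfolding AE_all_countable using spD(6)[OF p] by blast
 then have "AE l in M. mbd C (p (i l) l)" by eventually_elim blast
 moreover have "mfm M n (%l. p (i l) l)"
 proof (rule mfmI)
  show "rect n n (p (i l) l)" for l by (rule spD(3)[OF p])
  show "(%l. ent (p (i l) l) j k) \<in> borel_measurable M" for j k
   by (rule measurable_compose_countable[OF mfmD(2)[OF spD(2)[OF p]] i])
 qed
 ultimately show "bfm M n (%l. p (i l) l)" unfolding bfm_def by blast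
 have "AE l in M. \<forall>i. a l * p i l = p i l * a l" unfolding AE_all_countable using spD(4)[OF p] by blast
 then show "AE l in M. a l * p (i l) l = p (i l) l * a l" by eventually_elim blast
 have "AE l in M. \<forall>i. p i l * p i l = p i l" unfolding AE_all_countable using spD(5)[OF p] by blast
 then show "AE l in M. p (i l) l * p (i l) l = p (i l) l" by eventually_elim blast
 fix r assume r: "sp r"
 have "AE l in M. \<forall>i. p i l * r l = r l * p i l" unfolding AE_all_countable using sp_comm[OF p r] by blast
 then show "AE l in M. p (i l) l * r l = r l * p (i l) l" by eventually_elim blast
qed

text \<open>A candidate may not vanish where \<open>T\<close> does not, so that splitting it off
  lowers the rank at every point where something is left.\<close>

definition cand :: "('a => fmat) => ('a => fmat) => bool" where
 "cand T P \<longleftrightarrow> sp P \<and> (AE l in M. P l * T l = P l \<and> T l * P l = P l \<and> (T l \<noteq> 0 --> P l \<noteq> 0))"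

definition wt :: "('a => fmat) => real" where "wt P = (\<integral>l. real (rk n (P l)) \<partial>M)"

lemma wt_integrable:
 assumes "sp P" shows "integrable M (%l. real (rk n (P l)))"
proof -
 interpret finite_measure M by (rule fin_M)
 have "AE l in M. norm (real (rk n (P l))) \<le> real n"
  using spD(5)[OF assms] by eventually_elim (use rk_idem(2)[OF spD(3)[OF assms]] in simp)
 moreover have "(%l. real (rk n (P l))) \<in> borel_measurable M" by (rule mfm_rk_real[OF spD(2)[OF assms]])
 ultimately show ?thesis by (rule integrable_const_bound)
qed

text \<open>The integral of the rank is minimised. The infimum is attained: a minimising sequence,
  glued along the index of least rank, gives a candidate at least as good as every term. If some
  \<open>R\<close> in \<open>S\<close> cut \<open>P\<close> properly on a set of positive measure,
  replacing \<open>P\<close> by \<open>R * P\<close> wherever the latter is nonzero would give a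
  candidate with a smaller integral.\<close>

lemma minimal_cand:
 assumes T: "sp T"
 shows "\<exists>P. cand T P \<and> (\<forall>R. sp R --> (AE l in M. R l * P l = 0 \<or> R l * P l = P l))"
proof -
 have TT: "cand T T" unfolding cand_def using T spD(5)[OF T] by auto
 define \<alpha> where "\<alpha> = Inf (wt ` Collect (cand T))"
 have bdd: "bdd_below (wt ` Collect (cand T))" by (rule bdd_belowI[of _ 0]) (auto simp: wt_def)
 have ne: "wt ` Collect (cand T) \<noteq> {}" using TT by blast
 have "\<exists>P. cand T P \<and> wt P < \<alpha> + 1 / real (Suc i)" for i
  using cInf_lessD[OF ne, of "\<alpha> + 1 / real (Suc i)"] unfolding \<alpha>_def by auto
 then obtain Q where Q: "\<And>i. cand T (Q i)" "\<And>i. wt (Q i) < \<alpha> + 1 / real (Suc i)" by metis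
 have sQ: "sp (Q i)" for i using Q(1) unfolding cand_def by blast
 define i where "i l = (LEAST i. \<forall>j. rk n (Q i l) \<le> rk n (Q j l))" for l
 have im: "i \<in> measurable M (count_space UNIV)" unfolding i_def
 proof (rule measurable_Least)
  fix k
  have [measurable]: "(%l. real (rk n (Q j l))) \<in> borel_measurable M" for j by (rule mfm_rk_real[OF spD(2)[OF sQ]])
  have "Measurable.pred M (%l. \<forall>j. real (rk n (Q k l)) \<le> real (rk n (Q j l)))" by measurable
  then show "Measurable.pred M (%l. \<forall>j. rk n (Q k l) \<le> rk n (Q j l))" by simp
 qed
 define P where "P l = Q (i l) l" for l
 have sP: "sp P" unfolding P_def by (rule sp_glue[OF sQ im])
 have Pmin: "rk n (P l) \<le> rk n (Q j l)" for l j
 proof -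
  have "\<exists>k. \<forall>j. rk n (Q k l) \<le> rk n (Q j l)"
   using ex_has_least_nat[of "%_. True" 0 "%k. rk n (Q k l)"] by auto
  then have "\<forall>j. rk n (Q (i l) l) \<le> rk n (Q j l)" unfolding i_def by (rule LeastI_ex)
  then show ?thesis unfolding P_def by blast
 qed
 have "AE l in M. \<forall>j. Q j l * T l = Q j l \<and> T l * Q j l = Q j l \<and> (T l \<noteq> 0 --> Q j l \<noteq> 0)"
  unfolding AE_all_countable using Q(1) unfolding cand_def by blast
 then have PT: "AE l in M. P l * T l = P l \<and> T l * P l = P l \<and> (T l \<noteq> 0 --> P l \<noteq> 0)"
  unfolding P_def by eventually_elim blast
 have cP: "cand T P" unfolding cand_def using sP PT by blast
 have wP: "wt P \<le> \<alpha>"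
 proof (rule field_le_epsilon)
  fix \<epsilon> :: real assume "0 < \<epsilon>"
  then obtain j where j: "inverse (real (Suc j)) < \<epsilon>" using reals_Archimedean by blast
  have "wt P \<le> wt (Q j)" unfolding wt_def
   by (rule integral_mono[OF wt_integrable[OF sP] wt_integrable[OF sQ]]) (simp add: Pmin)
  then show "wt P \<le> \<alpha> + \<epsilon>" using Q(2)[of j] j by (simp add: inverse_eq_divide)
 qed
 have "AE l in M. R l * P l = 0 \<or> R l * P l = P l" if R: "sp R" for R
 proof -
  define RP where "RP l = R l * P l" for l
  have sRP: "sp RP" unfolding RP_def by (rule sp_mult[OF R sP])
  define E where "E = {l \<in> space M. rk n (RP l) \<noteq> 0}"
  have E: "E \<in> sets M"
  proof -
   have [measurable]: "(%l. real (rk n (RP l))) \<in> borel_measurable M" by (rule mfm_rk_real[OF spD(2)[OF sRP]])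
   have "{l \<in> space M. real (rk n (RP l)) \<noteq> 0} \<in> sets M" by measurable
   then show ?thesis unfolding E_def by simp
  qed
  define P' where "P' l = (if l \<in> E then RP l else P l)" for l
  have sP': "sp P'" unfolding P'_def by (rule sp_if[OF sRP sP E])
  have le: "AE l in M. P l * P' l = P' l \<and> P' l * P l = P' l"
   using spD(5)[OF sP] sp_comm[OF R sP]
  proof eventually_elim
   case (elim l)
   have "RP l * P l = RP l" unfolding RP_def mult.assoc elim(1) ..
   moreover have "P l * RP l = RP l" unfolding RP_def elim(2) mult.assoc[symmetric] elim(1) ..
   ultimately show ?case unfolding P'_def using elim(1) by simp
  qed
  have "AE l in M. P' l * T l = P' l \<and> T l * P' l = P' l \<and> (T l \<noteq> 0 --> P' l \<noteq> 0)"
   using le PT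
  proof eventually_elim
   case (elim l)
   have "P' l * T l = P' l * (P l * T l)" using elim(1) by (simp add: mult.assoc[symmetric])
   then have "P' l * T l = P' l" using elim by simp
   moreover have "T l * P' l = T l * P l * P' l" using elim(1) by (simp add: mult.assoc)
   then have "T l * P' l = P' l" using elim by simp
   moreover have "P' l \<noteq> 0" if "T l \<noteq> 0"
   proof (cases "l \<in> E")
    case True
    have "rk n 0 = 0" unfolding rk_def tr_def by simp
    then have "RP l \<noteq> 0" using True unfolding E_def by auto
    then show ?thesis unfolding P'_def using True by simp
   next
    case False then show ?thesis unfolding P'_def using elim(2) that by simp
   qed
   ultimately show ?case by blast
  qed
  then have "cand T P'" unfolding cand_def using sP' by blast
  then have "\<alpha> \<le> wt P'" unfolding \<alpha>_def by (intro cInf_lower bdd) blast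
  have rkle: "AE l in M. rk n (P' l) \<le> rk n (P l)"
   using le spD(5)[OF sP] spD(5)[OF sP']
   by eventually_elim (use rk_diff(2)[OF spD(3)[OF sP] _ spD(3)[OF sP']] in force)
  have int: "integrable M (%l. real (rk n (P l)) - real (rk n (P' l)))"
   by (intro Bochner_Integration.integrable_diff wt_integrable sP sP')
  have "(\<integral>l. real (rk n (P l)) - real (rk n (P' l)) \<partial>M) = wt P - wt P'"
   unfolding wt_def by (rule Bochner_Integration.integral_diff[OF wt_integrable[OF sP] wt_integrable[OF sP']])
  then have i0: "(\<integral>l. real (rk n (P l)) - real (rk n (P' l)) \<partial>M) \<le> 0" using wP \<open>\<alpha> \<le> wt P'\<close> by simp
  have nn: "AE l in M. 0 \<le> real (rk n (P l)) - real (rk n (P' l))" using rkle by eventually_elim simp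
  have "(\<integral>l. real (rk n (P l)) - real (rk n (P' l)) \<partial>M) = 0"
   using i0 integral_nonneg_AE[OF nn] by linarith
  then have "AE l in M. real (rk n (P l)) - real (rk n (P' l)) = 0"
   using integral_nonneg_eq_0_iff_AE[OF int nn] by blast
  then show ?thesis using le spD(5)[OF sP] spD(5)[OF sP'] spD(5)[OF sRP] AE_space
  proof eventually_elim
   case (elim l)
   have "P l = P' l" using rk_diff(3)[OF spD(3)[OF sP] elim(3) spD(3)[OF sP'] elim(4)] elim(1,2) by simp
   show ?case
   proof (cases "l \<in> E")
    case True then show ?thesis using \<open>P l = P' l\<close> unfolding P'_def RP_def by simp
   next
    case False
    then have "rk n (RP l) = 0" using elim(6) unfolding E_def by blast
    then have "RP l = 0" by (rule rk_idem(3)[OF spD(3)[OF sRP] elim(5)])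
    then show ?thesis unfolding RP_def by blast
   qed
  qed
 qed
 then show ?thesis using cP by blast
qed

definition step :: "('a => fmat) => ('a => fmat)" where
 "step T = (SOME P. cand T P \<and> (\<forall>R. sp R --> (AE l in M. R l * P l = 0 \<or> R l * P l = P l)))"

lemma step: "sp T ==> cand T (step T)" "sp T ==> sp R ==> AE l in M. R l * step T l = 0 \<or> R l * step T l = step T l"
 using someI_ex[OF minimal_cand, folded step_def] by blast+

text \<open>What is left of the identity after \<open>k\<close> minimal candidates have been split
  off.\<close>

primrec rest :: "nat => 'a => fmat" where
 "rest 0 = (%l. e n)"
| "rest (Suc k) = (%l. rest k l - step (rest k) l)"

lemma sp_rest: "sp (rest k)"
proof (induction k)
 case 0 then show ?case using sp_one by simp
next
 case (Suc k)
 have c: "cand (rest k) (step (rest k))" by (rule step(1)[OF Suc])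
 have "AE l in M. rest k l * step (rest k) l = step (rest k) l" using c unfolding cand_def by auto
 moreover have "sp (step (rest k))" using c unfolding cand_def by blast
 ultimately show ?case using sp_diff[OF Suc] by simp
qed

definition fr :: "nat => 'a => fmat" where "fr k = step (rest k)"

lemma sp_fr: "sp (fr k)" and fr_AE: "AE l in M. fr k l * rest k l = fr k l \<and> rest k l * fr k l = fr k l \<and> (rest k l \<noteq> 0 --> fr k l \<noteq> 0)"
 using step(1)[OF sp_rest[of k]] unfolding cand_def fr_def by blast+

lemma fr_min: "sp R ==> AE l in M. R l * fr k l = 0 \<or> R l * fr k l = fr k l"
 unfolding fr_def by (rule step(2)[OF sp_rest])

lemma rest_Suc: "rest (Suc k) l = rest k l - fr k l" by (simp add: fr_def)

declare rest.simps(2) [simp del]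

text \<open>Every piece is nonzero where the remainder is, so the remainder after \<open>k\<close>
  steps has rank at most \<open>n - k\<close> and \<open>n\<close> pieces suffice. For minimality,
  let \<open>q\<close> be a smaller idempotent in the commutant over a set \<open>E\<close>. Members
  of \<open>S\<close> act on the piece as 0 or as the identity, so \<open>q\<close>, extended by 0,
  commutes with all of \<open>S\<close> and belongs to it; but then \<open>q\<close> itself acts on
  the piece as 0 or as the identity.\<close>

lemma pframe_fr: "pframe M n a n fr"
proof -
 have comm: "AE l in M. \<forall>j k. fr j l * fr k l = fr k l * fr j l"
  unfolding AE_all_countable using sp_comm[OF sp_fr sp_fr] by blast
 have frA: "AE l in M. \<forall>k. fr k l * rest k l = fr k l \<and> rest k l * fr k l = fr k l \<and> (rest k l \<noteq> 0 --> fr k l \<noteq> 0)"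
  unfolding AE_all_countable using fr_AE by blast
 have idf: "AE l in M. \<forall>k. fr k l * fr k l = fr k l" unfolding AE_all_countable using spD(5)[OF sp_fr] by blast
 have idr: "AE l in M. \<forall>k. rest k l * rest k l = rest k l" unfolding AE_all_countable using spD(5)[OF sp_rest] by blast
 have struct: "AE l in M. ortho {..<n} (%k. fr k l) \<and> (\<Sum>k<n. fr k l) = e n"
  using comm frA idf idr
 proof eventually_elim
  case (elim l)
  have dec: "rest (k + d) l * rest k l = rest (k + d) l" for k d
  proof (induction d)
   case 0 then show ?case using elim(4) by simp
  next
   case (Suc d)
   have "fr (k + d) l * rest k l = fr (k + d) l * rest (k + d) l * rest k l" using elim(2) by simp
   also have "\<dots> = fr (k + d) l * (rest (k + d) l * rest k l)" by (simp only: mult.assoc)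
   also have "\<dots> = fr (k + d) l" unfolding Suc using elim(2) by blast
   finally show ?case using Suc by (simp only: add_Suc_right rest_Suc left_diff_distrib)
  qed
  have o: "fr j l * fr k l = 0" if "k < j" for j k
  proof -
   have z: "rest (Suc k) l * fr k l = 0" unfolding rest_Suc left_diff_distrib using elim(2,3) by simp
   have "rest j l * rest (Suc k) l = rest j l" using dec[of "Suc k" "j - Suc k"] that by simp
   then have "rest j l * fr k l = rest j l * (rest (Suc k) l * fr k l)" by (simp add: mult.assoc[symmetric])
   then have "rest j l * fr k l = 0" using z by simp
   then have "fr j l * rest j l * fr k l = 0" by (simp add: mult.assoc)
   then show ?thesis using elim(2) by simp
  qed
  have "ortho {..<n} (%k. fr k l)" unfolding ortho_def
  proof (intro ballI impI)
   fix i j :: nat assume "i \<noteq> j"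
   then consider "i < j" | "j < i" by linarith
   then show "fr i l * fr j l = 0" using o elim(1) by cases metis+
  qed
  moreover have r: "rk n (rest k l) \<le> n - k" for k
  proof (induction k)
   case 0 show ?case using rk_idem(2)[OF rect_e e_mult[OF rect_e], of n] by simp
  next
   case (Suc k)
   have d: "rk n (rest (Suc k) l) + rk n (fr k l) = rk n (rest k l)" unfolding rest_Suc
    by (rule rk_diff(2)[OF spD(3)[OF sp_rest] _ spD(3)[OF sp_fr]]) (use elim in blast)+
   show ?case
   proof (cases "rest k l = 0")
    case True
    have "rk n 0 = 0" unfolding rk_def tr_def by simp
    then show ?thesis using d True by simp
   next
    case False
    then have "rk n (fr k l) \<noteq> 0" using rk_idem(3)[OF spD(3)[OF sp_fr]] elim(2,3) by blast
    then show ?thesis using d Suc by simp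
   qed
  qed
  have "rest n l = 0" using r[of n] rk_idem(3)[OF spD(3)[OF sp_rest]] elim(4) by simp
  moreover have "(\<Sum>k<j. fr k l) = e n - rest j l" for j
  proof (induction j)
   case 0 then show ?case by simp
  next
   case (Suc j) then show ?case unfolding rest_Suc by simp
  qed
  ultimately show ?case by simp
 qed
 have min: "AE l in M. pmin (a l) (fr k l)" for k
 proof (rule pmin_AE[OF bfmD(1)[OF ba] spD(2)[OF sp_fr]])
  show "AE l in M. a l * fr k l = fr k l * a l \<and> fr k l * fr k l = fr k l"
   using spD(4)[OF sp_fr] spD(5)[OF sp_fr] by auto
  fix E q
  assume E: "E \<in> sets M" and q: "bfm M n q" and qE: "\<forall>l\<in>E. q l * q l = q l \<and> a l * q l = q l * a l \<and>
   fr k l * q l = q l \<and> q l * fr k l = q l \<and> q l \<noteq> 0 \<and> q l \<noteq> fr k l"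
  define q' where "q' l = (if l \<in> E then q l else 0)" for l
  have "sp q'"
  proof (rule spI)
   show "bfm M n q'" unfolding q'_def by (rule bfm_if[OF E q bfm_const]) simp
   show "AE l in M. a l * q' l = q' l * a l" "AE l in M. q' l * q' l = q' l"
    unfolding q'_def using qE by (auto intro!: AE_I2)
   fix R assume R: "sp R"
   from fr_min[OF R, of k] sp_comm[OF R sp_fr, of k] show "AE l in M. q' l * R l = R l * q' l"
   proof eventually_elim
    case (elim l)
    show ?case
    proof (cases "l \<in> E")
     case True
     have "q l * R l = q l * (fr k l * R l)" using qE True by (simp add: mult.assoc[symmetric])
     moreover have "R l * q l = R l * fr k l * q l" using qE True by (simp add: mult.assoc)
     moreover have "fr k l * R l = R l * fr k l" using elim(2) by simp
     ultimately show ?thesis unfolding q'_def using elim(1) qE True by auto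
    qed (simp add: q'_def)
   qed
  qed
  from fr_min[OF this, of k] show "AE l in M. l \<notin> E"
  proof eventually_elim
   case (elim l)
   show ?case
   proof
    assume lE: "l \<in> E"
    then have "q' l * fr k l = q l" "q l \<noteq> 0" "q l \<noteq> fr k l" unfolding q'_def using qE by auto
    then show False using elim by auto
   qed
  qed
 qed
 have "AE l in M. \<forall>k. pmin (a l) (fr k l)" unfolding AE_all_countable using min by blast
 then have "AE l in M. (\<forall>k<n. pmin (a l) (fr k l)) \<and> ortho {..<n} (%k. fr k l) \<and> (\<Sum>k<n. fr k l) = e n"
  using struct by eventually_elim blast
 then show ?thesis unfolding pframe_def using spD(1)[OF sp_fr] by blast
qed

lemma S_eq: "S = frame_set M n A n fr"
proof -
 have p: "pframe M n (%l. fm n (A l)) n fr" using pframe_fr unfolding a_def[abs_def] .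
 have "S \<subseteq> frame_set M n A n fr"
 proof
  fix Z assume Z: "Z \<in> S"
  then have "Z \<in> commutant_idempotents M n A" using S unfolding commuting_idempotents_def by blast
  then show "Z \<in> frame_set M n A n fr" unfolding frame_set_def using sp_comm[OF sp_fm[OF Z] sp_fr] by blast
 qed
 then show ?thesis using max[OF frame_set_props(1)[OF A p]] by blast
qed

end

section \<open>Similarity of frames and conjugacy of their maximal abelian sets\<close>

lemma closed_imp: "(Q ==> closed {z. P z}) ==> closed {z. Q --> P z}"
 by (cases Q) auto

lemma closed_bex_less:
 fixes m :: nat
 assumes "\<And>k. closed {z. P k z}" shows "closed {z. \<exists>k<m. P k z}"
proof -
 have "{z. \<exists>k<m. P k z} = (\<Union>k<m. {z. P k z})" by auto
 then show ?thesis using assms by (simp add: closed_UN)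
qed

lemmas closed_fm_intros = closed_Collect_all closed_imp closed_Collect_conj closed_Collect_disj closed_bex_less
 cfm_mult cfm_fst cfm_snd

lemma diag_block_index:
 assumes "\<And>k. k < m ==> B k \<in> carrier_mat (nn k) (nn k)"
 shows "diag_block_mat (map B [0..<m]) \<in> carrier_mat (off nn m) (off nn m)"
  "\<And>k k' i j. k < m ==> k' < m ==> i < nn k ==> j < nn k' ==>
   diag_block_mat (map B [0..<m]) $$ (off nn k + i, off nn k' + j) = (if k = k' then B k $$ (i, j) else 0)"
proof -
 have "diag_block_mat (map B [0..<m]) \<in> carrier_mat (off nn m) (off nn m) \<and>
  (\<forall>k<m. \<forall>k'<m. \<forall>i<nn k. \<forall>j<nn k'.
   diag_block_mat (map B [0..<m]) $$ (off nn k + i, off nn k' + j) = (if k = k' then B k $$ (i, j) else 0))"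
  using assms
 proof (induction m)
  case 0 show ?case by simp
 next
  case (Suc m)
  let ?D = "diag_block_mat (map B [0..<m])"
  have D: "?D \<in> carrier_mat (off nn m) (off nn m)" using Suc by simp
  have Bm: "B m \<in> carrier_mat (nn m) (nn m)" using Suc.prems by simp
  have eq: "diag_block_mat (map B [0..<Suc m]) =
   four_block_mat ?D (0\<^sub>m (off nn m) (nn m)) (0\<^sub>m (nn m) (off nn m)) (B m)"
   using D Bm by (simp add: diag_block_mat_last Let_def)
  show ?case
  proof (intro conjI allI impI)
   show "diag_block_mat (map B [0..<Suc m]) \<in> carrier_mat (off nn (Suc m)) (off nn (Suc m))"
    unfolding eq using D Bm by (auto intro: four_block_carrier_mat)
   fix k k' i j assume k: "k < Suc m" "k' < Suc m" "i < nn k" "j < nn k'"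
   have i1: "off nn k + i < off nn m + nn m" "off nn k' + j < off nn m + nn m"
    using off_less[of k "Suc m" i nn] off_less[of k' "Suc m" j nn] k by auto
   have lt: "k < m ==> off nn k + i < off nn m" "k' < m ==> off nn k' + j < off nn m"
    using off_less[of k m i nn] off_less[of k' m j nn] k by auto
   have "diag_block_mat (map B [0..<Suc m]) $$ (off nn k + i, off nn k' + j) =
    (if off nn k + i < off nn m then if off nn k' + j < off nn m then ?D $$ (off nn k + i, off nn k' + j)
      else 0\<^sub>m (off nn m) (nn m) $$ (off nn k + i, off nn k' + j - off nn m)
    else if off nn k' + j < off nn m then 0\<^sub>m (nn m) (off nn m) $$ (off nn k + i - off nn m, off nn k' + j)
      else B m $$ (off nn k + i - off nn m, off nn k' + j - off nn m))"
    unfolding eq using D Bm i1 by (subst index_mat_four_block) auto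
   also have "\<dots> = (if k = k' then B k $$ (i, j) else 0)"
   proof (cases "k < m"; cases "k' < m")
    assume "k < m" "k' < m" then show ?thesis using lt Suc k by simp
   next
    assume "k < m" "\<not> k' < m" then have "k' = m" "k < m" using k by auto
    then show ?thesis using lt k by simp
   next
    assume "\<not> k < m" "k' < m" then have "k = m" "k' < m" using k by auto
    then show ?thesis using lt k by simp
   next
    assume "\<not> k < m" "\<not> k' < m" then have "k = m" "k' = m" using k by auto
    then show ?thesis by simp
   qed
   finally show "diag_block_mat (map B [0..<Suc m]) $$ (off nn k + i, off nn k' + j) = (if k = k' then B k $$ (i, j) else 0)" .
  qed
 qed
 then show "diag_block_mat (map B [0..<m]) \<in> carrier_mat (off nn m) (off nn m)"
  "\<And>k k' i j. k < m ==> k' < m ==> i < nn k ==> j < nn k' ==>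
   diag_block_mat (map B [0..<m]) $$ (off nn k + i, off nn k' + j) = (if k = k' then B k $$ (i, j) else 0)" by blast+
qed

lemma tm_block_form:
 assumes "block_form m nn C" "off nn m = n"
 shows "tm n C = diag_block_mat (map (%k. mat (nn k) (nn k) (%(i, j). ent C (off nn k + i) (off nn k + j))) [0..<m])"
proof -
 define B where "B k = mat (nn k) (nn k) (%(i, j). ent C (off nn k + i) (off nn k + j))" for k
 have Bc: "\<And>k. k < m ==> B k \<in> carrier_mat (nn k) (nn k)" unfolding B_def by simp
 note d = diag_block_index[where B = B and nn = nn and m = m]
 have d1: "diag_block_mat (map B [0..<m]) \<in> carrier_mat (off nn m) (off nn m)" by (rule d(1)) (rule Bc)
 have "tm n C = diag_block_mat (map B [0..<m])"
 proof (rule eq_matI)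
  fix p q assume "p < dim_row (diag_block_mat (map B [0..<m]))" "q < dim_col (diag_block_mat (map B [0..<m]))"
  then have pq: "p < off nn m" "q < off nn m" using d1 by auto
  obtain k i where k: "k < m" "i < nn k" "p = off nn k + i" using off_split[OF pq(1)] by blast
  obtain k' j where k': "k' < m" "j < nn k'" "q = off nn k' + j" using off_split[OF pq(2)] by blast
  have "ent C p q = (if k = k' then ent C (off nn k + i) (off nn k + j) else 0)"
   using assms(1) k k' unfolding block_form_def by auto
  also have "\<dots> = (if k = k' then B k $$ (i, j) else 0)" using k k' unfolding B_def by auto
  finally show "tm n C $$ (p, q) = diag_block_mat (map B [0..<m]) $$ (p, q)"
   using d(2)[OF Bc k(1) k'(1) k(2) k'(2)] pq assms(2) k(3) k'(3) by simp
 qed (use d1 assms(2) in \<open>auto simp: tm_def\<close>)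
 then show ?thesis unfolding B_def .
qed

lemma bfm_uniform_bound:
 fixes m :: nat
 assumes "\<And>k. k < m ==> bfm M n (p k)"
 shows "\<exists>C\<ge>0. AE l in M. \<forall>k<m. mbd C (p k l)"
proof -
 have "\<forall>k\<in>{..<m}. \<exists>C. AE l in M. mbd C (p k l)" using assms unfolding bfm_def by blast
 from bchoice[OF this] obtain C where C: "\<forall>k\<in>{..<m}. AE l in M. mbd (C k) (p k l)" by (rule exE)
 have "AE l in M. \<forall>k\<in>{..<m}. mbd (C k) (p k l)" by (rule AE_finite_allI) (use C in auto)
 then have "AE l in M. \<forall>k<m. mbd (\<Sum>k<m. \<bar>C k\<bar>) (p k l)"
 proof eventually_elim
  case (elim l)
  show ?case
  proof (intro allI impI)
   fix k assume k: "k < m"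
   have "C k \<le> \<bar>C k\<bar>" by simp
   also have "\<dots> \<le> (\<Sum>k<m. \<bar>C k\<bar>)" by (rule member_le_sum[of k "{..<m}" "%k. \<bar>C k\<bar>"]) (use k in auto)
   finally show "mbd (\<Sum>k<m. \<bar>C k\<bar>) (p k l)" using elim k by (auto intro: mbd_mono[of "C k"])
  qed
 qed
 then show ?thesis by (intro exI[of _ "\<Sum>k<m. \<bar>C k\<bar>"] conjI sum_nonneg) auto
qed

text \<open>At almost every point \<open>krull_schmidt\<close> provides a pair of inverse matrices
  with entries bounded by the same \<open>K\<close>. The relation they satisfy is built from matrix
  equations by finite conjunctions and disjunctions, hence closed, so the pair can be selected
  measurably.\<close>

lemma frames_similar:
 assumes A: "A \<in> Mn_Linf M n" and p: "pframe M n (%l. fm n (A l)) m p" and q: "pframe M n (%l. fm n (A l)) m' q"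
 shows "\<exists>x y. bfm M n x \<and> bfm M n y \<and> (AE l in M. x l * y l = e n \<and> y l * x l = e n \<and>
  fm n (A l) * x l = x l * fm n (A l) \<and> fm n (A l) * y l = y l * fm n (A l) \<and>
  (\<forall>k<m. p k l = 0 \<or> (\<exists>j<m'. x l * p k l * y l = q j l)) \<and>
  (\<forall>j<m'. q j l = 0 \<or> (\<exists>k<m. x l * p k l * y l = q j l)))"
proof -
 note bp = pframeD(1)[OF p] and bq = pframeD(1)[OF q]
 have ba: "bfm M n (%l. fm n (A l))" by (rule bfm_fm[OF A])
 obtain C1 where C1: "0 \<le> C1" "AE l in M. \<forall>k<m. mbd C1 (p k l)" using bfm_uniform_bound[of m M n p] bp by blast
 obtain C2 where C2: "0 \<le> C2" "AE l in M. \<forall>k<m'. mbd C2 (q k l)" using bfm_uniform_bound[of m' M n q] bq by blast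
 define C where "C = max C1 C2"
 obtain K where K: "\<forall>A P Q S I J. rect n n A \<and> ks_family n A C I P m \<and> ks_family n A C J Q m' \<and>
   (\<Sum>k\<in>I. P k) = S \<and> (\<Sum>l\<in>J. Q l) = S --> (\<exists>X Y. ks_similar n A K I P J Q S X Y)"
  using krull_schmidt[of n C m m'] by (rule exE)
 define c where "c = max 0 K"
 have c0: "0 \<le> c" unfolding c_def by simp
 \<comment> \<open>All data in one sequence: index 0 carries \<open>A\<close>, indices 1 to
   \<open>m\<close> the first frame, the following \<open>m'\<close> indices the second frame, and
   \<open>e n\<close> fills the rest.\<close>
 define D where "D k = (if k = 0 then (%l. fm n (A l)) else if k \<le> m then p (k - 1)
  else if k \<le> m + m' then q (k - Suc m) else (%l. e n))" for k
 have D: "mfm M n (D k)" for k unfolding D_def using bfmD(1)[OF ba] bfmD(1)[OF bp] bfmD(1)[OF bq] by (simp add: mfm_const[OF rect_e])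
 have Dp: "D (Suc k) = p k" if "k < m" for k using that unfolding D_def by simp
 have Dq: "D (Suc m + j) = q j" if "j < m'" for j using that unfolding D_def by simp
 have D0: "D 0 = (%l. fm n (A l))" unfolding D_def by simp
 define R where "R x y \<longleftrightarrow> y 0 * y 1 = e n \<and> y 1 * y 0 = e n \<and> x 0 * y 0 = y 0 * x 0 \<and> x 0 * y 1 = y 1 * x 0 \<and>
  (\<forall>k. k < m --> (x (Suc k) = 0 \<or> (\<exists>j<m'. y 0 * x (Suc k) * y 1 = x (Suc m + j)))) \<and>
  (\<forall>j. j < m' --> (x (Suc m + j) = 0 \<or> (\<exists>k<m. y 0 * x (Suc k) * y 1 = x (Suc m + j))))" for x y :: "nat => fmat"
 have cl: "closed {z. R (%k. mk_fmat n n (fst z k)) (%k. mk_fmat n n (snd z k))}"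
  unfolding R_def
  by (intro closed_fm_intros closed_fm_eq[where n = n] cfm_const rect_e rect_zero)
 define E where "E = {l \<in> space M. \<exists>Y. (\<forall>k. rect n n (Y k) \<and> mbd c (Y k)) \<and> R (%k. D k l) Y}"
 have "\<exists>S. (\<forall>k. mfm M n (S k)) \<and> (\<forall>k l. mbd c (S k l)) \<and> (\<forall>l\<in>E. R (%k. D k l) (%k. S k l))"
  unfolding E_def by (rule fmat_selection(2)[where R = R and D = D, OF D c0 cl])
 then obtain S where S: "(\<forall>k. mfm M n (S k)) \<and> (\<forall>k l. mbd c (S k l)) \<and> (\<forall>l\<in>E. R (%k. D k l) (%k. S k l))"
  by (rule exE)
 have bS: "bfm M n (S k)" for k unfolding bfm_def using S by blast
 have DE: "AE l in M. l \<in> E"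
  using pframeD(2)[OF p] pframeD(2)[OF q] C1(2) C2(2) AE_space
 proof eventually_elim
  case (elim l)
  have f1: "ks_family n (fm n (A l)) C {..<m} (%k. p k l) m" unfolding ks_family_def
   using elim(1,3) bfmD(2)[OF bp] mbd_mono[of C1 _ C] unfolding C_def by auto
  have f2: "ks_family n (fm n (A l)) C {..<m'} (%k. q k l) m'" unfolding ks_family_def
   using elim(2,4) bfmD(2)[OF bq] mbd_mono[of C2 _ C] unfolding C_def by auto
  obtain X Y where XY: "ks_similar n (fm n (A l)) K {..<m} (%k. p k l) {..<m'} (%k. q k l) (e n) X Y"
   using K[rule_format, OF conjI[OF rect_fm conjI[OF f1 conjI[OF f2]]]] elim(1,2) by blast
  define Z where "Z k = (if k = (0::nat) then X else Y)" for k
  have ks: "rect n n X" "rect n n Y" "X * Y = e n" "Y * X = e n" "fm n (A l) * X = X * fm n (A l)"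
   "fm n (A l) * Y = Y * fm n (A l)" "mbd K X" "mbd K Y"
   "\<And>k. k < m ==> p k l = 0 \<or> (\<exists>j<m'. X * p k l * Y = q j l)"
   "\<And>j. j < m' ==> q j l = 0 \<or> (\<exists>k<m. X * p k l * Y = q j l)"
   using XY unfolding ks_similar_def by auto
  have Z: "Z 0 = X" "Z 1 = Y" unfolding Z_def by simp_all
  have "R (%k. D k l) Z" unfolding R_def Z D0
  proof (intro conjI allI impI ks(3-6))
   fix k assume k: "k < m"
   show "D (Suc k) l = 0 \<or> (\<exists>j<m'. X * D (Suc k) l * Y = D (Suc m + j) l)" unfolding Dp[OF k]
    using ks(9)[OF k] Dq by metis
  next
   fix j assume j: "j < m'"
   show "D (Suc m + j) l = 0 \<or> (\<exists>k<m. X * D (Suc k) l * Y = D (Suc m + j) l)" unfolding Dq[OF j]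
    using ks(10)[OF j] Dp by metis
  qed
  moreover have "rect n n (Z k) \<and> mbd c (Z k)" for k unfolding Z_def c_def using ks mbd_mono[of K _ "max 0 K"] by auto
  ultimately show ?case unfolding E_def using elim(5) by blast
 qed
 have "AE l in M. S 0 l * S 1 l = e n \<and> S 1 l * S 0 l = e n \<and>
  fm n (A l) * S 0 l = S 0 l * fm n (A l) \<and> fm n (A l) * S 1 l = S 1 l * fm n (A l) \<and>
  (\<forall>k<m. p k l = 0 \<or> (\<exists>j<m'. S 0 l * p k l * S 1 l = q j l)) \<and>
  (\<forall>j<m'. q j l = 0 \<or> (\<exists>k<m. S 0 l * p k l * S 1 l = q j l))"
  using DE
 proof eventually_elim
  case (elim l)
  then have "R (%k. D k l) (%k. S k l)" using S by blast
  then have r: "S 0 l * S 1 l = e n" "S 1 l * S 0 l = e n" "fm n (A l) * S 0 l = S 0 l * fm n (A l)"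
   "fm n (A l) * S 1 l = S 1 l * fm n (A l)"
   "\<And>k. k < m ==> D (Suc k) l = 0 \<or> (\<exists>j<m'. S 0 l * D (Suc k) l * S 1 l = D (Suc m + j) l)"
   "\<And>j. j < m' ==> D (Suc m + j) l = 0 \<or> (\<exists>k<m. S 0 l * D (Suc k) l * S 1 l = D (Suc m + j) l)"
   unfolding R_def D0 by blast+
  show ?case
  proof (intro conjI allI impI r(1-4))
   fix k assume k: "k < m"
   show "p k l = 0 \<or> (\<exists>j<m'. S 0 l * p k l * S 1 l = q j l)"
    using r(5)[OF k] unfolding Dp[OF k] using Dq by metis
  next
   fix j assume j: "j < m'"
   show "q j l = 0 \<or> (\<exists>k<m. S 0 l * p k l * S 1 l = q j l)"
    using r(6)[OF j] unfolding Dq[OF j] using Dp by metis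
  qed
 qed
 then show ?thesis using bS by blast
qed

text \<open>Which \<open>p k\<close> is carried to which \<open>q j\<close> varies with the point,
  so the frames are not conjugate member by member as fields. Commutation survives: a field that
  commutes with every \<open>p k\<close> is carried to one that commutes with every
  \<open>q j\<close>, and this is what membership in \<open>frame_set\<close> demands.\<close>

lemma frame_sets_conjugate:
 assumes A: "A \<in> Mn_Linf M n" and p: "pframe M n (%l. fm n (A l)) m p" and q: "pframe M n (%l. fm n (A l)) m' q"
 shows "\<exists>X Y. X \<in> rel_commutant M n A \<and> Y \<in> rel_commutant M n A \<and> Mn_inverse_pair M n X Y \<and>
  conjugate_set M n X Y (frame_set M n A m p) = frame_set M n A m' q"
proof -
 obtain x y where x: "bfm M n x" and y: "bfm M n y" and xy: "AE l in M. x l * y l = e n \<and> y l * x l = e n \<and>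
  fm n (A l) * x l = x l * fm n (A l) \<and> fm n (A l) * y l = y l * fm n (A l) \<and>
  (\<forall>k<m. p k l = 0 \<or> (\<exists>j<m'. x l * p k l * y l = q j l)) \<and>
  (\<forall>j<m'. q j l = 0 \<or> (\<exists>k<m. x l * p k l * y l = q j l))"
  using frames_similar[OF A p q] by blast
 define X where "X l = tm n (x l)" for l
 define Y where "Y l = tm n (y l)" for l
 have XM: "X \<in> Mn_Linf M n" "Y \<in> Mn_Linf M n" unfolding X_def Y_def by (rule bfm_tm[OF x], rule bfm_tm[OF y])
 have rx: "rect n n (x l)" "rect n n (y l)" for l by (rule bfmD(2)[OF x], rule bfmD(2)[OF y])
 have fX: "fm n (X l) = x l" "fm n (Y l) = y l" for l unfolding X_def Y_def using rx by simp_all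
 have XY: "AE l in M. X l * Y l = 1\<^sub>m n \<and> Y l * X l = 1\<^sub>m n"
  using xy
 proof eventually_elim
  case (elim l)
  show ?case unfolding X_def Y_def using tm_mult[OF rx(1) rx(2), of l l] tm_mult[OF rx(2) rx(1), of l l] elim by simp
 qed
 have XA: "AE l in M. A l * X l = X l * A l" using xy AE_space
  by eventually_elim (use fm_comm_iff[OF Mn_carrier[OF A] Mn_carrier[OF XM(1)]] fX in auto)
 have YA: "AE l in M. A l * Y l = Y l * A l" using xy AE_space
  by eventually_elim (use fm_comm_iff[OF Mn_carrier[OF A] Mn_carrier[OF XM(2)]] fX in auto)
 have cancel: "u * (v * w) = w" if "u * v = e n" "rect n n w" for u v w
  using e_mult[OF that(2)] that(1) by (simp add: mult.assoc[symmetric])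
 have CI_conj: "CI M n (%l. fm n (A l)) (%l. u l * z l * v l)"
  if "CI M n (%l. fm n (A l)) z" "bfm M n u" "bfm M n v" and ae: "AE l in M. v l * u l = e n \<and>
  fm n (A l) * u l = u l * fm n (A l) \<and> fm n (A l) * v l = v l * fm n (A l)" for z u v
  unfolding CI_def
 proof
  have z: "bfm M n z" "AE l in M. fm n (A l) * z l = z l * fm n (A l) \<and> z l * z l = z l" using that(1) unfolding CI_def by auto
  show "bfm M n (%l. u l * z l * v l)" by (intro bfm_mult that z)
  show "AE l in M. fm n (A l) * (u l * z l * v l) = u l * z l * v l * fm n (A l) \<and> u l * z l * v l * (u l * z l * v l) = u l * z l * v l"
   using z(2) ae
  proof eventually_elim
   case (elim l)
   have "u l * z l * v l * (u l * z l * v l) = u l * (z l * (v l * (u l * (z l * v l))))" by (simp add: mult.assoc)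
   also have "v l * (u l * (z l * v l)) = z l * v l"
    by (rule cancel) (use elim rect_sq[OF bfmD(2)[OF z(1)] bfmD(2)[OF that(3)]] in auto)
   also have "u l * (z l * (z l * v l)) = u l * (z l * z l) * v l" by (simp add: mult.assoc)
   finally have "u l * z l * v l * (u l * z l * v l) = u l * z l * v l" using elim by simp
   then show ?case using elim by (auto intro!: comm_mult)
  qed
 qed
 have main: "AE l in M. u l * z l * v l * g j l = g j l * (u l * z l * v l)"
  if z: "\<And>k. k < mf ==> AE l in M. z l * f k l = f k l * z l" and j: "j < mg"
   and ae: "AE l in M. v l * u l = e n \<and> (\<forall>j<mg. g j l = 0 \<or> (\<exists>k<mf. u l * f k l * v l = g j l))"
   and r: "\<And>l. rect n n (z l)" "\<And>k l. k < mf ==> rect n n (f k l)" for u v z j and f :: "nat => 'a => fmat" and g :: "nat => 'a => fmat" and mf mg :: nat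
 proof -
  have "AE l in M. \<forall>k\<in>{..<mf}. z l * f k l = f k l * z l" by (rule AE_finite_allI) (use z in auto)
  from this ae show ?thesis
  proof eventually_elim
   case (elim l)
   show ?case
   proof (cases "g j l = 0")
    case False
    then obtain k where k: "k < mf" "g j l = u l * f k l * v l" using elim(2) j by metis
    have 1: "v l * (u l * (f k l * w)) = f k l * w" "v l * (u l * (z l * w)) = z l * w" for w
     using elim(2) e_mult2[OF r(1), of l w] e_mult2[OF r(2)[OF k(1)], of l w]
     by (simp_all add: mult.assoc[symmetric, of "v l" "u l"])
    have "z l * f k l = f k l * z l" using elim(1) k(1) by simp
    then have zf: "z l * (f k l * w) = f k l * (z l * w)" for w by (simp add: mult.assoc[symmetric])
    show ?thesis unfolding k(2) by (simp add: mult.assoc 1 zf)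
   qed simp
  qed
 qed
 have rp: "rect n n (p k l)" if "k < m" for k l by (rule bfmD(2)[OF pframeD(1)[OF p that]])
 have rq: "rect n n (q k l)" if "k < m'" for k l by (rule bfmD(2)[OF pframeD(1)[OF q that]])
 have ae1: "AE l in M. y l * x l = e n \<and> (\<forall>j<m'. q j l = 0 \<or> (\<exists>k<m. x l * p k l * y l = q j l))" using xy by auto
 have ae2: "AE l in M. x l * y l = e n \<and> (\<forall>k<m. p k l = 0 \<or> (\<exists>j<m'. y l * q j l * x l = p k l))"
  using xy
 proof eventually_elim
  case (elim l)
  have "y l * (x l * p k l * y l) * x l = p k l" if "k < m" for k
  proof -
   have "y l * (x l * p k l * y l) * x l = (y l * x l) * p k l * (y l * x l)" by (simp add: mult.assoc)
   then show ?thesis using elim e_mult[OF rp[OF that]] mult_e[OF rp[OF that]] by simp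
  qed
  then show ?case using elim by metis
 qed
 have ZM: "Z \<in> Mn_Linf M n" if "Z \<in> frame_set M n A mm pp" for Z mm pp
  using that unfolding frame_set_def commutant_idempotents_def rel_commutant_def by blast
 have fs1: "(%l. tm n (x l * fm n (Z l) * y l)) \<in> frame_set M n A m' q" if Z: "Z \<in> frame_set M n A m p" for Z
 proof -
  have zb: "bfm M n (%l. fm n (Z l))" by (rule bfm_fm[OF ZM[OF Z]])
  have b: "bfm M n (%l. x l * fm n (Z l) * y l)" by (intro bfm_mult x y zb)
  have "CI M n (%l. fm n (A l)) (%l. x l * fm n (Z l) * y l)"
  proof (rule CI_conj)
   show "CI M n (%l. fm n (A l)) (%l. fm n (Z l))" using CI_fm[OF A] Z unfolding frame_set_def by blast
   show "AE l in M. y l * x l = e n \<and> fm n (A l) * x l = x l * fm n (A l) \<and> fm n (A l) * y l = y l * fm n (A l)" using xy by auto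
  qed (rule x, rule y)
  moreover have "AE l in M. x l * fm n (Z l) * y l * q j l = q j l * (x l * fm n (Z l) * y l)" if "j < m'" for j
   by (rule main[OF _ that ae1 rect_fm rp]) (use Z in \<open>auto simp: frame_set_def\<close>)
  ultimately show ?thesis unfolding frame_set_def using CI_tm[OF A] fm_tm_bfm[OF b] by simp
 qed
 have fs2: "(%l. tm n (y l * fm n (Z l) * x l)) \<in> frame_set M n A m p" if Z: "Z \<in> frame_set M n A m' q" for Z
 proof -
  have zb: "bfm M n (%l. fm n (Z l))" by (rule bfm_fm[OF ZM[OF Z]])
  have b: "bfm M n (%l. y l * fm n (Z l) * x l)" by (intro bfm_mult x y zb)
  have "CI M n (%l. fm n (A l)) (%l. y l * fm n (Z l) * x l)"
  proof (rule CI_conj)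
   show "CI M n (%l. fm n (A l)) (%l. fm n (Z l))" using CI_fm[OF A] Z unfolding frame_set_def by blast
   show "AE l in M. x l * y l = e n \<and> fm n (A l) * y l = y l * fm n (A l) \<and> fm n (A l) * x l = x l * fm n (A l)" using xy by auto
  qed (rule y, rule x)
  moreover have "AE l in M. y l * fm n (Z l) * x l * p j l = p j l * (y l * fm n (Z l) * x l)" if "j < m" for j
   by (rule main[OF _ that ae2 rect_fm rq]) (use Z in \<open>auto simp: frame_set_def\<close>)
  ultimately show ?thesis unfolding frame_set_def using CI_tm[OF A] fm_tm_bfm[OF b] by simp
 qed
 have XZY: "fm n (X l * Z * Y l) = x l * fm n Z * y l" "X l * Z * Y l \<in> carrier_mat n n"
  if "Z \<in> carrier_mat n n" "l \<in> space M" for l Z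
 proof -
  note c = that(1) Mn_carrier[OF XM(1) that(2)] Mn_carrier[OF XM(2) that(2)]
  show "X l * Z * Y l \<in> carrier_mat n n" using c by auto
  show "fm n (X l * Z * Y l) = x l * fm n Z * y l"
   unfolding fm_mult[OF mult_carrier_mat[OF c(2,1)] c(3)] fm_mult[OF c(2,1)] fX ..
 qed
 have "conjugate_set M n X Y (frame_set M n A m p) = frame_set M n A m' q"
 proof (rule equalityI; rule subsetI)
  fix Z' assume "Z' \<in> conjugate_set M n X Y (frame_set M n A m p)"
  then obtain Z where Z': "Z' \<in> Mn_Linf M n" and Z: "Z \<in> frame_set M n A m p" and eq: "AE l in M. Z' l = X l * Z l * Y l"
   unfolding conjugate_set_def by (elim CollectE conjE bexE) (rule that)
  have eq': "AE l in M. fm n (Z' l) = x l * fm n (Z l) * y l"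
   using eq AE_space by eventually_elim (use XZY(1)[OF Mn_carrier[OF ZM[OF Z]]] in simp)
  define W where "W l = tm n (x l * fm n (Z l) * y l)" for l
  have W: "W \<in> frame_set M n A m' q" unfolding W_def by (rule fs1[OF Z])
  have fW: "fm n (W l) = x l * fm n (Z l) * y l" for l unfolding W_def
   using rect_sq[OF rect_sq[OF rx(1) rect_fm] rx(2)] by simp
  have "CI M n (%l. fm n (A l)) (%l. fm n (Z' l))" unfolding CI_def
  proof
   show "bfm M n (%l. fm n (Z' l))" by (rule bfm_fm[OF Z'])
   have "AE l in M. fm n (A l) * fm n (W l) = fm n (W l) * fm n (A l) \<and> fm n (W l) * fm n (W l) = fm n (W l)"
    using CI_fm[OF A, of W] W unfolding frame_set_def CI_def by blast
   then show "AE l in M. fm n (A l) * fm n (Z' l) = fm n (Z' l) * fm n (A l) \<and> fm n (Z' l) * fm n (Z' l) = fm n (Z' l)"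
    using eq' by eventually_elim (simp add: fW)
  qed
  then have "(%l. tm n (fm n (Z' l))) \<in> commutant_idempotents M n A" by (rule CI_tm[OF A])
  then have "Z' \<in> commutant_idempotents M n A" using Z'
   unfolding commutant_idempotents_def rel_commutant_def
   by (auto elim!: AE_mp intro!: AE_I2 simp: tm_fm[OF Mn_carrier[OF Z']])
  moreover have "AE l in M. fm n (Z' l) * q k l = q k l * fm n (Z' l)" if "k < m'" for k
  proof -
   have "AE l in M. fm n (W l) * q k l = q k l * fm n (W l)" using W that unfolding frame_set_def by blast
   then show ?thesis using eq' by eventually_elim (simp add: fW)
  qed
  ultimately show "Z' \<in> frame_set M n A m' q" unfolding frame_set_def by blast
 next
  fix Z' assume Z': "Z' \<in> frame_set M n A m' q"
  define Z where "Z l = tm n (y l * fm n (Z' l) * x l)" for l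
  have Z: "Z \<in> frame_set M n A m p" unfolding Z_def by (rule fs2[OF Z'])
  have "AE l in M. Z' l = X l * Z l * Y l" using xy AE_space
  proof eventually_elim
   case (elim l)
   have c: "Z' l \<in> carrier_mat n n" "Z l \<in> carrier_mat n n" using Mn_carrier[OF ZM[OF Z']] elim(2) unfolding Z_def by auto
   have fZ: "fm n (Z l) = y l * fm n (Z' l) * x l" unfolding Z_def
    using rect_sq[OF rect_sq[OF rx(2) rect_fm] rx(1)] by simp
   have "fm n (X l * Z l * Y l) = (x l * y l) * fm n (Z' l) * (x l * y l)"
    unfolding XZY(1)[OF c(2) elim(2)] fZ by (simp add: mult.assoc)
   also have "\<dots> = fm n (Z' l)" using elim(1) e_mult[OF rect_fm] mult_e[OF rect_fm] by simp
   finally show ?case using fm_inj[OF XZY(2)[OF c(2) elim(2)] c(1)] by simp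
  qed
  then show "Z' \<in> conjugate_set M n X Y (frame_set M n A m p)" unfolding conjugate_set_def using ZM[OF Z'] Z by blast
 qed
 then show ?thesis using XM XY XA YA unfolding rel_commutant_def Mn_inverse_pair_def by blast
qed

section \<open>The Jordan form over pieces of constant rank\<close>

text \<open>The pieces of the partition must cover \<open>K\<close> and some may be null. There
  every almost-everywhere statement holds, and a single block of size \<open>n\<close> fixes
  admissible block sizes.\<close>

lemma null_jordan_block_form:
 fixes M :: "'a measure" and n :: nat
 assumes "AE l in M. False" "1 \<le> n"
 shows "jordan_block_form M n A"
proof -
 have ae: "AE l in M. P l" for P using assms(1) by eventually_elim simp
 have "bfm M n (%_. e n)" by (rule bfm_const[OF rect_e])
 from bfm_tm[OF this] have one: "(%l. 1\<^sub>m n) \<in> Mn_Linf M n" by simp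
 show ?thesis unfolding jordan_block_form_def
  by (intro exI[of _ 1] exI[of _ "%_. n"] exI[of _ "%l. 1\<^sub>m n"] exI[of _ "%k l. 1\<^sub>m n"])
   (use one assms(2) ae in \<open>auto simp: Mn_inverse_pair_def\<close>)
qed

lemma sum_filter_nth:
 fixes f :: "nat => 'b::comm_monoid_add" and m :: nat
 assumes "\<And>k. k < m ==> \<not> Q k ==> f k = 0"
 shows "(\<Sum>k<length (filter Q [0..<m]). f (filter Q [0..<m] ! k)) = (\<Sum>k<m. f k)"
proof -
 let ?ks = "filter Q [0..<m]"
 have "(\<Sum>k<length ?ks. f (?ks ! k)) = sum f (set ?ks)"
  by (rule sum.reindex_bij_betw) (rule bij_betw_nth, auto)
 also have "\<dots> = (\<Sum>k<m. f k)" by (rule sum.mono_neutral_left) (use assms in auto)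
 finally show ?thesis .
qed

context comp_meas
begin

text \<open>Constant ranks make the block sizes constant once members of rank 0 are dropped. The
  similarities have a common bound, but the lower bound on the superdiagonal depends on the point;
  so the selection is made separately on the sets \<open>E j\<close> with threshold
  \<open>1 / Suc j\<close> and glued along the least \<open>j\<close>.\<close>

lemma jordan_block_form_piece:
 assumes A: "A \<in> Mn_Linf M n" and n: "1 \<le> n" and p: "pframe M n (%l. fm n (A l)) m p"
  and L: "L \<in> sets borel" and rkL: "\<And>l k. l \<in> L ==> k < m ==> rk n (p k l) = \<rho> k"
 shows "jordan_block_form (restrict_space M L) n A"
proof (cases "AE l in M. l \<notin> L")
 case True
 have Ls: "L \<inter> space M \<in> sets M" using borel_sub[OF L] by simp
 show ?thesis by (rule null_jordan_block_form[OF _ n]) (use True AE_restrict_space_iff[OF Ls] in auto)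
next
 case False
 have Ls: "L \<inter> space M \<in> sets M" using borel_sub[OF L] by simp
 let ?M = "restrict_space M L"
 note bp = pframeD(1)[OF p] and ae = pframeD(2)[OF p]
 have ba: "bfm M n (%l. fm n (A l))" by (rule bfm_fm[OF A])
 obtain C where C: "0 \<le> C" "AE l in M. \<forall>k<m. mbd C (p k l)" using bfm_uniform_bound[of m M n p] bp by blast
 define ks where "ks = filter (%k. 0 < \<rho> k) [0..<m]"
 define m1 where "m1 = length ks"
 define nn where "nn k = \<rho> (ks ! k)" for k
 define p' where "p' k l = p (ks ! k) l" for k l
 have ksm: "ks ! k < m" "0 < \<rho> (ks ! k)" if "k < m1" for k
  using nth_mem[of k ks] that unfolding m1_def ks_def by auto
 have dks: "distinct ks" unfolding ks_def by simp
 define c where "c = max 1 (n * C)"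
 have c0: "0 \<le> c" unfolding c_def by simp
 have good: "AE l in M. l \<in> L --> (\<forall>k<m1. 0 < nn k) \<and> off nn m1 = n \<and>
  (\<exists>X Y \<epsilon>. rect n n X \<and> rect n n Y \<and> X * Y = e n \<and> Y * X = e n \<and> mbd c X \<and> mbd c Y \<and>
   block_form m1 nn (X * fm n (A l) * Y) \<and> 0 < \<epsilon> \<and> superdiag m1 nn \<epsilon> (X * fm n (A l) * Y))"
  using ae C(2)
 proof eventually_elim
  case elim0: (elim l)
  show ?case (is "_ --> ?G")
  proof
  assume lL: "l \<in> L"
  note elim = elim0 lL
  have pm: "pmin (fm n (A l)) (p' k l)" "rect n n (p' k l)" "mbd C (p' k l)" "rk n (p' k l) = nn k" if "k < m1" for k
   using elim ksm[OF that] bfmD(2)[OF bp[OF ksm(1)[OF that]]] rkL[OF elim(3) ksm(1)[OF that]] unfolding p'_def nn_def by auto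
  have rk0: "rk n 0 = 0" unfolding rk_def tr_def by simp
  show ?G unfolding c_def
  proof (rule frame_block_form[where P = "%k. p' k l"])
   show "p' k l \<noteq> 0" if "k < m1" for k using pm(4)[OF that] rk0 ksm(2)[OF that] unfolding nn_def by auto
   show "ortho {..<m1} (%k. p' k l)" unfolding ortho_def
   proof (intro ballI impI)
    fix i j assume "i \<in> {..<m1}" "j \<in> {..<m1}" "i \<noteq> j"
    then have "ks ! i \<noteq> ks ! j" "ks ! i < m" "ks ! j < m" using dks ksm nth_eq_iff_index_eq[of ks i j] unfolding m1_def by auto
    then show "p' i l * p' j l = 0" using elim(1) unfolding ortho_def p'_def by auto
   qed
   have "(\<Sum>k<m1. p' k l) = (\<Sum>k<m. p k l)" unfolding p'_def m1_def ks_def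
   proof (rule sum_filter_nth)
    fix k assume k: "k < m" "\<not> 0 < \<rho> k"
    then have 1: "rk n (p k l) = 0" using rkL[OF elim(3)] by simp
    have "pmin (fm n (A l)) (p k l)" using elim(1) k(1) by simp
    from rk_idem(3)[OF bfmD(2)[OF bp[OF k(1)]] pminD(1)[OF this] 1] show "p k l = 0" .
   qed
   then show "(\<Sum>k<m1. p' k l) = e n" using elim(1) by simp
   show "tr n (p' k l) = of_nat (nn k)" if "k < m1" for k
    using rk_idem(1)[OF pm(2)[OF that] pminD(1)[OF pm(1)[OF that]]] pm(4)[OF that] by simp
  qed (use pm in auto)
  qed
 qed
 \<comment> \<open>Positivity and sum of the block sizes do not mention the point, so a single good
   point of the non-null set \<open>L\<close> establishes them.\<close>
 have ex: "\<exists>l\<in>L. (\<forall>k<m1. 0 < nn k) \<and> off nn m1 = n"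
 proof (rule ccontr)
  assume "\<not> ?thesis"
  then have no: "\<not> ((\<forall>k<m1. 0 < nn k) \<and> off nn m1 = n)" if "l \<in> L" for l using that by blast
  have "AE l in M. l \<notin> L" using good by eventually_elim (use no in blast)
  with False show False ..
 qed
 then have nn0: "\<forall>k<m1. 0 < nn k" and offn: "off nn m1 = n" by auto
 have m1: "0 < m1" using offn n by (cases m1) auto
 define D where "D k l = fm n (A l)" for k :: nat and l
 have D: "mfm M n (D k)" for k unfolding D_def by (rule bfmD(1)[OF ba])
 define R where "R j x y \<longleftrightarrow> y 0 * y 1 = e n \<and> y 1 * y 0 = e n \<and> block_form m1 nn (y 0 * x 0 * y 1) \<and>
  superdiag m1 nn (1 / real (Suc j)) (y 0 * x 0 * y 1)" for j :: nat and x y :: "nat => fmat"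
 have cl: "closed {z. R j (%k. mk_fmat n n (fst z k)) (%k. mk_fmat n n (snd z k))}" for j
  unfolding R_def block_form_def superdiag_def
  by (intro closed_fm_intros closed_fm_eq[where n = n] cfm_const rect_e closed_fm_ent_eq[where n = n] closed_fm_ge[where n = n])
 define E where "E j = {l \<in> space M. \<exists>Y. (\<forall>k. rect n n (Y k) \<and> mbd c (Y k)) \<and> R j (%k. D k l) Y}" for j
 have Em: "E j \<in> sets M" for j unfolding E_def by (rule fmat_selection(1)[where R = "R j" and D = D, OF D c0 cl])
 have "\<exists>S. (\<forall>k. mfm M n (S k)) \<and> (\<forall>k l. mbd c (S k l)) \<and> (\<forall>l\<in>E j. R j (%k. D k l) (%k. S k l))" for j
  unfolding E_def by (rule fmat_selection(2)[where R = "R j" and D = D, OF D c0 cl])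
 then have "\<exists>S. \<forall>j. (\<forall>k. mfm M n (S j k)) \<and> (\<forall>k l. mbd c (S j k l)) \<and> (\<forall>l\<in>E j. R j (%k. D k l) (%k. S j k l))"
  by (intro choice) blast
 then obtain S where S: "\<forall>j. (\<forall>k. mfm M n (S j k)) \<and> (\<forall>k l. mbd c (S j k l)) \<and> (\<forall>l\<in>E j. R j (%k. D k l) (%k. S j k l))"
  by (rule exE)
 have Sm: "mfm M n (S j k)" and Sb: "mbd c (S j k l)" for j k l using S by auto
 have SR: "R j (%k. D k l) (%k. S j k l)" if "l \<in> E j" for j l using S that by auto
 define J where "J l = (LEAST j. l \<in> E j)" for l
 have Jm: "J \<in> measurable M (count_space UNIV)" unfolding J_def
 proof (rule measurable_Least)
  fix j
  have [measurable]: "E j \<in> sets M" by (rule Em)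
  show "Measurable.pred M (%l. l \<in> E j)" by measurable
 qed
 define G where "G k l = S (J l) k l" for k l
 have Gm: "mfm M n (G k)" for k
  unfolding mfm_def
 proof (intro conjI allI)
  show "rect n n (G k l)" for l unfolding G_def by (rule mfmD(1)[OF Sm])
  show "(%l. ent (G k l) i i') \<in> borel_measurable M" for i i' unfolding G_def
   by (rule measurable_compose_countable[OF mfmD(2)[OF Sm] Jm])
 qed
 have bG: "bfm M n (G k)" for k unfolding bfm_def using Gm[of k] Sb unfolding G_def by (intro conjI exI[of _ c]) auto
 have GR: "AE l in M. l \<in> L --> G 0 l * G 1 l = e n \<and> G 1 l * G 0 l = e n \<and> block_form m1 nn (G 0 l * fm n (A l) * G 1 l) \<and>
  superdiag m1 nn (1 / real (Suc (J l))) (G 0 l * fm n (A l) * G 1 l)"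
  using good
 proof eventually_elim
  case elim0: (elim l)
  show ?case (is "_ --> ?G")
  proof
  assume lL: "l \<in> L"
  note elim = mp[OF elim0 lL]
  obtain X Y \<epsilon> where XY: "rect n n X" "rect n n Y" "X * Y = e n" "Y * X = e n" "mbd c X" "mbd c Y"
   "block_form m1 nn (X * fm n (A l) * Y)" "0 < \<epsilon>" "superdiag m1 nn \<epsilon> (X * fm n (A l) * Y)"
   using elim by (elim exE conjE) (rule that)
  obtain j where j: "inverse (real (Suc j)) < \<epsilon>" using reals_Archimedean[OF XY(8)] by blast
  have "superdiag m1 nn (1 / real (Suc j)) (X * fm n (A l) * Y)"
   using XY(9) j unfolding superdiag_def by (force simp: inverse_eq_divide)
  then have "R j (%k. D k l) (%k. if k = 0 then X else Y)" unfolding R_def D_def using XY by simp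
  then have "l \<in> E j" unfolding E_def using XY by (intro CollectI conjI exI[of _ "%k. if k = 0 then X else Y"]) auto
  then have "l \<in> E (J l)" unfolding J_def by (rule LeastI[of "%j. l \<in> E j"])
  then have "R (J l) (%k. D k l) (%k. G k l)" unfolding G_def by (rule SR)
  then show ?G unfolding R_def D_def .
  qed
 qed
 define Cf where "Cf l = G 0 l * fm n (A l) * G 1 l" for l
 have bC: "bfm M n Cf" unfolding Cf_def by (intro bfm_mult bG ba)
 have rC: "rect n n (Cf l)" for l by (rule bfmD(2)[OF bC])
 have inL: "AE l in ?M. l \<in> L" by (simp add: AE_restrict_space_iff[OF Ls])
 have GR': "AE l in ?M. G 0 l * G 1 l = e n \<and> G 1 l * G 0 l = e n \<and> block_form m1 nn (Cf l) \<and>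
  superdiag m1 nn (1 / real (Suc (J l))) (Cf l)"
  using AE_restrictI[OF Ls GR] inL unfolding Cf_def by eventually_elim blast
 define X where "X l = tm n (G 0 l)" for l
 define Y where "Y l = tm n (G 1 l)" for l
 define B where "B k l = mat (nn k) (nn k) (%(i, j). ent (Cf l) (off nn k + i) (off nn k + j))" for k l
 have rG: "rect n n (G k l)" for k l by (rule bfmD(2)[OF bG])
 have XM: "X \<in> Mn_Linf ?M n" "Y \<in> Mn_Linf ?M n" unfolding X_def Y_def
  by (rule Mn_Linf_restrict[OF Ls bfm_tm[OF bG]])+
 have inv: "Mn_inverse_pair ?M n X Y" unfolding Mn_inverse_pair_def
 proof (intro conjI XM)
  show "AE l in ?M. X l * Y l = 1\<^sub>m n \<and> Y l * X l = 1\<^sub>m n" using GR'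
  proof eventually_elim
   case (elim l)
   show ?case unfolding X_def Y_def using tm_mult[OF rG rG, of 0 l 1 l] tm_mult[OF rG rG, of 1 l 0 l] elim by simp
  qed
 qed
 have BM: "B k \<in> Mn_Linf ?M (nn k)" for k
 proof -
  obtain D where D: "AE l in M. mbd D (Cf l)" using bC unfolding bfm_def by blast
  have "AE l in ?M. mbd D (Cf l)" by (rule AE_restrictI[OF Ls D])
  then have "AE l in ?M. cmod (ent (Cf l) i j) \<le> D" for i j by (auto simp: mbd_def)
  then show ?thesis using mfmD(2)[OF bfmD(1)[OF bC]] unfolding Mn_Linf_def B_def
   by (auto intro!: measurable_restrict_space1)
 qed
 have eq: "AE l in ?M. X l * A l * Y l = diag_block_mat (map (%k. B k l) [0..<m1])"
  using GR' AE_space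
 proof eventually_elim
  case (elim l)
  have c: "A l \<in> carrier_mat n n" using Mn_carrier[OF A] by simp
  have "tm n (Cf l) = tm n (G 0 l) * tm n (fm n (A l)) * tm n (G 1 l)"
   unfolding Cf_def tm_mult[OF rect_sq[OF rG rect_fm] rG] tm_mult[OF rG rect_fm] ..
  have "block_form m1 nn (Cf l)" using elim(1) by blast
  from tm_block_form[OF this offn] \<open>tm n (Cf l) = _\<close>[unfolded tm_fm[OF c]]
  show ?case unfolding X_def Y_def B_def by simp
 qed
 have off_eq: "off nn m1 = (\<Sum>k<m1. nn k)" by (simp add: off_def)
 show ?thesis unfolding jordan_block_form_def
 proof (intro exI conjI allI impI)
  show "0 < m1" by (rule m1)
  show "0 < nn k" if "k < m1" for k using nn0 that by blast
  show "(\<Sum>k<m1. nn k) = n" using offn off_eq by simp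
  show "Mn_inverse_pair ?M n X Y" by (rule inv)
  show "B k \<in> Mn_Linf ?M (nn k)" for k by (rule BM)
  show "AE l in ?M. X l * A l * Y l = diag_block_mat (map (%k. B k l) [0..<m1])" by (rule eq)
  fix k assume k: "k < m1"
  show "AE l in ?M. upper_triangular (B k l)" using GR'
   by eventually_elim (use k in \<open>auto simp: B_def block_form_def upper_triangular_def\<close>)
  show "AE l in ?M. B k l $$ (j, j) = B k l $$ (0, 0)" if j: "j < nn k" for j using GR'
  proof eventually_elim
   case (elim l)
   have "ent (Cf l) (off nn k + j) (off nn k + j) = ent (Cf l) (off nn k) (off nn k)"
    using elim k j unfolding block_form_def by blast
   then show ?case unfolding B_def using j by simp
  qed
  show "AE l in ?M. B k l $$ (j, Suc j) \<noteq> 0" if j: "Suc j < nn k" for j using GR'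
  proof eventually_elim
   case (elim l)
   have "1 / real (Suc (J l)) \<le> cmod (ent (Cf l) (off nn k + j) (off nn k + Suc j))"
    using elim k j unfolding superdiag_def by blast
   moreover have "0 < 1 / real (Suc (J l))" by simp
   ultimately have "ent (Cf l) (off nn k + j) (off nn k + Suc j) \<noteq> 0" by (metis norm_zero not_less)
   then show ?case unfolding B_def using j by simp
  qed
 qed
qed

text \<open>The pieces are Borel parts of the level sets of the vector of ranks, finitely many
  because ranks are at most \<open>n\<close>. The null remainder \<open>N\<close> of
  \<open>K\<close> is appended as the last piece.\<close>

lemma pframe_piecewise:
 assumes A: "A \<in> Mn_Linf M n" and n: "1 \<le> n" and p: "pframe M n (%l. fm n (A l)) m p"
 shows "piecewise_jordan_block_form K M n A"
proof -
 note bp = pframeD(1)[OF p] and ae = pframeD(2)[OF p]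
 define W where "W = {\<rho>. set \<rho> \<subseteq> {..n} \<and> length \<rho> = m}"
 have "finite W" unfolding W_def by (rule finite_lists_length_eq) simp
 then obtain ws where ws: "set ws = W" "distinct ws" using finite_distinct_list by blast
 define La where "La \<rho> = {l \<in> space M. \<forall>k\<in>{..<m}. rk n (p k l) = \<rho> ! k}" for \<rho>
 have La: "La \<rho> \<in> sets M" for \<rho>
 proof -
  have "{l \<in> space M. rk n (p k l) = c} \<in> sets M" if "k < m" for k c
   using measurable_sets[OF mfm_rk[OF bfmD(1)[OF bp[OF that]]], of "{c}"] by (simp add: vimage_def Int_def conj_commute)
  then show ?thesis unfolding La_def by (intro sets.sets_Collect_finite_All) auto
 qed
 have "\<exists>L. \<forall>\<rho>. L \<rho> \<in> sets borel \<and> L \<rho> \<subseteq> La \<rho> \<and> L \<rho> \<subseteq> K \<and> (AE l in M. l \<in> La \<rho> --> l \<in> L \<rho>)"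
  using borel_part[OF La] by (intro choice) blast
 then obtain Lb where Lb: "\<And>\<rho>. Lb \<rho> \<in> sets borel" "\<And>\<rho>. Lb \<rho> \<subseteq> La \<rho>" "\<And>\<rho>. Lb \<rho> \<subseteq> K" "\<And>\<rho>. AE l in M. l \<in> La \<rho> --> l \<in> Lb \<rho>"
  by blast
 define r where "r = length ws"
 define N where "N = K - (\<Union>\<rho>\<in>W. Lb \<rho>)"
 define L where "L t = (if t < r then Lb (ws ! t) else N)" for t
 have Nb: "N \<in> sets borel" unfolding N_def using K(1) Lb(1) \<open>finite W\<close> by blast
 have "AE l in M. \<forall>\<rho>\<in>W. l \<in> La \<rho> --> l \<in> Lb \<rho>" by (rule AE_finite_allI[OF \<open>finite W\<close>]) (rule Lb(4))
 then have Nn: "AE l in M. l \<notin> N" using ae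
 proof eventually_elim
  case (elim l)
  define \<rho> where "\<rho> = map (%k. rk n (p k l)) [0..<m]"
  have "rk n (p k l) \<le> n" if "k < m" for k
   by (rule rk_idem(2)[OF bfmD(2)[OF bp[OF that]]]) (use elim(2) that pminD(1) in blast)
  then have "\<rho> \<in> W" unfolding W_def \<rho>_def by auto
  moreover have "l \<in> La \<rho>" unfolding La_def \<rho>_def by auto
  ultimately show ?case using elim(1) unfolding N_def by blast
 qed
 have LaD: "La \<rho> \<inter> La \<rho>' = {}" if "\<rho> \<in> W" "\<rho>' \<in> W" "\<rho> \<noteq> \<rho>'" for \<rho> \<rho>'
 proof (rule ccontr)
  assume "La \<rho> \<inter> La \<rho>' \<noteq> {}"
  then obtain l where "l \<in> La \<rho>" "l \<in> La \<rho>'" by blast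
  then have "\<rho> ! k = \<rho>' ! k" if "k < m" for k using that unfolding La_def by auto
  then have "\<rho> = \<rho>'" using that(1,2) unfolding W_def by (auto intro: nth_equalityI)
  then show False using that by blast
 qed
 have wsW: "ws ! t \<in> W" if "t < r" for t using ws that nth_mem unfolding r_def by blast
 show ?thesis unfolding piecewise_jordan_block_form_def
 proof (intro exI[of _ "Suc r"] exI[of _ L] conjI allI impI)
  show "L t \<in> sets borel" for t unfolding L_def using Lb(1) Nb by simp
  show "disjoint_family_on L {..<Suc r}" unfolding disjoint_family_on_def
  proof (intro ballI impI)
   fix t u assume tu: "t \<in> {..<Suc r}" "u \<in> {..<Suc r}" "t \<noteq> u"
   have LN: "Lb (ws ! t) \<inter> N = {}" if "t < r" for t unfolding N_def using wsW[OF that] by blast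
   consider "t < r" "u < r" | "t < r" "\<not> u < r" | "\<not> t < r" "u < r" using tu by force
   then show "L t \<inter> L u = {}"
   proof cases
    case 1
    then have "ws ! t \<noteq> ws ! u" using ws(2) tu(3) nth_eq_iff_index_eq unfolding r_def by blast
    then show ?thesis unfolding L_def using 1 LaD[OF wsW wsW, of t u] Lb(2) by auto
   next
    case 2 then show ?thesis unfolding L_def using LN[of t] by simp
   next
    case 3 then show ?thesis unfolding L_def using LN[of u] by auto
   qed
  qed
  have "(\<Union>t<r. Lb (ws ! t)) = (\<Union>\<rho>\<in>W. Lb \<rho>)"
  proof -
   have "W = (!) ws ` {..<r}" using ws(1) unfolding r_def by (auto simp: set_conv_nth)
   then show ?thesis by simp
  qed
  moreover have "(\<Union>t<Suc r. L t) = (\<Union>t<r. Lb (ws ! t)) \<union> N"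
   unfolding lessThan_Suc UN_insert L_def by auto
  moreover have "(\<Union>\<rho>\<in>W. Lb \<rho>) \<subseteq> K" by (rule UN_least) (rule Lb(3))
  ultimately show "(\<Union>t<Suc r. L t) = K" unfolding N_def by (simp add: Un_absorb1)
  fix t assume "t < Suc r"
  show "jordan_block_form (restrict_space M (L t)) n A"
  proof (cases "t < r")
   case True
   show ?thesis
   proof (rule jordan_block_form_piece[OF A n p])
    show "L t \<in> sets borel" unfolding L_def using Lb(1) Nb by simp
    show "rk n (p k l) = (ws ! t) ! k" if "l \<in> L t" "k < m" for l k
     using that Lb(2)[of "ws ! t"] True unfolding L_def La_def by auto
   qed
  next
   case False
   have Ns: "N \<inter> space M \<in> sets M" using borel_sub[OF Nb] by simp
   show ?thesis unfolding L_def using False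
    by (auto intro!: null_jordan_block_form[OF _ n] simp: AE_restrict_space_iff[OF Ns] Nn)
  qed
 qed
qed

end

section \<open>Direct integrals\<close>

definition l2 :: "(nat => complex) => bool" where "l2 x \<longleftrightarrow> summable (%i. (cmod (x i))\<^sup>2)"
text \<open>The squared norm, with value 0 off the square-summable sequences so that it is
  nonnegative without a premise.\<close>

definition sq :: "(nat => complex) => real" where "sq x = (if l2 x then \<Sum>i. (cmod (x i))\<^sup>2 else 0)"

lemma sq_eq: "l2 x ==> sq x = (\<Sum>i. (cmod (x i))\<^sup>2)"
 by (simp add: sq_def)
definition ip :: "(nat => complex) => (nat => complex) => complex" where "ip x y = (\<Sum>i. x i * cnj (y i))"

lemma cmod_add_sq: "(cmod (a + b))\<^sup>2 \<le> 2 * (cmod a)\<^sup>2 + 2 * (cmod b)\<^sup>2"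
proof -
 have "(cmod (a + b))\<^sup>2 \<le> (cmod a + cmod b)\<^sup>2" by (intro power_mono norm_triangle_ineq norm_ge_zero)
 also have "\<dots> \<le> 2 * (cmod a)\<^sup>2 + 2 * (cmod b)\<^sup>2"
  using zero_le_power2[of "cmod a - cmod b"] by (simp add: power2_eq_square algebra_simps)
 finally show ?thesis .
qed

lemma l2_add: "l2 x ==> l2 y ==> l2 (%i. x i + y i)"
 and sq_add: "l2 x ==> l2 y ==> sq (%i. x i + y i) \<le> 2 * sq x + 2 * sq y"
proof -
 assume xy: "l2 x" "l2 y"
 then have s: "summable (%i. 2 * (cmod (x i))\<^sup>2 + 2 * (cmod (y i))\<^sup>2)"
  unfolding l2_def by (intro summable_add summable_mult)
 show l: "l2 (%i. x i + y i)" unfolding l2_def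
  by (rule summable_comparison_test'[OF s, of 0]) (use cmod_add_sq in auto)
 have "sq (%i. x i + y i) \<le> (\<Sum>i. 2 * (cmod (x i))\<^sup>2 + 2 * (cmod (y i))\<^sup>2)"
  unfolding sq_eq[OF l] by (rule suminf_le[OF cmod_add_sq l[unfolded l2_def] s])
 also have "\<dots> = 2 * sq x + 2 * sq y" unfolding sq_eq[OF xy(1)] sq_eq[OF xy(2)]
  using xy unfolding l2_def by (simp add: suminf_add[symmetric] suminf_mult[symmetric] summable_mult)
 finally show "sq (%i. x i + y i) \<le> 2 * sq x + 2 * sq y" .
qed

lemma l2_scale: "l2 x ==> l2 (%i. c * x i)"
 unfolding l2_def by (simp add: norm_mult power_mult_distrib summable_mult)

lemma sq_scale: "l2 x ==> sq (%i. c * x i) = (cmod c)\<^sup>2 * sq x"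
 using l2_scale[of x c] by (simp add: sq_eq norm_mult power_mult_distrib suminf_mult l2_def)

lemma l2_zero [simp]: "l2 (%i. 0)" and sq_0 [simp]: "sq (%i. 0) = 0"
 unfolding l2_def sq_def by simp_all

lemma sq_nonneg: "0 \<le> sq x"
proof (cases "l2 x")
 case True then show ?thesis unfolding sq_eq[OF True] l2_def by (intro suminf_nonneg) auto
next
 case False then show ?thesis unfolding sq_def by simp
qed

lemma l2_finite: "(\<And>i. N \<le> i ==> x i = 0) ==> l2 x"
 unfolding l2_def by (rule summable_finite[of "{..<N}"]) (auto simp: not_less)

lemma sq_finite: "(\<And>i. N \<le> i ==> x i = 0) ==> sq x = (\<Sum>i<N. (cmod (x i))\<^sup>2)"
 by (subst sq_eq[OF l2_finite], assumption) (rule suminf_finite, auto simp: not_less)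

lemma sum_le_sq: "l2 x ==> finite I ==> (\<Sum>i\<in>I. (cmod (x i))\<^sup>2) \<le> sq x"
 unfolding sq_eq unfolding l2_def by (rule sum_le_suminf) auto

lemma coord_le_sq: "l2 x ==> (cmod (x i))\<^sup>2 \<le> sq x"
 using sum_le_sq[of x "{i}"] by simp

lemma sq_eq_0: "l2 x ==> sq x = 0 ==> x i = 0"
 using coord_le_sq[of x i] by simp

lemma ip_summable_norm: "l2 x ==> l2 y ==> summable (%i. cmod (x i * cnj (y i)))"
proof -
 assume "l2 x" "l2 y"
 then have s: "summable (%i. (cmod (x i))\<^sup>2 + (cmod (y i))\<^sup>2)" unfolding l2_def by (rule summable_add)
 show ?thesis
 proof (rule summable_comparison_test'[OF s, of 0])
  fix i
  have "0 \<le> (cmod (x i) - cmod (y i))\<^sup>2" by simp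
  then have 1: "2 * (cmod (x i) * cmod (y i)) \<le> (cmod (x i))\<^sup>2 + (cmod (y i))\<^sup>2"
   by (simp add: power2_eq_square algebra_simps)
  have 2: "0 \<le> cmod (x i) * cmod (y i)" by simp
  have "norm (cmod (x i * cnj (y i))) = cmod (x i) * cmod (y i)" by (simp add: norm_mult)
  then show "norm (cmod (x i * cnj (y i))) \<le> (cmod (x i))\<^sup>2 + (cmod (y i))\<^sup>2" using 1 2 by linarith
 qed
qed

lemma ip_summable: "l2 x ==> l2 y ==> summable (%i. x i * cnj (y i))"
 by (rule summable_norm_cancel[OF ip_summable_norm])

lemma ip_self: "l2 x ==> ip x x = of_real (sq x)"
 unfolding ip_def by (simp add: sq_eq l2_def suminf_of_real complex_norm_square del: of_real_power)

lemma ip_add_left: "l2 x ==> l2 y ==> l2 z ==> ip (%i. x i + y i) z = ip x z + ip y z"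
 unfolding ip_def by (subst suminf_add) (simp_all add: ip_summable algebra_simps)
lemma ip_scale_left: "l2 x ==> l2 z ==> ip (%i. c * x i) z = c * ip x z"
 unfolding ip_def by (subst suminf_mult[symmetric]) (simp_all add: ip_summable mult_ac)
lemma ip_cnj: "l2 x ==> l2 y ==> ip y x = cnj (ip x y)"
proof -
 assume "l2 x" "l2 y"
 then have "(%i. x i * cnj (y i)) sums ip x y" unfolding ip_def by (intro summable_sums ip_summable)
 then have "(%i. cnj (x i * cnj (y i))) sums cnj (ip x y)" by (rule sums_cnj[THEN iffD2])
 then show ?thesis unfolding ip_def by (simp add: mult.commute sums_iff)
qed

lemma cauchy_schwarz:
 assumes "l2 x" "l2 y" shows "(cmod (ip x y))\<^sup>2 \<le> sq x * sq y"
proof -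
 have "(%n. (cmod (\<Sum>i<n. x i * cnj (y i)))\<^sup>2) \<longlonglongrightarrow> (cmod (ip x y))\<^sup>2"
  unfolding ip_def by (intro tendsto_intros summable_LIMSEQ ip_summable assms)
 then show ?thesis
 proof (rule LIMSEQ_le_const2, intro exI allI impI)
  fix n
  have "cmod (\<Sum>i<n. x i * cnj (y i)) \<le> (\<Sum>i<n. cmod (x i) * cmod (y i))"
   by (rule order_trans[OF norm_sum]) (simp add: norm_mult)
  then have "(cmod (\<Sum>i<n. x i * cnj (y i)))\<^sup>2 \<le> (\<Sum>i<n. cmod (x i) * cmod (y i))\<^sup>2"
   by (intro power_mono) auto
  also have "\<dots> \<le> (\<Sum>i<n. (cmod (x i))\<^sup>2) * (\<Sum>i<n. (cmod (y i))\<^sup>2)" by (rule Cauchy_Schwarz_ineq_sum)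
  also have "\<dots> \<le> sq x * sq y" by (intro mult_mono sum_le_sq assms sq_nonneg sum_nonneg) auto
  finally show "(cmod (\<Sum>i<n. x i * cnj (y i)))\<^sup>2 \<le> sq x * sq y" .
 qed
qed

lemma cmod_ip_le: "l2 x ==> l2 y ==> cmod (ip x y) \<le> sq x + sq y"
proof (rule power2_le_imp_le)
 assume "l2 x" "l2 y"
 then have "(cmod (ip x y))\<^sup>2 \<le> sq x * sq y" by (rule cauchy_schwarz)
 also have "\<dots> \<le> (sq x + sq y)\<^sup>2" using sq_nonneg[of x] sq_nonneg[of y]
  by (simp add: power2_eq_square algebra_simps)
 finally show "(cmod (ip x y))\<^sup>2 \<le> (sq x + sq y)\<^sup>2" .
qed (simp add: sq_nonneg)

lemma hdim_simps [simp]: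
 "x \<in> vecs (hdim d) \<longleftrightarrow> l2 x \<and> (\<forall>i. d \<le> enat i --> x i = 0)"
 "vadd (hdim d) = (%x y i. x i + y i)" "vscale (hdim d) = (%c x i. c * x i)" "vinner (hdim d) = ip"
 by (simp_all add: hdim_def l2_def ip_def[abs_def])

lemma vnorm_hdim: "l2 x ==> vnorm (hdim d) x = sqrt (sq x)"
 by (simp add: vnorm_def ip_self)

lemma heq_hdim: "l2 x ==> l2 y ==> heq (hdim d) x y \<longleftrightarrow> x = y"
proof -
 assume l: "l2 x" "l2 y"
 have d: "l2 (%i. x i + - 1 * y i)" by (intro l2_add l2_scale l)
 have "heq (hdim d) x y \<longleftrightarrow> sq (%i. x i + - 1 * y i) = 0" unfolding heq_def by (simp add: vnorm_hdim[OF d, simplified])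
 also have "\<dots> \<longleftrightarrow> x = y"
 proof
  assume "sq (%i. x i + - 1 * y i) = 0"
  from sq_eq_0[OF d this] show "x = y" by (simp add: fun_eq_iff)
 qed simp
 finally show ?thesis .
qed

section \<open>Vectors and bounded operators of a direct integral\<close>

text \<open>The vectors of \<open>direct_integral N d\<close> with all records unfolded; together
  with \<open>ip\<close> and the squared norm \<open>nrm\<close> it replaces the record in the
  arguments below.\<close>

definition DV :: "'a measure => ('a => enat) => ('a => nat => complex) => bool" where
 "DV N d f \<longleftrightarrow> (\<forall>g. l2 (f g)) \<and> (\<forall>g i. d g \<le> enat i --> f g i = 0) \<and> (\<forall>i. (%g. f g i) \<in> borel_measurable N) \<and>
  integrable N (%g. sq (f g))"

lemma DVD: "DV N d f ==> l2 (f g)" "DV N d f ==> d g \<le> enat i ==> f g i = 0"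
  "DV N d f ==> (%g. f g i) \<in> borel_measurable N" "DV N d f ==> integrable N (%g. sq (f g))"
 unfolding DV_def by blast+

lemma direct_integral_simps [simp]:
 "f \<in> vecs (direct_integral N d) \<longleftrightarrow> DV N d f"
 "vadd (direct_integral N d) = (%f h g i. f g i + h g i)" "vscale (direct_integral N d) = (%c f g i. c * f g i)"
 "vinner (direct_integral N d) = (%f h. LINT g|N. ip (f g) (h g))"
proof -
 have "(vnorm (hdim (d g)) (f g))\<^sup>2 = sq (f g)" if "l2 (f g)" for g
  using vnorm_hdim[OF that] sq_nonneg by simp
 then have "(\<forall>g. l2 (f g)) ==> (%g. (vnorm (hdim (d g)) (f g))\<^sup>2) = (%g. sq (f g))" by auto
 then show "f \<in> vecs (direct_integral N d) \<longleftrightarrow> DV N d f"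
  unfolding DV_def by (auto simp: direct_integral_def simp del: vnorm_def)
qed (simp_all add: direct_integral_def)

lemma meas_sq:
 assumes [measurable]: "\<And>i. (%g. f g i) \<in> borel_measurable N" and "\<And>g. l2 (f g)"
 shows "(%g. sq (f g)) \<in> borel_measurable N"
 unfolding sq_eq[OF assms(2)] by measurable

lemma meas_ip:
 assumes [measurable]: "\<And>i. (%g. f g i) \<in> borel_measurable N" "\<And>i. (%g. h g i) \<in> borel_measurable N"
 shows "(%g. ip (f g) (h g)) \<in> borel_measurable N"
proof -
 have [measurable]: "(%g. cnj (h g i)) \<in> borel_measurable N" for i
  by (rule measurable_compose[OF assms(2)]) (intro borel_measurable_continuous_onI continuous_intros)
 show ?thesis unfolding ip_def by measurable
qed

lemma DV_bound:
 assumes "\<And>g. l2 (f g)" "\<And>g i. d g \<le> enat i ==> f g i = 0" "\<And>i. (%g. f g i) \<in> borel_measurable N"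
  "integrable N h" "AE g in N. sq (f g) \<le> h g"
 shows "DV N d f"
 unfolding DV_def
proof (intro conjI allI impI assms)
 show "integrable N (%g. sq (f g))"
  by (rule Bochner_Integration.integrable_bound[OF assms(4) meas_sq[OF assms(3,1)]])
   (use assms(5) in eventually_elim, use sq_nonneg in \<open>auto intro: order_trans\<close>)
qed

lemma DV_add: assumes f: "DV N d f" and h: "DV N d h" shows "DV N d (%g i. f g i + h g i)"
proof (rule DV_bound)
 show "integrable N (%g. 2 * sq (f g) + 2 * sq (h g))" using DVD(4)[OF f] DVD(4)[OF h] by simp
qed (use DVD[OF f] DVD[OF h] in \<open>auto intro: l2_add intro!: AE_I2 sq_add\<close>)

lemma DV_scale: assumes f: "DV N d f" shows "DV N d (%g i. c * f g i)"
proof (rule DV_bound)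
 show "integrable N (%g. (cmod c)\<^sup>2 * sq (f g))" using DVD(4)[OF f] by simp
qed (use DVD[OF f] in \<open>auto intro: l2_scale simp: sq_scale\<close>)

text \<open>Multiplication by the characteristic function of \<open>S\<close>. Cuts stand in for the
  whole diagonal algebra below.\<close>

definition cut :: "'a set => ('a => nat => complex) => 'a => nat => complex" where
 "cut S f = (%g i. if g \<in> S then f g i else 0)"

lemma cut_in: "g \<in> S ==> cut S f g = f g" and cut_out: "g \<notin> S ==> cut S f g = (%i. 0)"
 by (simp_all add: cut_def)

lemma DV_cut: assumes S: "S \<in> sets N" and f: "DV N d f" shows "DV N d (cut S f)"
proof (rule DV_bound[OF _ _ _ DVD(4)[OF f]])
 show "l2 (cut S f g)" for g using DVD(1)[OF f, of g] by (cases "g \<in> S") (simp_all add: cut_in cut_out)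
 show "cut S f g i = 0" if "d g \<le> enat i" for g i using DVD(2)[OF f that] by (simp add: cut_def)
 show "(%g. cut S f g i) \<in> borel_measurable N" for i unfolding cut_def
  by (rule measurable_If_set[OF DVD(3)[OF f]]) (use S in auto)
 show "AE g in N. sq (cut S f g) \<le> sq (f g)"
 proof (rule AE_I2)
  fix g show "sq (cut S f g) \<le> sq (f g)" using sq_nonneg[of "f g"] by (cases "g \<in> S") (simp_all add: cut_in cut_out)
 qed
qed

lemma ip_integrable: assumes f: "DV N d f" and h: "DV N d h" shows "integrable N (%g. ip (f g) (h g))"
proof (rule Bochner_Integration.integrable_bound)
 show "integrable N (%g. sq (f g) + sq (h g))" using DVD(4)[OF f] DVD(4)[OF h] by simp
 show "(%g. ip (f g) (h g)) \<in> borel_measurable N" by (rule meas_ip[OF DVD(3)[OF f] DVD(3)[OF h]])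
 show "AE g in N. norm (ip (f g) (h g)) \<le> norm (sq (f g) + sq (h g))"
  using cmod_ip_le[OF DVD(1)[OF f] DVD(1)[OF h]] sq_nonneg by (intro AE_I2) (metis abs_of_nonneg add_nonneg_nonneg real_norm_def)
qed

definition nrm :: "'a measure => ('a => nat => complex) => real" where "nrm N f = (LINT g|N. sq (f g))"

lemma nrm_nonneg: "0 \<le> nrm N f" unfolding nrm_def by (rule integral_nonneg_AE) (simp add: sq_nonneg)

lemma ip_nrm: "DV N d f ==> (LINT g|N. ip (f g) (f g)) = of_real (nrm N f)"
 unfolding nrm_def by (simp add: ip_self[OF DVD(1)])

lemma vnorm_DI: "DV N d f ==> vnorm (direct_integral N d) f = sqrt (nrm N f)"
 unfolding vnorm_def by (simp add: ip_nrm)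

lemma nrm_eq_0: "DV N d f ==> nrm N f = 0 \<longleftrightarrow> (AE g in N. f g = (%i. 0))"
proof -
 assume f: "DV N d f"
 have "nrm N f = 0 \<longleftrightarrow> (AE g in N. sq (f g) = 0)" unfolding nrm_def
  by (rule integral_nonneg_eq_0_iff_AE[OF DVD(4)[OF f]]) (simp add: sq_nonneg)
 also have "\<dots> \<longleftrightarrow> (AE g in N. f g = (%i. 0))"
  proof (intro AE_cong iffI)
  fix g assume "sq (f g) = 0" then show "f g = (%i. 0)" using sq_eq_0[OF DVD(1)[OF f, of g]] by auto
 qed simp
 finally show ?thesis .
qed

lemma heq_DI: assumes f: "DV N d f" and h: "DV N d h"
 shows "heq (direct_integral N d) f h \<longleftrightarrow> (AE g in N. f g = h g)"
proof -
 have d: "DV N d (%g i. f g i + - 1 * h g i)" by (intro DV_add DV_scale f h)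
 have "heq (direct_integral N d) f h \<longleftrightarrow> nrm N (%g i. f g i + - 1 * h g i) = 0"
  unfolding heq_def by (simp add: vnorm_DI[OF d, simplified])
 also have "\<dots> \<longleftrightarrow> (AE g in N. f g = h g)" unfolding nrm_eq_0[OF d] by (intro AE_cong) (auto simp: fun_eq_iff)
 finally show ?thesis .
qed

text \<open>Equality up to \<open>heq\<close> turns into equality almost everywhere, and the norm
  estimate is squared so that it can be read as an inequality between integrals.\<close>

lemma bounded_op_DI:
 "bounded_op (direct_integral N d) (direct_integral N' d') T \<longleftrightarrow>
  (\<forall>f. DV N d f --> DV N' d' (T f)) \<and>
  (\<forall>f. DV N d f --> (\<forall>h. DV N d h --> (AE g in N'. T (%g i. f g i + h g i) g = (%i. T f g i + T h g i)))) \<and>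
  (\<forall>c f. DV N d f --> (AE g in N'. T (%g i. c * f g i) g = (%i. c * T f g i))) \<and>
  (\<exists>C\<ge>0. \<forall>f. DV N d f --> nrm N' (T f) \<le> C * nrm N f)" (is "?L \<longleftrightarrow> ?R1 \<and> ?R2 \<and> ?R3 \<and> ?R4")
proof -
 have 4: "(\<exists>C. \<forall>f. DV N d f --> vnorm (direct_integral N' d') (T f) \<le> C * vnorm (direct_integral N d) f) \<longleftrightarrow> ?R4" if ?R1
 proof
  assume "\<exists>C. \<forall>f. DV N d f --> vnorm (direct_integral N' d') (T f) \<le> C * vnorm (direct_integral N d) f"
  then obtain C where C: "\<And>f. DV N d f ==> sqrt (nrm N' (T f)) \<le> C * sqrt (nrm N f)"
  proof (rule exE, goal_cases)
   case prems: (1 C)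
   have "\<And>f. DV N d f ==> sqrt (nrm N' (T f)) \<le> C * sqrt (nrm N f)" using prems(2) \<open>?R1\<close> by (simp add: vnorm_DI)
   then show ?case by (rule prems(1))
  qed
  have "nrm N' (T f) \<le> C\<^sup>2 * nrm N f" if "DV N d f" for f
  proof -
   have "(sqrt (nrm N' (T f)))\<^sup>2 \<le> (C * sqrt (nrm N f))\<^sup>2" by (intro power_mono C that) (simp add: nrm_nonneg)
   then show ?thesis by (simp add: nrm_nonneg power_mult_distrib)
  qed
  then show ?R4 by (intro exI[of _ "C\<^sup>2"]) auto
 next
  assume ?R4
  then obtain C where C: "C \<ge> 0" "\<And>f. DV N d f ==> nrm N' (T f) \<le> C * nrm N f" by blast
  have "vnorm (direct_integral N' d') (T f) \<le> sqrt C * vnorm (direct_integral N d) f" if "DV N d f" for f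
   using C(2)[OF that] \<open>?R1\<close> that by (simp add: vnorm_DI real_sqrt_mult[symmetric])
  then show "\<exists>C. \<forall>f. DV N d f --> vnorm (direct_integral N' d') (T f) \<le> C * vnorm (direct_integral N d) f" by blast
 qed
 have 2: "(\<forall>f. DV N d f --> (\<forall>h. DV N d h --> heq (direct_integral N' d') (T (%g i. f g i + h g i)) (%g i. T f g i + T h g i))) \<longleftrightarrow> ?R2" if ?R1
  using that by (auto simp: heq_DI DV_add)
 have 3: "(\<forall>c f. DV N d f --> heq (direct_integral N' d') (T (%g i. c * f g i)) (%g i. c * T f g i)) \<longleftrightarrow> ?R3" if ?R1
  using that by (auto simp: heq_DI DV_scale)
 show ?thesis
 proof (cases ?R1)
  case True
  show ?thesis unfolding bounded_op_def direct_integral_simps Ball_def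
   by (simp only: 2[OF True] 3[OF True] 4[OF True])
 next
  case False
  then show ?thesis unfolding bounded_op_def direct_integral_simps Ball_def by (simp only: simp_thms)
 qed
qed

lemma bounded_op_DI_D:
 assumes "bounded_op (direct_integral N d) (direct_integral N' d') T"
 shows "\<And>f. DV N d f ==> DV N' d' (T f)"
  and "\<And>f h. DV N d f ==> DV N d h ==> AE g in N'. T (%g i. f g i + h g i) g = (%i. T f g i + T h g i)"
  and "\<And>c f. DV N d f ==> AE g in N'. T (%g i. c * f g i) g = (%i. c * T f g i)"
  and "\<exists>C\<ge>0. \<forall>f. DV N d f --> nrm N' (T f) \<le> C * nrm N f"
proof -
 note b = assms[unfolded bounded_op_DI]
 note 1 = conjunct1[OF b] and 2 = conjunct1[OF conjunct2[OF b]] and 3 = conjunct1[OF conjunct2[OF conjunct2[OF b]]]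
 show "\<And>f. DV N d f ==> DV N' d' (T f)" by (rule 1[rule_format])
 show "\<And>f h. DV N d f ==> DV N d h ==> AE g in N'. T (%g i. f g i + h g i) g = (%i. T f g i + T h g i)"
  by (rule 2[rule_format])
 show "\<And>c f. DV N d f ==> AE g in N'. T (%g i. c * f g i) g = (%i. c * T f g i)" by (rule 3[rule_format])
 show "\<exists>C\<ge>0. \<forall>f. DV N d f --> nrm N' (T f) \<le> C * nrm N f" by (rule conjunct2[OF conjunct2[OF conjunct2[OF b]]])
qed

text \<open>The difference of \<open>f\<close> and \<open>h\<close> has norm 0, and so has its
  image. Operators act on representatives, so this is invoked whenever an argument is replaced by an
  equivalent one.\<close>

lemma op_cong:
 assumes T: "bounded_op (direct_integral N d) (direct_integral N' d') T" and f: "DV N d f" and h: "DV N d h"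
  and eq: "AE g in N. f g = h g"
 shows "AE g in N'. T f g = T h g"
proof -
 note b = bounded_op_DI_D[OF T]
 obtain C where C: "\<And>f. DV N d f ==> nrm N' (T f) \<le> C * nrm N f" using b(4) by (elim exE conjE) (rule that, blast+)
 define u where "u = (%g i. f g i + - 1 * h g i)"
 have mh: "DV N d (%g i. - 1 * h g i)" by (rule DV_scale[OF h])
 have du: "DV N d u" unfolding u_def by (rule DV_add[OF f mh])
 have "nrm N u = 0"
 proof (rule nrm_eq_0[OF du, THEN iffD2])
  show "AE g in N. u g = (%i. 0)" using eq by eventually_elim (simp add: u_def fun_eq_iff)
 qed
 then have "nrm N' (T u) = 0" using C[OF du] nrm_nonneg[of N' "T u"] by simp
 then have "AE g in N'. T u g = (%i. 0)" using nrm_eq_0[OF b(1)[OF du]] by blast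
 moreover have "AE g in N'. T u g = (%i. T f g i + T (%g i. - 1 * h g i) g i)" unfolding u_def by (rule b(2)[OF f mh])
 moreover have "AE g in N'. T (%g i. - 1 * h g i) g = (%i. - 1 * T h g i)" by (rule b(3)[OF h])
 ultimately show ?thesis by eventually_elim (simp add: fun_eq_iff)
qed

lemma bounded_op_comp:
 assumes T: "bounded_op (direct_integral N d) (direct_integral N' d') T"
  and S: "bounded_op (direct_integral N' d') (direct_integral N'' d'') S"
 shows "bounded_op (direct_integral N d) (direct_integral N'' d'') (S \<circ> T)"
proof -
 note b = bounded_op_DI_D[OF T] and c = bounded_op_DI_D[OF S]
 obtain C where C: "C \<ge> 0" "\<And>f. DV N d f ==> nrm N' (T f) \<le> C * nrm N f" using b(4) by (elim exE conjE) (rule that, blast+)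
 obtain D where D: "D \<ge> 0" "\<And>f. DV N' d' f ==> nrm N'' (S f) \<le> D * nrm N' f" using c(4) by (elim exE conjE) (rule that, blast+)
 have TV: "DV N d f ==> DV N' d' (T f)" for f by (rule b(1))
 show ?thesis unfolding bounded_op_DI comp_def
 proof (intro conjI allI impI exI[of _ "D * C"])
  show "DV N'' d'' (S (T f))" if "DV N d f" for f by (rule c(1)[OF b(1)[OF that]])
  show "AE g in N''. S (T (%g i. f g i + h g i)) g = (%i. S (T f) g i + S (T h) g i)" if "DV N d f" "DV N d h" for f h
  proof -
   have "AE g in N'. T (%g i. f g i + h g i) g = (%i. T f g i + T h g i)" by (rule b(2)[OF that])
   from op_cong[OF S TV[OF DV_add[OF that]] DV_add[OF TV[OF that(1)] TV[OF that(2)]] this]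
   have "AE g in N''. S (T (%g i. f g i + h g i)) g = S (%g i. T f g i + T h g i) g" .
   moreover have "AE g in N''. S (%g i. T f g i + T h g i) g = (%i. S (T f) g i + S (T h) g i)" by (rule c(2)[OF TV[OF that(1)] TV[OF that(2)]])
   ultimately show ?thesis by eventually_elim simp
  qed
  show "AE g in N''. S (T (%g i. k * f g i)) g = (%i. k * S (T f) g i)" if "DV N d f" for k f
  proof -
   have "AE g in N'. T (%g i. k * f g i) g = (%i. k * T f g i)" by (rule b(3)[OF that])
   from op_cong[OF S TV[OF DV_scale[OF that]] DV_scale[OF TV[OF that]] this]
   have "AE g in N''. S (T (%g i. k * f g i)) g = S (%g i. k * T f g i) g" .
   moreover have "AE g in N''. S (%g i. k * T f g i) g = (%i. k * S (T f) g i)" by (rule c(3)[OF TV[OF that]])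
   ultimately show ?thesis by eventually_elim simp
  qed
  show "0 \<le> D * C" using C D by simp
  show "nrm N'' (S (T f)) \<le> D * C * nrm N f" if "DV N d f" for f
  proof -
   have "nrm N'' (S (T f)) \<le> D * nrm N' (T f)" by (rule D(2)[OF TV[OF that]])
   also have "\<dots> \<le> D * (C * nrm N f)" using C D that by (intro mult_left_mono) auto
   finally show ?thesis by simp
  qed
 qed
qed

lemma nrm_cut: "S \<in> sets N ==> nrm N (cut S f) = (LINT g|N. indicator S g * sq (f g))"
proof -
 have "sq (cut S f g) = indicator S g * sq (f g)" for g by (cases "g \<in> S") (simp_all add: cut_in cut_out)
 then show ?thesis unfolding nrm_def by simp
qed

text \<open>Tested on the set where the inequality fails. Combined with cuts, it localises
  integrated estimates to almost every fibre.\<close>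

lemma AE_le_of_integrals:
 fixes f h :: "'a => real"
 assumes f: "integrable N f" and h: "integrable N h"
  and le: "\<And>S. S \<in> sets N ==> (LINT g|N. indicator S g * f g) \<le> (LINT g|N. indicator S g * h g)"
 shows "AE g in N. f g \<le> h g"
proof -
 have [measurable]: "f \<in> borel_measurable N" "h \<in> borel_measurable N" using f h by auto
 define S where "S = {g \<in> space N. h g < f g}"
 have S: "S \<in> sets N" unfolding S_def by measurable
 have i: "integrable N (%g. indicator S g * f g)" "integrable N (%g. indicator S g * h g)"
  using integrable_mult_indicator[OF S f] integrable_mult_indicator[OF S h] by simp_all
 have ii: "integrable N (%g. indicator S g * f g - indicator S g * h g)" using i by simp
 have nn: "AE g in N. 0 \<le> indicator S g * f g - indicator S g * h g"
  by (intro AE_I2) (auto simp: S_def indicator_def)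
 have "(LINT g|N. indicator S g * f g - indicator S g * h g) \<le> 0" using le[OF S] i by simp
 then have "(LINT g|N. indicator S g * f g - indicator S g * h g) = 0" using integral_nonneg_AE[OF nn] by linarith
 then have "AE g in N. indicator S g * f g - indicator S g * h g = 0"
  using integral_nonneg_eq_0_iff_AE[OF ii nn] by blast
 then show ?thesis using AE_space by eventually_elim (auto simp: S_def indicator_def split: if_splits)
qed

lemma AE_eq_of_integrals:
 fixes f h :: "'a => complex"
 assumes f: "integrable N f" and h: "integrable N h"
  and eq: "\<And>S. S \<in> sets N ==> (LINT g|N. indicator S g * f g) = (LINT g|N. indicator S g * h g)"
 shows "AE g in N. f g = h g"
proof -
 have R: "(LINT g|N. indicator S g * Re (u g)) = Re (LINT g|N. indicator S g * u g)"
  "(LINT g|N. indicator S g * Im (u g)) = Im (LINT g|N. indicator S g * u g)"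
  if "S \<in> sets N" "integrable N u" for S and u :: "'a => complex"
 proof -
  have i: "integrable N (%g. indicator S g * u g)" using integrable_mult_indicator[OF that] by (simp add: scaleR_conv_of_real of_real_indicator)
  have "indicator S g * Re (u g) = Re (indicator S g * u g)" "indicator S g * Im (u g) = Im (indicator S g * u g)" for g
   by (auto simp: indicator_def)
  then show "(LINT g|N. indicator S g * Re (u g)) = Re (LINT g|N. indicator S g * u g)"
  "(LINT g|N. indicator S g * Im (u g)) = Im (LINT g|N. indicator S g * u g)"
   using integral_Re[OF i] integral_Im[OF i] by simp_all
 qed
 have "AE g in N. Re (f g) \<le> Re (h g)" "AE g in N. Re (h g) \<le> Re (f g)" "AE g in N. Im (f g) \<le> Im (h g)" "AE g in N. Im (h g) \<le> Im (f g)"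
  by (rule AE_le_of_integrals; use f h eq R in simp)+
 then show ?thesis by eventually_elim (simp add: complex_eq_iff)
qed

section \<open>Fibres and constant sections\<close>

definition hv :: "enat => (nat => complex) => bool" where
 "hv D x \<longleftrightarrow> l2 x \<and> (\<forall>i. D \<le> enat i --> x i = 0)"

lemma hvD: "hv D x ==> l2 x" "hv D x ==> D \<le> enat i ==> x i = 0"
 by (auto simp: hv_def)

lemma hv_zero: "hv D (%i. 0)"
 by (simp add: hv_def)

lemma hv_add: "hv D x ==> hv D y ==> hv D (%i. x i + y i)"
 by (simp add: hv_def l2_add)

lemma hv_scale: "hv D x ==> hv D (%i. c * x i)"
 by (simp add: hv_def l2_scale)

lemma DV_hv: "DV N d f ==> hv (d g) (f g)"
 by (simp add: hv_def DV_def)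

lemma heq_hv: "hv D x ==> hv D y ==> heq (hdim D) x y \<longleftrightarrow> x = y"
 by (rule heq_hdim[OF hvD(1) hvD(1)])

lemma bounded_op_hdim:
 "bounded_op (hdim D) (hdim D) P \<longleftrightarrow>
  (\<forall>x. hv D x --> hv D (P x)) \<and>
  (\<forall>x. hv D x --> (\<forall>y. hv D y --> P (%i. x i + y i) = (%i. P x i + P y i))) \<and>
  (\<forall>c. \<forall>x. hv D x --> P (%i. c * x i) = (%i. c * P x i)) \<and>
  (\<exists>C\<ge>0. \<forall>x. hv D x --> sq (P x) \<le> C * sq x)" (is "?L \<longleftrightarrow> ?R1 \<and> ?R2 \<and> ?R3 \<and> ?R4")
proof -
 have 4: "(\<exists>C. \<forall>x. hv D x --> vnorm (hdim D) (P x) \<le> C * vnorm (hdim D) x) \<longleftrightarrow> ?R4" if r1: ?R1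
 proof
  assume "\<exists>C. \<forall>x. hv D x --> vnorm (hdim D) (P x) \<le> C * vnorm (hdim D) x"
  then obtain C where C: "\<forall>x. hv D x --> vnorm (hdim D) (P x) \<le> C * vnorm (hdim D) x" by (rule exE)
  have "sq (P x) \<le> C\<^sup>2 * sq x" if x: "hv D x" for x
  proof -
   have 1: "l2 x" "l2 (P x)" using hvD(1)[OF x] hvD(1)[OF r1[rule_format, OF x]] by auto
   have "sqrt (sq (P x)) \<le> C * sqrt (sq x)" using C[rule_format, OF x] by (simp add: vnorm_hdim 1)
   then have "(sqrt (sq (P x)))\<^sup>2 \<le> (C * sqrt (sq x))\<^sup>2" by (intro power_mono) (simp_all add: sq_nonneg)
   then show ?thesis by (simp add: sq_nonneg power_mult_distrib)
  qed
  then show ?R4 by (intro exI[of _ "C\<^sup>2"]) auto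
 next
  assume ?R4
  then obtain C where C: "C \<ge> 0 \<and> (\<forall>x. hv D x --> sq (P x) \<le> C * sq x)" by (rule exE)
  have "vnorm (hdim D) (P x) \<le> sqrt C * vnorm (hdim D) x" if x: "hv D x" for x
  proof -
   have 1: "l2 x" "l2 (P x)" using hvD(1)[OF x] hvD(1)[OF r1[rule_format, OF x]] by auto
   show ?thesis using C x by (simp add: vnorm_hdim 1 real_sqrt_mult[symmetric])
  qed
  then show "\<exists>C. \<forall>x. hv D x --> vnorm (hdim D) (P x) \<le> C * vnorm (hdim D) x" by (intro exI allI impI)
 qed
 have 2: "(\<forall>x. hv D x --> (\<forall>y. hv D y --> heq (hdim D) (P (%i. x i + y i)) (%i. P x i + P y i))) \<longleftrightarrow> ?R2" if ?R1
  using that by (auto simp: heq_hv hv_add)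
 have 3: "(\<forall>c. \<forall>x. hv D x --> heq (hdim D) (P (%i. c * x i)) (%i. c * P x i)) \<longleftrightarrow> ?R3" if ?R1
  using that by (auto simp: heq_hv hv_scale)
 show ?thesis
 proof (cases ?R1)
  case True
  show ?thesis unfolding bounded_op_def hdim_simps Ball_def hv_def[symmetric]
   by (simp only: 2[OF True] 3[OF True] 4[OF True])
 next
  case False
  then show ?thesis unfolding bounded_op_def hdim_simps Ball_def hv_def[symmetric] by (simp only: simp_thms)
 qed
qed

lemma bounded_op_hdim_D:
 assumes "bounded_op (hdim D) (hdim D) P"
 shows "\<And>x. hv D x ==> hv D (P x)"
  and "\<And>x y. hv D x ==> hv D y ==> P (%i. x i + y i) = (%i. P x i + P y i)"
  and "\<And>c x. hv D x ==> P (%i. c * x i) = (%i. c * P x i)"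
  and "\<exists>C\<ge>0. \<forall>x. hv D x --> sq (P x) \<le> C * sq x"
proof -
 note b = assms[unfolded bounded_op_hdim]
 note 1 = conjunct1[OF b] and 2 = conjunct1[OF conjunct2[OF b]] and 3 = conjunct1[OF conjunct2[OF conjunct2[OF b]]]
 show "\<And>x. hv D x ==> hv D (P x)" by (rule 1[rule_format])
 show "\<And>x y. hv D x ==> hv D y ==> P (%i. x i + y i) = (%i. P x i + P y i)" by (rule 2[rule_format])
 show "\<And>c x. hv D x ==> P (%i. c * x i) = (%i. c * P x i)" by (rule 3[rule_format])
 show "\<exists>C\<ge>0. \<forall>x. hv D x --> sq (P x) \<le> C * sq x" by (rule conjunct2[OF conjunct2[OF conjunct2[OF b]]])
qed

lemma bounded_op_hdim_zero:
 assumes "bounded_op (hdim D) (hdim D) P" shows "P (%i. 0) = (%i. 0)"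
 using bounded_op_hdim_D(3)[OF assms hv_zero, of 0] by simp

lemma bounded_op_hdim_comp:
 assumes P: "bounded_op (hdim D) (hdim D) P" and Q: "bounded_op (hdim D) (hdim D) Q"
 shows "bounded_op (hdim D) (hdim D) (%x. P (Q x))"
proof -
 note p = bounded_op_hdim_D[OF P] and q = bounded_op_hdim_D[OF Q]
 obtain C where C: "C \<ge> 0 \<and> (\<forall>x. hv D x --> sq (P x) \<le> C * sq x)" using p(4) by (rule exE)
 obtain E where E: "E \<ge> 0 \<and> (\<forall>x. hv D x --> sq (Q x) \<le> E * sq x)" using q(4) by (rule exE)
 show ?thesis unfolding bounded_op_hdim
 proof (intro conjI allI impI exI[of _ "C * E"])
  show "hv D (P (Q x))" if "hv D x" for x by (rule p(1)[OF q(1)[OF that]])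
  show "P (Q (%i. x i + y i)) = (%i. P (Q x) i + P (Q y) i)" if "hv D x" "hv D y" for x y
   unfolding q(2)[OF that] by (rule p(2)[OF q(1)[OF that(1)] q(1)[OF that(2)]])
  show "P (Q (%i. c * x i)) = (%i. c * P (Q x) i)" if "hv D x" for x c
   unfolding q(3)[OF that] by (rule p(3)[OF q(1)[OF that]])
  show "0 \<le> C * E" using C E by simp
  show "sq (P (Q x)) \<le> C * E * sq x" if x: "hv D x" for x
  proof -
   have "sq (P (Q x)) \<le> C * sq (Q x)" using C q(1)[OF x] by simp
   also have "\<dots> \<le> C * (E * sq x)" using C E x by (intro mult_left_mono) auto
   finally show ?thesis by simp
  qed
 qed
qed

definition unitv :: "nat => nat => complex" where "unitv k = (%i. if i = k then 1 else 0)"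

lemma hv_unitv: "enat k < D ==> hv D (unitv k)"
 unfolding hv_def unitv_def by (auto intro!: l2_finite[of "Suc k"])

lemma sq_tail:
 assumes "l2 x" shows "(%J. sq (%i. if i < J then 0 else x i)) \<longlonglongrightarrow> 0"
proof -
 have f: "(%i. (cmod (x i))\<^sup>2) sums sq x" unfolding sq_eq[OF assms] using assms unfolding l2_def by (rule summable_sums)
 have eq: "sq (%i. if i < J then 0 else x i) = sq x - (\<Sum>i<J. (cmod (x i))\<^sup>2)" for J
 proof -
  have "(%i. if i \<in> {..<J} then (cmod (x i))\<^sup>2 else 0) sums (\<Sum>i<J. (cmod (x i))\<^sup>2)" by (rule sums_If_finite_set) simp
  from sums_diff[OF f this]
  have s: "(%i. (cmod (if i < J then 0 else x i))\<^sup>2) sums (sq x - (\<Sum>i<J. (cmod (x i))\<^sup>2))"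
   by (rule sums_cong[THEN iffD1, rotated]) auto
  then have "l2 (%i. if i < J then 0 else x i)" unfolding l2_def by (rule sums_summable)
  then show ?thesis using sums_unique[OF s] by (simp add: sq_eq)
 qed
 have "(%J. \<Sum>i<J. (cmod (x i))\<^sup>2) \<longlonglongrightarrow> sq x" using f unfolding sums_def .
 then have "(%J. sq x - (\<Sum>i<J. (cmod (x i))\<^sup>2)) \<longlonglongrightarrow> sq x - sq x" by (intro tendsto_intros)
 then show ?thesis unfolding eq by simp
qed

text \<open>Linearity settles the truncations of \<open>x\<close>; boundedness controls the tails,
  whose norms tend to 0. The fibre may be finite or infinite dimensional.\<close>

lemma hdim_op_eqI:
 assumes P: "bounded_op (hdim D) (hdim D) P" and Q: "bounded_op (hdim D) (hdim D) Q"
  and eq: "\<And>k. enat k < D ==> P (unitv k) = Q (unitv k)" and x: "hv D x"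
 shows "P x = Q x"
proof -
 note p = bounded_op_hdim_D[OF P] and q = bounded_op_hdim_D[OF Q]
 define tr tl where "tr J = (%i. if i < J then x i else 0)" and "tl J = (%i. if i < J then 0 else x i)" for J :: nat
 have l: "l2 x" by (rule hvD(1)[OF x])
 have htr: "hv D (tr J)" for J unfolding hv_def tr_def using hvD(2)[OF x] by (auto intro!: l2_finite[of J])
 have "x = (%i. tr J i + tl J i)" and tl2: "tl J = (%i. x i + - 1 * tr J i)" for J unfolding tr_def tl_def by auto
 then have split: "x = (%i. tr J i + tl J i)" for J by blast
 have htl: "hv D (tl J)" for J unfolding tl2 by (intro hv_add hv_scale x htr)
 have eqtr: "P (tr J) = Q (tr J)" for J
 proof (induction J)
  case 0
  have "tr 0 = (%i. 0)" unfolding tr_def by simp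
  then show ?case using bounded_op_hdim_zero[OF P] bounded_op_hdim_zero[OF Q] by simp
 next
  case (Suc J)
  have s: "tr (Suc J) = (%i. tr J i + x J * unitv J i)" unfolding tr_def unitv_def by (auto simp: less_Suc_eq)
  show ?case
  proof (cases "enat J < D")
   case True
   note u = hv_unitv[OF True]
   show ?thesis unfolding s p(2)[OF htr hv_scale[OF u]] q(2)[OF htr hv_scale[OF u]] p(3)[OF u] q(3)[OF u] Suc eq[OF True] ..
  next
   case False
   then have "tr (Suc J) = tr J" unfolding s using hvD(2)[OF x, of J] by (simp add: not_less)
   then show ?thesis using Suc by simp
  qed
 qed
 obtain C where C: "C \<ge> 0 \<and> (\<forall>x. hv D x --> sq (P x) \<le> C * sq x)" using p(4) by (rule exE)
 obtain E where E: "E \<ge> 0 \<and> (\<forall>x. hv D x --> sq (Q x) \<le> E * sq x)" using q(4) by (rule exE)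
 have "P x i = Q x i" for i
 proof -
  have le: "(cmod (P x i - Q x i))\<^sup>2 \<le> 2 * (C * sq (tl J)) + 2 * (E * sq (tl J))" for J
  proof -
   have Px: "P x = (%i. P (tr J) i + P (tl J) i)" using p(2)[OF htr[of J] htl[of J]] split[of J] by simp
   have Qx: "Q x = (%i. Q (tr J) i + Q (tl J) i)" using q(2)[OF htr[of J] htl[of J]] split[of J] by simp
   have "P x i - Q x i = P (tl J) i + (- Q (tl J) i)" unfolding Px Qx eqtr by simp
   then have "(cmod (P x i - Q x i))\<^sup>2 \<le> 2 * (cmod (P (tl J) i))\<^sup>2 + 2 * (cmod (- Q (tl J) i))\<^sup>2"
    using cmod_add_sq[of "P (tl J) i" "- Q (tl J) i"] by simp
   also have "\<dots> \<le> 2 * sq (P (tl J)) + 2 * sq (Q (tl J))"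
    using coord_le_sq[OF hvD(1)[OF p(1)[OF htl]], of J i] coord_le_sq[OF hvD(1)[OF q(1)[OF htl]], of J i] by simp
   also have "\<dots> \<le> 2 * (C * sq (tl J)) + 2 * (E * sq (tl J))"
    using C[THEN conjunct2, rule_format, OF htl, of J] E[THEN conjunct2, rule_format, OF htl, of J] by linarith
   finally show ?thesis .
  qed
  have "(%J. sq (tl J)) \<longlonglongrightarrow> 0" unfolding tl_def by (rule sq_tail[OF l])
  then have "(%J. 2 * (C * sq (tl J)) + 2 * (E * sq (tl J))) \<longlonglongrightarrow> 2 * (C * 0) + 2 * (E * 0)" by (intro tendsto_intros)
  then have "(cmod (P x i - Q x i))\<^sup>2 \<le> 2 * (C * 0) + 2 * (E * 0)" by (rule LIMSEQ_le_const) (use le in blast)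
  then show ?thesis by simp
 qed
 then show ?thesis by (rule ext)
qed

lemma l2_bound:
 assumes "\<And>K. (\<Sum>k<K. (cmod (y k))\<^sup>2) \<le> c" shows "l2 y" "sq y \<le> c"
proof -
 show l: "l2 y" unfolding l2_def by (rule summableI_nonneg_bounded[OF _ assms]) simp
 show "sq y \<le> c" unfolding sq_eq[OF l] using l unfolding l2_def by (rule suminf_le_const) (rule assms)
qed

text \<open>A constant section with \<open>J\<close> coordinates, truncated to the dimension of the
  fibre. It is a vector because the measure is finite, and countably many such sections control an
  operator on almost every fibre.\<close>

definition con :: "('a => enat) => nat => (nat => complex) => 'a => nat => complex" where
 "con d J z = (%g i. if i < J \<and> enat i < d g then z i else 0)"

lemma sq_con: "sq (con d J z g) = (\<Sum>i<J. (cmod (con d J z g i))\<^sup>2)"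
 by (rule sq_finite) (simp add: con_def)

lemma DV_con:
 assumes fin: "finite_measure N" and dk: "\<And>k. {g \<in> space N. enat k < d g} \<in> sets N"
 shows "DV N d (con d J z)"
proof (rule DV_bound)
 show "l2 (con d J z g)" for g by (rule l2_finite[of J]) (simp add: con_def)
 show "con d J z g i = 0" if "d g \<le> enat i" for g i using that by (simp add: con_def leD)
 show "(%g. con d J z g i) \<in> borel_measurable N" for i
 proof -
  have [measurable]: "Measurable.pred N (%g. enat i < d g)" using dk[of i] by (simp add: pred_def)
  show ?thesis unfolding con_def by measurable
 qed
 show "integrable N (%_. \<Sum>i<J. (cmod (z i))\<^sup>2)" using fin by (simp add: finite_measure.integrable_const)
 show "AE g in N. sq (con d J z g) \<le> (\<Sum>i<J. (cmod (z i))\<^sup>2)"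
  unfolding sq_con by (intro AE_I2 sum_mono) (simp add: con_def)
qed

lemma con_unitv: "enat k < d g ==> con d (Suc k) (unitv k) g = unitv k"
 by (auto simp: con_def unitv_def)

lemma ip_con: "ip x (con d (Suc k) (unitv k) g) = (if enat k < d g then x k else 0)"
proof -
 have "ip x (con d (Suc k) (unitv k) g) = (\<Sum>i\<in>{k}. x i * cnj (con d (Suc k) (unitv k) g i))"
  unfolding ip_def by (rule suminf_finite) (auto simp: con_def unitv_def)
 then show ?thesis by (simp add: con_def unitv_def)
qed

lemma nrm_cong: "DV N d f ==> DV N d h ==> (AE g in N. f g = h g) ==> nrm N f = nrm N h"
 unfolding nrm_def
proof (rule integral_cong_AE)
 assume "AE g in N. f g = h g" then show "AE g in N. sq (f g) = sq (h g)" by eventually_elim simp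
qed (auto dest: DVD(4))

lemma ip_zero [simp]: "ip (%i. 0) y = 0" "ip x (%i. 0) = 0"
 by (simp_all add: ip_def)

lemma cut_ip: "ip (cut S f g) y = indicator S g * ip (f g) y"
 by (cases "g \<in> S") (simp_all add: cut_in cut_out)

section \<open>Operators that commute with the cuts\<close>

text \<open>The rows of the fibre operator are the images \<open>s k\<close> of the unit sections
  under the adjoint \<open>R'\<close>: component \<open>k\<close> of \<open>R f\<close> is the inner
  product of \<open>f g\<close> with \<open>s k g\<close>, first as an identity of integrals over
  all cuts and therefore almost everywhere. Boundedness of the fibres is the delicate part, since
  the estimate holds off a null set that depends on the section. It is obtained for countably many
  sections and extended by limits.\<close>

lemma commutant_of_cuts:
 assumes fin: "finite_measure N" and dk: "\<And>k. {g \<in> space N. enat k < d g} \<in> sets N"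
  and R: "bounded_op (direct_integral N d) (direct_integral N d) R"
  and R': "\<And>h. DV N d h ==> DV N d (R' h)"
  and adj: "\<And>f h. DV N d f ==> DV N d h ==> (LINT g|N. ip (R f g) (h g)) = (LINT g|N. ip (f g) (R' h g))"
  and cm: "\<And>S f. S \<in> sets N ==> DV N d f ==> AE g in N. R (cut S f) g = cut S (R f) g"
 shows "\<exists>V. (AE g in N. bounded_op (hdim (d g)) (hdim (d g)) (V g)) \<and>
  (\<forall>f. DV N d f --> (AE g in N. R f g = V g (f g)))"
proof -
 note r = bounded_op_DI_D[OF R]
 obtain C where C: "C \<ge> 0 \<and> (\<forall>f. DV N d f --> nrm N (R f) \<le> C * nrm N f)" using r(4) by (rule exE)
 have C0: "0 \<le> C" using C by blast
 note dc = DV_con[OF fin dk]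
 define s where "s k = R' (con d (Suc k) (unitv k))" for k
 have sV: "DV N d (s k)" for k unfolding s_def by (rule R'[OF dc])
 define V where "V g x = (%k. if enat k < d g then ip x (s k g) else 0)" for g x
 have uv: "AE g in N. ip (R f g) (con d (Suc k) (unitv k) g) = ip (f g) (s k g)" if f: "DV N d f" for f k
 proof (rule AE_eq_of_integrals[OF ip_integrable[OF r(1)[OF f] dc] ip_integrable[OF f sV]])
  fix S assume S: "S \<in> sets N"
  let ?c = "con d (Suc k) (unitv k)"
  note cf = DV_cut[OF S f]
  have "(LINT g|N. indicator S g * ip (R f g) (?c g)) = (LINT g|N. ip (cut S (R f) g) (?c g))" by (simp add: cut_ip)
  also have "\<dots> = (LINT g|N. ip (R (cut S f) g) (?c g))"
  proof (rule integral_cong_AE)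
   show "AE g in N. ip (cut S (R f) g) (?c g) = ip (R (cut S f) g) (?c g)"
    using cm[OF S f] by eventually_elim simp
  qed (rule borel_measurable_integrable ip_integrable[OF DV_cut[OF S r(1)[OF f]] dc] ip_integrable[OF r(1)[OF cf] dc])+
  also have "\<dots> = (LINT g|N. ip (cut S f g) (s k g))" unfolding s_def by (rule adj[OF cf dc])
  also have "\<dots> = (LINT g|N. indicator S g * ip (f g) (s k g))" by (simp add: cut_ip)
  finally show "(LINT g|N. indicator S g * ip (R f g) (?c g)) = (LINT g|N. indicator S g * ip (f g) (s k g))" .
 qed
 have RV: "AE g in N. R f g = V g (f g)" if f: "DV N d f" for f
 proof -
  have "AE g in N. \<forall>k. ip (R f g) (con d (Suc k) (unitv k) g) = ip (f g) (s k g)"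
   unfolding AE_all_countable using uv[OF f] by blast
  then show ?thesis
  proof eventually_elim
   case (elim g)
   show ?case
   proof
    fix k show "R f g k = V g (f g) k"
     using elim[rule_format, of k] DVD(2)[OF r(1)[OF f], of g k] by (auto simp: V_def ip_con not_less)
   qed
  qed
 qed
 have RB: "AE g in N. sq (R f g) \<le> C * sq (f g)" if f: "DV N d f" for f
 proof (rule AE_le_of_integrals)
  show "integrable N (%g. sq (R f g))" by (rule DVD(4)[OF r(1)[OF f]])
  show "integrable N (%g. C * sq (f g))" using DVD(4)[OF f] by simp
  fix S assume S: "S \<in> sets N"
  have "(LINT g|N. indicator S g * sq (R f g)) = nrm N (cut S (R f))" by (rule nrm_cut[OF S, symmetric])
  also have "\<dots> = nrm N (R (cut S f))"
   by (rule nrm_cong[OF r(1)[OF DV_cut[OF S f]] DV_cut[OF S r(1)[OF f]] cm[OF S f], symmetric])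
  also have "\<dots> \<le> C * nrm N (cut S f)" using C DV_cut[OF S f] by blast
  also have "\<dots> = (LINT g|N. indicator S g * (C * sq (f g)))" unfolding nrm_cut[OF S] by (simp add: mult.left_commute)
  finally show "(LINT g|N. indicator S g * sq (R f g)) \<le> (LINT g|N. indicator S g * (C * sq (f g)))" .
 qed
 \<comment> \<open>Coefficients from a countable dense set: finite lists of them give countably many
   sections, so one null set serves all.\<close>
 obtain Dn :: "complex set" where Dn0: "countable Dn \<and> (\<forall>X. open X --> X \<noteq> {} --> (\<exists>d\<in>Dn. d \<in> X))"
  using countable_dense_exists by (rule exE)
 have "closure Dn = UNIV"
 proof (rule ccontr)
  assume "closure Dn \<noteq> UNIV"
  then have "- closure Dn \<noteq> {}" by auto
  then have "\<exists>d\<in>Dn. d \<in> - closure Dn" using Dn0 by (metis open_Compl closed_closure)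
  then show False using subsetD[OF closure_subset] by auto
 qed
 then have Dn: "countable Dn" "closure Dn = UNIV" using Dn0 by auto
 have cl: "countable (lists Dn)" using Dn(1) by simp
 have "AE g in N. \<forall>qs\<in>lists Dn. R (con d (length qs) ((!) qs)) g = V g (con d (length qs) ((!) qs) g) \<and>
   sq (R (con d (length qs) ((!) qs)) g) \<le> C * sq (con d (length qs) ((!) qs) g)"
  unfolding AE_ball_countable[OF cl]
 proof
  fix qs show "AE g in N. R (con d (length qs) ((!) qs)) g = V g (con d (length qs) ((!) qs) g) \<and>
   sq (R (con d (length qs) ((!) qs)) g) \<le> C * sq (con d (length qs) ((!) qs) g)"
   using RV[OF dc] RB[OF dc] by eventually_elim blast
 qed
 then have "AE g in N. bounded_op (hdim (d g)) (hdim (d g)) (V g)"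
 proof eventually_elim
  case (elim g)
  \<comment> \<open>The fibre operator on a vector with \<open>J\<close> coordinates, as a finite
    sum. Two limits are taken in it: in the coefficients for fixed \<open>J\<close>, and then in
    \<open>J\<close>.\<close>
  define T where "T J z k = (if enat k < d g then \<Sum>i<J. con d J z g i * cnj (s k g i) else 0)" for J z k
  have VT: "V g (con d J z g) k = T J z k" for J z k
  proof -
   have "ip (con d J z g) (s k g) = (\<Sum>i<J. con d J z g i * cnj (s k g i))"
    unfolding ip_def by (rule suminf_finite) (auto simp: con_def)
   then show ?thesis unfolding V_def T_def by simp
  qed
  have rat: "(\<Sum>k<K. (cmod (T J (%i. w i) k))\<^sup>2) \<le> C * (\<Sum>i<J. (cmod (con d J (%i. w i) g i))\<^sup>2)"
   if w: "\<And>i. w i \<in> Dn" for J K and w :: "nat => complex"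
  proof -
   define qs where "qs = map w [0..<J]"
   have qs: "length qs = J" "qs \<in> lists Dn" unfolding qs_def using w by auto
   have ce: "con d (length qs) ((!) qs) g = con d J w g" unfolding con_def qs(1) by (auto simp: qs_def)
   note e = elim[rule_format, OF qs(2), unfolded ce]
   have l: "l2 (V g (con d J w g))"
    unfolding conjunct1[OF e, symmetric] by (rule DVD(1)[OF r(1)[OF dc]])
   have "(\<Sum>k<K. (cmod (V g (con d J w g) k))\<^sup>2) \<le> sq (V g (con d J w g))" by (rule sum_le_sq[OF l]) simp
   also have "\<dots> \<le> C * sq (con d J w g)" using conjunct2[OF e] unfolding conjunct1[OF e] .
   finally show ?thesis unfolding VT sq_con .
  qed
  have fin_le: "(\<Sum>k<K. (cmod (T J z k))\<^sup>2) \<le> C * (\<Sum>i<J. (cmod (con d J z g i))\<^sup>2)" for J K and z :: "nat => complex"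
  proof -
   have "\<exists>w. (\<forall>m. w m \<in> Dn) \<and> w \<longlonglongrightarrow> z i" for i
    using closure_sequential[of "z i" Dn] Dn(2) by auto
   then have "\<exists>w. \<forall>i. (\<forall>m. w i m \<in> Dn) \<and> w i \<longlonglongrightarrow> z i" by (intro choice allI)
   then obtain w :: "nat => nat => complex" where w: "\<forall>i. (\<forall>m. w i m \<in> Dn) \<and> w i \<longlonglongrightarrow> z i" by (rule exE)
   have wt: "(%m. w i m) \<longlonglongrightarrow> z i" for i using w by blast
   have ct: "(%m. con d J (%i. w i m) g i) \<longlonglongrightarrow> con d J z g i" for i
    unfolding con_def by (cases "i < J \<and> enat i < d g") (simp_all only: if_True if_False simp_thms wt tendsto_const)
   have Tt: "(%m. T J (%i. w i m) k) \<longlonglongrightarrow> T J z k" for k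
   proof (cases "enat k < d g")
    case True then show ?thesis unfolding T_def by (simp, intro tendsto_intros ct)
   qed (simp add: T_def)
   show ?thesis
   proof (rule LIMSEQ_le)
    show "(%m. \<Sum>k<K. (cmod (T J (%i. w i m) k))\<^sup>2) \<longlonglongrightarrow> (\<Sum>k<K. (cmod (T J z k))\<^sup>2)"
     by (intro tendsto_intros Tt)
    show "(%m. C * (\<Sum>i<J. (cmod (con d J (%i. w i m) g i))\<^sup>2)) \<longlonglongrightarrow> C * (\<Sum>i<J. (cmod (con d J z g i))\<^sup>2)"
     by (intro tendsto_intros ct)
    show "\<exists>N. \<forall>m\<ge>N. (\<Sum>k<K. (cmod (T J (%i. w i m) k))\<^sup>2) \<le> C * (\<Sum>i<J. (cmod (con d J (%i. w i m) g i))\<^sup>2)"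
     by (intro exI allI impI rat) (use w in blast)
   qed
  qed
  have bd: "(\<Sum>k<K. (cmod (V g x k))\<^sup>2) \<le> C * sq x" if x: "hv (d g) x" for x K
  proof (rule LIMSEQ_le_const2)
   note l = hvD(1)[OF x]
   have cx: "con d J x g i = x i" if "i < J" for i J using that hvD(2)[OF x, of i] by (auto simp: con_def not_less)
   have "(%J. T J x k) \<longlonglongrightarrow> V g x k" for k
   proof (cases "enat k < d g")
    case True
    have "(%J. \<Sum>i<J. x i * cnj (s k g i)) \<longlonglongrightarrow> ip x (s k g)" unfolding ip_def
     by (rule summable_LIMSEQ[OF ip_summable[OF l DVD(1)[OF sV]]])
    moreover have "T J x k = (\<Sum>i<J. x i * cnj (s k g i))" for J
     unfolding T_def using True by (auto intro!: sum.cong simp: cx)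
    ultimately show ?thesis unfolding V_def using True by simp
   qed (simp add: T_def V_def)
   then show "(%J. \<Sum>k<K. (cmod (T J x k))\<^sup>2) \<longlonglongrightarrow> (\<Sum>k<K. (cmod (V g x k))\<^sup>2)" by (intro tendsto_intros)
   show "\<exists>N. \<forall>J\<ge>N. (\<Sum>k<K. (cmod (T J x k))\<^sup>2) \<le> C * sq x"
   proof (intro exI allI impI)
    fix J :: nat
    have "(\<Sum>k<K. (cmod (T J x k))\<^sup>2) \<le> C * (\<Sum>i<J. (cmod (con d J x g i))\<^sup>2)" by (rule fin_le)
    also have "(\<Sum>i<J. (cmod (con d J x g i))\<^sup>2) = (\<Sum>i<J. (cmod (x i))\<^sup>2)" by (simp add: cx)
    also have "C * \<dots> \<le> C * sq x" by (intro mult_left_mono sum_le_sq l C0) simp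
    finally show "(\<Sum>k<K. (cmod (T J x k))\<^sup>2) \<le> C * sq x" .
   qed
  qed
  show ?case unfolding bounded_op_hdim
  proof (intro conjI allI impI exI[of _ C])
   show "hv (d g) (V g x)" if x: "hv (d g) x" for x
    unfolding hv_def using l2_bound(1)[OF bd[OF x]] by (auto simp: V_def leD)
   show "V g (%i. x i + y i) = (%i. V g x i + V g y i)" if "hv (d g) x" "hv (d g) y" for x y
    unfolding V_def by (simp add: fun_eq_iff ip_add_left[OF hvD(1)[OF that(1)] hvD(1)[OF that(2)] DVD(1)[OF sV]])
   show "V g (%i. c * x i) = (%i. c * V g x i)" if "hv (d g) x" for x c
    unfolding V_def by (simp add: fun_eq_iff ip_scale_left[OF hvD(1)[OF that] DVD(1)[OF sV]])
   show "0 \<le> C" by (rule C0)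
   show "sq (V g x) \<le> C * sq x" if x: "hv (d g) x" for x by (rule l2_bound(2)[OF bd[OF x]])
  qed
 qed
 then show ?thesis using RV by blast
qed

text \<open>By \<open>commutant_of_cuts\<close> the operator \<open>R\<close> acts fibrewise. Almost
  every fibre is an idempotent that commutes with \<open>F g\<close>, hence 0 or the
  identity.\<close>

lemma irreducible_idempotent_cut:
 assumes fin: "finite_measure N" and dk: "\<And>k. {g \<in> space N. enat k < d g} \<in> sets N" and d1: "\<And>g. 1 \<le> d g"
  and R: "bounded_op (direct_integral N d) (direct_integral N d) R"
  and R': "\<And>h. DV N d h ==> DV N d (R' h)"
  and adj: "\<And>f h. DV N d f ==> DV N d h ==> (LINT g|N. ip (R f g) (h g)) = (LINT g|N. ip (f g) (R' h g))"
  and cm: "\<And>S f. S \<in> sets N ==> DV N d f ==> AE g in N. R (cut S f) g = cut S (R f) g"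
  and idem: "\<And>f. DV N d f ==> AE g in N. R (R f) g = R f g"
  and TV: "\<And>f. DV N d f ==> DV N d (T f)"
  and RT: "\<And>f. DV N d f ==> AE g in N. R (T f) g = T (R f) g"
  and TF: "\<And>f. DV N d f ==> AE g in N. T f g = F g (f g)"
  and irr: "AE g in N. strongly_irreducible (hdim (d g)) (F g)"
 shows "\<exists>S\<in>sets N. \<forall>f. DV N d f --> (AE g in N. R f g = cut S f g)"
proof -
 have "\<exists>V. (AE g in N. bounded_op (hdim (d g)) (hdim (d g)) (V g)) \<and>
  (\<forall>f. DV N d f --> (AE g in N. R f g = V g (f g)))"
  by (rule commutant_of_cuts[where R' = R', OF fin dk R]; (rule R' adj cm, assumption+))
 then obtain V where V: "(AE g in N. bounded_op (hdim (d g)) (hdim (d g)) (V g)) \<and>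
  (\<forall>f. DV N d f --> (AE g in N. R f g = V g (f g)))" by (rule exE)
 have RV: "AE g in N. R f g = V g (f g)" if "DV N d f" for f using V that by blast
 note r = bounded_op_DI_D[OF R]
 note dc = DV_con[OF fin dk]
 let ?c = "%k. con d (Suc k) (unitv k)"
 \<comment> \<open>The relations for \<open>R\<close> hold almost everywhere for each single section
   only. They are used for the countably many unit sections and extended to whole fibres by
   \<open>hdim_op_eqI\<close>.\<close>
 have "AE g in N. \<forall>k. V g (V g (?c k g)) = V g (?c k g) \<and> V g (F g (?c k g)) = F g (V g (?c k g))"
  unfolding AE_all_countable
 proof
  fix k
  note c = dc[of "Suc k" "unitv k"]
  show "AE g in N. V g (V g (?c k g)) = V g (?c k g) \<and> V g (F g (?c k g)) = F g (V g (?c k g))"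
   using RV[OF c] RV[OF r(1)[OF c]] idem[OF c] RV[OF TV[OF c]] TF[OF c] TF[OF r(1)[OF c]] RT[OF c]
   by eventually_elim simp
 qed
 moreover have "AE g in N. bounded_op (hdim (d g)) (hdim (d g)) (V g)" using V by blast
 ultimately have dich: "AE g in N. (\<forall>x. hv (d g) x --> V g x = (%i. 0)) \<or> (\<forall>x. hv (d g) x --> V g x = x)"
  using irr
 proof eventually_elim
  case (elim g)
  have F: "bounded_op (hdim (d g)) (hdim (d g)) (F g)" using elim(3) unfolding strongly_irreducible_def by blast
  note v = bounded_op_hdim_D[OF elim(2)] and f = bounded_op_hdim_D[OF F]
  have u: "V g (V g (unitv k)) = V g (unitv k)" "V g (F g (unitv k)) = F g (V g (unitv k))" if "enat k < d g" for k
   using elim(1)[rule_format, of k] con_unitv[of k d g] that by auto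
  have VV: "V g (V g x) = V g x" if "hv (d g) x" for x
   by (rule hdim_op_eqI[OF bounded_op_hdim_comp[OF elim(2,2)] elim(2) u(1) that])
  have VF: "V g (F g x) = F g (V g x)" if "hv (d g) x" for x
   by (rule hdim_op_eqI[OF bounded_op_hdim_comp[OF elim(2) F] bounded_op_hdim_comp[OF F elim(2)] u(2) that])
  have 1: "op_eq (hdim (d g)) (hdim (d g)) (F g \<circ> V g) (V g \<circ> F g)"
   unfolding op_eq_def hdim_simps(1) hv_def[symmetric] comp_def Ball_def
   using VF heq_hv[OF f(1)[OF v(1)] f(1)[OF v(1)]] by simp
  have 2: "op_eq (hdim (d g)) (hdim (d g)) (V g \<circ> V g) (V g)"
   unfolding op_eq_def hdim_simps(1) hv_def[symmetric] comp_def Ball_def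
   using VV heq_hv[OF v(1) v(1)] by simp
  have "op_eq (hdim (d g)) (hdim (d g)) (V g) (%x. vscale (hdim (d g)) 0 x) \<or> op_eq (hdim (d g)) (hdim (d g)) (V g) id"
   using elim(2,3) 1 2 unfolding strongly_irreducible_def by blast
  then show ?case
   unfolding op_eq_def hdim_simps hv_def[symmetric] Ball_def
   using heq_hv[OF v(1) hv_zero] heq_hv[OF v(1)] by auto
 qed
 \<comment> \<open>The set is read off from \<open>R\<close> applied to the first unit section,
   which makes it measurable; the fibre operators \<open>V g\<close> come without measurability.
   Coordinate 0 exists because fibres have dimension at least 1.\<close>
 define S where "S = {g \<in> space N. R (?c 0) g 0 = 1}"
 have S: "S \<in> sets N"
 proof -
  have [measurable]: "(%g. R (?c 0) g 0) \<in> borel_measurable N" by (rule DVD(3)[OF r(1)[OF dc]])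
  show ?thesis unfolding S_def by measurable
 qed
 have "AE g in N. R f g = cut S f g" if f: "DV N d f" for f
  using dich RV[OF f] RV[OF dc[of "Suc 0" "unitv 0"]] AE_space
 proof eventually_elim
  case (elim g)
  have "enat 0 < d g" using d1[of g] by (cases "d g") (auto simp: one_enat_def)
  note cu = con_unitv[of 0 d g, OF this] and hu = hv_unitv[of 0 "d g", OF this]
  from elim(1) show ?case
  proof
   assume a: "\<forall>x. hv (d g) x --> V g x = (%i. 0)"
   then have "R (?c 0) g 0 = 0" using elim(3) cu hu by simp
   then have "g \<notin> S" unfolding S_def by simp
   then show ?thesis using elim(2) a DV_hv[OF f] by (simp add: cut_out)
  next
   assume a: "\<forall>x. hv (d g) x --> V g x = x"
   then have "R (?c 0) g 0 = 1" using elim(3) cu hu by (simp add: unitv_def)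
   then have "g \<in> S" unfolding S_def using elim(4) by simp
   then show ?thesis using elim(2) a DV_hv[OF f] by (simp add: cut_in)
  qed
 qed
 then show ?thesis by (intro bexI[OF _ S] allI impI)
qed

section \<open>Matrix fields as operators\<close>

lemma sq_vanish: "(\<And>i. enat n \<le> enat i ==> x i = 0) ==> sq x = (\<Sum>i<n. (cmod (x i))\<^sup>2)"
 by (rule sq_finite) simp

lemma sq_mat_op:
 fixes n :: nat and C :: real
 assumes C: "0 \<le> C" and B: "\<And>i j. i < n ==> j < n ==> cmod (B l $$ (i, j)) \<le> C" and f: "\<And>i. enat n \<le> enat i ==> f l i = 0"
 shows "sq (mat_op n B f l) \<le> (real n * C)\<^sup>2 * sq (f l)"
proof -
 have s: "sq (f l) = (\<Sum>j<n. (cmod (f l j))\<^sup>2)" by (rule sq_vanish[OF f])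
 have 1: "(cmod (mat_op n B f l i))\<^sup>2 \<le> C\<^sup>2 * (real n * sq (f l))" if i: "i < n" for i
 proof -
  have "cmod (mat_op n B f l i) \<le> (\<Sum>j<n. cmod (B l $$ (i, j) * f l j))" unfolding mat_op_def using i by (simp add: norm_sum)
  also have "\<dots> \<le> (\<Sum>j<n. C * cmod (f l j))" by (rule sum_mono) (simp add: norm_mult B[OF i] mult_right_mono)
  also have "\<dots> = C * (\<Sum>j<n. 1 * cmod (f l j))" by (simp add: sum_distrib_left)
  finally have "(cmod (mat_op n B f l i))\<^sup>2 \<le> (C * (\<Sum>j<n. 1 * cmod (f l j)))\<^sup>2" by (intro power_mono) auto
  also have "\<dots> = C\<^sup>2 * (\<Sum>j<n. 1 * cmod (f l j))\<^sup>2" by (simp add: power_mult_distrib)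
  also have "\<dots> \<le> C\<^sup>2 * ((\<Sum>j<n. 1\<^sup>2) * (\<Sum>j<n. (cmod (f l j))\<^sup>2))" by (intro mult_left_mono Cauchy_Schwarz_ineq_sum) simp
  also have "\<dots> = C\<^sup>2 * (real n * sq (f l))" unfolding s by simp
  finally show ?thesis .
 qed
 have "sq (mat_op n B f l) = (\<Sum>i<n. (cmod (mat_op n B f l i))\<^sup>2)" by (rule sq_vanish) (simp add: mat_op_def)
 also have "\<dots> \<le> (\<Sum>i<n. C\<^sup>2 * (real n * sq (f l)))" by (rule sum_mono) (use 1 in simp)
 also have "\<dots> = (real n * C)\<^sup>2 * sq (f l)" by (simp add: power2_eq_square)
 finally show ?thesis .
qed

lemma mat_op_mult:
 assumes "B l \<in> carrier_mat n n" "C l \<in> carrier_mat n n"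
 shows "mat_op n (%l. B l * C l) f l = mat_op n B (mat_op n C f) l"
proof
 fix i
 show "mat_op n (%l. B l * C l) f l i = mat_op n B (mat_op n C f) l i"
 proof (cases "i < n")
  case True
  have "(\<Sum>j<n. (B l * C l) $$ (i, j) * f l j) = (\<Sum>j<n. (\<Sum>k<n. B l $$ (i, k) * C l $$ (k, j)) * f l j)"
   using True assms by (intro sum.cong refl) (auto simp: scalar_prod_def atLeast0LessThan)
  also have "\<dots> = (\<Sum>j<n. \<Sum>k<n. B l $$ (i, k) * (C l $$ (k, j) * f l j))" by (simp add: sum_distrib_right mult.assoc)
  also have "\<dots> = (\<Sum>k<n. \<Sum>j<n. B l $$ (i, k) * (C l $$ (k, j) * f l j))" by (rule sum.swap)
  also have "\<dots> = (\<Sum>k<n. B l $$ (i, k) * mat_op n C f l k)" by (simp add: mat_op_def sum_distrib_left)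
  finally show ?thesis using True by (simp add: mat_op_def)
 qed (simp add: mat_op_def)
qed

lemma mat_op_cong: "B l = C l ==> f l = h l ==> mat_op n B f l = mat_op n C h l"
 by (auto simp: mat_op_def fun_eq_iff)

definition mat_adj :: "nat => ('a => complex mat) => 'a => complex mat" where
 "mat_adj n B l = mat n n (%(i, j). cnj (B l $$ (j, i)))"

lemma ip_vanish: "(\<And>i. enat n \<le> enat i ==> x i = 0) ==> ip x y = (\<Sum>i<n. x i * cnj (y i))"
 unfolding ip_def by (rule suminf_finite) (auto simp: not_less)

lemma ip_mat_op:
 assumes "\<And>i. enat n \<le> enat i ==> f l i = 0"
 shows "ip (mat_op n B f l) (h l) = ip (f l) (mat_op n (mat_adj n B) h l)"
proof -
 have "ip (mat_op n B f l) (h l) = (\<Sum>i<n. (\<Sum>j<n. B l $$ (i, j) * f l j) * cnj (h l i))"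
  by (subst ip_vanish[of n]) (auto simp: mat_op_def)
 also have "\<dots> = (\<Sum>i<n. \<Sum>j<n. B l $$ (i, j) * f l j * cnj (h l i))" by (simp add: sum_distrib_right)
 also have "\<dots> = (\<Sum>j<n. \<Sum>i<n. B l $$ (i, j) * f l j * cnj (h l i))" by (rule sum.swap)
 also have "\<dots> = (\<Sum>j<n. f l j * cnj (\<Sum>i<n. cnj (B l $$ (i, j)) * h l i))"
  by (simp add: sum_distrib_left mult_ac)
 also have "\<dots> = ip (f l) (mat_op n (mat_adj n B) h l)"
  by (subst ip_vanish[of n]) (auto simp: mat_op_def mat_adj_def assms)
 finally show ?thesis .
qed

lemma Mn_LinfD:
 assumes "B \<in> Mn_Linf M n"
 shows "i < n ==> j < n ==> (%l. B l $$ (i, j)) \<in> borel_measurable M"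
 using assms unfolding Mn_Linf_def by simp

lemma mat_op_DV:
 fixes n :: nat and C :: real
 assumes B: "B \<in> Mn_Linf M n" and C: "0 \<le> C" "AE l in M. mbd C (fm n (B l))" and f: "DV M (%_. enat n) f"
 shows "DV M (%_. enat n) (mat_op n B f)" "nrm M (mat_op n B f) \<le> (real n * C)\<^sup>2 * nrm M f"
  "AE l in M. sq (mat_op n B f l) \<le> (real n * C)\<^sup>2 * sq (f l)"
proof -
 show ae: "AE l in M. sq (mat_op n B f l) \<le> (real n * C)\<^sup>2 * sq (f l)" using C(2)
 proof eventually_elim
  case (elim l)
  show ?case
  proof (rule sq_mat_op[where B = B and f = f and l = l and n = n, OF C(1) _ DVD(2)[OF f]])
   fix i j assume "i < n" "j < n"
   then show "cmod (B l $$ (i, j)) \<le> C" using elim[unfolded mbd_def, rule_format, of i j] by simp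
  qed
 qed
 show d: "DV M (%_. enat n) (mat_op n B f)"
 proof (rule DV_bound[OF _ _ _ _ ae])
  show "l2 (mat_op n B f l)" for l by (rule l2_finite[of n]) (simp add: mat_op_def)
  show "mat_op n B f l i = 0" if "enat n \<le> enat i" for l i using that by (simp add: mat_op_def)
  show "(%l. mat_op n B f l i) \<in> borel_measurable M" for i
  proof (cases "i < n")
   case True
   have "(%l. \<Sum>j<n. B l $$ (i, j) * f l j) \<in> borel_measurable M"
    by (intro borel_measurable_sum borel_measurable_times DVD(3)[OF f] Mn_LinfD[OF B True]) simp
   then show ?thesis using True by (simp add: mat_op_def)
  qed (simp add: mat_op_def)
  show "integrable M (%l. (real n * C)\<^sup>2 * sq (f l))" using DVD(4)[OF f] by simp
 qed
 have "nrm M (mat_op n B f) \<le> (LINT l|M. (real n * C)\<^sup>2 * sq (f l))" unfolding nrm_def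
  by (rule integral_mono_AE[OF DVD(4)[OF d] _ ae]) (use DVD(4)[OF f] in simp)
 then show "nrm M (mat_op n B f) \<le> (real n * C)\<^sup>2 * nrm M f" unfolding nrm_def by simp
qed

lemma Mn_Linf_bound:
 assumes "B \<in> Mn_Linf M n" obtains C where "0 \<le> C" "AE l in M. mbd C (fm n (B l))"
proof -
 obtain C where C: "AE l in M. mbd C (fm n (B l))" using bfm_fm[OF assms] unfolding bfm_def by blast
 have "AE l in M. mbd \<bar>C\<bar> (fm n (B l))" using C by eventually_elim (auto intro: mbd_mono)
 then show thesis by (intro that[of "\<bar>C\<bar>"]) auto
qed

lemma mat_op_bounded:
 assumes B: "B \<in> Mn_Linf M n"
 shows "bounded_op (direct_integral M (%_. enat n)) (direct_integral M (%_. enat n)) (mat_op n B)"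
proof -
 obtain C where C: "0 \<le> C" "AE l in M. mbd C (fm n (B l))" by (rule Mn_Linf_bound[OF B])
 show ?thesis unfolding bounded_op_DI
 proof (intro conjI allI impI exI[of _ "(real n * C)\<^sup>2"])
  show "DV M (%_. enat n) (mat_op n B f)" if "DV M (%_. enat n) f" for f by (rule mat_op_DV(1)[OF B C that])
  show "AE l in M. mat_op n B (%g i. f g i + h g i) l = (%i. mat_op n B f l i + mat_op n B h l i)" for f h
   by (rule AE_I2) (auto simp: mat_op_def fun_eq_iff sum.distrib algebra_simps)
  show "AE l in M. mat_op n B (%g i. c * f g i) l = (%i. c * mat_op n B f l i)" for c f
   by (rule AE_I2) (auto simp: mat_op_def fun_eq_iff sum_distrib_left algebra_simps)
  show "nrm M (mat_op n B f) \<le> (real n * C)\<^sup>2 * nrm M f" if "DV M (%_. enat n) f" for f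
   by (rule mat_op_DV(2)[OF B C that])
 qed simp
qed

lemma mat_op_unit:
 assumes "i < n" "j < n"
 shows "mat_op n B (con (%_. enat n) (Suc j) (unitv j)) l i = B l $$ (i, j)"
proof -
 have "(\<Sum>k<n. B l $$ (i, k) * con (%_. enat n) (Suc j) (unitv j) l k) = (\<Sum>k<n. if k = j then B l $$ (i, j) else 0)"
  using assms by (intro sum.cong) (auto simp: con_def unitv_def)
 then show ?thesis using assms by (simp add: mat_op_def)
qed

lemma mat_op_inj:
 fixes n :: nat
 assumes fin: "finite_measure M" and B: "B \<in> Mn_Linf M n" and C: "C \<in> Mn_Linf M n"
  and eq: "\<And>f. DV M (%_. enat n) f ==> AE l in M. mat_op n B f l = mat_op n C f l"
 shows "AE l in M. B l = C l"
proof -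
 have "AE l in M. \<forall>j. mat_op n B (con (%_. enat n) (Suc j) (unitv j)) l = mat_op n C (con (%_. enat n) (Suc j) (unitv j)) l"
  unfolding AE_all_countable by (intro allI eq DV_con[OF fin]) simp
 then show ?thesis using AE_space
 proof eventually_elim
  case (elim l)
  show ?case
  proof (rule eq_matI)
   fix i j assume "i < dim_row (C l)" "j < dim_col (C l)"
   then have ij: "i < n" "j < n" using Mn_carrier[OF C elim(2)] by auto
   show "B l $$ (i, j) = C l $$ (i, j)"
    using fun_cong[OF elim(1)[rule_format, of j], of i] unfolding mat_op_unit[OF ij] .
  qed (use Mn_carrier[OF B elim(2)] Mn_carrier[OF C elim(2)] in auto)
 qed
qed

lemma norm_bounded_iff:
 assumes "S \<subseteq> Mn_Linf M n"
 shows "norm_bounded M n S \<longleftrightarrow> (\<exists>C\<ge>0. \<forall>B\<in>S. \<forall>f. DV M (%_. enat n) f --> nrm M (mat_op n B f) \<le> C * nrm M f)"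
proof -
 have D: "DV M (%_. enat n) (mat_op n B f)" if "B \<in> S" "DV M (%_. enat n) f" for B f
  using bounded_op_DI_D(1)[OF mat_op_bounded that(2)] that(1) assms by blast
 show ?thesis
 proof
  assume "norm_bounded M n S"
  then obtain C where C: "\<forall>B\<in>S. \<forall>f\<in>vecs (L2n M n). vnorm (L2n M n) (mat_op n B f) \<le> C * vnorm (L2n M n) f"
   unfolding norm_bounded_def by (rule exE)
  have "nrm M (mat_op n B f) \<le> C\<^sup>2 * nrm M f" if B: "B \<in> S" and f: "DV M (%_. enat n) f" for B f
  proof -
   have "sqrt (nrm M (mat_op n B f)) \<le> C * sqrt (nrm M f)"
    using C[rule_format, OF B, of f] f by (simp add: L2n_def vnorm_DI[OF f] vnorm_DI[OF D[OF B f]])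
   then have "(sqrt (nrm M (mat_op n B f)))\<^sup>2 \<le> (C * sqrt (nrm M f))\<^sup>2" by (intro power_mono) (simp_all add: nrm_nonneg)
   then show ?thesis by (simp add: nrm_nonneg power_mult_distrib)
  qed
  then show "\<exists>C\<ge>0. \<forall>B\<in>S. \<forall>f. DV M (%_. enat n) f --> nrm M (mat_op n B f) \<le> C * nrm M f"
   by (intro exI[of _ "C\<^sup>2"] conjI ballI allI impI) auto
 next
  assume "\<exists>C\<ge>0. \<forall>B\<in>S. \<forall>f. DV M (%_. enat n) f --> nrm M (mat_op n B f) \<le> C * nrm M f"
  then obtain C where C: "0 \<le> C \<and> (\<forall>B\<in>S. \<forall>f. DV M (%_. enat n) f --> nrm M (mat_op n B f) \<le> C * nrm M f)" by (rule exE)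
  show "norm_bounded M n S" unfolding norm_bounded_def L2n_def direct_integral_simps(1)
  proof (intro exI[of _ "sqrt C"] ballI)
   fix B f assume B: "B \<in> S" and "f \<in> vecs (direct_integral M (%_. enat n))"
   then have f: "DV M (%_. enat n) f" by simp
   show "vnorm (direct_integral M (%_. enat n)) (mat_op n B f) \<le> sqrt C * vnorm (direct_integral M (%_. enat n)) f"
    unfolding vnorm_DI[OF f] vnorm_DI[OF D[OF B f]] real_sqrt_mult[symmetric] using C B f by simp
  qed
 qed
qed

lemma norm_boundedI:
 assumes S: "S \<subseteq> Mn_Linf M n" and C: "\<And>B. B \<in> S ==> AE l in M. mbd C (fm n (B l))"
 shows "norm_bounded M n S"
 unfolding norm_bounded_iff[OF S]
proof (intro exI[of _ "(real n * \<bar>C\<bar>)\<^sup>2"] conjI ballI allI impI)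
 fix B f assume B: "B \<in> S" and f: "DV M (%_. enat n) f"
 have "AE l in M. mbd \<bar>C\<bar> (fm n (B l))" using C[OF B] by eventually_elim (auto intro: mbd_mono)
 then show "nrm M (mat_op n B f) \<le> (real n * \<bar>C\<bar>)\<^sup>2 * nrm M f"
  using mat_op_DV(2)[OF _ _ _ f, of B "\<bar>C\<bar>"] B S by auto
qed simp

text \<open>The operator bound, tested on all cuts of the \<open>j\<close>-th unit section, bounds
  column \<open>j\<close> of the matrix at almost every point.\<close>

lemma norm_boundedD:
 fixes n :: nat
 assumes fin: "finite_measure M" and S: "S \<subseteq> Mn_Linf M n" and nb: "norm_bounded M n S"
 shows "\<exists>C. \<forall>B\<in>S. AE l in M. mbd C (fm n (B l))"
proof -
 obtain C where C: "0 \<le> C \<and> (\<forall>B\<in>S. \<forall>f. DV M (%_. enat n) f --> nrm M (mat_op n B f) \<le> C * nrm M f)"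
  using nb unfolding norm_bounded_iff[OF S] by (rule exE)
 have "AE l in M. mbd (sqrt C) (fm n (B l))" if B: "B \<in> S" for B
 proof -
  let ?c = "%j. con (%_::'a. enat n) (Suc j) (unitv j)"
  have dc: "DV M (%_. enat n) (?c j)" for j by (rule DV_con[OF fin]) simp
  have BM: "B \<in> Mn_Linf M n" using B S by blast
  note dB = bounded_op_DI_D(1)[OF mat_op_bounded[OF BM]]
  have "AE l in M. sq (mat_op n B (?c j) l) \<le> C * sq (?c j l)" for j
  proof (rule AE_le_of_integrals)
   show "integrable M (%l. sq (mat_op n B (?c j) l))" by (rule DVD(4)[OF dB[OF dc]])
   show "integrable M (%l. C * sq (?c j l))" using DVD(4)[OF dc] by simp
   fix E assume E: "E \<in> sets M"
   have "mat_op n B (cut E (?c j)) = cut E (mat_op n B (?c j))" by (auto simp: fun_eq_iff mat_op_def cut_def)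
   then have "nrm M (cut E (mat_op n B (?c j))) \<le> C * nrm M (cut E (?c j))"
    using C[THEN conjunct2, rule_format, OF B DV_cut[OF E dc, of j]] by simp
   then show "(LINT l|M. indicator E l * sq (mat_op n B (?c j) l)) \<le> (LINT l|M. indicator E l * (C * sq (?c j l)))"
    unfolding nrm_cut[OF E] by (simp add: mult.left_commute)
  qed
  then have "AE l in M. \<forall>j. sq (mat_op n B (?c j) l) \<le> C * sq (?c j l)" unfolding AE_all_countable by blast
  then show ?thesis
  proof eventually_elim
   case (elim l)
   show ?case unfolding mbd_def
   proof (intro allI)
    fix i j
    show "cmod (ent (fm n (B l)) i j) \<le> sqrt C"
    proof (cases "i < n \<and> j < n")
     case True
     have "(cmod (B l $$ (i, j)))\<^sup>2 \<le> sq (mat_op n B (?c j) l)"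
      using coord_le_sq[OF DVD(1)[OF dB[OF dc]], of j l i] mat_op_unit[of i n j B l] True by simp
     also have "\<dots> \<le> C * sq (?c j l)" using elim by blast
     also have "sq (?c j l) \<le> 1" unfolding sq_con using True by (simp add: con_def unitv_def if_distrib cong: if_cong)
     then have "C * sq (?c j l) \<le> C" using C by (simp add: mult_left_le)
     finally have "cmod (B l $$ (i, j)) \<le> sqrt C" by (rule real_le_rsqrt)
     then show ?thesis using True by simp
    next
     case False
     then have "ent (fm n (B l)) i j = 0" by auto
     then show ?thesis using C by simp
    qed
   qed
  qed
 qed
 then show ?thesis by blast
qed

context comp_meas
begin

lemma Mn_Linf_mult: "B \<in> Mn_Linf M n ==> C \<in> Mn_Linf M n ==> (%l. B l * C l) \<in> Mn_Linf M n"
proof -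
 assume B: "B \<in> Mn_Linf M n" and C: "C \<in> Mn_Linf M n"
 have "tm n (fm n (B l) * fm n (C l)) = B l * C l" for l
  using Mn_carrier[OF B, of l] Mn_carrier[OF C, of l] by (simp add: fm_mult[symmetric])
 then show ?thesis using bfm_tm[OF bfm_mult[OF bfm_fm[OF B] bfm_fm[OF C]]] by simp
qed

lemma Mn_Linf_adj: "B \<in> Mn_Linf M n ==> mat_adj n B \<in> Mn_Linf M n"
proof -
 assume B: "B \<in> Mn_Linf M n"
 have "(%l. cnj (B l $$ (j, i))) \<in> borel_measurable M" if "i < n" "j < n" for i j
  by (rule measurable_compose[OF Mn_LinfD[OF B that(2,1)]]) (intro borel_measurable_continuous_onI continuous_intros)
 then show ?thesis using B unfolding Mn_Linf_def mat_adj_def by auto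
qed

end

lemma cut_AE: "AE g in N. f g = h g ==> AE g in N. cut S f g = cut S h g"
proof -
 assume "AE g in N. f g = h g"
 then show ?thesis by eventually_elim (auto simp: cut_def fun_eq_iff)
qed

section \<open>From irreducible fibres to a maximal abelian set\<close>

text \<open>A unitary \<open>U\<close> onto a direct integral with its adjoint \<open>Us\<close>,
  both acting on representatives, so that they are inverse to each other only up to equality almost
  everywhere. The map \<open>rep\<close> transports matrix fields to the direct integral.\<close>

locale fibre_rep = comp_meas M M0 K for M :: "'a::topological_space measure" and M0 K +
 fixes n :: nat and N :: "'b measure" and d and U :: "('a => nat => complex) => 'b => nat => complex" and Us
 assumes U: "bounded_op (direct_integral M (%_. enat n)) (direct_integral N d) U"
  and iso: "\<And>f h. DV M (%_. enat n) f ==> DV M (%_. enat n) h ==>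
   (LINT g|N. ip (U f g) (U h g)) = (LINT l|M. ip (f l) (h l))"
  and surj: "\<And>y. DV N d y ==> \<exists>f. DV M (%_. enat n) f \<and> (AE g in N. U f g = y g)"
  and Us: "bounded_op (direct_integral N d) (direct_integral M (%_. enat n)) Us"
  and adj: "\<And>f y. DV M (%_. enat n) f ==> DV N d y ==>
   (LINT g|N. ip (U f g) (y g)) = (LINT l|M. ip (f l) (Us y l))"
begin

abbreviation "DM \<equiv> DV M (%_. enat n)"
abbreviation "DN \<equiv> DV N d"

lemmas u = bounded_op_DI_D[OF U] and us = bounded_op_DI_D[OF Us]

text \<open>The squared norm of the difference of \<open>Us (U f)\<close> and \<open>f\<close> is
  expanded into inner products, which \<open>adj\<close> and \<open>iso\<close> cancel.\<close>

lemma UsU: assumes f: "DM f" shows "AE l in M. Us (U f) l = f l"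
proof -
 define g where "g = Us (U f)"
 have g: "DM g" unfolding g_def by (rule us(1)[OF u(1)[OF f]])
 define h where "h = (%l i. g l i + - 1 * f l i)"
 have h: "DM h" unfolding h_def by (rule DV_add[OF g DV_scale[OF f]])
 have "ip (h l) (h l) = ip (h l) (g l) - ip (h l) (f l)" for l
 proof -
  have "ip (h l) (h l) = cnj (ip (%i. g l i + - 1 * f l i) (h l))"
   using ip_cnj[OF DVD(1)[OF h] DVD(1)[OF h], of l l] unfolding h_def by simp
  also have "\<dots> = cnj (ip (g l) (h l) + - 1 * ip (f l) (h l))"
   unfolding ip_add_left[OF DVD(1)[OF g] l2_scale[OF DVD(1)[OF f]] DVD(1)[OF h]]
    ip_scale_left[OF DVD(1)[OF f] DVD(1)[OF h]] ..
  also have "\<dots> = cnj (ip (g l) (h l)) - cnj (ip (f l) (h l))" by simp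
  finally show ?thesis
   unfolding ip_cnj[OF DVD(1)[OF g] DVD(1)[OF h]] ip_cnj[OF DVD(1)[OF f] DVD(1)[OF h]] .
 qed
 then have "(LINT l|M. ip (h l) (h l)) = (LINT l|M. ip (h l) (g l)) - (LINT l|M. ip (h l) (f l))"
  by (simp add: Bochner_Integration.integral_diff[OF ip_integrable[OF h g] ip_integrable[OF h f]])
 also have "\<dots> = 0" using adj[OF h u(1)[OF f]] iso[OF h f] unfolding g_def by simp
 finally have "nrm M h = 0" unfolding ip_nrm[OF h] by simp
 then have "AE l in M. h l = (%i. 0)" using nrm_eq_0[OF h] by blast
 then show ?thesis unfolding h_def g_def by eventually_elim (simp add: fun_eq_iff)
qed

lemma UUs: assumes y: "DN y" shows "AE g in N. U (Us y) g = y g"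
proof -
 obtain x where x: "DM x \<and> (AE g in N. U x g = y g)" using surj[OF y] by (rule exE)
 then have x1: "DM x" and x2: "AE g in N. U x g = y g" by auto
 have "AE l in M. Us (U x) l = Us y l" by (rule op_cong[OF Us u(1)[OF x1] y x2])
 then have "AE l in M. Us y l = x l" using UsU[OF x1] by eventually_elim simp
 from op_cong[OF U us(1)[OF y] x1 this] show ?thesis using x2 by eventually_elim simp
qed

definition rep where "rep B y = U (mat_op n B (Us y))"

lemma rep_bounded: "B \<in> Mn_Linf M n ==> bounded_op (direct_integral N d) (direct_integral N d) (rep B)"
 using bounded_op_comp[OF bounded_op_comp[OF Us mat_op_bounded] U] unfolding comp_def rep_def[abs_def] .

lemmas repD = bounded_op_DI_D[OF rep_bounded]

lemma rep_mult:
 assumes B: "B \<in> Mn_Linf M n" and C: "C \<in> Mn_Linf M n" and y: "DN y"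
 shows "AE g in N. rep B (rep C y) g = rep (%l. B l * C l) y g"
proof -
 note b = mat_op_bounded[OF B] and c = mat_op_bounded[OF C]
 note cy = bounded_op_DI_D(1)[OF c us(1)[OF y]]
 note UC = us(1)[OF u(1)[OF cy]]
 have "AE g in N. U (mat_op n B (Us (U (mat_op n C (Us y))))) g = U (mat_op n B (mat_op n C (Us y))) g"
  by (rule op_cong[OF U bounded_op_DI_D(1)[OF b UC] bounded_op_DI_D(1)[OF b cy] op_cong[OF b UC cy UsU[OF cy]]])
 moreover have "mat_op n B (mat_op n C (Us y)) = mat_op n (%l. B l * C l) (Us y)"
  by (rule ext) (rule mat_op_mult[symmetric], use Mn_carrier[OF B] Mn_carrier[OF C] in auto)
 ultimately show ?thesis unfolding rep_def by simp
qed

lemma rep_cong: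
 assumes B: "B \<in> Mn_Linf M n" and C: "C \<in> Mn_Linf M n" and y: "DN y" and eq: "AE l in M. B l = C l"
 shows "AE g in N. rep B y g = rep C y g"
proof -
 have "AE l in M. mat_op n B (Us y) l = mat_op n C (Us y) l" using eq by eventually_elim (rule mat_op_cong, auto)
 from op_cong[OF U bounded_op_DI_D(1)[OF mat_op_bounded[OF B] us(1)[OF y]] bounded_op_DI_D(1)[OF mat_op_bounded[OF C] us(1)[OF y]] this]
 show ?thesis unfolding rep_def .
qed

lemma Us_rep_U:
 assumes B: "B \<in> Mn_Linf M n" and f: "DM f"
 shows "AE l in M. Us (rep B (U f)) l = mat_op n B f l"
proof -
 note b = mat_op_bounded[OF B] and uf = us(1)[OF u(1)[OF f]]
 have "AE l in M. mat_op n B (Us (U f)) l = mat_op n B f l" by (rule op_cong[OF b uf f UsU[OF f]])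
 then show ?thesis using UsU[OF bounded_op_DI_D(1)[OF b uf]] unfolding rep_def by eventually_elim simp
qed

lemma rep_inj:
 assumes B: "B \<in> Mn_Linf M n" and C: "C \<in> Mn_Linf M n" and eq: "\<And>y. DN y ==> AE g in N. rep B y g = rep C y g"
 shows "AE l in M. B l = C l"
proof (rule mat_op_inj[OF fin_M B C])
 fix f assume f: "DM f"
 note y = u(1)[OF f]
 show "AE l in M. mat_op n B f l = mat_op n C f l"
  using op_cong[OF Us repD(1)[OF B y] repD(1)[OF C y] eq[OF y]] Us_rep_U[OF B f] Us_rep_U[OF C f]
  by eventually_elim simp
qed

lemma rep_adj:
 assumes B: "B \<in> Mn_Linf M n" and y: "DN y" and z: "DN z"
 shows "(LINT g|N. ip (rep B y g) (z g)) = (LINT g|N. ip (y g) (rep (mat_adj n B) z g))"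
proof -
 note bA = mat_op_bounded[OF Mn_Linf_adj[OF B]]
 note by' = bounded_op_DI_D(1)[OF mat_op_bounded[OF B] us(1)[OF y]]
 note bz = bounded_op_DI_D(1)[OF bA us(1)[OF z]]
 have "(LINT g|N. ip (rep B y g) (z g)) = (LINT l|M. ip (mat_op n B (Us y) l) (Us z l))"
  unfolding rep_def by (rule adj[OF by' z])
 also have "\<dots> = (LINT l|M. ip (Us y l) (mat_op n (mat_adj n B) (Us z) l))"
 proof -
  have "ip (mat_op n B (Us y) l) (Us z l) = ip (Us y l) (mat_op n (mat_adj n B) (Us z) l)" for l
   by (rule ip_mat_op) (rule DVD(2)[OF us(1)[OF y]])
  then show ?thesis by simp
 qed
 also have "\<dots> = (LINT l|M. cnj (ip (mat_op n (mat_adj n B) (Us z) l) (Us y l)))"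
  by (simp add: ip_cnj[OF DVD(1)[OF bz] DVD(1)[OF us(1)[OF y]]])
 also have "\<dots> = cnj (LINT l|M. ip (mat_op n (mat_adj n B) (Us z) l) (Us y l))" by simp
 also have "\<dots> = cnj (LINT g|N. ip (rep (mat_adj n B) z g) (y g))" unfolding rep_def by (simp only: adj[OF bz y])
 also have "\<dots> = (LINT g|N. cnj (ip (rep (mat_adj n B) z g) (y g)))" by simp
 also have "\<dots> = (LINT g|N. ip (y g) (rep (mat_adj n B) z g))"
  by (simp add: ip_cnj[OF DVD(1)[OF repD(1)[OF Mn_Linf_adj[OF B] z]] DVD(1)[OF y]])
 finally show ?thesis .
qed

end

context fibre_rep
begin

text \<open>The cut by \<open>S\<close>, carried back by \<open>U\<close>, is multiplication by the
  matrix field \<open>B\<close>. This is what the inclusion of the diagonal algebra in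
  \<open>Mn_Linf\<close> provides for each cut.\<close>

definition cut_rep where
 "cut_rep S B \<longleftrightarrow> S \<in> sets N \<and> B \<in> Mn_Linf M n \<and> (\<forall>f. DM f --> (AE l in M. Us (cut S (U f)) l = mat_op n B f l))"

lemma cut_repD:
 assumes "cut_rep S B"
 shows "S \<in> sets N" "B \<in> Mn_Linf M n" "DM f ==> AE l in M. Us (cut S (U f)) l = mat_op n B f l"
 using assms unfolding cut_rep_def by auto

lemma cut_rep_rep:
 assumes q: "cut_rep S B" and y: "DN y" shows "AE g in N. rep B y g = cut S y g"
proof -
 note q' = cut_repD[OF q]
 note uy = us(1)[OF y]
 note c = DV_cut[OF q'(1) u(1)[OF uy]]
 have "AE g in N. U (Us (cut S (U (Us y)))) g = U (mat_op n B (Us y)) g"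
  by (rule op_cong[OF U us(1)[OF c] bounded_op_DI_D(1)[OF mat_op_bounded[OF q'(2)] uy] q'(3)[OF uy]])
 then show ?thesis using UUs[OF c] cut_AE[OF UUs[OF y], of S] unfolding rep_def by eventually_elim simp
qed

lemma rep_cut_rep:
 assumes S: "S \<in> sets N" and B: "B \<in> Mn_Linf M n" and eq: "\<And>y. DN y ==> AE g in N. rep B y g = cut S y g"
 shows "cut_rep S B"
 unfolding cut_rep_def
proof (intro conjI allI impI S B)
 fix f assume f: "DM f"
 note y = u(1)[OF f]
 show "AE l in M. Us (cut S (U f)) l = mat_op n B f l"
  using op_cong[OF Us repD(1)[OF B y] DV_cut[OF S y] eq[OF y]] Us_rep_U[OF B f] by eventually_elim simp
qed

lemma rep_commute_iff:
 assumes q: "cut_rep S B" and W: "W \<in> Mn_Linf M n" and wb: "AE l in M. W l * B l = B l * W l" and y: "DN y"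
 shows "AE g in N. rep W (cut S y) g = cut S (rep W y) g"
proof -
 note q' = cut_repD[OF q]
 note wy = repD(1)[OF W y] and by' = repD(1)[OF q'(2) y] and cy = DV_cut[OF q'(1) y]
 show ?thesis
  using op_cong[OF rep_bounded[OF W] by' cy cut_rep_rep[OF q y]] rep_mult[OF W q'(2) y] rep_mult[OF q'(2) W y]
   rep_cong[OF Mn_Linf_mult[OF W q'(2)] Mn_Linf_mult[OF q'(2) W] y wb] cut_rep_rep[OF q wy]
  by eventually_elim simp
qed

end

locale irreducible_rep = fibre_rep +
 fixes A X Y F
 assumes finN: "finite_measure N" and dk: "\<And>k. {g \<in> space N. enat k < d g} \<in> sets N" and d1: "\<And>g. 1 \<le> d g"
  and A: "A \<in> Mn_Linf M n" and X: "X \<in> Mn_Linf M n" and Y: "Y \<in> Mn_Linf M n"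
  and XY: "AE l in M. X l * Y l = 1\<^sub>m n \<and> Y l * X l = 1\<^sub>m n"
  and F: "\<And>y. DN y ==> AE g in N. rep (%l. X l * A l * Y l) y g = F g (y g)"
  and irr: "AE g in N. strongly_irreducible (hdim (d g)) (F g)"
  and diag: "\<And>S. S \<in> sets N ==> \<exists>B. cut_rep S B"
begin

definition D where "D l = X l * A l * Y l"

lemma D: "D \<in> Mn_Linf M n"
 using Mn_Linf_mult[OF Mn_Linf_mult[OF X A] Y] unfolding D_def[abs_def] .

lemma D_rep: "DN y ==> AE g in N. rep D y g = F g (y g)"
 using F unfolding D_def[abs_def] .

text \<open>After transport \<open>D\<close> acts fibrewise, and such an action commutes with cuts
  because \<open>F g\<close> maps 0 to 0.\<close>

lemma cut_rep_D:
 assumes q: "cut_rep S B" shows "AE l in M. D l * B l = B l * D l"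
proof (rule rep_inj[OF Mn_Linf_mult[OF D cut_repD(2)[OF q]] Mn_Linf_mult[OF cut_repD(2)[OF q] D]])
 fix y assume y: "DN y"
 note S = cut_repD(1)[OF q] and B = cut_repD(2)[OF q]
 note Dy = repD(1)[OF D y] and By = repD(1)[OF B y] and cy = DV_cut[OF S y]
 show "AE g in N. rep (%l. D l * B l) y g = rep (%l. B l * D l) y g"
  using rep_mult[OF D B y] rep_mult[OF B D y] op_cong[OF rep_bounded[OF D] By cy cut_rep_rep[OF q y]] D_rep[OF cy] D_rep[OF y]
   cut_rep_rep[OF q Dy] irr
 proof eventually_elim
  case (elim g)
  have "F g (%i. 0) = (%i. 0)" using bounded_op_hdim_zero elim(7) unfolding strongly_irreducible_def by blast
  then have "F g (cut S y g) = cut S (rep D y) g" using elim(5) by (cases "g \<in> S") (simp_all add: cut_in cut_out)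
  then show ?case using elim by simp
 qed
qed

lemma cut_rep_commute:
 assumes q: "cut_rep S B" and q2: "cut_rep T C" shows "AE l in M. B l * C l = C l * B l"
proof (rule rep_inj[OF Mn_Linf_mult[OF cut_repD(2)[OF q] cut_repD(2)[OF q2]] Mn_Linf_mult[OF cut_repD(2)[OF q2] cut_repD(2)[OF q]]])
 fix y assume y: "DN y"
 note S = cut_repD(1)[OF q] and B = cut_repD(2)[OF q] and T = cut_repD(1)[OF q2] and C = cut_repD(2)[OF q2]
 have cc: "cut S (cut T y) = cut T (cut S y)" by (auto simp: cut_def fun_eq_iff)
 show "AE g in N. rep (%l. B l * C l) y g = rep (%l. C l * B l) y g"
  using rep_mult[OF B C y] rep_mult[OF C B y] cut_rep_rep[OF q repD(1)[OF C y]] cut_rep_rep[OF q2 repD(1)[OF B y]]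
   cut_AE[OF cut_rep_rep[OF q2 y], of S] cut_AE[OF cut_rep_rep[OF q y], of T]
  by eventually_elim (simp add: cc)
qed

lemma cut_rep_idem:
 assumes q: "cut_rep S B" shows "AE l in M. B l * B l = B l"
proof (rule rep_inj[OF Mn_Linf_mult[OF cut_repD(2)[OF q] cut_repD(2)[OF q]] cut_repD(2)[OF q]])
 fix y assume y: "DN y"
 note S = cut_repD(1)[OF q] and B = cut_repD(2)[OF q]
 have cc: "cut S (cut S y) = cut S y" by (auto simp: cut_def fun_eq_iff)
 show "AE g in N. rep (%l. B l * B l) y g = rep B y g"
  using rep_mult[OF B B y] cut_rep_rep[OF q repD(1)[OF B y]] cut_AE[OF cut_rep_rep[OF q y], of S] cut_rep_rep[OF q y]
  by eventually_elim (simp add: cc)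
qed

text \<open>Since \<open>W\<close> commutes with the matrix fields of all cuts, its transport
  commutes with the cuts; since it commutes with \<open>D\<close>, the fibres of its transport
  commute with the \<open>F g\<close>. Hence \<open>irreducible_idempotent_cut\<close>
  applies.\<close>

lemma idempotent_cut_rep:
 assumes W: "W \<in> Mn_Linf M n" and WD: "AE l in M. W l * D l = D l * W l" and WW: "AE l in M. W l * W l = W l"
  and WB: "\<And>S B. cut_rep S B ==> AE l in M. W l * B l = B l * W l"
 shows "\<exists>S. cut_rep S W"
proof -
 have "\<exists>S\<in>sets N. \<forall>f. DN f --> (AE g in N. rep W f g = cut S f g)"
 proof (rule irreducible_idempotent_cut[where R' = "rep (mat_adj n W)" and T = "rep D" and F = F, OF finN dk d1 rep_bounded[OF W]])
  show "DN (rep (mat_adj n W) h)" if "DN h" for h by (rule repD(1)[OF Mn_Linf_adj[OF W] that])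
  show "(LINT g|N. ip (rep W f g) (h g)) = (LINT g|N. ip (f g) (rep (mat_adj n W) h g))" if "DN f" "DN h" for f h
   by (rule rep_adj[OF W that])
  show "AE g in N. rep W (cut S f) g = cut S (rep W f) g" if S: "S \<in> sets N" and f: "DN f" for S f
  proof -
   obtain B where B: "cut_rep S B" using diag[OF S] by (rule exE)
   show ?thesis by (rule rep_commute_iff[OF B W WB[OF B] f])
  qed
  show "AE g in N. rep W (rep W f) g = rep W f g" if f: "DN f" for f
   using rep_mult[OF W W f] rep_cong[OF Mn_Linf_mult[OF W W] W f WW] by eventually_elim simp
  show "DN (rep D f)" if "DN f" for f by (rule repD(1)[OF D that])
  show "AE g in N. rep W (rep D f) g = rep D (rep W f) g" if f: "DN f" for f
   using rep_mult[OF W D f] rep_mult[OF D W f] rep_cong[OF Mn_Linf_mult[OF W D] Mn_Linf_mult[OF D W] f WD]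
   by eventually_elim simp
  show "AE g in N. rep D f g = F g (f g)" if "DN f" for f by (rule D_rep[OF that])
  show "AE g in N. strongly_irreducible (hdim (d g)) (F g)" by (rule irr)
 qed
 then obtain S where "S \<in> sets N" "\<forall>f. DN f --> (AE g in N. rep W f g = cut S f g)" by (elim bexE)
 then show ?thesis by (intro exI[of _ S] rep_cut_rep W) auto
qed

text \<open>The characteristic functions in the diagonal algebra, carried back through
  \<open>U\<close> and then through the similarity between \<open>X A Y\<close> and
  \<open>A\<close>.\<close>

definition diag_idempotents where
 "diag_idempotents = {Z \<in> commutant_idempotents M n A. \<exists>S B. cut_rep S B \<and> (AE l in M. Z l = Y l * B l * X l)}"

lemma fmXY: "AE l in M. fm n (X l) * fm n (Y l) = e n \<and> fm n (Y l) * fm n (X l) = e n"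
 using XY
proof eventually_elim
 case (elim l)
 have c: "X l \<in> carrier_mat n n" "Y l \<in> carrier_mat n n" using Mn_carrier[OF X] Mn_carrier[OF Y] by auto
 show ?case using elim fm_mult[OF c] fm_mult[OF c(2,1)] by simp
qed

lemma fm3: "B \<in> Mn_Linf M n ==> C \<in> Mn_Linf M n ==> Z \<in> Mn_Linf M n ==> fm n (B l * C l * Z l) = fm n (B l) * (fm n (C l) * fm n (Z l))"
proof -
 assume "B \<in> Mn_Linf M n" "C \<in> Mn_Linf M n" "Z \<in> Mn_Linf M n"
 then have c: "B l \<in> carrier_mat n n" "C l \<in> carrier_mat n n" "Z l \<in> carrier_mat n n" by (simp_all add: Mn_carrier)
 show ?thesis unfolding fm_mult[OF mult_carrier_mat[OF c(1,2)] c(3)] fm_mult[OF c(1,2)] by (simp add: mult.assoc)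
qed

lemma fm_comm: "B \<in> Mn_Linf M n ==> C \<in> Mn_Linf M n ==> B l * C l = C l * B l \<longleftrightarrow> fm n (B l) * fm n (C l) = fm n (C l) * fm n (B l)"
 by (rule fm_comm_iff) (auto intro: Mn_carrier)

lemma fm_idem: "B \<in> Mn_Linf M n ==> B l * B l = B l \<longleftrightarrow> fm n (B l) * fm n (B l) = fm n (B l)"
proof -
 assume "B \<in> Mn_Linf M n"
 then have c: "B l \<in> carrier_mat n n" by (simp add: Mn_carrier)
 show ?thesis using fm_inj[OF mult_carrier_mat[OF c c] c] fm_mult[OF c c] by simp
qed

lemma cancel:
 assumes "u * v = e n" shows "u * (v * fm n Z) = fm n Z" "u * (v * (fm n Z * w)) = fm n Z * w"
 using assms by (simp_all add: mult.assoc[symmetric] e_mult[OF rect_fm])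

lemma conj_in:
 assumes q: "cut_rep S B" shows "(%l. Y l * B l * X l) \<in> diag_idempotents"
proof -
 note B = cut_repD(2)[OF q]
 define Z where "Z l = Y l * B l * X l" for l
 have Z: "Z \<in> Mn_Linf M n" unfolding Z_def[abs_def] by (rule Mn_Linf_mult[OF Mn_Linf_mult[OF Y B] X])
 have fZ: "fm n (Z l) = fm n (Y l) * (fm n (B l) * fm n (X l))" for l unfolding Z_def by (rule fm3[OF Y B X])
 have fD: "fm n (D l) = fm n (X l) * (fm n (A l) * fm n (Y l))" for l unfolding D_def by (rule fm3[OF X A Y])
 have "AE l in M. A l * Z l = Z l * A l"
  using cut_rep_D[OF q] fmXY
 proof eventually_elim
  case (elim l)
  let ?x = "fm n (X l)" and ?y = "fm n (Y l)" and ?a = "fm n (A l)" and ?b = "fm n (B l)" and ?d = "fm n (D l)"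
  have db: "?d * ?b = ?b * ?d" using elim(1) fm_comm[OF D B] by blast
  have yd: "?y * ?d = ?a * ?y" unfolding fD using cancel(2) elim(2) by blast
  have dx: "?d * ?x = ?x * ?a" unfolding fD using elim(2) mult_e[OF rect_fm] by (simp add: mult.assoc)
  have "?a * (?y * (?b * ?x)) = ?a * ?y * ?b * ?x" by (simp add: mult.assoc)
  also have "\<dots> = ?y * (?d * ?b) * ?x" unfolding yd[symmetric] by (simp add: mult.assoc)
  also have "\<dots> = ?y * ?b * (?d * ?x)" unfolding db by (simp add: mult.assoc)
  also have "\<dots> = ?y * (?b * ?x) * ?a" unfolding dx by (simp add: mult.assoc)
  finally show ?case unfolding fm_comm[OF A Z] fZ .
 qed
 moreover have "AE l in M. Z l * Z l = Z l"
  using cut_rep_idem[OF q] fmXY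
 proof eventually_elim
  case (elim l)
  have "fm n (B l) * fm n (B l) = fm n (B l)" using elim(1) fm_idem[OF B] by blast
  then have bb: "fm n (B l) * (fm n (B l) * w) = fm n (B l) * w" for w by (simp add: mult.assoc[symmetric])
  have "fm n (Z l) * fm n (Z l) = fm n (Y l) * (fm n (B l) * (fm n (X l) * (fm n (Y l) * (fm n (B l) * fm n (X l)))))"
   unfolding fZ by (simp add: mult.assoc)
  also have "fm n (X l) * (fm n (Y l) * (fm n (B l) * fm n (X l))) = fm n (B l) * fm n (X l)"
   using cancel(2) elim(2) by blast
  finally show ?case unfolding fm_idem[OF Z] bb fZ .
 qed
 ultimately have "Z \<in> diag_idempotents"
  unfolding diag_idempotents_def commutant_idempotents_def rel_commutant_def using Z q
  by (auto simp: Z_def intro!: exI[of _ S] exI[of _ B])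
 then show ?thesis unfolding Z_def[abs_def] .
qed

lemma diag_sub: "diag_idempotents \<subseteq> Mn_Linf M n"
 unfolding diag_idempotents_def commutant_idempotents_def rel_commutant_def by blast

lemma diag_commuting: "commuting_idempotents M n A diag_idempotents"
 unfolding commuting_idempotents_def
proof (intro conjI ballI)
 show "diag_idempotents \<subseteq> commutant_idempotents M n A" unfolding diag_idempotents_def by blast
 fix P Q assume P: "P \<in> diag_idempotents" and Q: "Q \<in> diag_idempotents"
 obtain S B where B: "cut_rep S B" "AE l in M. P l = Y l * B l * X l" using P unfolding diag_idempotents_def by auto
 obtain T C where C: "cut_rep T C" "AE l in M. Q l = Y l * C l * X l" using Q unfolding diag_idempotents_def by auto
 note Bm = cut_repD(2)[OF B(1)] and Cm = cut_repD(2)[OF C(1)]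
 have PM: "P \<in> Mn_Linf M n" "Q \<in> Mn_Linf M n" using P Q diag_sub by auto
 show "AE l in M. P l * Q l = Q l * P l"
  using B(2) C(2) cut_rep_commute[OF B(1) C(1)] fmXY
 proof eventually_elim
  case (elim l)
  let ?x = "fm n (X l)" and ?y = "fm n (Y l)" and ?b = "fm n (B l)" and ?c = "fm n (C l)"
  have bc: "?b * ?c = ?c * ?b" using elim(3) fm_comm[OF Bm Cm] by blast
  have "?y * (?b * ?x) * (?y * (?c * ?x)) = ?y * (?b * (?x * (?y * (?c * ?x))))" by (simp add: mult.assoc)
  also have "?x * (?y * (?c * ?x)) = ?c * ?x" using cancel(2) elim(4) by blast
  also have "?y * (?b * (?c * ?x)) = ?y * ((?b * ?c) * ?x)" by (simp add: mult.assoc)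
  also have "\<dots> = ?y * (?c * (?b * ?x))" unfolding bc by (simp add: mult.assoc)
  also have "\<dots> = ?y * (?c * (?x * (?y * (?b * ?x))))"
   using cancel(2)[where u = ?x and v = ?y and Z = "B l" and w = ?x] elim(4) by simp
  also have "\<dots> = ?y * (?c * ?x) * (?y * (?b * ?x))" by (simp add: mult.assoc)
  finally show ?case unfolding fm_comm[OF PM] unfolding elim(1,2) unfolding fm3[OF Y Bm X] fm3[OF Y Cm X] .
 qed
qed

text \<open>An idempotent that commutes with all of them is moved forward to
  \<open>W = X Z Y\<close>, which commutes with \<open>D\<close> and with the matrix fields of all
  cuts and is therefore such a field itself.\<close>

lemma diag_maximal:
 assumes S': "commuting_idempotents M n A S'" and sub: "diag_idempotents \<subseteq> S'" shows "S' = diag_idempotents"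
proof (rule equalityI[OF subsetI sub])
 fix Z assume Z: "Z \<in> S'"
 have Zc: "Z \<in> commutant_idempotents M n A" using Z S' unfolding commuting_idempotents_def by blast
 then have ZM: "Z \<in> Mn_Linf M n" and ZA: "AE l in M. A l * Z l = Z l * A l" and ZZ: "AE l in M. Z l * Z l = Z l"
  unfolding commutant_idempotents_def rel_commutant_def by auto
 define W where "W l = X l * Z l * Y l" for l
 have W: "W \<in> Mn_Linf M n" unfolding W_def[abs_def] by (rule Mn_Linf_mult[OF Mn_Linf_mult[OF X ZM] Y])
 have fW: "fm n (W l) = fm n (X l) * (fm n (Z l) * fm n (Y l))" for l unfolding W_def by (rule fm3[OF X ZM Y])
 have fD: "fm n (D l) = fm n (X l) * (fm n (A l) * fm n (Y l))" for l unfolding D_def by (rule fm3[OF X A Y])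
 have WD: "AE l in M. W l * D l = D l * W l"
  using ZA fmXY
 proof eventually_elim
  case (elim l)
  let ?x = "fm n (X l)" and ?y = "fm n (Y l)" and ?a = "fm n (A l)" and ?z = "fm n (Z l)"
  have az: "?a * ?z = ?z * ?a" using elim(1) fm_comm[OF A ZM] by blast
  have c: "?y * (?x * (?a * ?y)) = ?a * ?y" "?y * (?x * (?z * ?y)) = ?z * ?y" using cancel(2) elim(2) by blast+
  have "?x * (?z * ?y) * (?x * (?a * ?y)) = ?x * (?z * (?y * (?x * (?a * ?y))))" by (simp add: mult.assoc)
  also have "\<dots> = ?x * (?z * ?a * ?y)" unfolding c by (simp add: mult.assoc)
  also have "\<dots> = ?x * (?a * (?z * ?y))" unfolding az[symmetric] by (simp add: mult.assoc)
  also have "\<dots> = ?x * (?a * (?y * (?x * (?z * ?y))))" unfolding c ..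
  also have "\<dots> = ?x * (?a * ?y) * (?x * (?z * ?y))" by (simp add: mult.assoc)
  finally show ?case unfolding fm_comm[OF W D] fW fD .
 qed
 have WW: "AE l in M. W l * W l = W l"
  using ZZ fmXY
 proof eventually_elim
  case (elim l)
  let ?x = "fm n (X l)" and ?y = "fm n (Y l)" and ?z = "fm n (Z l)"
  have zz: "?z * ?z = ?z" using elim(1) fm_idem[OF ZM] by blast
  have c: "?y * (?x * (?z * ?y)) = ?z * ?y" using cancel(2) elim(2) by blast
  have "?x * (?z * ?y) * (?x * (?z * ?y)) = ?x * (?z * (?y * (?x * (?z * ?y))))" by (simp add: mult.assoc)
  also have "\<dots> = ?x * ((?z * ?z) * ?y)" unfolding c by (simp add: mult.assoc)
  finally show ?case unfolding fm_idem[OF W] fW zz .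
 qed
 have WB: "AE l in M. W l * B l = B l * W l" if q: "cut_rep S B" for S B
 proof -
  note B = cut_repD(2)[OF q]
  have "AE l in M. Z l * (Y l * B l * X l) = Y l * B l * X l * Z l"
   by (rule conjunct2[OF S'[unfolded commuting_idempotents_def], rule_format, OF Z subsetD[OF sub conj_in[OF q]]])
  then show ?thesis using fmXY
  proof eventually_elim
   case (elim l)
   let ?x = "fm n (X l)" and ?y = "fm n (Y l)" and ?b = "fm n (B l)" and ?z = "fm n (Z l)"
   have zb: "?z * (?y * (?b * ?x)) = (?y * (?b * ?x)) * ?z"
    using elim(1) fm_comm[OF ZM Mn_Linf_mult[OF Mn_Linf_mult[OF Y B] X]] unfolding fm3[OF Y B X] by blast
   have xy: "?x * ?y = e n" using elim(2) by blast
   have "?x * (?z * ?y) * ?b = ?x * (?z * (?y * (?b * (?x * ?y))))"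
    unfolding xy mult_e[OF rect_fm] by (simp add: mult.assoc)
   also have "\<dots> = ?x * ((?z * (?y * (?b * ?x))) * ?y)" by (simp add: mult.assoc)
   also have "\<dots> = ?x * (?y * (?b * (?x * (?z * ?y))))" unfolding zb by (simp add: mult.assoc)
   also have "\<dots> = ?b * (?x * (?z * ?y))" by (rule cancel(2)[OF xy])
   finally show ?case unfolding fm_comm[OF W B] fW .
  qed
 qed
 obtain S where S: "cut_rep S W" using idempotent_cut_rep[OF W WD WW WB] by (rule exE)
 have "AE l in M. Z l = Y l * W l * X l"
  using fmXY
 proof eventually_elim
  case (elim l)
  let ?x = "fm n (X l)" and ?y = "fm n (Y l)" and ?z = "fm n (Z l)"
  have yx: "?y * ?x = e n" using elim by blast
  have "?y * ((?x * (?z * ?y)) * ?x) = ?y * (?x * (?z * (?y * ?x)))" by (simp add: mult.assoc)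
  also have "\<dots> = ?z" unfolding yx mult_e[OF rect_fm] by (rule cancel(1)[OF yx])
  finally have "fm n (Y l * W l * X l) = ?z" unfolding fm3[OF Y W X] fW .
  then show ?case using fm_inj[OF Mn_carrier[OF ZM] Mn_carrier[OF Mn_Linf_mult[OF Mn_Linf_mult[OF Y W] X]], of l l] by simp
 qed
 then show "Z \<in> diag_idempotents" unfolding diag_idempotents_def using Zc S by blast
qed

text \<open>Cuts are contractions, so the bounds of the fixed operators given by \<open>Y\<close>,
  \<open>Us\<close>, \<open>U\<close> and \<open>X\<close> suffice.\<close>

lemma diag_norm_bounded: "norm_bounded M n diag_idempotents"
 unfolding norm_bounded_iff[OF diag_sub]
proof -
 obtain c1 where c1: "0 \<le> c1 \<and> (\<forall>f. DM f --> nrm M (mat_op n Y f) \<le> c1 * nrm M f)" using bounded_op_DI_D(4)[OF mat_op_bounded[OF Y]] by (rule exE)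
 obtain c2 where c2: "0 \<le> c2 \<and> (\<forall>f. DM f --> nrm M (mat_op n X f) \<le> c2 * nrm M f)" using bounded_op_DI_D(4)[OF mat_op_bounded[OF X]] by (rule exE)
 obtain c3 where c3: "0 \<le> c3 \<and> (\<forall>f. DM f --> nrm N (U f) \<le> c3 * nrm M f)" using u(4) by (rule exE)
 obtain c4 where c4: "0 \<le> c4 \<and> (\<forall>f. DN f --> nrm M (Us f) \<le> c4 * nrm N f)" using us(4) by (rule exE)
 show "\<exists>C\<ge>0. \<forall>B\<in>diag_idempotents. \<forall>f. DM f --> nrm M (mat_op n B f) \<le> C * nrm M f"
 proof (intro exI[of _ "c1 * (c4 * (c3 * c2))"] conjI ballI allI impI)
  show "0 \<le> c1 * (c4 * (c3 * c2))" using c1 c2 c3 c4 by simp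
  fix Z f assume Z: "Z \<in> diag_idempotents" and f: "DM f"
  obtain S B where q: "cut_rep S B" "AE l in M. Z l = Y l * B l * X l" using Z unfolding diag_idempotents_def by auto
  note S = cut_repD(1)[OF q(1)] and B = cut_repD(2)[OF q(1)]
  have ZM: "Z \<in> Mn_Linf M n" using Z diag_sub by auto
  define h where "h = mat_op n X f"
  have h: "DM h" unfolding h_def by (rule bounded_op_DI_D(1)[OF mat_op_bounded[OF X] f])
  have Bh: "DM (mat_op n B h)" by (rule bounded_op_DI_D(1)[OF mat_op_bounded[OF B] h])
  have Yh: "DM (mat_op n Y (mat_op n B h))" by (rule bounded_op_DI_D(1)[OF mat_op_bounded[OF Y] Bh])
  have Zf: "DM (mat_op n Z f)" by (rule bounded_op_DI_D(1)[OF mat_op_bounded[OF ZM] f])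
  have cUh: "DN (cut S (U h))" by (rule DV_cut[OF S u(1)[OF h]])
  have eq: "mat_op n (%l. Y l * B l * X l) f = mat_op n Y (mat_op n B h)"
  proof
   fix l
   have "mat_op n (%l. Y l * B l * X l) f l = mat_op n (%l. Y l * B l) h l" unfolding h_def
    by (rule mat_op_mult) (use Mn_carrier[OF Mn_Linf_mult[OF Y B]] Mn_carrier[OF X] in auto)
   also have "\<dots> = mat_op n Y (mat_op n B h) l"
    by (rule mat_op_mult) (use Mn_carrier[OF Y] Mn_carrier[OF B] in auto)
   finally show "mat_op n (%l. Y l * B l * X l) f l = mat_op n Y (mat_op n B h) l" .
  qed
  have "AE l in M. mat_op n Z f l = mat_op n Y (mat_op n B h) l" unfolding eq[symmetric]
   using q(2) by eventually_elim (rule mat_op_cong, auto)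
  then have "nrm M (mat_op n Z f) = nrm M (mat_op n Y (mat_op n B h))" by (rule nrm_cong[OF Zf Yh])
  also have "\<dots> \<le> c1 * nrm M (mat_op n B h)" using c1 Bh by blast
  also have "nrm M (mat_op n B h) = nrm M (Us (cut S (U h)))" by (rule nrm_cong[OF us(1)[OF cUh] Bh cut_repD(3)[OF q(1) h], symmetric])
  also have "c1 * \<dots> \<le> c1 * (c4 * (c3 * (c2 * nrm M f)))"
  proof (intro mult_left_mono)
   have "nrm M (Us (cut S (U h))) \<le> c4 * nrm N (cut S (U h))" using c4 cUh by blast
   also have "\<dots> \<le> c4 * nrm N (U h)"
   proof (intro mult_left_mono)
    show "nrm N (cut S (U h)) \<le> nrm N (U h)" unfolding nrm_def
    proof (rule integral_mono_AE[OF DVD(4)[OF cUh] DVD(4)[OF u(1)[OF h]]], rule AE_I2)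
     fix g show "sq (cut S (U h) g) \<le> sq (U h g)" using sq_nonneg by (cases "g \<in> S") (simp_all add: cut_in cut_out)
    qed
   qed (use c4 in simp)
   also have "\<dots> \<le> c4 * (c3 * nrm M h)" using c3 c4 h by (intro mult_left_mono) auto
   also have "\<dots> \<le> c4 * (c3 * (c2 * nrm M f))" unfolding h_def using c2 c3 c4 f by (intro mult_left_mono) auto
   finally show "nrm M (Us (cut S (U h))) \<le> c4 * (c3 * (c2 * nrm M f))" .
  qed (use c1 in simp)
  finally show "nrm M (mat_op n Z f) \<le> c1 * (c4 * (c3 * c2)) * nrm M f" by (simp add: mult.assoc)
 qed
qed

lemma diag_bounded_maximal: "bounded_maximal_abelian_idempotents M n A diag_idempotents"
 unfolding bounded_maximal_abelian_idempotents_def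
 by (intro conjI allI impI diag_norm_bounded diag_commuting) (rule diag_maximal, auto)

end

lemma cut_diagonal:
 assumes S: "S \<in> sets N" and dj: "\<And>j. {g. d g = j} \<in> sets N"
 shows "cut S \<in> diagonal_algebra N d"
 unfolding diagonal_algebra_def
proof (intro CollectI exI conjI)
 let ?F = "%g x i. if g \<in> S then x i else (0::complex)"
 show "decomposes N d (cut S) ?F" unfolding decomposes_def operator_field_def
 proof (intro conjI allI ballI)
  show "bounded_op (direct_integral N d) (direct_integral N d) (cut S)" unfolding bounded_op_DI
  proof (intro conjI allI impI exI[of _ 1])
   show "DV N d (cut S f)" if "DV N d f" for f by (rule DV_cut[OF S that])
   show "nrm N (cut S f) \<le> 1 * nrm N f" if f: "DV N d f" for f
   proof -
    have "nrm N (cut S f) \<le> nrm N f" unfolding nrm_def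
    proof (rule integral_mono_AE[OF DVD(4)[OF DV_cut[OF S f]] DVD(4)[OF f]], rule AE_I2)
     fix g show "sq (cut S f g) \<le> sq (f g)" using sq_nonneg by (cases "g \<in> S") (simp_all add: cut_in cut_out)
    qed
    then show ?thesis by simp
   qed
  qed (auto simp: cut_def fun_eq_iff)
  show "bounded_op (hdim (d g)) (hdim (d g)) (?F g)" for g unfolding bounded_op_hdim
  proof (intro conjI allI impI exI[of _ 1])
   show "hv (d g) (?F g x)" if "hv (d g) x" for x using that hv_zero by (cases "g \<in> S") simp_all
   show "sq (?F g x) \<le> 1 * sq x" for x using sq_nonneg by (cases "g \<in> S") simp_all
  qed auto
  show "(%g. if d g = j then ?F g x i else 0) \<in> borel_measurable N" for j x i
  proof -
   have [measurable]: "Measurable.pred N (%g. d g = j)" "Measurable.pred N (%g. g \<in> S)"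
    using dj[of j] S sets.sets_into_space[OF dj[of j]] unfolding pred_def by (auto simp: Int_absorb1 Collect_conj_eq)
   show ?thesis by measurable
  qed
  show "AE g in N. cut S f g = ?F g (f g)" for f by (simp add: cut_def)
 qed
 show "AE g in N. \<exists>c. op_eq (hdim (d g)) (hdim (d g)) (?F g) (vscale (hdim (d g)) c)"
 proof (rule AE_I2)
  fix g
  show "\<exists>c. op_eq (hdim (d g)) (hdim (d g)) (?F g) (vscale (hdim (d g)) c)"
   by (rule exI[of _ "if g \<in> S then 1 else 0"]) (auto simp: op_eq_def heq_hdim)
 qed
qed

text \<open>The hypothesis on the diagonal algebra is applied to characteristic functions, so that
  every cut has a matrix field. The set obtained is \<open>diag_idempotents\<close>.\<close>

lemma (in comp_meas) direct_integral_bounded_maximal: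
 assumes A: "A \<in> Mn_Linf M n" and s: "similar_to_direct_integral M n A"
 shows "\<exists>S. bounded_maximal_abelian_idempotents M n A S"
proof -
 obtain X Y and G :: "real set" and N d U Us where XY: "Mn_inverse_pair M n X Y" and N: "compactly_supported_measure G N"
  and d: "dimension_function d" and U: "unitary_op (L2n M n) (direct_integral N d) U"
  and Us: "adjoint_op (L2n M n) (direct_integral N d) U Us"
  and ir: "direct_integral_of_strongly_irreducibles N d (U \<circ> mat_op n X \<circ> mat_op n A \<circ> mat_op n Y \<circ> Us)"
  and diag: "\<forall>T\<in>diagonal_algebra N d. \<exists>B\<in>Mn_Linf M n. op_eq (L2n M n) (L2n M n) (Us \<circ> T \<circ> U) (mat_op n B)"
  using s unfolding similar_to_direct_integral_def by (elim exE conjE) (rule that)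
 obtain N0 where N0: "sets N0 = sets borel" "finite_measure N0" "emeasure N0 (- G) = 0" "N = completion N0" and G: "compact G"
  using N unfolding compactly_supported_measure_def by auto
 interpret NN: comp_meas N N0 G
  by (intro comp_meas.intro N0 borel_closed compact_imp_closed G)
 have dj: "{g. d g = j} \<in> sets N" for j using d NN.borel_sub unfolding dimension_function_def by blast
 have d1: "1 \<le> d g" for g using d unfolding dimension_function_def by blast
 have dk: "{g \<in> space N. enat k < d g} \<in> sets N" for k
 proof -
  have "(\<Union>j\<in>{..k}. {g. d g = enat j}) \<in> sets N" by (intro sets.finite_UN dj) simp
  then have "space N - (\<Union>j\<in>{..k}. {g. d g = enat j}) \<in> sets N" by (rule sets.compl_sets)
  moreover have "space N - (\<Union>j\<in>{..k}. {g. d g = enat j}) = {g \<in> space N. enat k < d g}"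
  proof (rule Set.set_eqI)
   fix g show "g \<in> space N - (\<Union>j\<in>{..k}. {g. d g = enat j}) \<longleftrightarrow> g \<in> {g \<in> space N. enat k < d g}"
    by (cases "d g") auto
  qed
  ultimately show ?thesis by simp
 qed
 note di = direct_integral_simps
 have Ub: "bounded_op (direct_integral M (%_. enat n)) (direct_integral N d) U" using U unfolding unitary_op_def L2n_def by blast
 have Usb: "bounded_op (direct_integral N d) (direct_integral M (%_. enat n)) Us" using Us unfolding adjoint_op_def L2n_def by blast
 note uu = U[unfolded unitary_op_def L2n_def di, THEN conjunct2] and ua = Us[unfolded adjoint_op_def L2n_def di, THEN conjunct2]
 interpret fibre_rep M M0 K n N d U Us
 proof unfold_locales
  show "bounded_op (direct_integral M (%_. enat n)) (direct_integral N d) U" by (rule Ub)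
  show "bounded_op (direct_integral N d) (direct_integral M (%_. enat n)) Us" by (rule Usb)
  show "(LINT g|N. ip (U f g) (U h g)) = (LINT l|M. ip (f l) (h l))" if "DV M (%_. enat n) f" "DV M (%_. enat n) h" for f h
   by (rule uu[THEN conjunct1, rule_format]) (use that in simp_all)
  show "(LINT g|N. ip (U f g) (y g)) = (LINT l|M. ip (f l) (Us y l))" if "DV M (%_. enat n) f" "DV N d y" for f y
   by (rule ua[rule_format]) (use that in simp_all)
  show "\<exists>f. DV M (%_. enat n) f \<and> (AE g in N. U f g = y g)" if y: "DV N d y" for y
  proof -
   have "\<exists>x\<in>vecs (direct_integral M (%_. enat n)). heq (direct_integral N d) (U x) y"
    by (rule uu[THEN conjunct2, rule_format]) (use y in simp)
   then obtain x where x: "DV M (%_. enat n) x" "heq (direct_integral N d) (U x) y" by auto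
   then show ?thesis using heq_DI[OF bounded_op_DI_D(1)[OF Ub x(1)] y] by blast
  qed
 qed
 have XYm: "X \<in> Mn_Linf M n" "Y \<in> Mn_Linf M n" "AE l in M. X l * Y l = 1\<^sub>m n \<and> Y l * X l = 1\<^sub>m n"
  using XY unfolding Mn_inverse_pair_def by auto
 obtain F where F: "decomposes N d (U \<circ> mat_op n X \<circ> mat_op n A \<circ> mat_op n Y \<circ> Us) F"
  and irr: "AE g in N. strongly_irreducible (hdim (d g)) (F g)"
  using ir unfolding direct_integral_of_strongly_irreducibles_def by auto
 have eq: "(U \<circ> mat_op n X \<circ> mat_op n A \<circ> mat_op n Y \<circ> Us) y = rep (%l. X l * A l * Y l) y" for y
 proof -
  have "mat_op n X (mat_op n A (mat_op n Y (Us y))) l = mat_op n (%l. X l * A l * Y l) (Us y) l" for l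
  proof -
   have c: "X l \<in> carrier_mat n n" "A l \<in> carrier_mat n n" "Y l \<in> carrier_mat n n" for l
    using Mn_carrier[OF XYm(1)] Mn_carrier[OF A] Mn_carrier[OF XYm(2)] by auto
   have "mat_op n (%l. X l * A l * Y l) (Us y) l = mat_op n (%l. X l * A l) (mat_op n Y (Us y)) l"
    by (rule mat_op_mult) (rule mult_carrier_mat[OF c(1,2)] c(3))+
   also have "\<dots> = mat_op n X (mat_op n A (mat_op n Y (Us y))) l" by (rule mat_op_mult) (rule c)+
   finally show ?thesis by (rule sym)
  qed
  then have "mat_op n X (mat_op n A (mat_op n Y (Us y))) = mat_op n (%l. X l * A l * Y l) (Us y)" by (rule ext)
  then show ?thesis by (simp add: rep_def)
 qed
 interpret irreducible_rep M M0 K n N d U Us A X Y F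
 proof (intro irreducible_rep.intro irreducible_rep_axioms.intro fibre_rep_axioms)
  show "AE g in N. rep (%l. X l * A l * Y l) y g = F g (y g)" if y: "DV N d y" for y
  proof -
   have "y \<in> vecs (direct_integral N d)" using y by simp
   from F[unfolded decomposes_def, THEN conjunct2, THEN conjunct2, rule_format, OF this] show ?thesis unfolding eq .
  qed
  show "\<exists>B. cut_rep S B" if S: "S \<in> sets N" for S
  proof -
   obtain B where B: "B \<in> Mn_Linf M n" "op_eq (L2n M n) (L2n M n) (Us \<circ> cut S \<circ> U) (mat_op n B)"
    using bspec[OF diag cut_diagonal[OF S dj]] by (elim bexE) (rule that)
   have "AE l in M. Us (cut S (U f)) l = mat_op n B f l" if f: "DM f" for f
    using B(2) f heq_DI[OF us(1)[OF DV_cut[OF S u(1)[OF f]]] bounded_op_DI_D(1)[OF mat_op_bounded[OF B(1)] f]]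
    unfolding op_eq_def L2n_def di by simp
   then show ?thesis unfolding cut_rep_def using S B(1) by blast
  qed
 qed (rule NN.fin_M dk d1 A XYm irr)+
 show ?thesis using diag_bounded_maximal by blast
qed

section \<open>Blocks over disjoint copies of the plane\<close>

text \<open>Several blocks sit over one point of the plane, but a fibre of the direct integral has
  to be a single block. So block \<open>k\<close> over \<open>l\<close> receives a base point of its
  own, \<open>k + \<phi> l\<close>; \<open>E k\<close> is the set of points that have a block number
  \<open>k\<close>. The measure \<open>N\<close> is the completed image of the restrictions of
  \<open>M\<close> to the sets \<open>E k\<close>, placed on disjoint sheets.\<close>

locale sheets = comp_meas M M0 K for M :: "complex measure" and M0 K +
 fixes \<phi> :: "complex => real" and \<psi> :: "real => complex" and n :: nat and E :: "nat => complex set"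
 assumes phi: "\<phi> \<in> borel_measurable borel" and psi: "\<psi> \<in> borel_measurable borel"
  and psi_phi: "\<And>z. \<psi> (\<phi> z) = z" and phi_range: "\<And>z. 0 \<le> \<phi> z" "\<And>z. \<phi> z < 1"
  and E: "\<And>k. E k \<in> sets borel"
begin

definition code :: "nat \<times> complex => real" where "code x = real (fst x) + \<phi> (snd x)"
definition kap :: "real => nat" where "kap g = nat \<lfloor>g\<rfloor>"
definition lam :: "real => complex" where "lam g = \<psi> (g - real (kap g))"
definition Q :: "(nat \<times> complex) measure" where "Q = count_space {..<n} \<Otimes>\<^sub>M M"
definition EE :: "(nat \<times> complex) set" where "EE = (\<Union>k\<in>{..<n}. {k} \<times> E k)"
definition P where "P = restrict_space Q EE"
definition N0 :: "real measure" where "N0 = distr P borel code"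
definition N :: "real measure" where "N = completion N0"
text \<open>The set of all base points, described by decoding so that it is a Borel set. Its
  complement is null for \<open>N\<close>.\<close>

definition V :: "real set" where "V = (\<Union>k\<in>{..<n}. {g. kap g = k \<and> lam g \<in> E k \<and> real k + \<phi> (lam g) = g})"

lemma kap_code [simp]: "kap (real k + \<phi> l) = k"
proof -
 have "\<lfloor>real k + \<phi> l\<rfloor> = int k" using phi_range[of l] by (intro floor_unique) auto
 then show ?thesis by (simp add: kap_def)
qed

lemma lam_code [simp]: "lam (real k + \<phi> l) = l"
 by (simp add: lam_def psi_phi)

lemma code_V: "k < n ==> l \<in> E k ==> real k + \<phi> l \<in> V"
 unfolding V_def by auto

lemma V_E: "g \<in> V ==> kap g < n \<and> lam g \<in> E (kap g) \<and> real (kap g) + \<phi> (lam g) = g"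
 unfolding V_def by auto

lemma borel_meas_M: "f \<in> measurable borel X ==> f \<in> measurable M X"
 unfolding M by (rule measurable_completion) (simp add: measurable_cong_sets[OF M0 refl])

lemma pair: "pair_sigma_finite (count_space {..<n}) M"
 by (intro pair_sigma_finite.intro sigma_finite_measure_count_space_finite finite_measure.axioms(1)[OF fin_M]) simp

lemma sections_Q: "(\<And>k. k < n ==> S k \<in> sets M) ==> (\<Union>k\<in>{..<n}. {k} \<times> S k) \<in> sets Q"
 unfolding Q_def by (intro sets.finite_UN pair_measureI) auto

lemma null_Q:
 assumes "\<And>k. k < n ==> S k \<in> null_sets M" shows "(\<Union>k\<in>{..<n}. {k} \<times> S k) \<in> null_sets Q"
proof (rule null_sets.finite_UN)
 interpret sigma_finite_measure M by (rule finite_measure.axioms(1)[OF fin_M])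
 fix k assume k: "k \<in> {..<n}"
 then have s: "S k \<in> sets M" "emeasure M (S k) = 0" using assms by (auto simp: null_sets_def)
 have "emeasure Q ({k} \<times> S k) = emeasure (count_space {..<n}) {k} * emeasure M (S k)"
  unfolding Q_def by (rule emeasure_pair_measure_Times) (use k s in auto)
 then show "{k} \<times> S k \<in> null_sets Q" using k s unfolding Q_def by (auto simp: null_sets_def intro!: pair_measureI)
qed simp

lemma EE_Q: "EE \<in> sets Q"
 unfolding EE_def by (rule sections_Q) (rule borel_sub[OF E])

lemma EE_Q': "EE \<inter> space Q \<in> sets Q"
 using EE_Q by (rule sets.Int) simp

lemma space_Q: "space Q = {..<n} \<times> UNIV"
 unfolding Q_def space_pair_measure by simp

lemma EE_iff: "x \<in> EE \<longleftrightarrow> fst x < n \<and> snd x \<in> E (fst x)"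
 unfolding EE_def by (cases x) auto

lemma code_Q: "code \<in> borel_measurable Q"
 unfolding Q_def
proof (rule measurable_pair_measure_countable1)
 fix k
 have "\<phi> \<in> borel_measurable M" by (rule borel_meas_M[OF phi])
 then show "(%l. code (k, l)) \<in> borel_measurable M" unfolding code_def by simp
qed simp

lemma code_P0: "code \<in> borel_measurable P"
 unfolding P_def by (rule measurable_restrict_space1[OF code_Q])

text \<open>A subset of a null set has null sections, which are measurable because \<open>M\<close>
  is complete, and there are only finitely many sections. Completeness makes \<open>code\<close>
  measurable into the completed measure \<open>N\<close>.\<close>

lemma complete_P: "complete_measure P"
proof
 fix A B assume BA: "B \<subseteq> A" and "A \<in> null_sets P"
 then have A: "A \<subseteq> EE" "A \<in> null_sets Q" unfolding P_def null_sets_restrict_space[OF EE_Q] by auto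
 interpret pair_sigma_finite "count_space {..<n}" M by (rule pair)
 have "AE x in Q. x \<notin> A" by (rule AE_not_in[OF A(2)])
 then have "AE k in count_space {..<n}. AE l in M. (k, l) \<notin> A" unfolding Q_def by (rule AE_pair)
 then have "AE l in M. (k, l) \<notin> A" if "k < n" for k using that unfolding AE_count_space by simp
 then have "AE l in M. l \<notin> Pair k -` B" if "k < n" for k using that BA by (fastforce elim!: eventually_mono)
 then have "Pair k -` B \<in> null_sets M" if k: "k < n" for k
  using that unfolding M completion.null_sets_iff_AE by (simp add: M[symmetric])
 then have "(\<Union>k\<in>{..<n}. {k} \<times> (Pair k -` B)) \<in> sets Q" by (intro sections_Q) auto
 also have "(\<Union>k\<in>{..<n}. {k} \<times> (Pair k -` B)) = B" using BA A(1) unfolding EE_def by auto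
 finally show "B \<in> sets P" unfolding P_def sets_restrict_space_iff[OF EE_Q'] using BA A(1) by auto
qed

lemma sets_N0 [simp]: "sets N0 = sets borel" and space_N0 [simp]: "space N0 = UNIV"
 unfolding N0_def by simp_all

lemma space_N [simp]: "space N = UNIV" by (simp add: N_def)

lemma code_P: "code \<in> measurable P N"
 unfolding N_def
proof (rule complete_measure.measurable_completion2[OF complete_P])
 show "code \<in> measurable P N0" using code_P0 by (simp add: measurable_cong_sets[OF refl sets_N0])
 have "distr P N0 code = N0" unfolding N0_def by (rule distr_cong) simp_all
 then show "null_sets N0 \<subseteq> null_sets (distr P N0 code)" by simp
qed

lemma N_distr: "N = distr P N code"
proof -
 have c: "code \<in> measurable P N0" using code_P0 by (simp add: measurable_cong_sets[OF refl sets_N0])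
 have d: "distr P N0 code = N0" unfolding N0_def by (rule distr_cong) simp_all
 have "completion (distr P N0 code) = distr P (completion N0) code"
  by (rule complete_measure.completion_distr_eq[OF complete_P c]) (simp add: d)
 then show ?thesis unfolding d N_def .
qed

lemma lam_borel: "lam \<in> borel_measurable borel" and kap_borel: "kap \<in> measurable borel (count_space UNIV)"
proof -
 show k: "kap \<in> measurable borel (count_space UNIV)" unfolding kap_def by measurable
 have "(%g. g - real (kap g)) \<in> borel_measurable borel" using k by measurable
 from measurable_compose[OF this psi] show "lam \<in> borel_measurable borel" unfolding lam_def .
qed

lemma lam_sheet: "S \<in> sets borel ==> {g. kap g = k \<and> lam g \<in> S} \<in> sets borel"
proof -
 assume S: "S \<in> sets borel"
 have "kap -` {k} \<inter> space borel \<in> sets borel" by (rule measurable_sets[OF kap_borel]) simp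
 moreover have "lam -` S \<inter> space borel \<in> sets borel" by (rule measurable_sets[OF lam_borel S])
 ultimately have "(kap -` {k} \<inter> space borel) \<inter> (lam -` S \<inter> space borel) \<in> sets borel" by (rule sets.Int)
 also have "(kap -` {k} \<inter> space borel) \<inter> (lam -` S \<inter> space borel) = {g. kap g = k \<and> lam g \<in> S}" by auto
 finally show ?thesis .
qed

lemma V_borel: "V \<in> sets borel"
 unfolding V_def
proof (rule sets.finite_UN)
 fix k assume "k \<in> {..<n}"
 have m: "(%g. real k + \<phi> (lam g)) \<in> borel_measurable borel"
  by (intro borel_measurable_add borel_measurable_const measurable_compose[OF lam_borel phi])
 have "{g \<in> space borel. real k + \<phi> (lam g) = g} \<in> sets borel"
  by (rule borel_measurable_eq[OF m]) simp
 from sets.Int[OF lam_sheet[OF E] this]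
 show "{g. kap g = k \<and> lam g \<in> E k \<and> real k + \<phi> (lam g) = g} \<in> sets borel"
  by (simp add: Collect_conj_eq Int_ac)
qed simp

text \<open>\<open>R\<close> need not be measurable. Its exceptional points on each sheet are
  enclosed in a Borel null set \<open>Z k\<close>, and the set \<open>W\<close> of numbers that
  decode into these sets is Borel.\<close>

lemma AE_N_I:
 assumes "\<And>k. k < n ==> AE l in M. l \<in> E k --> R (real k + \<phi> l)"
 shows "AE g in N. g \<in> V \<and> R g"
proof -
 have "\<exists>Z. Z \<in> null_sets M0 \<and> {l. \<not> (l \<in> E k --> R (real k + \<phi> l))} \<subseteq> Z" if "k < n" for k
 proof -
  have "AE l in M0. l \<in> E k --> R (real k + \<phi> l)" using assms[OF that] unfolding M AE_completion_iff .
  then show ?thesis unfolding eventually_ae_filter using sets_eq_imp_space_eq[OF M0] by auto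
 qed
 then have "\<exists>Z. \<forall>k. k < n --> Z k \<in> null_sets M0 \<and> {l. \<not> (l \<in> E k --> R (real k + \<phi> l))} \<subseteq> Z k"
  by (intro choice) blast
 then obtain Z where Z: "\<forall>k. k < n --> Z k \<in> null_sets M0 \<and> {l. \<not> (l \<in> E k --> R (real k + \<phi> l))} \<subseteq> Z k" by (rule exE)
 have Zb: "Z k \<in> sets borel" if "k < n" for k using Z that M0 by (auto simp: null_sets_def)
 define W where "W = (\<Union>k\<in>{..<n}. {g. kap g = k \<and> lam g \<in> Z k})"
 have W: "W \<in> sets borel" unfolding W_def by (intro sets.finite_UN lam_sheet Zb) auto
 have VW: "{g \<in> space borel. g \<in> V \<and> g \<notin> W} \<in> sets borel"
 proof -
  have "{g \<in> space borel. g \<in> V \<and> g \<notin> W} = V - W" by auto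
  then show ?thesis using V_borel W by auto
 qed
 have nZ: "(\<Union>k\<in>{..<n}. {k} \<times> Z k) \<in> null_sets Q"
  by (rule null_Q) (use Z in \<open>auto simp: M intro: null_sets_completionI\<close>)
 have "AE x in P. code x \<in> V \<and> code x \<notin> W" unfolding P_def AE_restrict_space_iff[OF EE_Q']
  using AE_not_in[OF nZ]
 proof eventually_elim
  case (elim x)
  then show ?case by (cases x) (auto simp: EE_iff code_def code_V W_def)
 qed
 then have "AE g in N0. g \<in> V \<and> g \<notin> W" unfolding N0_def AE_distr_iff[OF code_P0 VW] .
 then have "AE g in N. g \<in> V \<and> g \<notin> W" unfolding N_def AE_completion_iff .
 then show ?thesis
 proof eventually_elim
  case (elim g)
  then have v: "kap g < n" "lam g \<in> E (kap g)" "real (kap g) + \<phi> (lam g) = g" using V_E by auto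
  then have "lam g \<notin> Z (kap g)" using elim unfolding W_def by auto
  then have "R (real (kap g) + \<phi> (lam g))" using Z v(1,2) by blast
  then show ?case using v(3) elim by simp
 qed
qed

lemma AE_N_D:
 assumes "AE g in N. R g" "k < n" shows "AE l in M. l \<in> E k --> R (real k + \<phi> l)"
proof -
 interpret pair_sigma_finite "count_space {..<n}" M by (rule pair)
 have "AE g in distr P N code. R g" using assms(1) by (subst N_distr[symmetric])
 then have "AE x in P. R (code x)" by (rule AE_distrD[OF code_P])
 then have "AE x in Q. x \<in> EE --> R (code x)" unfolding P_def AE_restrict_space_iff[OF EE_Q'] .
 then have "AE k in count_space {..<n}. AE l in M. (k, l) \<in> EE --> R (code (k, l))" unfolding Q_def by (rule AE_pair)
 then have "AE l in M. (k, l) \<in> EE --> R (code (k, l))" using assms(2) unfolding AE_count_space by simp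
 then show ?thesis by eventually_elim (simp add: EE_iff code_def assms(2))
qed

lemma borel_N: "f \<in> measurable borel X ==> f \<in> measurable N X"
 unfolding N_def by (rule measurable_completion) (simp add: measurable_cong_sets[OF sets_N0 refl])

lemma sets_N: "S \<in> sets borel ==> S \<in> sets N"
 unfolding N_def by (simp add: sets_completionI_sets)

text \<open>For the completed measure on the target, preimages of null sets have to be null, which
  is a case of \<open>AE_N_I\<close>.\<close>

lemma lam_N: "lam \<in> measurable N M"
proof -
 have l0: "lam \<in> measurable N M0" using borel_N[OF lam_borel] by (simp add: measurable_cong_sets[OF refl M0])
 have "lam \<in> measurable N (completion M0)" unfolding N_def
 proof (rule completion.measurable_completion2)
  show "lam \<in> measurable (completion N0) M0" using l0 unfolding N_def .
  show "null_sets M0 \<subseteq> null_sets (distr (completion N0) M0 lam)"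
  proof
   fix Z assume Z: "Z \<in> null_sets M0"
   have "AE l in M. l \<notin> Z" unfolding M AE_completion_iff by (rule AE_not_in[OF Z])
   then have "AE l in M. l \<in> E k --> lam (real k + \<phi> l) \<notin> Z" for k by eventually_elim simp
   then have "AE g in N. g \<in> V \<and> lam g \<notin> Z" by (rule AE_N_I)
   then have "AE g in N. lam g \<notin> Z" by eventually_elim simp
   then have "{g \<in> space N. \<not> lam g \<notin> Z} \<in> null_sets N" unfolding N_def completion.AE_iff_null_sets .
   then have n: "emeasure N (lam -` Z \<inter> space N) = 0" by (auto simp: null_sets_def vimage_def)
   have Zs: "Z \<in> sets M0" using Z by auto
   have "emeasure (distr N M0 lam) Z = 0" using emeasure_distr[OF l0 Zs] n by simp
   then show "Z \<in> null_sets (distr (completion N0) M0 lam)" using Zs unfolding N_def by (simp add: null_sets_def)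
  qed
 qed
 then show ?thesis unfolding M .
qed

definition bk :: "(real => 'c::zero) => nat => complex => 'c" where
 "bk f k l = (if l \<in> E k then f (real k + \<phi> l) else 0)"

lemma ind_bk:
 fixes f :: "real => 'c::real_vector"
 assumes "k < n" shows "indicator EE (k, l) *\<^sub>R f (code (k, l)) = bk f k l"
 using assms by (simp add: bk_def EE_iff code_def indicator_def)

lemma ind_Q:
 fixes f :: "real => 'c::{banach, second_countable_topology}"
 assumes f: "f \<in> borel_measurable N"
 shows "(%x. indicator EE x *\<^sub>R f (code x)) \<in> borel_measurable Q"
proof -
 have "(%x. f (code x)) \<in> borel_measurable P" by (rule measurable_compose[OF code_P f])
 then show ?thesis unfolding P_def borel_measurable_restrict_space_iff[OF EE_Q'] .
qed

lemma bk_meas: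
 fixes f :: "real => 'c::{banach, second_countable_topology}"
 assumes f: "f \<in> borel_measurable N" and k: "k < n"
 shows "bk f k \<in> borel_measurable M"
proof -
 have "Pair k \<in> measurable M Q" unfolding Q_def by (rule measurable_Pair1') (use k in simp)
 from measurable_compose[OF this ind_Q[OF f]] show ?thesis
  by (simp add: ind_bk[OF k] cong: measurable_cong)
qed

text \<open>Change of variables along \<open>code\<close>, then Fubini for the counting measure on
  the finitely many sheets.\<close>

lemma integrable_N_iff:
 fixes f :: "real => 'c::{banach, second_countable_topology}"
 assumes f: "f \<in> borel_measurable N"
 shows "integrable N f \<longleftrightarrow> (\<forall>k<n. integrable M (bk f k))"
  and "integrable N f ==> (LINT g|N. f g) = (\<Sum>k<n. LINT l|M. bk f k l)"
proof -
 interpret pair_sigma_finite "count_space {..<n}" M by (rule pair)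
 let ?h = "%x. indicator EE x *\<^sub>R f (code x)"
 have 1: "integrable N f \<longleftrightarrow> integrable Q ?h"
 proof -
  have "integrable N f \<longleftrightarrow> integrable (distr P N code) f" using N_distr by simp
  also have "\<dots> \<longleftrightarrow> integrable P (%x. f (code x))" by (rule integrable_distr_eq[OF code_P f])
  also have "\<dots> \<longleftrightarrow> integrable Q ?h" unfolding P_def by (rule integrable_restrict_space[OF EE_Q'])
  finally show ?thesis .
 qed
 show "integrable N f \<longleftrightarrow> (\<forall>k<n. integrable M (bk f k))"
 proof
  assume "integrable N f"
  then have "integrable (count_space {..<n} \<Otimes>\<^sub>M M) ?h" using 1 unfolding Q_def by simp
  from AE_integrable_fst'[OF this] have "\<forall>k\<in>{..<n}. integrable M (%l. ?h (k, l))" unfolding AE_count_space .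
  then show "\<forall>k<n. integrable M (bk f k)" by (simp add: ind_bk cong: integrable_cong)
 next
  assume a: "\<forall>k<n. integrable M (bk f k)"
  have "integrable (count_space {..<n} \<Otimes>\<^sub>M M) ?h"
  proof (rule Fubini_integrable)
   show "?h \<in> borel_measurable (count_space {..<n} \<Otimes>\<^sub>M M)" using ind_Q[OF f] unfolding Q_def .
   show "integrable (count_space {..<n}) (%k. LINT l|M. norm (?h (k, l)))" by (rule integrable_count_space) simp
   show "AE k in count_space {..<n}. integrable M (%l. ?h (k, l))"
    unfolding AE_count_space using a by (simp add: ind_bk cong: integrable_cong)
  qed
  then show "integrable N f" using 1 unfolding Q_def by simp
 qed
 assume i: "integrable N f"
 then have iQ: "integrable (count_space {..<n} \<Otimes>\<^sub>M M) ?h" using 1 unfolding Q_def by simp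
 have "(LINT g|N. f g) = (LINT g|distr P N code. f g)" using N_distr by simp
 also have "\<dots> = (LINT x|P. f (code x))" by (rule integral_distr[OF code_P f])
 also have "\<dots> = (LINT x|Q. ?h x)" unfolding P_def by (rule integral_restrict_space[OF EE_Q'])
 also have "\<dots> = (LINT k|count_space {..<n}. LINT l|M. ?h (k, l))" unfolding Q_def by (rule integral_fst'[OF iQ, symmetric])
 also have "\<dots> = (\<Sum>k<n. LINT l|M. ?h (k, l))" by (rule lebesgue_integral_count_space_finite) simp
 also have "\<dots> = (\<Sum>k<n. LINT l|M. bk f k l)" by (intro sum.cong refl) (simp add: ind_bk)
 finally show "(LINT g|N. f g) = (\<Sum>k<n. LINT l|M. bk f k l)" .
qed

lemma N_compact: "compactly_supported_measure {0..real n} N"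
 unfolding compactly_supported_measure_def
proof (intro conjI exI[of _ N0])
 have finQ: "finite_measure Q"
 proof
  have "emeasure Q (space Q) = emeasure (count_space {..<n}) {..<n} * emeasure M UNIV"
  proof -
   interpret sigma_finite_measure M by (rule finite_measure.axioms(1)[OF fin_M])
   show ?thesis unfolding space_Q unfolding Q_def by (rule emeasure_pair_measure_Times) (use sets.top[of M] in auto)
  qed
  also have "\<dots> \<noteq> \<infinity>"
   using finite_measure.emeasure_finite[OF fin_M, of UNIV] by (simp add: ennreal_mult_eq_top_iff)
  finally show "emeasure Q (space Q) \<noteq> \<infinity>" .
 qed
 have "finite_measure P"
 proof
  have "emeasure P (space P) \<le> emeasure Q (space Q)"
   unfolding P_def by (simp add: emeasure_restrict_space[OF EE_Q'] space_restrict_space emeasure_space)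
  then show "emeasure P (space P) \<noteq> \<infinity>" using finite_measure.emeasure_finite[OF finQ, of "space Q"] by (auto simp: top_unique)
 qed
 then show "finite_measure N0" unfolding N0_def by (rule finite_measure.finite_measure_distr[OF _ code_P0])
 have "AE x in P. code x \<in> {0..real n}" unfolding P_def AE_restrict_space_iff[OF EE_Q']
 proof (rule AE_I2, rule impI)
  fix x assume "x \<in> EE"
  then have "real (fst x) + 1 \<le> real n" unfolding EE_iff by linarith
  then show "code x \<in> {0..real n}" unfolding code_def using phi_range[of "snd x"] by auto
 qed
 then have "AE g in N0. g \<in> {0..real n}" unfolding N0_def by (subst AE_distr_iff[OF code_P0]) auto
 then show "emeasure N0 (- {0..real n}) = 0" by (subst (asm) AE_iff_measurable[where N = "- {0..real n}"]) auto
qed (auto simp: N_def)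

end

section \<open>Strong irreducibility of a single block\<close>

lemma bounded_op_mat:
 "bounded_op (hdim (enat p)) (hdim (enat p)) (%x. mat_op p (%_. B) (%_. x) (g::'a))"
proof -
 define c where "c = (\<Sum>i<p. \<Sum>j<p. cmod (B $$ (i, j)))"
 have c0: "0 \<le> c" unfolding c_def by (intro sum_nonneg) simp
 have cB: "cmod (B $$ (i, j)) \<le> c" if "i < p" "j < p" for i j
 proof -
  have "cmod (B $$ (i, j)) \<le> (\<Sum>j<p. cmod (B $$ (i, j)))" by (rule member_le_sum) (use that in auto)
  also have "\<dots> \<le> c" unfolding c_def
   by (rule member_le_sum[of i "{..<p}" "%i. \<Sum>j<p. cmod (B $$ (i, j))"]) (use that in \<open>auto intro: sum_nonneg\<close>)
  finally show ?thesis .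
 qed
 show ?thesis unfolding bounded_op_hdim
 proof (intro conjI allI impI exI[of _ "(real p * c)\<^sup>2"])
  show "hv (enat p) (mat_op p (%_. B) (%_. x) g)" for x
   unfolding hv_def by (auto simp: mat_op_def intro!: l2_finite[of p])
  show "mat_op p (%_. B) (%_ i. x i + y i) g = (%i. mat_op p (%_. B) (%_. x) g i + mat_op p (%_. B) (%_. y) g i)" for x y
   by (auto simp: mat_op_def fun_eq_iff sum.distrib algebra_simps)
  show "mat_op p (%_. B) (%_ i. a * x i) g = (%i. a * mat_op p (%_. B) (%_. x) g i)" for a x
   by (auto simp: mat_op_def fun_eq_iff sum_distrib_left algebra_simps)
  show "sq (mat_op p (%_. B) (%_. x) g) \<le> (real p * c)\<^sup>2 * sq x" if "hv (enat p) x" for x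
   by (rule sq_mat_op[where B = "%_. B" and f = "%_. x" and l = g, OF c0 cB hvD(2)[OF that]])
 qed simp
qed

lemma mat_op_unitv: "j < p ==> mat_op p (%_. B) (%_. unitv j) g = (%i. if i < p then B $$ (i, j) else 0)"
proof
 fix i assume "j < p"
 then have "(\<Sum>k<p. B $$ (i, k) * unitv j k) = (\<Sum>k<p. if k = j then B $$ (i, j) else 0)"
  by (intro sum.cong) (auto simp: unitv_def)
 then show "mat_op p (%_. B) (%_. unitv j) g i = (if i < p then B $$ (i, j) else 0)" using \<open>j < p\<close> by (simp add: mat_op_def)
qed

text \<open>On a finite dimensional fibre the idempotent is given by the matrix of its values on
  unit vectors, to which \<open>jlike_idem\<close> applies. The argument \<open>g\<close> is a dummy
  point, as \<open>mat_op\<close> acts on fields.\<close>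

lemma strongly_irreducible_jlike:
 assumes B: "B \<in> carrier_mat p p" and J: "jlike p (fm p B)"
 shows "strongly_irreducible (hdim (enat p)) (%x. mat_op p (%_. B) (%_. x) (g::'a))"
proof -
 let ?op = "%B x. mat_op p (%_. B) (%_. x) g"
 have mult: "?op B (?op C x) = ?op (B * C) x" if "B \<in> carrier_mat p p" "C \<in> carrier_mat p p" for B C x
 proof -
  have "?op (B * C) x = mat_op p (%_. B) (mat_op p (%_. C) (%_. x)) g"
   by (rule mat_op_mult) (rule that)+
  then show ?thesis by (simp add: mat_op_def)
 qed
 have inj: "B = C" if c: "B \<in> carrier_mat p p" "C \<in> carrier_mat p p" and eq: "\<And>j. j < p ==> ?op B (unitv j) = ?op C (unitv j)" for B C
 proof (rule eq_matI)
  fix i j assume "i < dim_row C" "j < dim_col C"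
  then have ij: "i < p" "j < p" using c by auto
  show "B $$ (i, j) = C $$ (i, j)" using fun_cong[OF eq[OF ij(2)], of i] unfolding mat_op_unitv[OF ij(2)] using ij by simp
 qed (use c in auto)
 show ?thesis unfolding strongly_irreducible_def
 proof (intro conjI allI impI)
  show "bounded_op (hdim (enat p)) (hdim (enat p)) (?op B)" by (rule bounded_op_mat)
  fix P assume a: "bounded_op (hdim (enat p)) (hdim (enat p)) P \<and> op_eq (hdim (enat p)) (hdim (enat p)) (?op B \<circ> P) (P \<circ> ?op B) \<and>
   op_eq (hdim (enat p)) (hdim (enat p)) (P \<circ> P) P"
  then have P: "bounded_op (hdim (enat p)) (hdim (enat p)) P" by blast
  note pd = bounded_op_hdim_D[OF P] and bd = bounded_op_hdim_D[OF bounded_op_mat[of p B g]]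
  have PB: "?op B (P x) = P (?op B x)" if "hv (enat p) x" for x
   using a that heq_hv[OF bd(1)[OF pd(1)[OF that]] pd(1)[OF bd(1)[OF that]]]
   unfolding op_eq_def hdim_simps(1) hv_def[symmetric] comp_def Ball_def by blast
  have PP: "P (P x) = P x" if "hv (enat p) x" for x
   using a that heq_hv[OF pd(1)[OF pd(1)[OF that]] pd(1)[OF that]]
   unfolding op_eq_def hdim_simps(1) hv_def[symmetric] comp_def Ball_def by blast
  define Pm where "Pm = mat p p (%(i, j). P (unitv j) i)"
  have Pm: "Pm \<in> carrier_mat p p" unfolding Pm_def by simp
  have hu: "hv (enat p) (unitv j)" if "j < p" for j using hv_unitv[of j "enat p"] that by simp
  have Px: "P x = ?op Pm x" if x: "hv (enat p) x" for x
  proof (rule hdim_op_eqI[OF P bounded_op_mat _ x])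
   fix k assume "enat k < enat p"
   then have k: "k < p" by simp
   show "P (unitv k) = ?op Pm (unitv k)" unfolding mat_op_unitv[OF k]
    using k hvD(2)[OF pd(1)[OF hu[OF k]]] by (auto simp: Pm_def fun_eq_iff not_less)
  qed
  have "B * Pm = Pm * B"
  proof (rule inj[OF mult_carrier_mat[OF B Pm] mult_carrier_mat[OF Pm B]])
   fix j assume "j < p"
   note h = hu[OF this]
   show "?op (B * Pm) (unitv j) = ?op (Pm * B) (unitv j)"
    using PB[OF h] Px[OF h] Px[OF bd(1)[OF h]] mult[OF B Pm] mult[OF Pm B] by simp
  qed
  then have 1: "fm p Pm * fm p B = fm p B * fm p Pm" using fm_mult[OF B Pm] fm_mult[OF Pm B] by simp
  have "Pm * Pm = Pm"
  proof (rule inj[OF mult_carrier_mat[OF Pm Pm] Pm])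
   fix j assume "j < p"
   note h = hu[OF this]
   show "?op (Pm * Pm) (unitv j) = ?op Pm (unitv j)"
    using PP[OF h] Px[OF h] Px[OF pd(1)[OF h]] mult[OF Pm Pm] by simp
  qed
  then have 2: "fm p Pm * fm p Pm = fm p Pm" using fm_mult[OF Pm Pm] by simp
  from jlike_idem[OF J rect_fm 2 1]
  show "op_eq (hdim (enat p)) (hdim (enat p)) P (%x. vscale (hdim (enat p)) 0 x) \<or> op_eq (hdim (enat p)) (hdim (enat p)) P id"
  proof
   assume "fm p Pm = 0"
   then have "Pm = 0\<^sub>m p p" using tm_fm[OF Pm] by simp
   then have "P x = (%i. 0)" if "hv (enat p) x" for x using Px[OF that] by (auto simp: mat_op_def fun_eq_iff)
   then show ?thesis unfolding op_eq_def hdim_simps hv_def[symmetric] Ball_def using heq_hv[OF hv_zero hv_zero] by simp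
  next
   assume "fm p Pm = e p"
   then have "Pm = 1\<^sub>m p" using tm_fm[OF Pm] by simp
   then have "P x = x" if x: "hv (enat p) x" for x
   proof -
    have "?op (1\<^sub>m p) x i = x i" for i
    proof (cases "i < p")
     case True
     have "(\<Sum>j<p. 1\<^sub>m p $$ (i, j) * x j) = (\<Sum>j<p. if j = i then x i else 0)" using True by (intro sum.cong) auto
     then show ?thesis using True by (simp add: mat_op_def)
    qed (use hvD(2)[OF x, of i] in \<open>simp add: mat_op_def\<close>)
    then show ?thesis using Px[OF x] \<open>Pm = 1\<^sub>m p\<close> by auto
   qed
   then show ?thesis unfolding op_eq_def hdim_simps hv_def[symmetric] Ball_def id_def using heq_hv by simp
  qed
 qed
qed

lemma sum_lessThan_add: "(\<Sum>j<a + b. f j) = (\<Sum>j<a. f j) + (\<Sum>i<b. f (a + i :: nat) :: 'c::comm_monoid_add)"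
 by (induction b) (simp_all add: add.assoc)

lemma sum_off: "(\<Sum>j<off nn m. f j) = (\<Sum>k<m. \<Sum>i<nn k. f (off nn k + i) :: 'c::comm_monoid_add)"
 by (induction m) (simp_all add: sum_lessThan_add)

section \<open>The unitary that distributes blocks over the sheets\<close>

text \<open>\<open>\<tau> l\<close> is the index of the piece that contains \<open>l\<close>,
  \<open>mt t\<close> the number of blocks on piece \<open>t\<close>, and \<open>nt t k\<close> the
  size of block \<open>k\<close> there. The assumptions concern every index \<open>t\<close>,
  including one for points outside all pieces.\<close>

locale block_rep = sheets M M0 K \<phi> \<psi> n "%k. {l. k < mt (\<tau> l)}"
 for M :: "complex measure" and M0 K \<phi> \<psi> n and mt :: "nat => nat" and \<tau> :: "complex => nat" +
 fixes nt :: "nat => nat => nat"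
 assumes tau: "\<tau> \<in> measurable borel (count_space UNIV)"
  and nt: "\<And>t k. k < mt t ==> 0 < nt t k" and offn: "\<And>t. off (nt t) (mt t) = n"
begin

lemma mt_le_n: "mt t \<le> n"
proof -
 have "j \<le> mt t ==> j \<le> off (nt t) j" for j
 proof (induction j)
  case (Suc j) then show ?case using nt[of j t] by simp
 qed simp
 from this[of "mt t"] show ?thesis using offn[of t] by simp
qed

lemma mt_le: "k < mt t ==> k < n"
 using mt_le_n[of t] by simp

lemma off_n: "k < mt t ==> i < nt t k ==> off (nt t) k + i < n"
 using off_less[of k "mt t" i "nt t"] offn by simp

text \<open>\<open>bl t j\<close> and \<open>ix t j\<close> are the block of coordinate
  \<open>j\<close> on piece \<open>t\<close> and its position in that block, inverting the
  addressing by \<open>off\<close>.\<close>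

definition bl where "bl t j = (SOME k. k < mt t \<and> (\<exists>i<nt t k. j = off (nt t) k + i))"
definition ix where "ix t j = j - off (nt t) (bl t j)"

lemma bl:
 assumes "k < mt t" "i < nt t k" shows "bl t (off (nt t) k + i) = k" "ix t (off (nt t) k + i) = i"
proof -
 have "bl t (off (nt t) k + i) < mt t \<and> (\<exists>i'<nt t (bl t (off (nt t) k + i)). off (nt t) k + i = off (nt t) (bl t (off (nt t) k + i)) + i')"
  unfolding bl_def by (rule someI[of _ k]) (use assms in auto)
 then obtain i' where i': "i' < nt t (bl t (off (nt t) k + i))" "off (nt t) k + i = off (nt t) (bl t (off (nt t) k + i)) + i'"
  by (elim conjE exE) (rule that)
 show 1: "bl t (off (nt t) k + i) = k"
  by (rule off_inj(1)[where nn = "nt t" and k = k and k' = "bl t (off (nt t) k + i)" and i = i and j = i', OF assms(2) i', symmetric])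
 show "ix t (off (nt t) k + i) = i" unfolding ix_def 1 by simp
qed

lemma split_n:
 assumes "j < n" obtains k i where "k < mt t" "i < nt t k" "j = off (nt t) k + i" "bl t j = k" "ix t j = i"
proof -
 obtain k i where ki: "k < mt t" "i < nt t k" "j = off (nt t) k + i" using off_split[of j "nt t" "mt t"] assms offn by auto
 then show thesis using bl[OF ki(1,2)] that by simp
qed

text \<open>At the base point of block \<open>k\<close> over \<open>l\<close> the value of
  \<open>U f\<close> is the segment of \<open>f l\<close> that belongs to the block.\<close>

definition U :: "(complex => nat => complex) => real => nat => complex" where
 "U f g = (%i. if g \<in> V \<and> i < nt (\<tau> (lam g)) (kap g) then f (lam g) (off (nt (\<tau> (lam g))) (kap g) + i) else 0)"
definition Us :: "(real => nat => complex) => complex => nat => complex" where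
 "Us y l = (%j. if j < n then y (real (bl (\<tau> l) j) + \<phi> l) (ix (\<tau> l) j) else 0)"
text \<open>The default 1 off \<open>V\<close> respects the lower bound required of a
  \<open>dimension_function\<close>.\<close>

definition d :: "real => enat" where "d g = (if g \<in> V then enat (nt (\<tau> (lam g)) (kap g)) else 1)"

abbreviation "DM \<equiv> DV M (%_. enat n)"
abbreviation "DN \<equiv> DV N d"

lemma in_V: "k < mt (\<tau> l) ==> real k + \<phi> l \<in> V"
 using code_V[of k l] mt_le by auto

lemma V_D: "g \<in> V ==> kap g < mt (\<tau> (lam g)) \<and> real (kap g) + \<phi> (lam g) = g"
 using V_E[of g] by auto

lemma U_code: "k < mt (\<tau> l) ==> U f (real k + \<phi> l) = (%i. if i < nt (\<tau> l) k then f l (off (nt (\<tau> l)) k + i) else 0)"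
 using in_V[of k l] by (auto simp: U_def fun_eq_iff)

lemma d_code: "k < mt (\<tau> l) ==> d (real k + \<phi> l) = enat (nt (\<tau> l) k)"
 using in_V[of k l] by (simp add: d_def)

lemma Us_off: "k < mt (\<tau> l) ==> i < nt (\<tau> l) k ==> Us y l (off (nt (\<tau> l)) k + i) = y (real k + \<phi> l) i"
 unfolding Us_def using bl[of k "\<tau> l" i] off_n by simp

lemma sum_n: "(\<Sum>j<n. f j) = (\<Sum>k<mt t. \<Sum>i<nt t k. f (off (nt t) k + i) :: 'c::comm_monoid_add)"
 using sum_off[of f "nt t" "mt t"] offn by simp

lemma sum_bk: "(\<Sum>k<n. bk f k l) = (\<Sum>k<mt (\<tau> l). f (real k + \<phi> l) :: 'c::comm_monoid_add)"
 by (rule sum.mono_neutral_cong_right) (use mt_le_n[of "\<tau> l"] in \<open>auto simp: bk_def\<close>)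

lemma UsU: "(\<And>i. enat n \<le> enat i ==> f l i = 0) ==> Us (U f) l = f l"
proof
 fix j assume z: "\<And>i. enat n \<le> enat i ==> f l i = 0"
 show "Us (U f) l j = f l j"
 proof (cases "j < n")
  case True
  obtain k i where "k < mt (\<tau> l)" "i < nt (\<tau> l) k" "j = off (nt (\<tau> l)) k + i" by (rule split_n[OF True])
  then show ?thesis using Us_off[of k l i "U f"] U_code[of k l f] by simp
 qed (simp add: Us_def z)
qed

lemma UUs: "g \<in> V ==> (\<And>i. d g \<le> enat i ==> y g i = 0) ==> U (Us y) g = y g"
proof
 fix i assume g: "g \<in> V" and z: "\<And>i. d g \<le> enat i ==> y g i = 0"
 note v = V_D[OF g]
 show "U (Us y) g i = y g i"
 proof (cases "i < nt (\<tau> (lam g)) (kap g)")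
  case True then show ?thesis using g Us_off[of "kap g" "lam g" i y] v by (simp add: U_def)
 next
  case False then show ?thesis using g z[of i] by (simp add: U_def d_def)
 qed
qed

lemma tau_N: "(%g. \<tau> (lam g)) \<in> measurable N (count_space UNIV)"
 by (rule borel_N[OF measurable_compose[OF lam_borel tau]])

lemma piecewise_N:
 assumes "\<And>t k. F t k \<in> borel_measurable N" shows "(%g. F (\<tau> (lam g)) (kap g) g) \<in> borel_measurable N"
proof -
 have "(%g. F t (kap g) g) \<in> borel_measurable N" for t
  by (rule measurable_compose_countable[OF assms borel_N[OF kap_borel]])
 then show ?thesis by (rule measurable_compose_countable[OF _ tau_N])
qed

lemma U_meas: assumes "\<And>j. (%l. f l j) \<in> borel_measurable M" shows "(%g. U f g i) \<in> borel_measurable N"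
proof -
 define F where "F t k = (%g. if g \<in> V \<and> i < nt t k then f (lam g) (off (nt t) k + i) else 0)" for t k
 have "F t k \<in> borel_measurable N" for t k
 proof (cases "i < nt t k")
  case True
  have "(%g. f (lam g) (off (nt t) k + i)) \<in> borel_measurable N" by (rule measurable_compose[OF lam_N assms])
  then have "(%g. if g \<in> V then f (lam g) (off (nt t) k + i) else 0) \<in> borel_measurable N"
   by (rule measurable_If_set) (use sets_N[OF V_borel] in auto)
  then show ?thesis using True unfolding F_def by simp
 qed (simp add: F_def)
 from piecewise_N[OF this] show ?thesis unfolding F_def U_def .
qed

lemma Us_meas: assumes "\<And>j. (%g. y g j) \<in> borel_measurable N" shows "(%l. Us y l j) \<in> borel_measurable M"
proof (cases "j < n")
 case True
 have "bk (%g. y g (ix t j)) (bl t j) \<in> borel_measurable M" for t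
 proof (rule bk_meas[OF assms])
  show "bl t j < n" by (rule split_n[OF True, of t]) (auto dest: mt_le)
 qed
 then have "(%l. bk (%g. y g (ix (\<tau> l) j)) (bl (\<tau> l) j) l) \<in> borel_measurable M"
  by (rule measurable_compose_countable[OF _ borel_meas_M[OF tau]])
 moreover have "bk (%g. y g (ix (\<tau> l) j)) (bl (\<tau> l) j) l = Us y l j" for l
  by (rule split_n[OF True, of "\<tau> l"]) (use True in \<open>auto simp: bk_def Us_def\<close>)
 ultimately show ?thesis by simp
qed (simp add: Us_def)

text \<open>Pythagoras: the segments of \<open>f l\<close> on the different sheets make up all of
  \<open>f l\<close>.\<close>

lemma sq_U: "(\<And>i. enat n \<le> enat i ==> f l i = 0) ==> (\<Sum>k<n. bk (%g. sq (U f g)) k l) = sq (f l)"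
proof -
 assume z: "\<And>i. enat n \<le> enat i ==> f l i = 0"
 have "sq (U f (real k + \<phi> l)) = (\<Sum>i<nt (\<tau> l) k. (cmod (f l (off (nt (\<tau> l)) k + i)))\<^sup>2)" if k: "k < mt (\<tau> l)" for k
  unfolding U_code[OF k] by (subst sq_vanish[of "nt (\<tau> l) k"]) auto
 moreover have "sq (f l) = (\<Sum>j<n. (cmod (f l j))\<^sup>2)" by (rule sq_vanish) (rule z)
 ultimately show ?thesis unfolding sum_bk sum_n[of _ "\<tau> l"] by simp
qed

lemma sq_Us: "(\<And>g i. d g \<le> enat i ==> y g i = 0) ==> (\<Sum>k<n. bk (%g. sq (y g)) k l) = sq (Us y l)"
proof -
 assume z: "\<And>g i. d g \<le> enat i ==> y g i = 0"
 have 1: "sq (y (real k + \<phi> l)) = (\<Sum>i<nt (\<tau> l) k. (cmod (Us y l (off (nt (\<tau> l)) k + i)))\<^sup>2)" if k: "k < mt (\<tau> l)" for k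
 proof -
  have "sq (y (real k + \<phi> l)) = (\<Sum>i<nt (\<tau> l) k. (cmod (y (real k + \<phi> l) i))\<^sup>2)"
   by (rule sq_vanish) (use z[of "real k + \<phi> l"] d_code[OF k] in simp)
  then show ?thesis using Us_off[OF k] by simp
 qed
 have "sq (Us y l) = (\<Sum>j<n. (cmod (Us y l j))\<^sup>2)" by (rule sq_vanish) (simp add: Us_def)
 then show ?thesis unfolding sum_bk sum_n[of _ "\<tau> l"] using 1 by simp
qed

lemma DN_U: assumes f: "DM f" shows "DN (U f)" "nrm N (U f) = nrm M f"
proof -
 have l: "l2 (U f g)" for g by (rule l2_finite[of "nt (\<tau> (lam g)) (kap g)"]) (simp add: U_def)
 have m: "(%g. U f g i) \<in> borel_measurable N" for i by (rule U_meas[OF DVD(3)[OF f]])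
 note sm = meas_sq[OF m l]
 have su: "(\<Sum>k<n. bk (%g. sq (U f g)) k l) = sq (f l)" for l by (rule sq_U) (rule DVD(2)[OF f])
 have nn: "0 \<le> bk (%g. sq (U f g)) k l" for k l unfolding bk_def by (simp add: sq_nonneg)
 have ib: "integrable M (bk (%g. sq (U f g)) k)" if k: "k < n" for k
 proof (rule Bochner_Integration.integrable_bound[OF DVD(4)[OF f] bk_meas[OF sm k]], rule AE_I2)
  fix l
  have "bk (%g. sq (U f g)) k l \<le> (\<Sum>k<n. bk (%g. sq (U f g)) k l)"
   by (rule member_le_sum) (use k nn in auto)
  then show "norm (bk (%g. sq (U f g)) k l) \<le> norm (sq (f l))" unfolding su[of l] using nn[of k l] sq_nonneg[of "f l"] by simp
 qed
 then have i: "integrable N (%g. sq (U f g))" by (intro integrable_N_iff(1)[OF sm, THEN iffD2] allI impI)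
 show "DN (U f)" unfolding DV_def
 proof (intro conjI allI impI l m i)
  fix g i assume "d g \<le> enat i" then show "U f g i = 0" by (auto simp: U_def d_def split: if_splits)
 qed
 have "nrm N (U f) = (\<Sum>k<n. LINT l|M. bk (%g. sq (U f g)) k l)" unfolding nrm_def by (rule integrable_N_iff(2)[OF sm i])
 also have "\<dots> = (LINT l|M. (\<Sum>k<n. bk (%g. sq (U f g)) k l))"
  by (rule Bochner_Integration.integral_sum[symmetric]) (use ib in auto)
 also have "\<dots> = nrm M f" unfolding nrm_def su ..
 finally show "nrm N (U f) = nrm M f" .
qed

lemma DM_Us: assumes y: "DN y" shows "DM (Us y)" "nrm M (Us y) = nrm N y"
proof -
 note z = DVD(2)[OF y]
 note sm = meas_sq[OF DVD(3)[OF y] DVD(1)[OF y]]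
 have ib: "integrable M (bk (%g. sq (y g)) k)" if "k < n" for k
  by (rule integrable_N_iff(1)[OF sm, THEN iffD1, OF DVD(4)[OF y], rule_format, OF that])
 have su: "(\<Sum>k<n. bk (%g. sq (y g)) k l) = sq (Us y l)" for l by (rule sq_Us) (rule z)
 have isum: "integrable M (%l. \<Sum>k<n. bk (%g. sq (y g)) k l)" by (rule Bochner_Integration.integrable_sum) (use ib in auto)
 show "DM (Us y)" unfolding DV_def
 proof (intro conjI allI impI)
  show "l2 (Us y l)" for l by (rule l2_finite[of n]) (simp add: Us_def)
  show "Us y l i = 0" if "enat n \<le> enat i" for l i using that by (simp add: Us_def)
  show "(%l. Us y l i) \<in> borel_measurable M" for i by (rule Us_meas[OF DVD(3)[OF y]])
  show "integrable M (%l. sq (Us y l))" using isum unfolding su .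
 qed
 have "nrm N y = (\<Sum>k<n. LINT l|M. bk (%g. sq (y g)) k l)" unfolding nrm_def by (rule integrable_N_iff(2)[OF sm DVD(4)[OF y]])
 also have "\<dots> = (LINT l|M. (\<Sum>k<n. bk (%g. sq (y g)) k l))"
  by (rule Bochner_Integration.integral_sum[symmetric]) (use ib in auto)
 also have "\<dots> = nrm M (Us y)" unfolding nrm_def su ..
 finally show "nrm M (Us y) = nrm N y" by simp
qed

lemma adj: assumes f: "DM f" and y: "DN y" shows "(LINT g|N. ip (U f g) (y g)) = (LINT l|M. ip (f l) (Us y l))"
proof -
 note uf = DN_U(1)[OF f]
 note i = ip_integrable[OF uf y]
 have m: "(%g. ip (U f g) (y g)) \<in> borel_measurable N" using i by (rule borel_measurable_integrable)
 have ib: "integrable M (bk (%g. ip (U f g) (y g)) k)" if "k < n" for k by (rule integrable_N_iff(1)[OF m, THEN iffD1, OF i, rule_format, OF that])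
 have su: "(\<Sum>k<n. bk (%g. ip (U f g) (y g)) k l) = ip (f l) (Us y l)" for l
 proof -
  have "ip (U f (real k + \<phi> l)) (y (real k + \<phi> l)) =
    (\<Sum>i<nt (\<tau> l) k. f l (off (nt (\<tau> l)) k + i) * cnj (Us y l (off (nt (\<tau> l)) k + i)))" if k: "k < mt (\<tau> l)" for k
   unfolding U_code[OF k] by (subst ip_vanish[of "nt (\<tau> l) k"]) (auto simp: Us_off[OF k])
  moreover have "ip (f l) (Us y l) = (\<Sum>j<n. f l j * cnj (Us y l j))" by (rule ip_vanish) (rule DVD(2)[OF f])
  ultimately show ?thesis unfolding sum_bk sum_n[of _ "\<tau> l"] by simp
 qed
 have "(LINT g|N. ip (U f g) (y g)) = (\<Sum>k<n. LINT l|M. bk (%g. ip (U f g) (y g)) k l)" by (rule integrable_N_iff(2)[OF m i])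
 also have "\<dots> = (LINT l|M. (\<Sum>k<n. bk (%g. ip (U f g) (y g)) k l))"
  by (rule Bochner_Integration.integral_sum[symmetric]) (use ib in auto)
 also have "\<dots> = (LINT l|M. ip (f l) (Us y l))" unfolding su ..
 finally show ?thesis .
qed

lemma iso: assumes f: "DM f" and h: "DM h" shows "(LINT g|N. ip (U f g) (U h g)) = (LINT l|M. ip (f l) (h l))"
proof -
 have "Us (U h) l = h l" for l by (rule UsU) (rule DVD(2)[OF h])
 then show ?thesis unfolding adj[OF f DN_U(1)[OF h]] by simp
qed

lemma U_bounded: "bounded_op (direct_integral M (%_. enat n)) (direct_integral N d) U"
 unfolding bounded_op_DI
proof (intro conjI allI impI exI[of _ 1] DN_U(1))
 show "nrm N (U f) \<le> 1 * nrm M f" if "DM f" for f using DN_U(2)[OF that] by simp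
qed (auto simp: U_def fun_eq_iff)

lemma Us_bounded: "bounded_op (direct_integral N d) (direct_integral M (%_. enat n)) Us"
 unfolding bounded_op_DI
proof (intro conjI allI impI exI[of _ 1] DM_Us(1))
 show "nrm M (Us f) \<le> 1 * nrm N f" if "DN f" for f using DM_Us(2)[OF that] by simp
qed (auto simp: Us_def fun_eq_iff)

lemma AE_V: "AE g in N. g \<in> V"
 using AE_N_I[of "%_. True"] by simp

lemma U_unitary: "unitary_op (L2n M n) (direct_integral N d) U"
 unfolding unitary_op_def L2n_def direct_integral_simps Ball_def Bex_def
proof (intro conjI allI impI U_bounded iso)
 fix y assume y: "DN y"
 have "AE g in N. U (Us y) g = y g" using AE_V by eventually_elim (rule UUs, assumption, rule DVD(2)[OF y])
 then have "heq (direct_integral N d) (U (Us y)) y" using heq_DI[OF DN_U(1)[OF DM_Us(1)[OF y]] y] by blast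
 then show "\<exists>x. DM x \<and> heq (direct_integral N d) (U x) y" using DM_Us(1)[OF y] by blast
qed

lemma Us_adjoint: "adjoint_op (L2n M n) (direct_integral N d) U Us"
 unfolding adjoint_op_def L2n_def direct_integral_simps Ball_def
 by (intro conjI allI impI Us_bounded adj)

lemma d_meas: "d \<in> measurable borel (count_space UNIV)"
proof -
 have 1: "(%g. if g \<in> V then enat (nt t k) else 1) \<in> measurable borel (count_space UNIV)" for t k
  by (rule measurable_If_set) (use V_borel in auto)
 have 2: "(%g. if g \<in> V then enat (nt t (kap g)) else 1) \<in> measurable borel (count_space UNIV)" for t
  by (rule measurable_compose_countable[OF 1 kap_borel])
 show ?thesis unfolding d_def[abs_def]
  by (rule measurable_compose_countable[OF 2 measurable_compose[OF lam_borel tau]])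
qed

lemma d_set: "{g. d g = j} \<in> sets borel"
 using measurable_sets[OF d_meas, of "{j}"] by (simp add: vimage_def)

lemma d_ge1: "1 \<le> d g"
 using V_D[of g] nt[of "kap g" "\<tau> (lam g)"] by (auto simp: d_def one_enat_def)

lemma d_dim: "dimension_function d"
 unfolding dimension_function_def using d_set d_ge1 by blast

lemma d_lt: "{g \<in> space N. enat k < d g} \<in> sets N"
 using measurable_sets[OF borel_N[OF d_meas], of "{j. enat k < j}"] by (simp add: vimage_def)

text \<open>A diagonal operator multiplies by a scalar function \<open>c\<close>, recovered as the
  first coordinate of its value on the first unit section. Carried back to the plane it multiplies
  coordinate \<open>j\<close> by the value of \<open>c\<close> at the base point of the block of
  \<open>j\<close>, which is a diagonal matrix field.\<close>

lemma diag_matrix: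
 assumes T: "T \<in> diagonal_algebra N d"
 shows "\<exists>B\<in>Mn_Linf M n. op_eq (L2n M n) (L2n M n) (Us \<circ> T \<circ> U) (mat_op n B)"
proof -
 obtain F where F: "decomposes N d T F" and sc: "AE g in N. \<exists>c. op_eq (hdim (d g)) (hdim (d g)) (F g) (vscale (hdim (d g)) c)"
  using T unfolding diagonal_algebra_def by auto
 have Tb: "bounded_op (direct_integral N d) (direct_integral N d) T" by (rule F[unfolded decomposes_def, THEN conjunct1])
 have TF: "AE g in N. T f g = F g (f g)" if "DN f" for f
  by (rule F[unfolded decomposes_def, THEN conjunct2, THEN conjunct2, rule_format]) (simp add: that)
 have Fb: "bounded_op (hdim (d g)) (hdim (d g)) (F g)" for g
  by (rule F[unfolded decomposes_def operator_field_def, THEN conjunct2, THEN conjunct1, THEN conjunct1, rule_format])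
 note td = bounded_op_DI_D[OF Tb]
 obtain C where C: "0 \<le> C \<and> (\<forall>f. DN f --> nrm N (T f) \<le> C * nrm N f)" using td(4) by (rule exE)
 obtain N1 where N1: "sets N1 = sets borel" "finite_measure N1" "emeasure N1 (- {0..real n}) = 0" "N = completion N1"
  using N_compact unfolding compactly_supported_measure_def by auto
 have "comp_meas N N1 {0..real n}" by (intro comp_meas.intro N1) simp
 note finN = comp_meas.fin_M[OF this]
 let ?e = "con d (Suc 0) (unitv 0)"
 have e: "DN ?e" by (rule DV_con[OF finN d_lt])
 define c where "c g = T ?e g 0" for g
 have ce: "?e g = unitv 0" for g by (rule con_unitv) (use d_ge1[of g] in \<open>cases "d g"; auto simp: one_enat_def\<close>)
 have Tc: "AE g in N. T f g = (%i. c g * f g i)" if f: "DN f" for f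
  using TF[OF f] TF[OF e] sc
 proof eventually_elim
  case (elim g)
  obtain c' where c': "op_eq (hdim (d g)) (hdim (d g)) (F g) (vscale (hdim (d g)) c')" using elim(3) by (rule exE)
  have Fx: "F g x = (%i. c' * x i)" if "hv (d g) x" for x
   using c' that heq_hv[OF bounded_op_hdim_D(1)[OF Fb that] hv_scale[OF that]]
   unfolding op_eq_def hdim_simps hv_def[symmetric] Ball_def by blast
  have "T ?e g = (%i. c' * unitv 0 i)" using elim(2) Fx[OF DV_hv[OF e, of g]] unfolding ce by (rule trans)
  then have "c g = c'" unfolding c_def by (simp add: unitv_def)
  then show ?case using elim(1) Fx[OF DV_hv[OF f]] by simp
 qed
 have cm: "c \<in> borel_measurable N" unfolding c_def[abs_def] by (rule DVD(3)[OF td(1)[OF e]])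
 \<comment> \<open>The operator bound on every cut of the unit section makes \<open>c\<close>
   essentially bounded. Cuts commute with \<open>T\<close> since \<open>T\<close> is multiplication
   by \<open>c\<close>.\<close>
 have "AE g in N. sq (T ?e g) \<le> C * sq (?e g)"
 proof (rule AE_le_of_integrals)
  show "integrable N (%g. sq (T ?e g))" by (rule DVD(4)[OF td(1)[OF e]])
  show "integrable N (%g. C * sq (?e g))" using DVD(4)[OF e] by simp
  fix S assume S: "S \<in> sets N"
  note eS = DV_cut[OF S e]
  have "AE g in N. T (cut S ?e) g = cut S (T ?e) g"
   using Tc[OF eS] Tc[OF e] by eventually_elim (auto simp: cut_def fun_eq_iff)
  then have "nrm N (cut S (T ?e)) = nrm N (T (cut S ?e))" by (rule nrm_cong[OF td(1)[OF eS] DV_cut[OF S td(1)[OF e]], symmetric])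
  also have "\<dots> \<le> C * nrm N (cut S ?e)" by (rule C[THEN conjunct2, rule_format, OF eS])
  finally show "(LINT g|N. indicator S g * sq (T ?e g)) \<le> (LINT g|N. indicator S g * (C * sq (?e g)))"
   unfolding nrm_cut[OF S] by (simp add: mult.left_commute)
 qed
 then have cb: "AE g in N. cmod (c g) \<le> sqrt C"
 proof eventually_elim
  case (elim g)
  have "(cmod (c g))\<^sup>2 \<le> sq (T ?e g)" unfolding c_def by (rule coord_le_sq[OF DVD(1)[OF td(1)[OF e]]])
  also have "sq (T ?e g) \<le> C"
  proof -
   have "sq (unitv 0) = (\<Sum>i<Suc 0. (cmod (unitv 0 i))\<^sup>2)" by (rule sq_finite) (simp add: unitv_def)
   then have "sq (?e g) = 1" unfolding ce by (simp add: unitv_def[of 0])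
   then show ?thesis using elim by simp
  qed
  finally show ?case by (rule real_le_rsqrt)
 qed
 define B where "B l = mat n n (%(i, j). if i = j then c (real (bl (\<tau> l) j) + \<phi> l) else 0)" for l
 have BM: "B \<in> Mn_Linf M n" unfolding Mn_Linf_def
 proof (intro CollectI conjI ballI allI impI)
  show "B l \<in> carrier_mat n n" for l unfolding B_def by simp
  fix i j assume i: "i < n" and j: "j < n"
  have eq: "B l $$ (i, j) = (if i = j then bk c (bl (\<tau> l) j) l else 0)" for l
   by (rule split_n[OF j, of "\<tau> l"]) (use i j in \<open>auto simp: B_def bk_def\<close>)
  have "bk c (bl t j) \<in> borel_measurable M" for t
  proof (rule bk_meas[OF cm])
   show "bl t j < n" by (rule split_n[OF j, of t]) (auto dest: mt_le)
  qed
  then have "(%l. bk c (bl (\<tau> l) j) l) \<in> borel_measurable M" by (rule measurable_compose_countable[OF _ borel_meas_M[OF tau]])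
  then show "(%l. B l $$ (i, j)) \<in> borel_measurable M" unfolding eq by (cases "i = j") simp_all
  have "AE l in M. \<forall>k\<in>{..<n}. k < mt (\<tau> l) --> cmod (c (real k + \<phi> l)) \<le> sqrt C"
   by (rule AE_finite_allI) (use AE_N_D[OF cb] in auto)
  then have "AE l in M. cmod (B l $$ (i, j)) \<le> sqrt C"
  proof eventually_elim
   case (elim l)
   obtain k i' where "k < mt (\<tau> l)" "bl (\<tau> l) j = k" by (rule split_n[OF j, of "\<tau> l"])
   then show ?case using elim mt_le[of k "\<tau> l"] C i j by (simp add: B_def)
  qed
  then show "\<exists>c. AE l in M. cmod (B l $$ (i, j)) \<le> c" by (rule exI[of _ "sqrt C"])
 qed
 have main: "AE l in M. Us (T (U f)) l = mat_op n B f l" if f: "DM f" for f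
 proof -
  note uf = DN_U(1)[OF f]
  have "AE l in M. \<forall>k\<in>{..<n}. k < mt (\<tau> l) --> T (U f) (real k + \<phi> l) = (%i. c (real k + \<phi> l) * U f (real k + \<phi> l) i)"
  proof (rule AE_finite_allI)
   fix k assume "k \<in> {..<n}"
   then have "k < n" by simp
   from AE_N_D[OF Tc[OF uf] this]
   show "AE l in M. k < mt (\<tau> l) --> T (U f) (real k + \<phi> l) = (%i. c (real k + \<phi> l) * U f (real k + \<phi> l) i)"
    unfolding mem_Collect_eq .
  qed simp
  then show ?thesis
  proof eventually_elim
   case (elim l)
   show ?case
   proof
    fix j show "Us (T (U f)) l j = mat_op n B f l j"
    proof (cases "j < n")
     case True
     obtain k i where ki: "k < mt (\<tau> l)" "i < nt (\<tau> l) k" "j = off (nt (\<tau> l)) k + i" "bl (\<tau> l) j = k" by (rule split_n[OF True])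
     have "(\<Sum>j'<n. B l $$ (j, j') * f l j') = (\<Sum>j'<n. if j' = j then c (real k + \<phi> l) * f l j else 0)"
      using True ki(4) by (intro sum.cong) (auto simp: B_def)
     then have "mat_op n B f l j = c (real k + \<phi> l) * f l j" using True by (simp add: mat_op_def)
     moreover have "Us (T (U f)) l j = c (real k + \<phi> l) * f l j"
      using Us_off[OF ki(1,2), of "T (U f)"] elim mt_le[OF ki(1)] ki(1,2) U_code[OF ki(1), of f] unfolding ki(3) by simp
     ultimately show ?thesis by simp
    qed (simp add: Us_def mat_op_def)
   qed
  qed
 qed
 have "op_eq (L2n M n) (L2n M n) (Us \<circ> T \<circ> U) (mat_op n B)"
  unfolding op_eq_def L2n_def direct_integral_simps Ball_def comp_def
 proof (intro allI impI)
  fix f assume f: "DM f"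
  show "heq (direct_integral M (%_. enat n)) (Us (T (U f))) (mat_op n B f)"
   by (rule heq_DI[OF DM_Us(1)[OF td(1)[OF DN_U(1)[OF f]]] bounded_op_DI_D(1)[OF mat_op_bounded[OF BM] f], THEN iffD2, OF main[OF f]])
 qed
 then show ?thesis using BM by (rule bexI)
qed

definition Bm :: "(complex => complex mat) => complex => nat => complex mat" where
 "Bm C l k = mat (nt (\<tau> l) k) (nt (\<tau> l) k) (%(i, i'). C l $$ (off (nt (\<tau> l)) k + i, off (nt (\<tau> l)) k + i'))"

text \<open>The fibre operators are the diagonal blocks of \<open>C\<close>. Off \<open>V\<close>
  the operator 0 keeps the field bounded at every point, as \<open>operator_field\<close>
  demands.\<close>

definition FF where
 "FF C g = (if g \<in> V then (%x. mat_op (nt (\<tau> (lam g)) (kap g)) (%_. Bm C (lam g) (kap g)) (%_. x) g) else (%x i. 0))"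

lemma FF_field: assumes C: "C \<in> Mn_Linf M n" shows "operator_field N d (FF C)"
 unfolding operator_field_def
proof (intro conjI allI ballI)
 fix g show "bounded_op (hdim (d g)) (hdim (d g)) (FF C g)"
 proof (cases "g \<in> V")
  case True then show ?thesis unfolding FF_def d_def using bounded_op_mat by simp
 next
  case False then show ?thesis unfolding FF_def bounded_op_hdim by (auto simp: hv_zero sq_nonneg intro!: exI[of _ 1])
 qed
next
 fix j and x :: "nat => complex" and i
 define F where "F t k = (%g. if g \<in> {g. d g = j} \<inter> V then (if k < mt t \<and> i < nt t k then
  (\<Sum>i'<nt t k. C (lam g) $$ (off (nt t) k + i, off (nt t) k + i') * x i') else 0) else 0)" for t k
 have "F t k \<in> borel_measurable N" for t k
 proof -
  have "(%g. if k < mt t \<and> i < nt t k then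
  (\<Sum>i'<nt t k. C (lam g) $$ (off (nt t) k + i, off (nt t) k + i') * x i') else 0) \<in> borel_measurable N"
  proof (cases "k < mt t \<and> i < nt t k")
   case True
   have "(%g. C (lam g) $$ (off (nt t) k + i, off (nt t) k + i')) \<in> borel_measurable N" if "i' < nt t k" for i'
    by (rule measurable_compose[OF lam_N Mn_LinfD[OF C]]) (use True that off_n in auto)
   then have "(%g. \<Sum>i'<nt t k. C (lam g) $$ (off (nt t) k + i, off (nt t) k + i') * x i') \<in> borel_measurable N"
    by (intro borel_measurable_sum borel_measurable_times) auto
   then show ?thesis using True by simp
  next
   case False
   then have eq: "(k < mt t \<and> i < nt t k) = False" by simp
   show ?thesis unfolding eq by simp
  qed
  then show ?thesis unfolding F_def
   by (rule measurable_If_set) (use sets_N[OF V_borel] sets_N[OF d_set[of j]] in auto)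
 qed
 from piecewise_N[OF this]
 have "(%g. F (\<tau> (lam g)) (kap g) g) \<in> borel_measurable N" .
 moreover have "F (\<tau> (lam g)) (kap g) g = (if d g = j then FF C g x i else 0)" for g
 proof (cases "g \<in> V")
  case True
  let ?p = "nt (\<tau> (lam g)) (kap g)" and ?o = "off (nt (\<tau> (lam g))) (kap g)"
  have "(\<Sum>i'<?p. Bm C (lam g) (kap g) $$ (i, i') * x i') = (\<Sum>i'<?p. C (lam g) $$ (?o + i, ?o + i') * x i')" if "i < ?p"
   by (intro sum.cong refl) (simp add: Bm_def that)
  then show ?thesis using True V_D[OF True] by (simp add: F_def FF_def mat_op_def)
 next
  case False
  then show ?thesis by (simp add: F_def FF_def)
 qed
 ultimately show "(%g. if d g = j then FF C g x i else 0) \<in> borel_measurable N" by simp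
qed

text \<open>In the sum over all coordinates only the block of the given base point contributes,
  because \<open>C\<close> does not mix blocks.\<close>

lemma FF_decomposes:
 assumes C: "C \<in> Mn_Linf M n"
  and blk: "AE l in M. \<forall>k<mt (\<tau> l). \<forall>k'<mt (\<tau> l). \<forall>i<nt (\<tau> l) k. \<forall>i'<nt (\<tau> l) k'. k \<noteq> k' -->
   C l $$ (off (nt (\<tau> l)) k + i, off (nt (\<tau> l)) k' + i') = 0"
 shows "decomposes N d (%y. U (mat_op n C (Us y))) (FF C)"
 unfolding decomposes_def
proof (intro conjI ballI FF_field[OF C])
 show "bounded_op (direct_integral N d) (direct_integral N d) (%y. U (mat_op n C (Us y)))"
  using bounded_op_comp[OF bounded_op_comp[OF Us_bounded mat_op_bounded[OF C]] U_bounded] unfolding comp_def .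
 fix y assume "y \<in> vecs (direct_integral N d)"
 then have y: "DN y" by simp
 have "AE l in M. l \<in> {l. k < mt (\<tau> l)} --> U (mat_op n C (Us y)) (real k + \<phi> l) = FF C (real k + \<phi> l) (y (real k + \<phi> l))" for k
  using blk
 proof eventually_elim
  case (elim l)
  show ?case
  proof
   assume "l \<in> {l. k < mt (\<tau> l)}"
   then have k: "k < mt (\<tau> l)" by simp
   let ?g = "real k + \<phi> l" and ?o = "off (nt (\<tau> l))" and ?p = "nt (\<tau> l)"
   show "U (mat_op n C (Us y)) ?g = FF C ?g (y ?g)"
   proof
    fix i
    show "U (mat_op n C (Us y)) ?g i = FF C ?g (y ?g) i"
    proof (cases "i < ?p k")
     case True
     have "mat_op n C (Us y) l (?o k + i) = (\<Sum>j<n. C l $$ (?o k + i, j) * Us y l j)"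
      using off_n[OF k True] by (simp add: mat_op_def)
     also have "\<dots> = (\<Sum>k'<mt (\<tau> l). \<Sum>i'<?p k'. C l $$ (?o k + i, ?o k' + i') * Us y l (?o k' + i'))" by (rule sum_n)
     also have "\<dots> = (\<Sum>k'<mt (\<tau> l). if k' = k then (\<Sum>i'<?p k. C l $$ (?o k + i, ?o k + i') * y ?g i') else 0)"
     proof (intro sum.cong refl)
      fix k' assume "k' \<in> {..<mt (\<tau> l)}"
      then have k': "k' < mt (\<tau> l)" by simp
      show "(\<Sum>i'<?p k'. C l $$ (?o k + i, ?o k' + i') * Us y l (?o k' + i')) =
       (if k' = k then (\<Sum>i'<?p k. C l $$ (?o k + i, ?o k + i') * y ?g i') else 0)"
      proof (cases "k' = k")
       case True then show ?thesis using Us_off[OF k] by simp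
      next
       case False then show ?thesis using elim k k' True by (auto intro!: sum.neutral)
      qed
     qed
     also have "\<dots> = (\<Sum>i'<?p k. C l $$ (?o k + i, ?o k + i') * y ?g i')" using k by simp
     finally show ?thesis using True in_V[OF k] by (simp add: U_code[OF k] FF_def mat_op_def Bm_def)
    next
     case False then show ?thesis using in_V[OF k] by (simp add: U_code[OF k] FF_def mat_op_def)
    qed
   qed
  qed
 qed
 then have "AE g in N. g \<in> V \<and> U (mat_op n C (Us y)) g = FF C g (y g)" by (rule AE_N_I)
 then show "AE g in N. U (mat_op n C (Us y)) g = FF C g (y g)" by eventually_elim simp
qed

lemma FF_irreducible:
 assumes J: "AE l in M. \<forall>k<mt (\<tau> l). jlike (nt (\<tau> l) k) (fm (nt (\<tau> l) k) (Bm C l k))"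
 shows "AE g in N. strongly_irreducible (hdim (d g)) (FF C g)"
proof -
 have "AE l in M. l \<in> {l. k < mt (\<tau> l)} --> strongly_irreducible (hdim (d (real k + \<phi> l))) (FF C (real k + \<phi> l))" for k
  using J
 proof eventually_elim
  case (elim l)
  show ?case
  proof
   assume "l \<in> {l. k < mt (\<tau> l)}"
   then have k: "k < mt (\<tau> l)" by simp
   have "Bm C l k \<in> carrier_mat (nt (\<tau> l) k) (nt (\<tau> l) k)" unfolding Bm_def by simp
   from strongly_irreducible_jlike[OF this elim[rule_format, OF k], of "real k + \<phi> l"]
   show "strongly_irreducible (hdim (d (real k + \<phi> l))) (FF C (real k + \<phi> l))"
    unfolding d_code[OF k] FF_def using in_V[OF k] by simp
  qed
 qed
 then have "AE g in N. g \<in> V \<and> strongly_irreducible (hdim (d g)) (FF C g)" by (rule AE_N_I)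
 then show ?thesis by eventually_elim simp
qed

lemma similar_to_direct_integral_blocks:
 assumes A: "A \<in> Mn_Linf M n" and XY: "Mn_inverse_pair M n X Y"
  and blk: "AE l in M. \<forall>k<mt (\<tau> l). \<forall>k'<mt (\<tau> l). \<forall>i<nt (\<tau> l) k. \<forall>i'<nt (\<tau> l) k'. k \<noteq> k' -->
   (X l * A l * Y l) $$ (off (nt (\<tau> l)) k + i, off (nt (\<tau> l)) k' + i') = 0"
  and J: "AE l in M. \<forall>k<mt (\<tau> l). jlike (nt (\<tau> l) k) (fm (nt (\<tau> l) k) (Bm (%l. X l * A l * Y l) l k))"
 shows "similar_to_direct_integral M n A"
proof -
 have X: "X \<in> Mn_Linf M n" and Y: "Y \<in> Mn_Linf M n" using XY unfolding Mn_inverse_pair_def by auto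
 define C where "C l = X l * A l * Y l" for l
 have C: "C \<in> Mn_Linf M n" unfolding C_def[abs_def] by (rule Mn_Linf_mult[OF Mn_Linf_mult[OF X A] Y])
 have eq: "U \<circ> mat_op n X \<circ> mat_op n A \<circ> mat_op n Y \<circ> Us = (%y. U (mat_op n C (Us y)))"
 proof
  fix y
  have "mat_op n X (mat_op n A (mat_op n Y (Us y))) l = mat_op n C (Us y) l" for l
  proof -
   have c: "X l \<in> carrier_mat n n" "A l \<in> carrier_mat n n" "Y l \<in> carrier_mat n n" for l
    using Mn_carrier[OF X] Mn_carrier[OF A] Mn_carrier[OF Y] by auto
   have "mat_op n C (Us y) l = mat_op n (%l. X l * A l) (mat_op n Y (Us y)) l" unfolding C_def[abs_def]
    by (rule mat_op_mult) (rule mult_carrier_mat[OF c(1,2)] c(3))+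
   also have "\<dots> = mat_op n X (mat_op n A (mat_op n Y (Us y))) l" by (rule mat_op_mult) (rule c)+
   finally show ?thesis by (rule sym)
  qed
  then have "mat_op n X (mat_op n A (mat_op n Y (Us y))) = mat_op n C (Us y)" by (rule ext)
  then show "(U \<circ> mat_op n X \<circ> mat_op n A \<circ> mat_op n Y \<circ> Us) y = U (mat_op n C (Us y))" by simp
 qed
 show ?thesis unfolding similar_to_direct_integral_def
 proof (intro exI conjI ballI)
  show "direct_integral_of_strongly_irreducibles N d (U \<circ> mat_op n X \<circ> mat_op n A \<circ> mat_op n Y \<circ> Us)"
   unfolding eq direct_integral_of_strongly_irreducibles_def
   by (intro exI[of _ "FF C"] conjI FF_decomposes[OF C] FF_irreducible[of C]) (rule blk[folded C_def] J[folded C_def])+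
 qed (rule XY N_compact d_dim U_unitary Us_adjoint diag_matrix, assumption?)+
qed

end

section \<open>Gluing the pieces\<close>

text \<open>The content of \<open>jordan_block_form\<close> at a single point, freed from
  \<open>diag_block_mat\<close>. As a pointwise property it can be glued along the pieces even
  though block sizes change.\<close>

definition block_data where
 "block_data n A m nn X Y l \<longleftrightarrow>
  (\<forall>k<m. \<forall>k'<m. \<forall>i<nn k. \<forall>i'<nn k'. k \<noteq> k' --> (X l * A l * Y l) $$ (off nn k + i, off nn k' + i') = 0) \<and>
  (\<forall>k<m. jlike (nn k) (fm (nn k) (mat (nn k) (nn k) (%(i, i'). (X l * A l * Y l) $$ (off nn k + i, off nn k + i'))))) \<and>
  X l * Y l = 1\<^sub>m n \<and> Y l * X l = 1\<^sub>m n"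

lemma jordan_block_data:
 assumes "jordan_block_form M n A"
 shows "\<exists>m nn X Y. 0 < m \<and> (\<forall>k<m. 0 < nn k) \<and> off nn m = n \<and> X \<in> Mn_Linf M n \<and> Y \<in> Mn_Linf M n \<and>
  (AE l in M. block_data n A m nn X Y l)"
proof -
 obtain m :: nat and nn X Y and B :: "nat => 'a => complex mat" where m: "0 < m" and nn: "\<forall>k<m. 0 < nn k" and sm: "(\<Sum>k<m. nn k) = n"
  and XY: "Mn_inverse_pair M n X Y" and B: "\<forall>k<m. B k \<in> Mn_Linf M (nn k)"
  and eq: "AE l in M. X l * A l * Y l = diag_block_mat (map (%k. B k l) [0..<m])"
  and J: "\<forall>k<m. (AE l in M. upper_triangular (B k l)) \<and> (\<forall>j<nn k. AE l in M. B k l $$ (j, j) = B k l $$ (0, 0)) \<and>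
    (\<forall>j. Suc j < nn k --> (AE l in M. B k l $$ (j, Suc j) \<noteq> 0))"
  using assms unfolding jordan_block_form_def by (elim exE conjE) (rule that)
 have J1: "AE l in M. upper_triangular (B k l) \<and> (\<forall>j\<in>{..<nn k}. B k l $$ (j, j) = B k l $$ (0, 0)) \<and>
    (\<forall>j\<in>{..<nn k - 1}. B k l $$ (j, Suc j) \<noteq> 0)" if k: "k < m" for k
 proof -
  have a: "AE l in M. upper_triangular (B k l)" using J k by simp
  have b: "AE l in M. \<forall>j\<in>{..<nn k}. B k l $$ (j, j) = B k l $$ (0, 0)" by (rule AE_finite_allI) (use J k in auto)
  have c: "AE l in M. \<forall>j\<in>{..<nn k - 1}. B k l $$ (j, Suc j) \<noteq> 0" by (rule AE_finite_allI) (use J k in auto)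
  show ?thesis using a b c by eventually_elim blast
 qed
 have J2: "AE l in M. \<forall>k\<in>{..<m}. upper_triangular (B k l) \<and> (\<forall>j\<in>{..<nn k}. B k l $$ (j, j) = B k l $$ (0, 0)) \<and>
    (\<forall>j\<in>{..<nn k - 1}. B k l $$ (j, Suc j) \<noteq> 0)" by (rule AE_finite_allI) (use J1 in auto)
 have "AE l in M. X l * Y l = 1\<^sub>m n \<and> Y l * X l = 1\<^sub>m n" using XY unfolding Mn_inverse_pair_def by blast
 then have "AE l in M. block_data n A m nn X Y l" using eq J2 AE_space
 proof eventually_elim
  case (elim l)
  have Bc: "B k l \<in> carrier_mat (nn k) (nn k)" if "k < m" for k by (rule Mn_carrier[OF B[rule_format, OF that] elim(4)])
  note ind = diag_block_index(2)[where B = "%k. B k l" and nn = nn and m = m, OF Bc]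
  have bm: "mat (nn k) (nn k) (%(i, i'). (X l * A l * Y l) $$ (off nn k + i, off nn k + i')) = B k l" if k: "k < m" for k
  proof (rule eq_matI)
   fix i j assume "i < dim_row (B k l)" "j < dim_col (B k l)"
   then have ij: "i < nn k" "j < nn k" using Bc[OF k] by auto
   show "mat (nn k) (nn k) (%(i, i'). (X l * A l * Y l) $$ (off nn k + i, off nn k + i')) $$ (i, j) = B k l $$ (i, j)"
    using ij ind[OF _ k k ij] unfolding elim(2) by simp
  qed (use Bc[OF k] in auto)
  show ?case unfolding block_data_def
  proof (intro conjI allI impI)
   show "X l * Y l = 1\<^sub>m n" "Y l * X l = 1\<^sub>m n" using elim(1) by auto
   show "(X l * A l * Y l) $$ (off nn k + i, off nn k' + i') = 0" if "k < m" "k' < m" "i < nn k" "i' < nn k'" "k \<noteq> k'" for k k' i i'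
    unfolding elim(2) using ind[OF _ that(1-4)] that(5) by simp
   fix k assume k: "k < m"
   have e3: "upper_triangular (B k l) \<and> (\<forall>j\<in>{..<nn k}. B k l $$ (j, j) = B k l $$ (0, 0)) \<and>
    (\<forall>j\<in>{..<nn k - 1}. B k l $$ (j, Suc j) \<noteq> 0)" by (rule bspec[OF elim(3)]) (simp add: k)
   have u1: "upper_triangular (B k l)" by (rule conjunct1[OF e3])
   have u2: "B k l $$ (j, j) = B k l $$ (0, 0)" if "j < nn k" for j
    by (rule bspec[OF conjunct1[OF conjunct2[OF e3]]]) (simp add: that)
   have u3: "B k l $$ (j, Suc j) \<noteq> 0" if "Suc j < nn k" for j
    by (rule bspec[OF conjunct2[OF conjunct2[OF e3]]]) (use that in simp)
   show "jlike (nn k) (fm (nn k) (mat (nn k) (nn k) (%(i, i'). (X l * A l * Y l) $$ (off nn k + i, off nn k + i'))))"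
    unfolding bm[OF k] jlike_def
   proof (intro conjI allI impI)
    show "band 0 (fm (nn k) (B k l))" unfolding band_def using u1 Bc[OF k] by (auto simp: upper_triangular_def)
    show "ent (fm (nn k) (B k l)) i i = ent (fm (nn k) (B k l)) 0 0" if "i < nn k" for i using that u2[OF that] by simp
    show "ent (fm (nn k) (B k l)) i (Suc i) \<noteq> 0" if "Suc i < nn k" for i using that u3[OF that] by simp
   qed simp
  qed
 qed
 moreover have "off nn m = n" using sm by (simp add: off_def)
 ultimately show ?thesis using m nn XY unfolding Mn_inverse_pair_def
  by (intro exI[of _ m] exI[of _ nn] exI[of _ X] exI[of _ Y]) auto
qed

text \<open>The pieces are finitely many, so the sum of their bounds serves the glued field. The
  identity outside the pieces is bounded and equal to its own inverse.\<close>

lemma (in comp_meas) glue_Mn: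
 fixes L :: "nat => 'a set" and \<tau> :: "'a => nat"
 assumes L: "\<And>t. t < r ==> L t \<in> sets borel" and tm: "\<tau> \<in> measurable borel (count_space UNIV)"
  and tL: "\<And>l. \<tau> l < r ==> l \<in> L (\<tau> l)"
  and Z: "\<And>t. t < r ==> Z t \<in> Mn_Linf (restrict_space M (L t)) n"
 shows "(%l. if \<tau> l < r then Z (\<tau> l) l else 1\<^sub>m n) \<in> Mn_Linf M n"
 unfolding Mn_Linf_def
proof (intro CollectI conjI ballI allI impI)
 have Ls: "L t \<inter> space M \<in> sets M" if "t < r" for t using borel_sub[OF L[OF that]] by simp
 have sp: "space (restrict_space M (L t)) = L t" for t by (simp add: space_restrict_space)
 show "(if \<tau> l < r then Z (\<tau> l) l else 1\<^sub>m n) \<in> carrier_mat n n" for l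
  using Mn_carrier[OF Z[of "\<tau> l"], of l] tL[of l] by (simp add: sp)
 fix i j assume i: "i < n" and j: "j < n"
 define F where "F t l = (if t < r then (if l \<in> L t then Z t l $$ (i, j) else 1\<^sub>m n $$ (i, j)) else 1\<^sub>m n $$ (i, j))" for t l
 have "F t \<in> borel_measurable M" for t
 proof (cases "t < r")
  case True
  have "(%l. Z t l $$ (i, j)) \<in> borel_measurable (restrict_space M (L t))" by (rule Mn_LinfD[OF Z[OF True] i j])
  then have "(%l. if l \<in> L t then Z t l $$ (i, j) else 1\<^sub>m n $$ (i, j)) \<in> borel_measurable M"
   by (subst (asm) measurable_restrict_space_iff[OF Ls[OF True], of "1\<^sub>m n $$ (i, j)"]) simp_all
  then show ?thesis using True unfolding F_def[abs_def] by simp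
 qed (simp add: F_def[abs_def])
 moreover have "\<tau> \<in> measurable M (count_space UNIV)"
  unfolding M by (rule measurable_completion) (use tm in \<open>simp add: measurable_cong_sets[OF M0 refl]\<close>)
 ultimately have "(%l. F (\<tau> l) l) \<in> borel_measurable M" by (rule measurable_compose_countable)
 moreover have "F (\<tau> l) l = (if \<tau> l < r then Z (\<tau> l) l else 1\<^sub>m n) $$ (i, j)" for l using tL[of l] by (simp add: F_def)
 ultimately show "(%l. (if \<tau> l < r then Z (\<tau> l) l else 1\<^sub>m n) $$ (i, j)) \<in> borel_measurable M" by simp
 have "\<exists>c. AE l in M. l \<in> L t --> cmod (Z t l $$ (i, j)) \<le> c" if "t < r" for t
  using Z[OF that] i j unfolding Mn_Linf_def AE_restrict_space_iff[OF Ls[OF that], symmetric] by blast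
 then have "\<forall>t\<in>{..<r}. \<exists>c. AE l in M. l \<in> L t --> cmod (Z t l $$ (i, j)) \<le> c" by blast
 from bchoice[OF this] obtain c where c: "\<forall>t\<in>{..<r}. AE l in M. l \<in> L t --> cmod (Z t l $$ (i, j)) \<le> c t" by (rule exE)
 have "AE l in M. \<forall>t\<in>{..<r}. l \<in> L t --> cmod (Z t l $$ (i, j)) \<le> c t" by (rule AE_finite_allI) (use c in auto)
 then have "AE l in M. cmod ((if \<tau> l < r then Z (\<tau> l) l else 1\<^sub>m n) $$ (i, j)) \<le> 1 + (\<Sum>t<r. \<bar>c t\<bar>)"
 proof eventually_elim
  case (elim l)
  show ?case
  proof (cases "\<tau> l < r")
   case True
   then have "cmod (Z (\<tau> l) l $$ (i, j)) \<le> c (\<tau> l)" using elim tL by simp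
   also have "\<dots> \<le> \<bar>c (\<tau> l)\<bar>" by simp
   also have "\<dots> \<le> (\<Sum>t<r. \<bar>c t\<bar>)" by (rule member_le_sum[of "\<tau> l" "{..<r}" "%t. \<bar>c t\<bar>"]) (use True in auto)
   finally show ?thesis using True by simp
  next
   case False
   have "0 \<le> (\<Sum>t<r. \<bar>c t\<bar>)" by (rule sum_nonneg) simp
   then show ?thesis using False i j by simp
  qed
 qed
 then show "\<exists>c. AE l in M. cmod ((if \<tau> l < r then Z (\<tau> l) l else 1\<^sub>m n) $$ (i, j)) \<le> c" by (rule exI[of _ "1 + (\<Sum>t<r. \<bar>c t\<bar>)"])
qed

lemma piecewise_similar:
 fixes M :: "complex measure" and n :: nat
 assumes cm: "comp_meas M M0 K" and A: "A \<in> Mn_Linf M n" and n: "1 \<le> n" and pw: "piecewise_jordan_block_form K M n A"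
 shows "similar_to_direct_integral M n A"
proof -
 interpret comp_meas M M0 K by (rule cm)
 obtain r and L :: "nat => complex set" where L: "\<forall>t<r. L t \<in> sets borel" and dis: "disjoint_family_on L {..<r}" and UL: "(\<Union>t<r. L t) = K"
  and jb: "\<forall>t<r. jordan_block_form (restrict_space M (L t)) n A"
  using pw unfolding piecewise_jordan_block_form_def by (elim exE conjE) (rule that)
 have Ls: "L t \<inter> space M \<in> sets M" if "t < r" for t using borel_sub L that by simp
 have "\<forall>t\<in>{..<r}. \<exists>m nn X Y. 0 < m \<and> (\<forall>k<m. 0 < nn k) \<and> off nn m = n \<and>
   X \<in> Mn_Linf (restrict_space M (L t)) n \<and> Y \<in> Mn_Linf (restrict_space M (L t)) n \<and>
  (AE l in restrict_space M (L t). block_data n A m nn X Y l)"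
  by (intro ballI jordan_block_data) (use jb in simp)
 then obtain m nn X Y where d: "\<forall>t\<in>{..<r}. 0 < m t \<and> (\<forall>k<m t. 0 < nn t k) \<and> off (nn t) (m t) = n \<and>
   X t \<in> Mn_Linf (restrict_space M (L t)) n \<and> Y t \<in> Mn_Linf (restrict_space M (L t)) n \<and>
  (AE l in restrict_space M (L t). block_data n A (m t) (nn t) (X t) (Y t) l)"
  unfolding bchoice_iff by (elim exE) (rule that)
 have dd: "0 < m t" "\<And>k. k < m t ==> 0 < nn t k" "off (nn t) (m t) = n"
   "X t \<in> Mn_Linf (restrict_space M (L t)) n" "Y t \<in> Mn_Linf (restrict_space M (L t)) n"
   "AE l in restrict_space M (L t). block_data n A (m t) (nn t) (X t) (Y t) l" if "t < r" for t
 proof -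
  have "t \<in> {..<r}" using that by simp
  note c = bspec[OF d this]
  show "0 < m t" by (rule c[THEN conjunct1])
  show "0 < nn t k" if "k < m t" for k by (rule c[THEN conjunct2, THEN conjunct1, rule_format, OF that])
  show "off (nn t) (m t) = n" by (rule c[THEN conjunct2, THEN conjunct2, THEN conjunct1])
  show "X t \<in> Mn_Linf (restrict_space M (L t)) n" by (rule c[THEN conjunct2, THEN conjunct2, THEN conjunct2, THEN conjunct1])
  show "Y t \<in> Mn_Linf (restrict_space M (L t)) n" by (rule c[THEN conjunct2, THEN conjunct2, THEN conjunct2, THEN conjunct2, THEN conjunct1])
  show "AE l in restrict_space M (L t). block_data n A (m t) (nn t) (X t) (Y t) l"
   by (rule c[THEN conjunct2, THEN conjunct2, THEN conjunct2, THEN conjunct2, THEN conjunct2])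
 qed
 \<comment> \<open>The alternative \<open>t = r\<close> guarantees a least element; the value
   \<open>r\<close> is taken by the points outside all pieces, which form a null set.\<close>
 define \<tau> where "\<tau> l = (LEAST t. t = r \<or> l \<in> L t \<and> t < r)" for l
 have tau_ex: "\<tau> l = r \<or> l \<in> L (\<tau> l) \<and> \<tau> l < r" for l unfolding \<tau>_def by (rule LeastI[of _ r]) simp
 have tau_L: "\<tau> l < r" if lK: "l \<in> K" for l
 proof -
  obtain t where t: "t < r" "l \<in> L t" using lK UL by (auto elim!: UN_E)
  then have "\<tau> l \<le> t" unfolding \<tau>_def by (intro Least_le) simp
  then show ?thesis using t by simp
 qed
 have tau_in: "\<tau> l < r ==> l \<in> L (\<tau> l)" for l using tau_ex[of l] by auto
 have tau_m: "\<tau> \<in> measurable borel (count_space UNIV)" unfolding \<tau>_def[abs_def]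
 proof (rule measurable_Least)
  fix t
  show "Measurable.pred borel (%l. t = r \<or> l \<in> L t \<and> t < r)"
  proof (cases "t < r")
   case True
   then have [measurable]: "L t \<in> sets borel" using L by blast
   show ?thesis by measurable
  qed simp
 qed
 \<comment> \<open>From index \<open>r\<close> on, a single block of size \<open>n\<close>, so that
   the sizes add up to \<open>n\<close> for every index.\<close>
 define mt where "mt t = (if t < r then m t else 1)" for t
 define nt where "nt t = (if t < r then nn t else (%_. n))" for t
 define Xg where "Xg l = (if \<tau> l < r then X (\<tau> l) l else 1\<^sub>m n)" for l
 define Yg where "Yg l = (if \<tau> l < r then Y (\<tau> l) l else 1\<^sub>m n)" for l
 have XM: "Xg \<in> Mn_Linf M n" unfolding Xg_def[abs_def]
 proof (rule glue_Mn[where L = L and Z = X and r = r and \<tau> = \<tau>])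
  show "L t \<in> sets borel" if "t < r" for t by (rule L[rule_format, OF that])
  show "\<tau> \<in> measurable borel (count_space UNIV)" by (rule tau_m)
  show "l \<in> L (\<tau> l)" if "\<tau> l < r" for l by (rule tau_in[OF that])
  show "X t \<in> Mn_Linf (restrict_space M (L t)) n" if "t < r" for t by (rule dd(4)[OF that])
 qed
 have YM: "Yg \<in> Mn_Linf M n" unfolding Yg_def[abs_def]
 proof (rule glue_Mn[where L = L and Z = Y and r = r and \<tau> = \<tau>])
  show "L t \<in> sets borel" if "t < r" for t by (rule L[rule_format, OF that])
  show "\<tau> \<in> measurable borel (count_space UNIV)" by (rule tau_m)
  show "l \<in> L (\<tau> l)" if "\<tau> l < r" for l by (rule tau_in[OF that])
  show "Y t \<in> Mn_Linf (restrict_space M (L t)) n" if "t < r" for t by (rule dd(5)[OF that])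
 qed
 have "AE l in M. \<forall>t\<in>{..<r}. l \<in> L t --> block_data n A (m t) (nn t) (X t) (Y t) l"
 proof (rule AE_finite_allI)
  fix t assume t: "t \<in> {..<r}"
  have "AE l in restrict_space M (L t). block_data n A (m t) (nn t) (X t) (Y t) l" by (rule dd(6)) (use t in simp)
  then show "AE l in M. l \<in> L t --> block_data n A (m t) (nn t) (X t) (Y t) l"
   using AE_restrict_space_iff[OF Ls] t by simp
 qed simp
 then have bd: "AE l in M. block_data n A (mt (\<tau> l)) (nt (\<tau> l)) Xg Yg l" using AE_K
 proof eventually_elim
  case (elim l)
  note t = tau_L[OF elim(2)]
  have bdd: "block_data n A (m (\<tau> l)) (nn (\<tau> l)) (X (\<tau> l)) (Y (\<tau> l)) l" using elim(1) t tau_in[OF t] by simp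
  have eqs: "mt (\<tau> l) = m (\<tau> l)" "nt (\<tau> l) = nn (\<tau> l)" "Xg l = X (\<tau> l) l" "Yg l = Y (\<tau> l) l"
   using t by (simp_all add: mt_def nt_def Xg_def Yg_def)
  from bdd show ?case unfolding block_data_def eqs .
 qed
 obtain \<phi> :: "complex => real" and \<psi> :: "real => complex" where code: "\<phi> \<in> borel_measurable borel" "\<psi> \<in> borel_measurable borel"
  "\<forall>z. \<psi> (\<phi> z) = z" "\<forall>z. 0 \<le> \<phi> z \<and> \<phi> z < 1"
  using borel_code by (elim exE conjE) (rule that)
 interpret block_rep M M0 K \<phi> \<psi> n mt \<tau> nt
 proof (intro block_rep.intro sheets.intro sheets_axioms.intro block_rep_axioms.intro cm)
  show "\<phi> \<in> borel_measurable borel" "\<psi> \<in> borel_measurable borel" by (rule code)+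
  show "\<psi> (\<phi> z) = z" "0 \<le> \<phi> z" "\<phi> z < 1" for z using code by auto
  show "{l. k < mt (\<tau> l)} \<in> sets borel" for k
   using measurable_sets[OF tau_m, of "{t. k < mt t}"] by (simp add: vimage_def)
  show "\<tau> \<in> measurable borel (count_space UNIV)" by (rule tau_m)
  show "0 < nt t k" if "k < mt t" for t k using that dd(2)[of t k] n unfolding mt_def nt_def by (cases "t < r") simp_all
  show "off (nt t) (mt t) = n" for t using dd(3)[of t] unfolding mt_def nt_def by (cases "t < r") simp_all
 qed
 have "AE l in M. Xg l * Yg l = 1\<^sub>m n \<and> Yg l * Xg l = 1\<^sub>m n" using bd unfolding block_data_def by eventually_elim blast
 then have inv: "Mn_inverse_pair M n Xg Yg" unfolding Mn_inverse_pair_def by (intro conjI XM YM)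
 have b1: "AE l in M. \<forall>k<mt (\<tau> l). \<forall>k'<mt (\<tau> l). \<forall>i<nt (\<tau> l) k. \<forall>i'<nt (\<tau> l) k'. k \<noteq> k' -->
   (Xg l * A l * Yg l) $$ (off (nt (\<tau> l)) k + i, off (nt (\<tau> l)) k' + i') = 0"
  using bd
 proof eventually_elim
  case (elim l)
  show ?case by (rule conjunct1[OF elim[unfolded block_data_def]])
 qed
 have b2: "AE l in M. \<forall>k<mt (\<tau> l). jlike (nt (\<tau> l) k) (fm (nt (\<tau> l) k) (Bm (%l. Xg l * A l * Yg l) l k))"
  using bd
 proof eventually_elim
  case (elim l)
  show ?case unfolding Bm_def by (rule conjunct1[OF conjunct2[OF elim[unfolded block_data_def]]])
 qed
 show ?thesis by (rule similar_to_direct_integral_blocks[OF A inv b1 b2])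
qed

lemma (in max_abelian) frame: "\<exists>p. pframe M n (%l. fm n (A l)) n p \<and> S = frame_set M n A n p"
 using pframe_fr S_eq unfolding a_def[abs_def] by blast

lemma (in comp_meas) bounded_maximal_frame:
 assumes A: "A \<in> Mn_Linf M n" and S: "bounded_maximal_abelian_idempotents M n A S"
 shows "\<exists>p. pframe M n (%l. fm n (A l)) n p \<and> S = frame_set M n A n p"
proof -
 have 1: "norm_bounded M n S" and 2: "commuting_idempotents M n A S"
  and 3: "\<And>S'. commuting_idempotents M n A S' ==> S \<subseteq> S' ==> S' = S"
  using S unfolding bounded_maximal_abelian_idempotents_def by auto
 have sub: "S \<subseteq> Mn_Linf M n"
  using 2 unfolding commuting_idempotents_def commutant_idempotents_def rel_commutant_def by auto
 obtain C where C: "\<forall>B\<in>S. AE l in M. mbd C (fm n (B l))" using norm_boundedD[OF fin_M sub 1] by (rule exE)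
 have "max_abelian M M0 K n A S C"
  by (intro max_abelian.intro max_abelian_axioms.intro comp_meas_axioms A 2 3) (use C in auto)
 then show ?thesis by (rule max_abelian.frame)
qed

lemma (in comp_meas) frame_bounded_maximal:
 assumes A: "A \<in> Mn_Linf M n" and p: "pframe M n (%l. fm n (A l)) m p"
 shows "bounded_maximal_abelian_idempotents M n A (frame_set M n A m p)"
proof -
 note fs = frame_set_props[OF A p]
 have sub: "frame_set M n A m p \<subseteq> Mn_Linf M n"
  unfolding frame_set_def commutant_idempotents_def rel_commutant_def by blast
 obtain C where C: "\<forall>B\<in>frame_set M n A m p. AE l in M. mbd C (fm n (B l))" using fs(4) by (rule exE)
 have "norm_bounded M n (frame_set M n A m p)" by (rule norm_boundedI[OF sub]) (use C in auto)
 then show ?thesis unfolding bounded_maximal_abelian_idempotents_def using fs(1,3) by auto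
qed

theorem theorem1p2:
  fixes \<Lambda> :: "complex set" and \<mu> :: "complex measure"
    and n :: nat and A :: "complex \<Rightarrow> complex mat"
  assumes "compactly_supported_measure \<Lambda> \<mu>"
    and "1 \<le> n"
    and "A \<in> Mn_Linf \<mu> n"
  shows
    "((\<exists>m P. finite_frame \<Lambda> \<mu> n A m P) \<longleftrightarrow>
        (\<exists>\<P>. bounded_maximal_abelian_idempotents \<mu> n A \<P>)) \<and>
     ((\<exists>\<P>. bounded_maximal_abelian_idempotents \<mu> n A \<P>) \<longleftrightarrow>
        piecewise_jordan_block_form \<Lambda> \<mu> n A) \<and>
     (piecewise_jordan_block_form \<Lambda> \<mu> n A \<longleftrightarrow>
        similar_to_direct_integral \<mu> n A) \<and>
     ((\<exists>m P. finite_frame \<Lambda> \<mu> n A m P) \<or>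
      (\<exists>\<P>. bounded_maximal_abelian_idempotents \<mu> n A \<P>) \<or>
      piecewise_jordan_block_form \<Lambda> \<mu> n A \<or>
      similar_to_direct_integral \<mu> n A \<longrightarrow>
        (\<forall>\<P> \<Q>. bounded_maximal_abelian_idempotents \<mu> n A \<P> \<and>
            bounded_maximal_abelian_idempotents \<mu> n A \<Q> \<longrightarrow>
          (\<exists>X Y. X \<in> rel_commutant \<mu> n A \<and> Y \<in> rel_commutant \<mu> n A \<and>
             Mn_inverse_pair \<mu> n X Y \<and> conjugate_set \<mu> n X Y \<P> = \<Q>)))"
proof -
 note n = assms(2) and A = assms(3)
 obtain M0 where M0: "sets M0 = sets borel" "finite_measure M0" "emeasure M0 (- \<Lambda>) = 0" "\<mu> = completion M0" and comp: "compact \<Lambda>"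
  using assms(1) unfolding compactly_supported_measure_def by auto
 have cm: "comp_meas \<mu> M0 \<Lambda>"
  by (intro comp_meas.intro M0 borel_closed compact_imp_closed comp)
 interpret comp_meas \<mu> M0 \<Lambda> by (rule cm)
 \<comment> \<open>A pointwise frame is equivalent to each of the first two conditions. The Jordan
   form and the direct integral are tied to it by one cycle: frame, Jordan form, direct integral,
   maximal abelian set, frame.\<close>
 let ?F = "\<exists>m p. pframe \<mu> n (%l. fm n (A l)) m p"
 let ?Fr = "\<exists>m P. finite_frame \<Lambda> \<mu> n A m P" and ?Ab = "\<exists>S. bounded_maximal_abelian_idempotents \<mu> n A S"
  and ?Jo = "piecewise_jordan_block_form \<Lambda> \<mu> n A" and ?Di = "similar_to_direct_integral \<mu> n A"
 have F1: "?F ==> ?Fr" using pframe_finite_frame[OF A] by metis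
 have f1: "?Fr ==> ?F" using finite_frame_pframe[OF A] by metis
 have F2: "?F ==> ?Ab" using frame_bounded_maximal[OF A] by metis
 have f2: "?Ab ==> ?F" using bounded_maximal_frame[OF A] by metis
 have F3: "?F ==> ?Jo" using pframe_piecewise[OF A n] by metis
 have f34: "?Jo ==> ?Di" by (rule piecewise_similar[OF cm A n])
 have f42: "?Di ==> ?Ab" by (rule direct_integral_bounded_maximal[OF A])
 \<comment> \<open>Every bounded maximal abelian set is the \<open>frame_set\<close> of a pointwise
   frame, so conjugacy of such sets is a statement about two frames.\<close>
 have un: "\<exists>X Y. X \<in> rel_commutant \<mu> n A \<and> Y \<in> rel_commutant \<mu> n A \<and> Mn_inverse_pair \<mu> n X Y \<and> conjugate_set \<mu> n X Y P = Q"
  if P: "bounded_maximal_abelian_idempotents \<mu> n A P" and Q: "bounded_maximal_abelian_idempotents \<mu> n A Q" for P Q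
 proof -
  obtain p where p: "pframe \<mu> n (%l. fm n (A l)) n p \<and> P = frame_set \<mu> n A n p" using bounded_maximal_frame[OF A P] by (rule exE)
  obtain q where q: "pframe \<mu> n (%l. fm n (A l)) n q \<and> Q = frame_set \<mu> n A n q" using bounded_maximal_frame[OF A Q] by (rule exE)
  show ?thesis using frame_sets_conjugate[OF A conjunct1[OF p] conjunct1[OF q]]
   unfolding conjunct2[OF p, symmetric] conjunct2[OF q, symmetric] .
 qed
 show ?thesis
 proof (intro conjI)
  show "?Fr \<longleftrightarrow> ?Ab" by (rule iffI) (rule F2[OF f1], assumption, rule F1[OF f2], assumption)
  show "?Ab \<longleftrightarrow> ?Jo" by (rule iffI) (rule F3[OF f2], assumption, rule f42[OF f34], assumption)
  show "?Jo \<longleftrightarrow> ?Di" by (rule iffI) (rule f34, assumption, rule F3[OF f2[OF f42]], assumption)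
 qed (intro impI allI, elim conjE, rule un)
qed

end
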